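(* There exists a random function $F:\mathbb H\to[0,\infty)$ such that the following holds. Fix $u\in(-1,1)$ and a sequence of integers $k_n$ (with $k_n+n$ odd) such that $k_n/n\to u$. Let $G_n$ be a uniformly random (reverse standard) staircase Young tableau on $T(k_n,n)$. Then $$\frac{G_n}{n}\ \xrightarrow[n\to\infty]{d}\ \frac1{\sqrt{1-u^2}}\,F .$$ Moreover, $F$ is stationary and mixing of all orders with respect to translations by $(2m,0)$, $m\in\mathbb Z$.
   Context: $\mathbb N=\{1,2,\dots\}$ and $\mathbb H=\{(x,y)\in\mathbb Z\times\mathbb N: x+y\text{ even}\}$, with the partial order $(x,y)\le(x',y')$ iff $x+y\le x'+y'$ and $y-x\le y'-x'$. For integers $c$ and $n\ge2$ with $(c,n-1)\in\mathbb H$ (i.e. $c+n$ odd), $T(c,n)=\{z\in\mathbb H: z\le(c,n-1)\}$, a rotated staircase Young diagram with $N=\binom n2$ squares. A reverse standard staircase Young tableau on $T(c,n)$ is an order-preserving bijection $G:T(c,n)\to\{1,\dots,N\}$; it is extended to $\mathbb H$ by $G(z)=\infty$ for $z\notin T(c,n)$. "Uniformly random" means uniform over all such bijections. Convergence in distribution is for random elements of $[0,\infty]^{\mathbb H}$ with the topology of pointwise convergence. Let $\tau(x,y)=(x+2,y)$. Stationary means $F\circ\tau$ has the same law as $F$. A measure $\mu$ is $k$-mixing with respect to a measure-preserving map $\tau$ if for all measurable $A_1,\dots,A_k$, $\lim_{m_1,\dots,m_{k}\to\infty}\mu(A_1\cap\tau^{-m_1}A_2\cap\dots\cap\tau^{-m_1-\dots-m_{k-1}}A_k)=\prod_{i=1}^k\mu(A_i)$;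 mixing of all orders means $k$-mixing for every $k$ (here for the law of $F$ and the shift induced by $\tau$). *)

theory Defs
  imports "HOL-Probability.Probability"
begin

text \<open>The second coordinate ranges over the positive integers; it is kept in \<^typ>\<open>int\<close>
  so that the differences in the order below are not truncated.\<close>

typedef hpoint = "{(x, y) :: int \<times> int | x y. 1 \<le> y \<and> even (x + y)}"
proof
  show "(1, 1) \<in> {(x, y) :: int \<times> int | x y. 1 \<le> y \<and> even (x + y)}"
    by simp
qed

definition rot_le :: "int \<times> int \<Rightarrow> int \<times> int \<Rightarrow> bool" where
  "rot_le p q \<longleftrightarrow> fst p + snd p \<le> fst q + snd q \<and> snd p - fst p \<le> snd q - fst q"

instantiation hpoint :: order
begin

definition less_eq_hpoint :: "hpoint \<Rightarrow> hpoint \<Rightarrow> bool" where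
  "z \<le> w \<longleftrightarrow> rot_le (Rep_hpoint z) (Rep_hpoint w)"

definition less_hpoint :: "hpoint \<Rightarrow> hpoint \<Rightarrow> bool" where
  "z < w \<longleftrightarrow> z \<le> w \<and> \<not> w \<le> (z :: hpoint)"

instance
proof
  fix x y z :: hpoint
  show "x < y \<longleftrightarrow> x \<le> y \<and> \<not> y \<le> x"
    by (rule less_hpoint_def)
  show "x \<le> x"
    by (simp add: less_eq_hpoint_def rot_le_def)
  show "x \<le> z" if "x \<le> y" "y \<le> z"
    using that by (auto simp: less_eq_hpoint_def rot_le_def)
  show "x = y" if "x \<le> y" "y \<le> x"
  proof -
    have "Rep_hpoint x = Rep_hpoint y"
      using that by (auto simp: less_eq_hpoint_def rot_le_def prod_eq_iff)
    then show ?thesis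
      by (simp add: Rep_hpoint_inject)
  qed
qed

end

text \<open>Countability makes the Borel sigma-algebra of the product topology on functions
  from \<^typ>\<open>hpoint\<close> coincide with the product sigma-algebra.\<close>

instance hpoint :: countable
proof
  have "inj (to_nat \<circ> Rep_hpoint)"
    by (intro inj_compose inj_to_nat) (simp add: inj_def Rep_hpoint_inject)
  then show "\<exists>f :: hpoint \<Rightarrow> nat. inj f"
    by blast
qed

text \<open>The apex \<open>(c, n - 1)\<close> is a raw pair here; it lies in the half-plane lattice when
  \<open>n \<ge> 2\<close> and \<open>c + n\<close> is odd.\<close>

definition staircase :: "int \<Rightarrow> nat \<Rightarrow> hpoint set" where
  "staircase c n = {z. rot_le (Rep_hpoint z) (c, int n - 1)}"

definition staircase_tableaux :: "int \<Rightarrow> nat \<Rightarrow> (hpoint \<Rightarrow> nat) set" where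
  "staircase_tableaux c n =
     {G \<in> extensional (staircase c n).
        bij_betw G (staircase c n) {1..n choose 2} \<and> mono_on (staircase c n) G}"

definition extend_tableau :: "int \<Rightarrow> nat \<Rightarrow> (hpoint \<Rightarrow> nat) \<Rightarrow> hpoint \<Rightarrow> ennreal" where
  "extend_tableau c n G z = (if z \<in> staircase c n then of_nat (G z) else \<infinity>)"

definition uniform_tableau :: "int \<Rightarrow> nat \<Rightarrow> (hpoint \<Rightarrow> nat) measure" where
  "uniform_tableau c n = measure_pmf (pmf_of_set (staircase_tableaux c n))"

text \<open>Convergence in distribution, stated for the laws. The library's \<^const>\<open>weak_conv_m\<close>
  covers only measures on the real line.\<close>

definition converges_in_distribution ::
    "(nat \<Rightarrow> 'a::topological_space measure) \<Rightarrow> 'a measure \<Rightarrow> bool" where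
  "converges_in_distribution \<mu>s \<mu> \<longleftrightarrow>
     (\<forall>f :: 'a \<Rightarrow> real. continuous_on UNIV f \<longrightarrow> bounded (range f) \<longrightarrow>
        (\<lambda>n. integral\<^sup>L (\<mu>s n) f) \<longlonglongrightarrow> integral\<^sup>L \<mu> f)"

definition shift_point :: "hpoint \<Rightarrow> hpoint" where
  "shift_point z = Abs_hpoint (fst (Rep_hpoint z) + 2, snd (Rep_hpoint z))"

definition shift_fun :: "(hpoint \<Rightarrow> 'b) \<Rightarrow> hpoint \<Rightarrow> 'b" where
  "shift_fun f = f \<circ> shift_point"

text \<open>The sets are \<open>A 0, \<dots>, A (k - 1)\<close> and the gaps \<open>m 0, \<dots>, m (k - 2)\<close>; all gaps tend
  to infinity jointly and independently.\<close>

definition k_mixing :: "nat \<Rightarrow> 'a measure \<Rightarrow> ('a \<Rightarrow> 'a) \<Rightarrow> bool" where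
  "k_mixing k \<mu> T \<longleftrightarrow>
     (\<forall>A :: nat \<Rightarrow> 'a set. (\<forall>i<k. A i \<in> sets \<mu>) \<longrightarrow>
        (\<forall>\<epsilon>>0. \<exists>M. \<forall>m :: nat \<Rightarrow> nat. (\<forall>j<k - 1. M \<le> m j) \<longrightarrow>
           \<bar>measure \<mu> {x \<in> space \<mu>. \<forall>i<k. (T ^^ (\<Sum>j<i. m j)) x \<in> A i}
             - (\<Prod>i<k. measure \<mu> (A i))\<bar> < \<epsilon>))"

definition mixing_of_all_orders :: "'a measure \<Rightarrow> ('a \<Rightarrow> 'a) \<Rightarrow> bool" where
  "mixing_of_all_orders \<mu> T \<longleftrightarrow> (\<forall>k\<ge>1. k_mixing k \<mu> T)"

end

theory Submission
  imports Defs
begin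

text \<open>Listing the boxes by their entries turns a uniform tableau into a uniform linear extension, that is, a
  Markov chain removing corners. The transition probabilities are explicit: up to the number of
  remaining boxes they are residues of a rational function whose zeros and poles are the peaks and
  corners of the remaining shape. Hence the chain run in continuous time with these rates has a
  deterministic clock in the limit, and its rates are monotone: a small staircase inside a large one,
  after rescaling time by the local density, can be coupled to lag behind it. Smoothing the rates with
  a Poisson kernel shows that the mean number of removed boxes per column agrees in both up to a small
  error, so an ordered coupling is close to equality. This gives the local limit; running several
  disjoint windows inside one staircase, which evolve independently, gives mixing of all orders.
  Finally rectangle probabilities determine convergence in distribution by the Stone-Weierstrass
  theorem on the cube of all fields.\<close>

text \<open>In the coordinates given by peaks and corners the transition probabilities are Kerov's
  cotransition measure. The initial rates follow a semicircle,
  \<open>rate_const * sqrt (width2 a b x)\<close>, whose height at the centre produces the factor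
  \<open>1 / sqrt (1 - u\<^sup>2)\<close>. Only order n of the order n^2 boxes are gone when the
  local picture has formed, so the macroscopic shape is still the full staircase. The obstacle is
  that the rate in one column depends on all earlier removals, however distant. Attraction between
  removals allows comparisons of staircases in one direction only; the other direction has to come
  from first moments, and the mean of a single column has no formula. What can be controlled is a
  mean with Poisson weights on a scale eps, a small fraction of n: large enough that order n
  removals hardly disturb the resolvent at height eps, small enough that the semicircle is flat
  there. Monotonicity under inclusion turns this average over columns into one over translates,
  hence into a bound for two adjacent columns. Two, because translates move by even amounts and the
  parities behave differently.\<close>

abbreviation ir :: "int => real" where "ir == real_of_int"
abbreviation pr :: "'a pmf => 'a set => real" where "pr p A == measure_pmf.prob p A"

subsection \<open>Partial fractions and a coupling\<close>

text \<open>Minus the residue at \<open>y\<close> of the quotient of the polynomials with roots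
  \<open>X\<close> and \<open>Y\<close>. With this sign it is positive for real interlacing sets
  whose extreme points lie in \<open>X\<close>.\<close>

definition pf_residue :: "'a::field set => 'a set => 'a => 'a" where
 "pf_residue X Y y = - (\<Prod>x\<in>X. y - x) / (\<Prod>w\<in>Y - {y}. y - w)"

text \<open>Adding a zero \<open>x0\<close> and a pole \<open>y0\<close> multiplies the quotient by
  \<open>1 + (y0 - x0) / (z - y0)\<close>, which acts on the residues in a simple way. The second
  identity compares the coefficients of \<open>1 / z\<close> in an expansion at infinity; carrying
  it through the same induction avoids the expansion.\<close>

lemma partial_fractions:
 fixes X Y :: "'a::field set"
 assumes "finite Y" "finite X" "card X = Suc (card Y)"
 shows "(\<forall>z. z \<notin> Y --> (\<Prod>x\<in>X. z - x) / (\<Prod>y\<in>Y. z - y)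
      = z - (\<Sum>X - \<Sum>Y) - (\<Sum>y\<in>Y. pf_residue X Y y / (z - y)))
   \<and> 2 * (\<Sum>y\<in>Y. pf_residue X Y y) = (\<Sum>x\<in>X. x\<^sup>2) - (\<Sum>y\<in>Y. y\<^sup>2) - (\<Sum>X - \<Sum>Y)\<^sup>2"
 using assms
proof (induction Y arbitrary: X rule: finite_induct)
 case empty
 then obtain x where "X = {x}" by (auto simp: card_Suc_eq)
 then show ?case by simp
next
 case (insert y0 Y X')
 from insert.prems(2) obtain x0 where "x0 \<in> X'" by fastforce
 define X where "X = X' - {x0}"
 have X': "X' = insert x0 X" "x0 \<notin> X" and fX: "finite X"
  using \<open>x0 \<in> X'\<close> insert.prems(1) by (auto simp: X_def)
 have cX: "card X = Suc (card Y)"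
  using insert.prems insert.hyps X' fX by simp
 define A where "A = \<Sum>X - \<Sum>Y"
 define \<Phi> where "\<Phi> z = (\<Prod>x\<in>X. z - x) / (\<Prod>y\<in>Y. z - y)" for z
 define R where "R = pf_residue X Y"
 define R' where "R' = pf_residue X' (insert y0 Y)"
 have IH1: "\<Phi> z = z - A - (\<Sum>y\<in>Y. R y / (z - y))" if "z \<notin> Y" for z
  using insert.IH[OF fX cX] that unfolding \<Phi>_def A_def R_def by blast
 have IH2: "2 * (\<Sum>y\<in>Y. R y) = (\<Sum>x\<in>X. x\<^sup>2) - (\<Sum>y\<in>Y. y\<^sup>2) - A\<^sup>2"
  using insert.IH[OF fX cX] unfolding A_def R_def by blast
 have R'y: "R' y = R y - (y0 - x0) * (R y / (y0 - y))" if "y \<in> Y" for y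
 proof -
  have ne: "y \<noteq> y0" using that insert.hyps by auto
  have "insert y0 Y - {y} = insert y0 (Y - {y})" using ne by auto
  then have "R' y = R y * ((y - x0) / (y - y0))"
   using X' fX insert.hyps ne that by (simp add: R'_def R_def pf_residue_def mult_ac)
  also have "(y - x0) / (y - y0) = 1 - (y0 - x0) / (y0 - y)"
   using ne by (simp add: field_simps)
  finally show ?thesis by (simp add: algebra_simps)
 qed
 have "insert y0 Y - {y0} = Y" using insert.hyps by auto
 then have R'y0: "R' y0 = - (y0 - x0) * \<Phi> y0"
  using X' fX by (simp add: R'_def pf_residue_def \<Phi>_def divide_inverse algebra_simps)
 \<comment> \<open>The value of the old quotient at the new pole ties both claims together: up to a
   factor it is the new residue, and it contains the sum by which the old residues change.\<close>
 have P0: "\<Phi> y0 = y0 - A - (\<Sum>y\<in>Y. R y / (y0 - y))" using IH1 insert.hyps by blast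
 have A': "\<Sum>X' - \<Sum>(insert y0 Y) = A + x0 - y0"
  using X' fX insert.hyps by (simp add: A_def)
 have 1: "(\<Prod>x\<in>X'. z - x) / (\<Prod>y\<in>insert y0 Y. z - y)
      = z - (\<Sum>X' - \<Sum>(insert y0 Y)) - (\<Sum>y\<in>insert y0 Y. R' y / (z - y))"
  if z: "z \<notin> insert y0 Y" for z
 proof -
  have z0: "z - y0 \<noteq> 0" and zY: "z \<notin> Y" using z by auto
  have "(\<Prod>x\<in>X'. z - x) / (\<Prod>y\<in>insert y0 Y. z - y) = \<Phi> z * ((z - x0) / (z - y0))"
   using X' fX insert.hyps by (simp add: \<Phi>_def mult_ac)
  also have "(z - x0) / (z - y0) = 1 + (y0 - x0) / (z - y0)" using z0 by (simp add: field_simps)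
  finally have e1: "(\<Prod>x\<in>X'. z - x) / (\<Prod>y\<in>insert y0 Y. z - y)
    = \<Phi> z + (y0 - x0) * (\<Phi> z / (z - y0))" by (simp add: algebra_simps)
  have "\<Phi> z = \<Phi> y0 + (z - y0) + (\<Sum>y\<in>Y. R y / (y0 - y) - R y / (z - y))"
   unfolding IH1[OF zY] P0 by (simp add: sum_subtractf)
  also have "(\<Sum>y\<in>Y. R y / (y0 - y) - R y / (z - y))
    = (z - y0) * (\<Sum>y\<in>Y. R y / (y0 - y) / (z - y))"
   unfolding sum_distrib_left
  proof (rule sum.cong)
   fix y assume "y \<in> Y"
   then have "y0 - y \<noteq> 0" "z - y \<noteq> 0" using zY insert.hyps by auto
   then show "R y / (y0 - y) - R y / (z - y) = (z - y0) * (R y / (y0 - y) / (z - y))"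
    by (simp add: field_simps)
  qed simp
  finally have e2: "\<Phi> z / (z - y0) = \<Phi> y0 / (z - y0) + 1 + (\<Sum>y\<in>Y. R y / (y0 - y) / (z - y))"
   using z0 by (simp add: field_simps)
  have "(\<Sum>y\<in>Y. R' y / (z - y)) = (\<Sum>y\<in>Y. R y / (z - y) - (y0 - x0) * (R y / (y0 - y) / (z - y)))"
   by (rule sum.cong) (auto simp: R'y diff_divide_distrib)
  then have e3: "(\<Sum>y\<in>insert y0 Y. R' y / (z - y)) = - (y0 - x0) * \<Phi> y0 / (z - y0)
    + (\<Sum>y\<in>Y. R y / (z - y)) - (y0 - x0) * (\<Sum>y\<in>Y. R y / (y0 - y) / (z - y))"
   using insert.hyps R'y0 by (simp add: sum_subtractf sum_distrib_left)
  show ?thesis unfolding e1 e2 e3 A' unfolding IH1[OF zY] by (simp add: divide_inverse algebra_simps)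
 qed
 have RY: "(\<Sum>y\<in>Y. R' y) = (\<Sum>y\<in>Y. R y) - (y0 - x0) * (\<Sum>y\<in>Y. R y / (y0 - y))"
  by (simp add: R'y sum_subtractf sum_distrib_left)
 have "(\<Sum>y\<in>insert y0 Y. R' y) = R' y0 + (\<Sum>y\<in>Y. R' y)" using insert.hyps by simp
 also have "\<dots> = (\<Sum>y\<in>Y. R y) - (y0 - x0) * (y0 - A)"
  unfolding RY R'y0 P0 by (simp add: algebra_simps)
 finally have "(\<Sum>y\<in>insert y0 Y. R' y) = (\<Sum>y\<in>Y. R y) - (y0 - x0) * (y0 - A)" .
 then have "2 * (\<Sum>y\<in>insert y0 Y. R' y) = 2 * (\<Sum>y\<in>Y. R y) - 2 * ((y0 - x0) * (y0 - A))"
  by (simp only: right_diff_distrib)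
 also have "\<dots> = (\<Sum>x\<in>X'. x\<^sup>2) - (\<Sum>y\<in>insert y0 Y. y\<^sup>2) - (A + x0 - y0)\<^sup>2"
  unfolding IH2 using X' fX insert.hyps by (simp add: algebra_simps power2_eq_square)
 finally show ?case using 1 unfolding A' R'_def by blast
qed

text \<open>Draw \<open>y\<close> from \<open>q\<close>. If \<open>y\<close> lies in
  \<open>C\<close>, keep \<open>x = y\<close> with probability \<open>pmf p y / pmf q y\<close>; in
  all other cases draw \<open>x\<close> afresh from \<open>p\<close> conditioned on the complement
  of \<open>C\<close>. The leftover mass is exactly \<open>pr p (- C)\<close>, so \<open>x\<close>
  has law \<open>p\<close>, and any \<open>x\<close> in \<open>C\<close> was kept.\<close>

lemma rel_pmf_agree_on:
 fixes p q :: "'a pmf"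
 assumes le: "\<And>x. x \<in> C ==> pmf p x <= pmf q x"
 shows "rel_pmf (\<lambda>x y. x \<in> C --> y = x) p q"
proof (cases "pr p (- C) = 0")
 \<comment> \<open>Without mass outside \<open>C\<close> there is no conditional law to draw from,
   but then one mass function lies below the other and both have total one, so they
   coincide.\<close>
 case True
 have pC: "pr p C = 1"
  using True measure_pmf.prob_compl[of C p] by (simp add: Compl_eq_Diff_UNIV)
 have sp: "set_pmf p \<subseteq> C"
 proof
  fix x assume x: "x \<in> set_pmf p"
  show "x \<in> C"
  proof (rule ccontr)
   assume "x \<notin> C"
   then have "pr p {x} <= pr p (- C)"
    by (intro measure_pmf.finite_measure_mono) auto
   then show False using True x pmf_positive[of x p] by (simp add: measure_pmf_single)
  qed
 qed
 have "p = q"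
 proof (rule pmf_eqI)
  fix x
  have "\<forall>x. pmf p x <= pmf q x"
   using le sp by (metis pmf_nonneg set_pmf_iff subsetD)
  then show "pmf p x = pmf q x"
   using pmf_neq_exists_less[of q p] by (metis not_less)
 qed
 then show ?thesis by (auto intro: rel_pmf_reflI)
next
 case False
 define p' where "p' = cond_pmf p (- C)"
 have ne: "set_pmf p \<inter> - C \<noteq> {}" using False by (metis measure_Int_set_pmf measure_empty inf_commute)
 have p': "pmf p' x = (if x \<in> C then 0 else pmf p x / pr p (- C))" for x
  unfolding p'_def by (subst pmf_cond[OF ne]) auto
 define f where "f y = (if y \<in> C then pmf p y / pmf q y else 0)" for y
 have f01: "0 <= f y" "f y <= 1" for y
  using le[of y] by (auto simp: f_def divide_le_eq_1 pmf_nonneg)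
 define J where "J = bind_pmf q (\<lambda>y. bind_pmf (bernoulli_pmf (f y))
   (\<lambda>b. if b then return_pmf (y, y) else map_pmf (\<lambda>x. (x, y)) p'))"
 have snd: "map_pmf snd J = q"
 proof -
  have "map_pmf snd (if b then return_pmf (y, y) else map_pmf (\<lambda>x. (x, y)) p') = return_pmf y" for b and y :: 'a
   by (simp add: pmf.map_comp o_def)
  then show ?thesis by (simp add: J_def map_bind_pmf bind_return_pmf')
 qed
 have qf: "pmf q y * f y = (if y \<in> C then pmf p y else 0)" for y
  using le[of y] pmf_nonneg[of p y] by (auto simp: f_def)
 have "map_pmf fst J = p"
 proof (rule pmf_eqI)
  fix x
  have "map_pmf fst (if b then return_pmf (y, y) else map_pmf (\<lambda>x. (x, y)) p') = (if b then return_pmf y else p')"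
   for b and y :: 'a
   by (simp add: pmf.map_comp o_def)
  then have fj: "map_pmf fst J = bind_pmf q (\<lambda>y. bind_pmf (bernoulli_pmf (f y))
   (\<lambda>b. if b then return_pmf y else p'))" by (simp add: J_def map_bind_pmf)
  have inner: "ennreal (pmf (bind_pmf (bernoulli_pmf (f y)) (\<lambda>b. if b then return_pmf y else p')) x)
   = ennreal (f y) * indicator {x} y + ennreal (1 - f y) * pmf p' x" for y
   unfolding ennreal_pmf_bind using f01[of y]
   by (subst nn_integral_measure_pmf_support[where A = UNIV])
    (auto simp: UNIV_bool pmf_return indicator_def mult.commute ennreal_mult' ennreal_mult'')
  have qfx: "pmf q y * (1 - f y) = pmf q y - (if y \<in> C then pmf p y else 0)" for y
   using qf[of y] by (simp add: algebra_simps)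
  have m1: "(\<integral>\<^sup>+ y. ennreal (f y) * indicator {x} y \<partial>measure_pmf q) = ennreal (if x \<in> C then pmf p x else 0)"
   by (subst nn_integral_indicator_singleton)
    (auto simp: emeasure_pmf_single ennreal_mult'[symmetric] f01 qf mult.commute simp flip: qf)
  have m2: "(\<integral>\<^sup>+ y. ennreal (1 - f y) \<partial>measure_pmf q) = ennreal (pr p (- C))"
  proof -
   have int: "integrable (measure_pmf q) f"
    by (rule measure_pmf.integrable_const_bound[where B = 1]) (use f01 in auto)
   have "(\<integral> y. f y \<partial>measure_pmf q) = (\<integral> y. indicator C y \<partial>measure_pmf p)"
    unfolding pmf_expectation_eq_infsetsum qf
    by (rule infsetsum_cong) (auto simp: indicator_def)
   then have "(\<integral> y. f y \<partial>measure_pmf q) = pr p C" by simp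
   then have "(\<integral> y. 1 - f y \<partial>measure_pmf q) = pr p (- C)"
    using int measure_pmf.prob_compl[of C p] by (simp add: Compl_eq_Diff_UNIV)
   then show ?thesis
    using int f01 by (subst nn_integral_eq_integral) auto
  qed
  have "ennreal (pmf (map_pmf fst J) x) = (\<integral>\<^sup>+ y. ennreal (f y) * indicator {x} y + ennreal (1 - f y) * pmf p' x \<partial>measure_pmf q)"
   unfolding fj ennreal_pmf_bind[of q] inner ..
  also have "\<dots> = ennreal (if x \<in> C then pmf p x else 0) + ennreal (pr p (- C)) * pmf p' x"
   by (subst nn_integral_add) (auto simp: nn_integral_multc m1 m2)
  also have "\<dots> = ennreal (pmf p x)"
   using False by (auto simp: p' ennreal_mult'[symmetric] simp flip: ennreal_plus)
  finally show "pmf (map_pmf fst J) x = pmf p x" by simp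
 qed
 moreover have "x \<in> C --> y = x" if "(x, y) \<in> set_pmf J" for x y
  using that by (auto simp: J_def split: if_splits) (auto simp: set_pmf_iff p' split: if_splits)
 ultimately show ?thesis using snd by (intro rel_pmf.intros[of J]) auto
qed

subsection \<open>Profiles and corner rates\<close>

text \<open>The staircase with apex \<open>(c, n - 1)\<close> is encoded by \<open>2 a = c - n + 1\<close> and \<open>2 b = c + n - 1\<close>, so its
 columns are the integers strictly between \<open>2 a\<close> and \<open>2 b\<close>. A state is the number \<open>m x\<close> of boxes removed
 from each column. \<open>curv\<close> is, up to a factor, the second difference of the boundary of the remaining
 shape: \<open>1\<close> at its peaks and \<open>- 1\<close> at the removable corners.\<close>

definition curv0 :: "int => int => int => int" where
 "curv0 a b x = (if 2 * a <= x \<and> x <= 2 * b then (if even x then 1 else - 1) else 0)"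

definition curv :: "int => int => (int => nat) => int => int" where
 "curv a b m x = curv0 a b x + 2 * int (m x) - int (m (x - 1)) - int (m (x + 1))"

definition valid :: "int => int => (int => nat) => bool" where
 "valid a b m \<longleftrightarrow> (\<forall>x. x <= 2 * a \<or> 2 * b <= x --> m x = 0) \<and>
  (\<forall>x. odd x --> 2 * a < x --> x < 2 * b -->
    m (x + 1) <= m x \<and> m x <= m (x + 1) + 1 \<and> m (x - 1) <= m x \<and> m x <= m (x - 1) + 1)"

definition corners :: "int => int => (int => nat) => int set" where
 "corners a b m = {x. curv a b m x = - 1}"

text \<open>By \<open>pf_residue_rate\<close> this product over peaks and corners is a residue of the quotient of the two
 polynomials; \<open>extensions_rate\<close> identifies it with a transition probability.\<close>

definition rate :: "int => int => (int => nat) => int => real" where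
 "rate a b m x = exp (\<Sum>w\<in>{2*a..2*b}. ir (curv a b m w) * ln \<bar>ir (x - w)\<bar>)"

definition nbox :: "int => int => nat" where
 "nbox a b = nat ((b - a + 1) * (b - a) div 2)"

definition removed :: "int => int => (int => nat) => nat" where
 "removed a b m = (\<Sum>x\<in>{2*a..2*b}. m x)"

lemma real_nbox: "a <= b ==> real (nbox a b) = ir ((b - a + 1) * (b - a)) / 2"
proof -
 assume "a <= b"
 have ev: "even ((b - a + 1) * (b - a))" by auto
 have "0 <= (b - a + 1) * (b - a) div 2" using \<open>a <= b\<close>
  by (intro pos_imp_zdiv_nonneg_iff[THEN iffD2] mult_nonneg_nonneg) auto
 then have "real (nbox a b) = ir ((b - a + 1) * (b - a) div 2)"
  unfolding nbox_def by (subst of_nat_nat) auto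
 also have "\<dots> = ir ((b - a + 1) * (b - a)) / 2"
  using ev by (metis real_of_int_div of_int_numeral)
 finally show ?thesis .
qed

section \<open>Valid profiles and their corners\<close>

lemma valid_zero: "valid a b (\<lambda>_. 0)"
 by (simp add: valid_def)

lemma valid_outside: "valid a b m ==> x <= 2 * a \<or> 2 * b <= x ==> m x = 0"
 by (auto simp: valid_def)

lemma valid_odd:
 assumes "valid a b m" "odd x" "2 * a < x" "x < 2 * b"
 shows "m (x + 1) <= m x" "m x <= m (x + 1) + 1" "m (x - 1) <= m x" "m x <= m (x - 1) + 1"
 using assms by (auto simp: valid_def)

lemma valid_even:
 assumes v: "valid a b m" "even x"
 shows "2 * a <= x ==> x < 2 * b ==> m x <= m (x + 1) \<and> m (x + 1) <= m x + 1"
  and "2 * a < x ==> x <= 2 * b ==> m x <= m (x - 1) \<and> m (x - 1) <= m x + 1"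
proof -
 assume "2 * a <= x" "x < 2 * b"
 then have "2 * a < x + 1" "x + 1 < 2 * b" using v(2) by presburger+
 then show "m x <= m (x + 1) \<and> m (x + 1) <= m x + 1"
  using valid_odd[OF v(1), of "x + 1"] v(2) by auto
next
 assume "2 * a < x" "x <= 2 * b"
 then have "2 * a < x - 1" "x - 1 < 2 * b" using v(2) by presburger+
 then show "m x <= m (x - 1) \<and> m (x - 1) <= m x + 1"
  using valid_odd[OF v(1), of "x - 1"] v(2) by auto
qed

lemma curv_outside:
 assumes v: "valid a b m" and x: "x < 2 * a \<or> 2 * b < x"
 shows "curv a b m x = 0"
 using x valid_outside[OF v, of x] valid_outside[OF v, of "x - 1"] valid_outside[OF v, of "x + 1"]
 by (auto simp: curv_def curv0_def)

lemma curv_even_end: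
 assumes v: "valid a b m" and ab: "a < b"
 shows "curv a b m (2 * a) \<in> {0, 1}" "curv a b m (2 * b) \<in> {0, 1}"
 using valid_even(1)[OF v, of "2 * a"] valid_even(2)[OF v, of "2 * b"] ab
  valid_outside[OF v, of "2 * a"] valid_outside[OF v, of "2 * a - 1"]
  valid_outside[OF v, of "2 * b"] valid_outside[OF v, of "2 * b + 1"]
 by (auto simp: curv_def curv0_def)

lemma curv_inside:
 assumes "2 * a < x" "x < 2 * b"
 shows "curv a b m x = (if even x then 1 else - 1) + 2 * int (m x) - int (m (x - 1)) - int (m (x + 1))"
 using assms by (simp add: curv_def curv0_def)

lemma curv_range:
 assumes v: "valid a b m" and ab: "a < b"
 shows "curv a b m x \<in> {-1, 0, 1}"
proof -
 consider "x < 2 * a \<or> 2 * b < x" | "x = 2 * a \<or> x = 2 * b" | "2 * a < x" "x < 2 * b" by linarith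
 then show ?thesis
 proof cases
  case 1
  then show ?thesis using curv_outside[OF v] by simp
 next
  case 2
  then show ?thesis using curv_even_end[OF v ab] by auto
 next
  case 3
  show ?thesis
  proof (cases "odd x")
   case True
   have "- 1 <= curv a b m x" "curv a b m x <= 1"
    using curv_inside[OF 3, of m] valid_odd[OF v True 3] True by simp_all
   then show ?thesis by auto
  next
   case False
   then have "even x" by simp
   then have "m x <= m (x + 1) \<and> m (x + 1) <= m x + 1" "m x <= m (x - 1) \<and> m (x - 1) <= m x + 1"
    using valid_even[OF v] 3 by simp_all
   then have "- 1 <= curv a b m x" "curv a b m x <= 1"
    using curv_inside[OF 3, of m] False by simp_all
   then show ?thesis by auto
  qed
 qed
qed

lemma corners_subset:
 assumes v: "valid a b m" and ab: "a < b"
 shows "corners a b m \<subseteq> {2*a<..<2*b}"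
proof
 fix x assume "x \<in> corners a b m"
 then have c: "curv a b m x = - 1" by (simp add: corners_def)
 have "\<not> (x < 2 * a \<or> 2 * b < x)" using c curv_outside[OF v, of x] by linarith
 moreover have "x \<noteq> 2 * a" "x \<noteq> 2 * b" using c curv_even_end[OF v ab] by fastforce+
 ultimately show "x \<in> {2*a<..<2*b}" by auto
qed

lemma finite_corners: "valid a b m ==> a < b ==> finite (corners a b m)"
 by (rule finite_subset[OF corners_subset]) auto

text \<open>Columns start at height 1 if odd and at height 2 if even, and a box rests on its two
  lower neighbours. Hence both neighbours of an odd corner have the same count as the corner, and
  those of an even corner are one ahead.\<close>

lemma corner_cases:
 assumes v: "valid a b m" and ab: "a < b"
 shows "x \<in> corners a b m \<longleftrightarrow> 2 * a < x \<and> x < 2 * b \<and>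
  (if odd x then m (x + 1) = m x \<and> m (x - 1) = m x else m (x + 1) = m x + 1 \<and> m (x - 1) = m x + 1)"
proof (cases "2 * a < x \<and> x < 2 * b")
 case True
 then have r: "2 * a < x" "x < 2 * b" by auto
 define p q t where "p = m x" and "q = m (x - 1)" and "t = m (x + 1)"
 show ?thesis
 proof (cases "odd x")
  case True
  have "q <= p" "t <= p" using valid_odd[OF v True r] by (simp_all add: p_def q_def t_def)
  moreover have "x \<in> corners a b m \<longleftrightarrow> - 1 + 2 * int p - int q - int t = - 1"
   using True by (simp add: corners_def curv_inside[OF r] p_def q_def t_def)
  moreover have "- 1 + 2 * int p - int q - int t = - 1 \<longleftrightarrow> t = p \<and> q = p"
   using calculation by presburger
  ultimately show ?thesis using True r by (simp add: p_def q_def t_def)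
 next
  case False
  then have "even x" by simp
  then have "q <= p + 1" "t <= p + 1"
   using valid_even[OF v, of x] r by (simp_all add: p_def q_def t_def)
  moreover have "x \<in> corners a b m \<longleftrightarrow> 1 + 2 * int p - int q - int t = - 1"
   using False by (simp add: corners_def curv_inside[OF r] p_def q_def t_def)
  moreover have "1 + 2 * int p - int q - int t = - 1 \<longleftrightarrow> t = p + 1 \<and> q = p + 1"
   using calculation by presburger
  ultimately show ?thesis using False r by (simp add: p_def q_def t_def)
 qed
next
 case False
 then show ?thesis using corners_subset[OF v ab] by auto
qed

lemma valid_upd:
 assumes v: "valid a b m" and ab: "a < b" and x: "x \<in> corners a b m"
 shows "valid a b (m(x := m x + 1))"
proof -
 have c: "2 * a < x" "x < 2 * b"
  "if odd x then m (x + 1) = m x \<and> m (x - 1) = m x else m (x + 1) = m x + 1 \<and> m (x - 1) = m x + 1"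
  using x corner_cases[OF v ab] by auto
 show ?thesis
  unfolding valid_def
 proof (intro conjI allI impI)
  fix w assume "w <= 2 * a \<or> 2 * b <= w"
  then show "(m(x := m x + 1)) w = 0" using c valid_outside[OF v, of w] by auto
 next
  fix w assume w: "odd w" "2 * a < w" "w < 2 * b"
  note o = valid_odd[OF v w]
  show "(m(x := m x + 1)) (w + 1) <= (m(x := m x + 1)) w" using o w c by (auto split: if_splits)
  show "(m(x := m x + 1)) w <= (m(x := m x + 1)) (w + 1) + 1" using o w c by (auto split: if_splits)
  show "(m(x := m x + 1)) (w - 1) <= (m(x := m x + 1)) w" using o w c by (auto split: if_splits)
  show "(m(x := m x + 1)) w <= (m(x := m x + 1)) (w - 1) + 1" using o w c by (auto split: if_splits)
 qed
qed

lemma removed_upd: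
 assumes v: "valid a b m" and ab: "a < b" and x: "x \<in> corners a b m"
 shows "removed a b (m(x := m x + 1)) = Suc (removed a b m)"
proof -
 have x: "x \<in> {2*a..2*b}" using corners_subset[OF v ab] x by auto
 have "removed a b (m(x := m x + 1)) = m x + 1 + (\<Sum>w\<in>{2*a..2*b} - {x}. m w)"
  unfolding removed_def by (subst sum.remove[OF _ x]) (auto intro!: sum.cong)
 also have "\<dots> = Suc (removed a b m)"
  unfolding removed_def using sum.remove[OF _ x, of m] by simp
 finally show ?thesis .
qed

lemma laplace_sum:
 fixes mu g :: "int => real"
 assumes "\<And>x. x <= l \<or> u <= x ==> mu x = 0"
 shows "(\<Sum>x\<in>{l..u}. (2 * mu x - mu (x - 1) - mu (x + 1)) * g x)
   = (\<Sum>x\<in>{l..u}. mu x * (2 * g x - g (x - 1) - g (x + 1)))"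
proof -
 have 1: "(\<Sum>x\<in>{l..u}. mu (x - 1) * g x) = (\<Sum>x\<in>{l..u}. mu x * g (x + 1))"
 proof -
  have "(\<Sum>x\<in>{l..u}. mu (x - 1) * g x) = (\<Sum>x\<in>{l-1..u-1}. mu x * g (x + 1))"
   by (rule sum.reindex_bij_witness[of _ "\<lambda>x. x + 1" "\<lambda>x. x - 1"]) auto
  also have "\<dots> = (\<Sum>x\<in>{l-1..u}. mu x * g (x + 1))"
   by (rule sum.mono_neutral_left) (auto simp: assms)
  also have "\<dots> = (\<Sum>x\<in>{l..u}. mu x * g (x + 1))"
   by (rule sum.mono_neutral_right) (auto simp: assms)
  finally show ?thesis .
 qed
 have 2: "(\<Sum>x\<in>{l..u}. mu (x + 1) * g x) = (\<Sum>x\<in>{l..u}. mu x * g (x - 1))"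
 proof -
  have "(\<Sum>x\<in>{l..u}. mu (x + 1) * g x) = (\<Sum>x\<in>{l+1..u+1}. mu x * g (x - 1))"
   by (rule sum.reindex_bij_witness[of _ "\<lambda>x. x - 1" "\<lambda>x. x + 1"]) auto
  also have "\<dots> = (\<Sum>x\<in>{l..u+1}. mu x * g (x - 1))"
   by (rule sum.mono_neutral_left) (auto simp: assms)
  also have "\<dots> = (\<Sum>x\<in>{l..u}. mu x * g (x - 1))"
   by (rule sum.mono_neutral_right) (auto simp: assms)
  finally show ?thesis .
 qed
 show ?thesis
  using 1 2 by (simp add: algebra_simps sum.distrib sum_subtractf)
qed

text \<open>Summation by parts: a linear statistic of the boundary is its initial value plus one
  second difference of \<open>g\<close> for each removed box. It is used with linear
  \<open>g\<close>, which gives an invariant, with quadratic \<open>g\<close>, which counts boxes,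
  and with a logarithm, which gives the interaction.\<close>

lemma curv_sum:
 assumes v: "valid a b m"
 shows "(\<Sum>x\<in>{2*a..2*b}. ir (curv a b m x) * g x)
  = (\<Sum>x\<in>{2*a..2*b}. ir (curv0 a b x) * g x)
   + (\<Sum>x\<in>{2*a..2*b}. real (m x) * (2 * g x - g (x - 1) - g (x + 1)))"
proof -
 have "(\<Sum>x\<in>{2*a..2*b}. ir (curv a b m x) * g x)
  = (\<Sum>x\<in>{2*a..2*b}. ir (curv0 a b x) * g x)
   + (\<Sum>x\<in>{2*a..2*b}. (2 * real (m x) - real (m (x - 1)) - real (m (x + 1))) * g x)"
  by (simp add: curv_def algebra_simps flip: sum.distrib)
 then show ?thesis
  using laplace_sum[of "2*a" "2*b" "\<lambda>x. real (m x)" g] valid_outside[OF v] by simp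
qed

lemma curv0_sum_power:
 assumes "a <= b"
 shows "(\<Sum>x\<in>{2*a..2*b}. ir (curv0 a b x) * ir x) = ir (a + b)"
  and "(\<Sum>x\<in>{2*a..2*b}. ir (curv0 a b x) * (ir x)\<^sup>2)
     = (ir (a + b))\<^sup>2 + 2 * real (nbox a b)"
proof -
 define s where "s x = (if even x then 1 else - 1 :: real)" for x :: int
 have cs: "ir (curv0 a b x) = s x" if "x \<in> {2*a..2*b}" for x
  using that by (simp add: curv0_def s_def)
 have "(\<Sum>x\<in>{2*a..2*b}. s x * ir x) = ir (a + b) \<and>
  (\<Sum>x\<in>{2*a..2*b}. s x * (ir x)\<^sup>2)
    = (ir (a + b))\<^sup>2 + ir ((b - a + 1) * (b - a))"
  using assms
 proof (induction b rule: int_ge_induct)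
  case base
  then show ?case by (simp add: s_def)
 next
  case (step b)
  have "{2*a..2*(b+1)} = insert (2*b+2) (insert (2*b+1) {2*a..2*b})"
   using step.hyps by auto
  then show ?case using step.IH by (simp add: s_def power2_eq_square algebra_simps)
 qed
 then show "(\<Sum>x\<in>{2*a..2*b}. ir (curv0 a b x) * ir x) = ir (a + b)"
  "(\<Sum>x\<in>{2*a..2*b}. ir (curv0 a b x) * (ir x)\<^sup>2)
     = (ir (a + b))\<^sup>2 + 2 * real (nbox a b)"
  using real_nbox[OF assms] by (simp_all add: cs)
qed

text \<open>Tail sums of a second difference telescope, and the parity term comes from the
  alternating signs of \<open>curv0\<close>. The result counts peaks against corners to the right of
  a point and so expresses their interlacing.\<close>

lemma curv_tail_sum:
 assumes v: "valid a b m" and "2 * a - 1 <= y" "y <= 2 * b"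
 shows "(\<Sum>x\<in>{y<..2*b}. curv a b m x) = (if odd y then 1 else 0) + int (m (y + 1)) - int (m y)"
 using assms(3,2)
proof (induction y rule: int_le_induct)
 case base
 then show ?case using valid_outside[OF v, of "2*b"] valid_outside[OF v, of "2*b+1"] by simp
next
 case (step y)
 have "{y - 1<..2*b} = insert y {y<..2*b}" using step.hyps by auto
 then have "(\<Sum>x\<in>{y - 1<..2*b}. curv a b m x) = curv a b m y + (\<Sum>x\<in>{y<..2*b}. curv a b m x)" by simp
 then show ?case using step by (simp add: curv_def curv0_def)
qed

section \<open>Interlacing of peaks and corners, and rates as residues\<close>

definition peaks :: "int => int => (int => nat) => int set" where
 "peaks a b m = {x. curv a b m x = 1}"

lemma peaks_subset:
 assumes v: "valid a b m"
 shows "peaks a b m \<subseteq> {2*a..2*b}"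
proof
 fix x assume "x \<in> peaks a b m"
 then have "\<not> (x < 2 * a \<or> 2 * b < x)"
  using curv_outside[OF v, of x] by (auto simp: peaks_def)
 then show "x \<in> {2*a..2*b}" by auto
qed

lemma curv_sum_split:
 fixes g :: "int => 'a::comm_ring_1"
 assumes v: "valid a b m" and ab: "a < b" and S: "S \<subseteq> {2*a..2*b}"
 shows "(\<Sum>x\<in>S. of_int (curv a b m x) * g x)
  = (\<Sum>x\<in>peaks a b m \<inter> S. g x) - (\<Sum>x\<in>corners a b m \<inter> S. g x)"
proof -
 have fS: "finite S" by (rule finite_subset[OF S]) simp
 have "of_int (curv a b m x) * g x
  = (if x \<in> peaks a b m then g x else 0) - (if x \<in> corners a b m then g x else 0)" for x
  using curv_range[OF v ab, of x] by (auto simp: peaks_def corners_def)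
 then show ?thesis
  by (simp add: sum_subtractf sum.inter_restrict[OF fS, symmetric] Int_commute)
qed

lemma curv_sum_peaks_corners:
 fixes g :: "int => 'a::comm_ring_1"
 assumes v: "valid a b m" and ab: "a < b"
 shows "(\<Sum>x\<in>{2*a..2*b}. of_int (curv a b m x) * g x)
  = (\<Sum>x\<in>peaks a b m. g x) - (\<Sum>x\<in>corners a b m. g x)"
proof -
 have "peaks a b m \<inter> {2*a..2*b} = peaks a b m" "corners a b m \<inter> {2*a..2*b} = corners a b m"
  using peaks_subset[OF v] corners_subset[OF v ab] by fastforce+
 then show ?thesis using curv_sum_split[OF v ab order_refl, of g] by simp
qed

lemma card_peaks_above:
 assumes v: "valid a b m" and ab: "a < b" and y: "2 * a - 1 <= y" "y <= 2 * b"
 shows "int (card (peaks a b m \<inter> {y<..2*b}))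
  = int (card (corners a b m \<inter> {y<..2*b})) + (if odd y then 1 else 0) + int (m (y + 1)) - int (m y)"
proof -
 have "{y<..2*b} \<subseteq> {2*a..2*b}" using y by auto
 from curv_sum_split[OF v ab this, of "\<lambda>_. 1 :: int"] curv_tail_sum[OF v y]
 show ?thesis by simp
qed

lemma card_peaks:
 assumes v: "valid a b m" and ab: "a < b"
 shows "card (peaks a b m) = Suc (card (corners a b m))"
proof -
 have "peaks a b m \<inter> {2*a-1<..2*b} = peaks a b m" "corners a b m \<inter> {2*a-1<..2*b} = corners a b m"
  using peaks_subset[OF v] corners_subset[OF v ab] by fastforce+
 then show ?thesis
  using card_peaks_above[OF v ab, of "2*a-1"] ab valid_outside[OF v, of "2*a"] valid_outside[OF v, of "2*a-1"]
  by auto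
qed

lemma prod_diff_sign:
 fixes y :: real
 assumes "finite X"
 shows "(\<Prod>x\<in>X. y - x) = (- 1) ^ card {x\<in>X. y < x} * (\<Prod>x\<in>X. \<bar>y - x\<bar>)"
 using assms
proof (induction X)
 case (insert w X)
 have "{x \<in> insert w X. y < x} = (if y < w then insert w {x\<in>X. y < x} else {x\<in>X. y < x})" by auto
 then have "card {x \<in> insert w X. y < x} = (if y < w then Suc (card {x\<in>X. y < x}) else card {x\<in>X. y < x})"
  using insert.hyps by simp
 then show ?case using insert by (cases "y < w") (simp_all add: algebra_simps)
qed simp

text \<open>Only the sign is at stake. To the right of a corner there is one more peak than there
  are corners, so numerator and denominator differ in sign and the minus sign in
  \<open>pf_residue\<close> makes the value positive.\<close>

lemma pf_residue_rate:
 assumes v: "valid a b m" and ab: "a < b" and y: "y \<in> corners a b m"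
 shows "pf_residue (of_int ` peaks a b m) (of_int ` corners a b m) (of_int y) = rate a b m y"
proof -
 let ?X = "peaks a b m" and ?Y = "corners a b m"
 have fX: "finite ?X" by (rule finite_subset[OF peaks_subset[OF v]]) simp
 have fY: "finite ?Y" by (rule finite_corners[OF v ab])
 have yr: "2 * a < y" "y < 2 * b" using corners_subset[OF v ab] y by auto
 have yX: "y \<notin> ?X" using y by (auto simp: peaks_def corners_def)
 have P: "(\<Prod>x\<in>ir ` S. y - x) = (- 1) ^ card (S \<inter> {y<..2*b}) * (\<Prod>x\<in>S. \<bar>ir (y - x)\<bar>)"
  if "S \<subseteq> {2*a..2*b}" for S
 proof -
  have fS: "finite S" by (rule finite_subset[OF that]) simp
  have "{x \<in> ir ` S. ir y < x} = ir ` (S \<inter> {y<..2*b})" using that by auto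
  then have "card {x \<in> ir ` S. ir y < x} = card (S \<inter> {y<..2*b})"
   by (simp add: card_image inj_on_def)
  then show ?thesis
   using prod_diff_sign[of "ir ` S" y] fS
   by (simp add: prod.reindex inj_on_def)
 qed
 have XR: "?X \<subseteq> {2*a..2*b}" by (rule peaks_subset[OF v])
 have YR: "?Y - {y} \<subseteq> {2*a..2*b}" using corners_subset[OF v ab] by auto
 have img: "ir ` ?Y - {ir y} = ir ` (?Y - {y})" by auto
 have e1: "(?Y - {y}) \<inter> {y<..2*b} = ?Y \<inter> {y<..2*b}" by auto
 have par: "card (?X \<inter> {y<..2*b}) = Suc (card (?Y \<inter> {y<..2*b}))"
  using card_peaks_above[OF v ab, of y] yr y corner_cases[OF v ab, of y] by (auto split: if_splits)
 have "(\<Sum>w\<in>{2*a..2*b}. ir (curv a b m w) * ln \<bar>ir (y - w)\<bar>)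
  = (\<Sum>w\<in>?X. ln \<bar>ir (y - w)\<bar>) - (\<Sum>w\<in>?Y. ln \<bar>ir (y - w)\<bar>)"
  by (rule curv_sum_peaks_corners[OF v ab])
 \<comment> \<open>The corner itself contributes \<open>ln 0 = 0\<close>, which is why
   \<open>rate\<close> can sum over all columns without excluding its own.\<close>
 also have "(\<Sum>w\<in>?Y. ln \<bar>ir (y - w)\<bar>) = (\<Sum>w\<in>?Y - {y}. ln \<bar>ir (y - w)\<bar>)"
  using y fY by (subst sum.remove[of _ y]) auto
 finally have "rate a b m y = exp (\<Sum>w\<in>?X. ln \<bar>ir (y - w)\<bar>) / exp (\<Sum>w\<in>?Y - {y}. ln \<bar>ir (y - w)\<bar>)"
  by (simp add: rate_def exp_diff)
 also have "exp (\<Sum>w\<in>?X. ln \<bar>ir (y - w)\<bar>) = (\<Prod>w\<in>?X. \<bar>ir (y - w)\<bar>)"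
  unfolding exp_sum[OF fX] by (rule prod.cong) (use yX in auto)
 also have "exp (\<Sum>w\<in>?Y - {y}. ln \<bar>ir (y - w)\<bar>) = (\<Prod>w\<in>?Y - {y}. \<bar>ir (y - w)\<bar>)"
  unfolding exp_sum[OF finite_Diff[OF fY]] by (rule prod.cong) auto
 finally have R: "rate a b m y = (\<Prod>w\<in>?X. \<bar>ir (y - w)\<bar>) / (\<Prod>w\<in>?Y - {y}. \<bar>ir (y - w)\<bar>)" .
 show ?thesis
  unfolding pf_residue_def img P[OF XR] P[OF YR] e1 par R by simp
qed

lemma pf_residue_rate_complex:
 assumes v: "valid a b m" and ab: "a < b" and y: "y \<in> corners a b m"
 shows "pf_residue (of_int ` peaks a b m) (of_int ` corners a b m) (of_int y) = complex_of_real (rate a b m y)"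
proof -
 have d1: "ir ` S - {of_int y} = of_int ` (S - {y})"
  and d2: "complex_of_int ` S - {of_int y} = of_int ` (S - {y})" for S by auto
 have "pf_residue (of_int ` peaks a b m) (of_int ` corners a b m) (of_int y) =
  complex_of_real (pf_residue (of_int ` peaks a b m) (of_int ` corners a b m) (of_int y))"
  unfolding pf_residue_def d1 d2 by (simp add: prod.reindex inj_on_def)
 then show ?thesis using pf_residue_rate[OF assms] by simp
qed

text \<open>By the second part of \<open>partial_fractions\<close> the sum is half of the second
  moment minus the squared first moment, for the signed measure of peaks and corners. Removals keep
  the first moment and lower the second by two each.\<close>

lemma sum_rates:
 assumes v: "valid a b m" and ab: "a < b"
 shows "(\<Sum>x\<in>corners a b m. rate a b m x) = real (nbox a b) - real (removed a b m)"
proof -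
 let ?X = "peaks a b m" and ?Y = "corners a b m"
 have fX: "finite ?X" by (rule finite_subset[OF peaks_subset[OF v]]) simp
 have fY: "finite ?Y" by (rule finite_corners[OF v ab])
 have c: "card (ir ` ?X) = Suc (card (ir ` ?Y))"
  using card_peaks[OF v ab] by (simp add: card_image inj_on_def)
 have "2 * (\<Sum>y\<in>ir ` ?Y. pf_residue (ir ` ?X) (ir ` ?Y) y)
  = (\<Sum>x\<in>ir ` ?X. x\<^sup>2) - (\<Sum>y\<in>ir ` ?Y. y\<^sup>2) - (\<Sum>(ir ` ?X) - \<Sum>(ir ` ?Y))\<^sup>2"
  by (rule partial_fractions[OF finite_imageI[OF fY] finite_imageI[OF fX] c, THEN conjunct2])
 then have "2 * (\<Sum>y\<in>?Y. rate a b m y)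
  = (\<Sum>x\<in>?X. (ir x)\<^sup>2) - (\<Sum>y\<in>?Y. (ir y)\<^sup>2) - ((\<Sum>x\<in>?X. ir x) - (\<Sum>y\<in>?Y. ir y))\<^sup>2"
  by (simp add: sum.reindex inj_on_def pf_residue_rate[OF v ab])
 also have "\<dots> = (\<Sum>x\<in>{2*a..2*b}. ir (curv a b m x) * (ir x)\<^sup>2)
   - (\<Sum>x\<in>{2*a..2*b}. ir (curv a b m x) * ir x)\<^sup>2"
  unfolding curv_sum_peaks_corners[OF v ab] ..
 also have "\<dots> = 2 * real (nbox a b) - 2 * real (removed a b m)"
 proof -
  have "real (m x) * (2 * (ir x)\<^sup>2 - (ir (x - 1))\<^sup>2 - (ir (x + 1))\<^sup>2)
   = - (2 * real (m x))" for x
   by (simp add: power2_eq_square algebra_simps)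
  then have "(\<Sum>x\<in>{2*a..2*b}. real (m x) * (2 * (ir x)\<^sup>2 - (ir (x - 1))\<^sup>2 - (ir (x + 1))\<^sup>2))
   = - (2 * real (removed a b m))"
   by (simp add: removed_def sum_negf sum_distrib_left)
  then show ?thesis
   unfolding curv_sum[OF v] curv0_sum_power[OF less_imp_le[OF ab]] by simp
 qed
 finally show ?thesis by simp
qed

text \<open>The constant term is the first moment of peaks against corners, which removals do not
  change.\<close>

lemma resolvent_identity:
 assumes v: "valid a b m" and ab: "a < b" and z: "z \<notin> of_int ` corners a b m"
 shows "(\<Prod>x\<in>peaks a b m. z - of_int x) / (\<Prod>x\<in>corners a b m. z - of_int x)
  = z - of_int (a + b) - (\<Sum>x\<in>corners a b m. complex_of_real (rate a b m x) / (z - of_int x))"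
proof -
 let ?X = "peaks a b m" and ?Y = "corners a b m"
 have fX: "finite ?X" by (rule finite_subset[OF peaks_subset[OF v]]) simp
 have fY: "finite ?Y" by (rule finite_corners[OF v ab])
 have c: "card (complex_of_int ` ?X) = Suc (card (complex_of_int ` ?Y))"
  using card_peaks[OF v ab] by (simp add: card_image inj_on_def)
 have s: "(\<Sum>x\<in>?X. x) - (\<Sum>y\<in>?Y. y) = a + b"
 proof -
  have "(\<Sum>x\<in>?X. ir x) - (\<Sum>y\<in>?Y. ir y) = (\<Sum>x\<in>{2*a..2*b}. ir (curv a b m x) * ir x)"
   by (rule curv_sum_peaks_corners[OF v ab, symmetric])
  also have "\<dots> = ir (a + b)"
   unfolding curv_sum[OF v] curv0_sum_power[OF less_imp_le[OF ab]] by simp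
  finally have "ir ((\<Sum>x\<in>?X. x) - (\<Sum>y\<in>?Y. y)) = ir (a + b)"
   by (simp only: of_int_sum of_int_diff)
  then show ?thesis by (simp only: of_int_eq_iff)
 qed
 have s': "(\<Sum>x\<in>?X. complex_of_int x) - (\<Sum>y\<in>?Y. complex_of_int y) = of_int (a + b)"
  unfolding s[symmetric] of_int_sum of_int_diff ..
 have "(\<Prod>x\<in>complex_of_int ` ?X. z - x) / (\<Prod>y\<in>complex_of_int ` ?Y. z - y)
      = z - (\<Sum>(complex_of_int ` ?X) - \<Sum>(complex_of_int ` ?Y))
       - (\<Sum>y\<in>complex_of_int ` ?Y. pf_residue (complex_of_int ` ?X) (complex_of_int ` ?Y) y / (z - y))"
  by (rule partial_fractions[OF finite_imageI[OF fY] finite_imageI[OF fX] c, THEN conjunct1, rule_format, OF z])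
 moreover have "(\<Prod>x\<in>complex_of_int ` S. g x) = (\<Prod>x\<in>S. g (of_int x))"
  and "(\<Sum>x\<in>complex_of_int ` S. g x) = (\<Sum>x\<in>S. g (of_int x))" for S and g :: "complex => complex"
  by (simp_all add: sum.reindex prod.reindex inj_on_def)
 ultimately show ?thesis
  unfolding s'[symmetric] by (simp add: pf_residue_rate_complex[OF v ab])
qed

text \<open>Minus the second difference of the logarithm of the distance: the amount by which a
  removal in column \<open>w\<close> changes \<open>ln\<close> of the rate in column
  \<open>x\<close>. The convention \<open>ln 0 = 0\<close> covers equal and adjacent
  columns.\<close>

definition interaction :: "int => int => real" where
 "interaction x w = 2 * ln \<bar>ir (x - w)\<bar> - ln \<bar>ir (x - w + 1)\<bar> - ln \<bar>ir (x - w - 1)\<bar>"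

lemma interaction_commute: "interaction x w = interaction w x"
proof -
 have "\<bar>ir (x - w)\<bar> = \<bar>ir (w - x)\<bar>" "\<bar>ir (x - w + 1)\<bar> = \<bar>ir (w - x - 1)\<bar>"
  "\<bar>ir (x - w - 1)\<bar> = \<bar>ir (w - x + 1)\<bar>" by auto
 then show ?thesis unfolding interaction_def by simp
qed

text \<open>Concavity of \<open>ln\<close>. Beyond the adjacent columns a removal can only speed up
  other removals; every monotone coupling below rests on this attraction.\<close>

lemma interaction_nonneg:
 assumes "2 <= \<bar>x - w\<bar>"
 shows "0 <= interaction x w"
proof -
 define d where "d = \<bar>ir (x - w)\<bar>"
 have d: "2 <= d" using assms unfolding d_def by linarith
 have "{\<bar>ir (x - w + 1)\<bar>, \<bar>ir (x - w - 1)\<bar>} = {d + 1, d - 1}"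
  using assms unfolding d_def by auto
 then have "interaction x w = 2 * ln d - (ln (d + 1) + ln (d - 1))"
  unfolding interaction_def d_def[symmetric] by (auto simp: doubleton_eq_iff)
 moreover have "ln (d + 1) + ln (d - 1) <= 2 * ln d"
 proof -
  have "ln (d + 1) + ln (d - 1) = ln ((d + 1) * (d - 1))" using d by (simp add: ln_mult)
  also have "\<dots> <= ln (d * d)"
   using d mult_mono[of 2 d 2 d] by (intro ln_mono) (auto simp: algebra_simps)
  also have "ln (d * d) = 2 * ln d" using d by (simp add: ln_mult)
  finally show ?thesis .
 qed
 ultimately show ?thesis by simp
qed

lemma ln_rate:
 assumes v: "valid a b m"
 shows "ln (rate a b m x) = (\<Sum>w\<in>{2*a..2*b}. ir (curv0 a b w) * ln \<bar>ir (x - w)\<bar>)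
  + (\<Sum>w\<in>{2*a..2*b}. real (m w) * interaction x w)"
proof -
 have "ln (rate a b m x) = (\<Sum>w\<in>{2*a..2*b}. ir (curv a b m w) * ln \<bar>ir (x - w)\<bar>)"
  by (simp add: rate_def)
 also have "\<dots> = (\<Sum>w\<in>{2*a..2*b}. ir (curv0 a b w) * ln \<bar>ir (x - w)\<bar>)
  + (\<Sum>w\<in>{2*a..2*b}. real (m w) * (2 * ln \<bar>ir (x - w)\<bar> - ln \<bar>ir (x - (w - 1))\<bar> - ln \<bar>ir (x - (w + 1))\<bar>))"
  by (rule curv_sum[OF v])
 finally show ?thesis by (simp add: interaction_def algebra_simps)
qed

lemma rate_pos [simp]: "0 < rate a b m x" by (simp add: rate_def)

lemma corner_succ:
 assumes v: "valid a b m" and ab: "a < b" and x: "x \<in> corners a b m"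
 shows "x + 1 \<notin> corners a b m"
proof
 assume "x + 1 \<in> corners a b m"
 then have "if even x then m x = m (x + 1) else m x = m (x + 1) + 1"
  using corner_cases[OF v ab, of "x + 1"] by (simp split: if_splits)
 moreover have "if odd x then m (x + 1) = m x else m (x + 1) = m x + 1"
  using x corner_cases[OF v ab, of x] by (simp split: if_splits)
 ultimately show False by (cases "odd x") simp_all
qed

lemma corners_far:
 assumes v: "valid a b m" and ab: "a < b" and x: "x \<in> corners a b m" and y: "y \<in> corners a b m" and "x \<noteq> y"
 shows "2 <= \<bar>x - y\<bar>"
proof (rule ccontr)
 assume "\<not> 2 <= \<bar>x - y\<bar>"
 then consider "y = x + 1" | "x = y + 1" using assms(5) by linarith
 then show False using corner_succ[OF v ab x] corner_succ[OF v ab y] x y by cases auto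
qed

lemma corner_upd:
 assumes v: "valid a b m" and ab: "a < b" and "x \<in> corners a b m" "y \<in> corners a b m" "x \<noteq> y"
 shows "y \<in> corners a b (m(x := m x + 1))"
proof -
 have "x \<noteq> y - 1" "x \<noteq> y + 1" using corners_far[OF assms] by auto
 then have "curv a b (m(x := m x + 1)) y = curv a b m y" using \<open>x \<noteq> y\<close> by (simp add: curv_def)
 then show ?thesis using assms(4) by (simp add: corners_def)
qed

lemma rate_upd:
 assumes v: "valid a b m" and ab: "a < b" and x: "x \<in> corners a b m"
 shows "rate a b (m(x := m x + 1)) y = rate a b m y * exp (interaction y x)"
proof -
 have xr: "x \<in> {2*a..2*b}" using corners_subset[OF v ab] x by auto
 have "(\<Sum>w\<in>{2*a..2*b}. real ((m(x := m x + 1)) w) * interaction y w)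
  = (\<Sum>w\<in>{2*a..2*b}. real (m w) * interaction y w) + interaction y x"
  unfolding sum.remove[OF finite_atLeastAtMost_int xr]
  by (auto simp: algebra_simps intro!: sum.cong)
 then have "ln (rate a b (m(x := m x + 1)) y) = ln (rate a b m y) + interaction y x"
  unfolding ln_rate[OF v] ln_rate[OF valid_upd[OF v ab x]] by simp
 then show ?thesis
  by (metis exp_add exp_ln rate_pos)
qed

text \<open>Symmetry of the interaction: two removals have the same weight in either order, as they
  must if all linear extensions are equally likely.\<close>

lemma rate_exchange:
 assumes v: "valid a b m" and ab: "a < b" and "x \<in> corners a b m" "y \<in> corners a b m"
 shows "rate a b m x * rate a b (m(x := m x + 1)) y = rate a b m y * rate a b (m(y := m y + 1)) x"
 using rate_upd[OF v ab assms(3), of y] rate_upd[OF v ab assms(4), of x]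
 by (simp add: interaction_commute)

text \<open>Moving inwards from a side of the staircase, the count rises by at most one every two
  columns, so the removed part cannot cross the sides. It is needed to place the box at a corner
  inside the staircase.\<close>

lemma profile_bound:
 assumes v: "valid a b m" and x: "2 * a <= x" "x <= 2 * b"
 shows "2 * int (m x) + (if odd x then 1 else 2) <= 2 + 2 * b - x"
  and "2 * int (m x) + (if odd x then 1 else 2) <= 2 + x - 2 * a"
proof -
 show "2 * int (m x) + (if odd x then 1 else 2) <= 2 + 2 * b - x"
  using x(2,1)
 proof (induction x rule: int_le_induct)
  case base
  then show ?case using valid_outside[OF v] by simp
 next
  case (step x)
  then show ?case
   using valid_odd(2)[OF v, of "x - 1"] valid_even(1)[OF v, of "x - 1"]
   by (cases "odd x") (auto)
 qed
 show "2 * int (m x) + (if odd x then 1 else 2) <= 2 + x - 2 * a"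
  using x
 proof (induction x rule: int_ge_induct)
  case base
  then show ?case using valid_outside[OF v] by simp
 next
  case (step x)
  have "x + 1 < 2 * b" if "even x" using that step.prems by presburger
  with step show ?case
   using valid_odd(4)[OF v, of "x + 1"] valid_even(2)[OF v, of "x + 1"]
   by (cases "odd x") (auto)
 qed
qed

subsection \<open>Removal dynamics\<close>

text \<open>Both laws are embedded into a sum type in which points of \<open>C\<close> are
  identified with their images and all other points are kept apart, so that the coupling on a common
  type applies.\<close>

lemma rel_pmf_agree_on_inj:
 fixes p :: "'a pmf" and q :: "'b pmf"
 assumes inj: "inj_on phi C" and le: "\<And>x. x \<in> C ==> pmf p x <= pmf q (phi x)"
 shows "rel_pmf (\<lambda>x y. x \<in> C --> y = phi x) p q"
proof -
 define psi :: "'a => 'b + 'a" where "psi x = (if x \<in> C then Inl (phi x) else Inr x)" for x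
 have injpsi: "inj psi" using inj by (auto simp: inj_def psi_def inj_on_def)
 have injl: "inj (Inl :: 'b => 'b + 'a)" by auto
 have "rel_pmf (\<lambda>x y. x \<in> psi ` C --> y = x) (map_pmf psi p) (map_pmf Inl q)"
 proof (rule rel_pmf_agree_on)
  fix s assume "s \<in> psi ` C"
  then obtain x where x: "x \<in> C" "s = psi x" by auto
  then have s: "s = Inl (phi x)" by (simp add: psi_def)
  have "pmf (map_pmf psi p) (psi x) = pmf p x" using injpsi by (rule pmf_map_inj')
  moreover have "pmf (map_pmf Inl q) (Inl (phi x) :: 'b + 'a) = pmf q (phi x)" using injl by (rule pmf_map_inj')
  ultimately show "pmf (map_pmf psi p) s <= pmf (map_pmf Inl q) s" using le[OF x(1)] x s by simp
 qed
 then have "rel_pmf (\<lambda>x y. psi x \<in> psi ` C --> Inl y = psi x) p q" by (simp add: pmf.rel_map)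
 then show ?thesis by (rule pmf.rel_mono_strong) (auto simp: psi_def)
qed

definition sub_pmf :: "'a set => ('a => real) => 'a option pmf" where
 "sub_pmf S f = embed_pmf (case_option (1 - sum f S) (\<lambda>x. if x \<in> S then f x else 0))"

lemma pmf_sub_pmf:
 assumes S: "finite S" and f: "\<And>x. x \<in> S ==> 0 <= f x" "sum f S <= 1"
 shows "pmf (sub_pmf S f) y = case_option (1 - sum f S) (\<lambda>x. if x \<in> S then f x else 0) y"
 unfolding sub_pmf_def
proof (rule pmf_embed_pmf)
 let ?g = "case_option (1 - sum f S) (\<lambda>x. if x \<in> S then f x else 0)"
 show nn: "0 <= ?g x" for x using f by (auto split: option.split)
 have "(\<integral>\<^sup>+ x. ennreal (?g x) \<partial>count_space UNIV) = (\<Sum>x\<in>insert None (Some ` S). ennreal (?g x))"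
  by (rule nn_integral_count_space') (use S nn in \<open>auto split: option.splits\<close>)
 also have "\<dots> = ennreal (\<Sum>x\<in>insert None (Some ` S). ?g x)" using nn by (intro sum_ennreal) auto
 also have "(\<Sum>x\<in>insert None (Some ` S). ?g x) = 1"
  using S by (subst sum.insert) (auto simp: sum.reindex)
 finally show "(\<integral>\<^sup>+ x. ennreal (?g x) \<partial>count_space UNIV) = 1" by simp
qed

type_synonym state = "nat => int => nat"

text \<open>Continuous time is replaced by steps in which each corner is removed with probability \<open>rate / L\<close>
 for a large \<open>L\<close>. Several disjoint staircases \<open>A i, B i\<close> for \<open>i < k\<close> evolve independently, up to the
 exclusion of simultaneous removals.\<close>

definition sys_moves :: "nat => (nat => int) => (nat => int) => state => (nat \<times> int) set" where
 "sys_moves k A B ms = (SIGMA i:{..<k}. corners (A i) (B i) (ms i))"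

definition move_pmf :: "nat => (nat => int) => (nat => int) => real => state => (nat \<times> int) option pmf" where
 "move_pmf k A B L ms = sub_pmf (sys_moves k A B ms) (\<lambda>(i, x). rate (A i) (B i) (ms i) x / L)"

definition incr :: "state => nat => int => state" where
 "incr ms i x = ms(i := (ms i)(x := ms i x + 1))"

fun do_move :: "state => (nat \<times> int) option => state" where
 "do_move ms None = ms"
| "do_move ms (Some (i, x)) = incr ms i x"

definition step_pmf :: "nat => (nat => int) => (nat => int) => real => state => state pmf" where
 "step_pmf k A B L ms = map_pmf (do_move ms) (move_pmf k A B L ms)"

text \<open>Whole trajectories are kept, since the events to be compared refer to several times at
  once.\<close>

primrec path_pmf :: "nat => (nat => int) => (nat => int) => real => nat => state => state list pmf" where
 "path_pmf k A B L 0 ms = return_pmf [ms]"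
| "path_pmf k A B L (Suc s) ms =
  bind_pmf (step_pmf k A B L ms) (\<lambda>ms'. map_pmf (Cons ms) (path_pmf k A B L s ms'))"

primrec at_pmf :: "nat => (nat => int) => (nat => int) => real => nat => state => state pmf" where
 "at_pmf k A B L 0 ms = return_pmf ms"
| "at_pmf k A B L (Suc s) ms = bind_pmf (at_pmf k A B L s ms) (step_pmf k A B L)"

definition sys_box :: "nat => (nat => int) => (nat => int) => nat" where
 "sys_box k A B = (\<Sum>i<k. nbox (A i) (B i))"

text \<open>The total rate is the number of remaining boxes, so a scale \<open>L\<close> no smaller
  than the number of all boxes leaves a nonnegative probability for doing nothing.\<close>

definition sys_ok :: "nat => (nat => int) => (nat => int) => real => bool" where
 "sys_ok k A B L \<longleftrightarrow> (\<forall>i<k. A i < B i) \<and> real (sys_box k A B) <= L \<and> 0 < L"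

definition sys_valid :: "nat => (nat => int) => (nat => int) => state => bool" where
 "sys_valid k A B ms \<longleftrightarrow> (\<forall>i<k. valid (A i) (B i) (ms i))"

lemma finite_sys_moves: "sys_ok k A B L ==> sys_valid k A B ms ==> finite (sys_moves k A B ms)"
 unfolding sys_moves_def by (intro finite_SigmaI) (auto simp: sys_ok_def sys_valid_def intro: finite_corners)

lemma sum_moves:
 assumes "sys_ok k A B L" "sys_valid k A B ms"
 shows "(\<Sum>(i, x)\<in>sys_moves k A B ms. g i x) = (\<Sum>i<k. \<Sum>x\<in>corners (A i) (B i) (ms i). g i x)"
 unfolding sys_moves_def
 by (rule sum.Sigma[symmetric]) (use assms in \<open>auto simp: sys_ok_def sys_valid_def intro: finite_corners\<close>)

lemma sum_move_rates:
 assumes "sys_ok k A B L" "sys_valid k A B ms"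
 shows "(\<Sum>(i, x)\<in>sys_moves k A B ms. rate (A i) (B i) (ms i) x / L)
  = (\<Sum>i<k. real (nbox (A i) (B i)) - real (removed (A i) (B i) (ms i))) / L"
proof -
 have "(\<Sum>x\<in>corners (A i) (B i) (ms i). rate (A i) (B i) (ms i) x / L)
   = (real (nbox (A i) (B i)) - real (removed (A i) (B i) (ms i))) / L" if "i < k" for i
  using sum_rates[of "A i" "B i" "ms i"] assms that
  by (simp add: sys_ok_def sys_valid_def flip: sum_divide_distrib)
 then show ?thesis
  unfolding sum_moves[OF assms] by (simp add: sum_divide_distrib)
qed

lemma pmf_move_pmf:
 assumes "sys_ok k A B L" "sys_valid k A B ms"
 shows "pmf (move_pmf k A B L ms) (Some (i, x))
   = (if (i, x) \<in> sys_moves k A B ms then rate (A i) (B i) (ms i) x / L else 0)"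
  and "pmf (move_pmf k A B L ms) None
   = 1 - (\<Sum>i<k. real (nbox (A i) (B i)) - real (removed (A i) (B i) (ms i))) / L"
proof -
 have "(\<Sum>i<k. real (nbox (A i) (B i)) - real (removed (A i) (B i) (ms i))) <= real (sys_box k A B)"
  unfolding sys_box_def of_nat_sum by (rule sum_mono) simp
 then have le: "(\<Sum>i<k. real (nbox (A i) (B i)) - real (removed (A i) (B i) (ms i))) / L <= 1"
  using assms(1) by (simp add: sys_ok_def)
 have P: "pmf (move_pmf k A B L ms) y = case_option (1 - sum (\<lambda>(i, x). rate (A i) (B i) (ms i) x / L) (sys_moves k A B ms))
  (\<lambda>z. if z \<in> sys_moves k A B ms then (\<lambda>(i, x). rate (A i) (B i) (ms i) x / L) z else 0) y" for y
  unfolding move_pmf_def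
  by (rule pmf_sub_pmf) (use finite_sys_moves[OF assms] le assms(1) in
    \<open>auto simp: sum_move_rates[OF assms] sys_ok_def intro!: divide_nonneg_pos less_imp_le[OF rate_pos]\<close>)
 show "pmf (move_pmf k A B L ms) (Some (i, x))
   = (if (i, x) \<in> sys_moves k A B ms then rate (A i) (B i) (ms i) x / L else 0)"
  unfolding P by simp
 show "pmf (move_pmf k A B L ms) None
   = 1 - (\<Sum>i<k. real (nbox (A i) (B i)) - real (removed (A i) (B i) (ms i))) / L"
  unfolding P by (simp add: sum_move_rates[OF assms])
qed

lemma set_move_pmf:
 assumes "sys_ok k A B L" "sys_valid k A B ms"
 shows "set_pmf (move_pmf k A B L ms) \<subseteq> insert None (Some ` sys_moves k A B ms)"
proof
 fix y assume y: "y \<in> set_pmf (move_pmf k A B L ms)"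
 show "y \<in> insert None (Some ` sys_moves k A B ms)"
 proof (cases y)
  case (Some z)
  then obtain i x where "y = Some (i, x)" by (cases z) auto
  then show ?thesis using y pmf_move_pmf(1)[OF assms, of i x] by (auto simp: set_pmf_iff split: if_splits)
 qed simp
qed

lemma finite_set_move_pmf: "sys_ok k A B L ==> sys_valid k A B ms ==> finite (set_pmf (move_pmf k A B L ms))"
 using finite_subset[OF set_move_pmf] finite_sys_moves by (metis finite_imageI finite_insert)

lemma sys_valid_incr:
 assumes "sys_ok k A B L" "sys_valid k A B ms" "(i, x) \<in> sys_moves k A B ms"
 shows "sys_valid k A B (incr ms i x)"
 unfolding sys_valid_def incr_def
proof (intro allI impI)
 fix j assume j: "j < k"
 show "valid (A j) (B j) ((ms(i := (ms i)(x := ms i x + 1))) j)"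
 proof (cases "j = i")
  case True
  then show ?thesis using valid_upd[of "A i" "B i" "ms i" x] assms j
   by (auto simp: sys_ok_def sys_valid_def sys_moves_def)
 qed (use assms j in \<open>auto simp: sys_valid_def\<close>)
qed

lemma sys_valid_step:
 assumes "sys_ok k A B L" "sys_valid k A B ms" "ms' \<in> set_pmf (step_pmf k A B L ms)"
 shows "sys_valid k A B ms'"
proof -
 obtain y where y: "y \<in> set_pmf (move_pmf k A B L ms)" "ms' = do_move ms y"
  using assms(3) by (auto simp: step_pmf_def)
 show ?thesis
 proof (cases y)
  case (Some z)
  then obtain i x where "y = Some (i, x)" by (cases z) auto
  then show ?thesis using y set_move_pmf[OF assms(1,2)] sys_valid_incr[OF assms(1,2)] by auto
 qed (use y assms in simp)
qed

lemma finite_set_step_pmf: "sys_ok k A B L ==> sys_valid k A B ms ==> finite (set_pmf (step_pmf k A B L ms))"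
 by (simp add: step_pmf_def finite_set_move_pmf)

lemma sys_valid_at:
 assumes "sys_ok k A B L" "sys_valid k A B ms"
 shows "\<forall>ms'\<in>set_pmf (at_pmf k A B L s ms). sys_valid k A B ms'"
 by (induction s) (use assms sys_valid_step[OF assms(1)] in auto)

lemma finite_set_at_pmf:
 assumes "sys_ok k A B L" "sys_valid k A B ms"
 shows "finite (set_pmf (at_pmf k A B L s ms))"
proof (induction s)
 case (Suc s)
 then show ?case using sys_valid_at[OF assms, of s] finite_set_step_pmf[OF assms(1)] by auto
qed simp

lemma at_pmf_Suc': "at_pmf k A B L (Suc s) ms = bind_pmf (step_pmf k A B L ms) (at_pmf k A B L s)"
proof (induction s)
 case 0
 show ?case by (simp add: bind_return_pmf bind_return_pmf')
next
 case (Suc s)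
 have "at_pmf k A B L (Suc (Suc s)) ms = bind_pmf (at_pmf k A B L (Suc s) ms) (step_pmf k A B L)" by simp
 then show ?case unfolding Suc by (simp add: bind_assoc_pmf)
qed

lemma length_path: "p \<in> set_pmf (path_pmf k A B L s ms) ==> length p = Suc s"
 by (induction s arbitrary: ms p) auto

lemma path_at:
 "t <= s ==> map_pmf (\<lambda>p. p ! t) (path_pmf k A B L s ms) = at_pmf k A B L t ms"
proof (induction s arbitrary: ms t)
 case (Suc s)
 show ?case
 proof (cases t)
  case 0
  have "map_pmf (\<lambda>p. p ! 0) (path_pmf k A B L (Suc s) ms)
   = bind_pmf (step_pmf k A B L ms) (\<lambda>ms'. map_pmf (\<lambda>_. ms) (path_pmf k A B L s ms'))"
   by (simp add: map_bind_pmf pmf.map_comp o_def)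
  then show ?thesis using 0 by simp
 next
  case (Suc t')
  have "map_pmf (\<lambda>p. p ! t) (path_pmf k A B L (Suc s) ms)
   = bind_pmf (step_pmf k A B L ms) (\<lambda>ms'. map_pmf (\<lambda>p. p ! t') (path_pmf k A B L s ms'))"
   by (simp add: map_bind_pmf pmf.map_comp o_def Suc)
  also have "\<dots> = at_pmf k A B L t ms"
   unfolding Suc at_pmf_Suc' by (rule bind_pmf_cong) (use Suc Suc.IH Suc.prems in auto)
  finally show ?thesis .
 qed
qed simp

lemma path_mono_time:
 assumes "p \<in> set_pmf (path_pmf k A B L s ms)" "t <= t'" "t' <= s"
 shows "(p ! t) i x <= (p ! t') i x"
 using assms
proof (induction s arbitrary: ms p t t')
 case (Suc s)
 from Suc.prems(1) obtain ms' q where q: "ms' \<in> set_pmf (step_pmf k A B L ms)" "q \<in> set_pmf (path_pmf k A B L s ms')" "p = ms # q"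
  by auto
 have st: "ms i x <= ms' i x"
 proof -
  obtain y where "ms' = do_move ms y" using q by (auto simp: step_pmf_def)
  then show ?thesis by (cases "(ms, y)" rule: do_move.cases) (auto simp: incr_def)
 qed
 have q0: "q ! 0 = ms'" using q(2) by (cases s) auto
 have q0': "(q ! 0) i x <= (q ! t) i x" if "t <= s" for t
  using Suc.IH[OF q(2), of 0 t] that by simp
 show ?case
 proof (cases t)
  case 0
  then show ?thesis using q st q0 q0' Suc.prems by (cases t') (auto intro: le_trans)
 next
  case (Suc u)
  then show ?thesis using Suc.prems q Suc.IH[OF q(2), of u "t' - 1"] by (cases t') auto
 qed
qed simp

section \<open>Comparison of rates in nested staircases\<close>

definition pot :: "int => int => int => real" where
 "pot a b x = (\<Sum>w\<in>{2*a..2*b}. ir (curv0 a b w) * ln \<bar>ir (x - w)\<bar>)"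

lemma pot_extend_right:
 assumes "a <= b" "x < 2 * b"
 shows "pot a (b + 1) x = pot a b x - ln (ir (2 * b + 1 - x)) + ln (ir (2 * b + 2 - x))"
proof -
 have "{2*a..2*(b+1)} = insert (2*b+2) (insert (2*b+1) {2*a..2*b})" using assms by auto
 moreover have "(\<Sum>w\<in>{2*a..2*b}. ir (curv0 a (b + 1) w) * ln \<bar>ir (x - w)\<bar>) = pot a b x"
  unfolding pot_def by (rule sum.cong) (auto simp: curv0_def)
 moreover have "\<bar>ir (x - (2*b+2))\<bar> = ir (2 * b + 2 - x)"
  "\<bar>ir (x - (2*b+1))\<bar> = ir (2 * b + 1 - x)" using assms by auto
 ultimately show ?thesis using assms unfolding pot_def by (simp add: curv0_def)
qed

lemma pot_extend_left:
 assumes "a <= b" "2 * a < x"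
 shows "pot (a - 1) b x = pot a b x - ln (ir (x + 1 - 2 * a)) + ln (ir (x + 2 - 2 * a))"
proof -
 have "{2*(a-1)..2*b} = insert (2*a-2) (insert (2*a-1) {2*a..2*b})" using assms by auto
 moreover have "(\<Sum>w\<in>{2*a..2*b}. ir (curv0 (a - 1) b w) * ln \<bar>ir (x - w)\<bar>) = pot a b x"
  unfolding pot_def by (rule sum.cong) (auto simp: curv0_def)
 moreover have "\<bar>ir (x - (2*a-2))\<bar> = ir (x + 2 - 2 * a)"
  "\<bar>ir (x - (2*a-1))\<bar> = ir (x + 1 - 2 * a)" using assms by auto
 ultimately have "pot (a - 1) b x = ln (ir x - (2 * ir a - 2))
   - ln (ir x - (2 * ir a - 1)) + pot a b x"
  using assms unfolding pot_def by (simp add: curv0_def)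
 then show ?thesis by (simp add: algebra_simps)
qed

lemma ln_step_bounds:
 fixes y :: real
 assumes "0 < y"
 shows "(ln (y + 3) - ln (y + 1)) / 2 <= ln (y + 2) - ln (y + 1)"
  and "ln (y + 2) - ln (y + 1) <= (ln (y + 2) - ln y) / 2"
proof -
 have "ln (y + 3) + ln (y + 1) = ln ((y + 3) * (y + 1))" using assms by (simp add: ln_mult)
 also have "\<dots> <= ln ((y + 2) * (y + 2))" using assms by (intro ln_mono) (auto simp: algebra_simps intro: add_pos_pos)
 also have "\<dots> = 2 * ln (y + 2)" using assms by (simp add: ln_mult)
 finally show "(ln (y + 3) - ln (y + 1)) / 2 <= ln (y + 2) - ln (y + 1)" by simp
 have "ln (y + 2) + ln y = ln ((y + 2) * y)" using assms by (simp add: ln_mult)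
 also have "\<dots> <= ln ((y + 1) * (y + 1))" using assms by (intro ln_mono) (auto simp: algebra_simps intro: add_pos_pos)
 also have "\<dots> = 2 * ln (y + 1)" using assms by (simp add: ln_mult)
 finally show "ln (y + 2) - ln (y + 1) <= (ln (y + 2) - ln y) / 2" by simp
qed

text \<open>Its square root is the semicircle. The two offsets by one are chosen so that ratios of
  initial rates can be compared exactly at every size and not only asymptotically.\<close>

definition width2 :: "int => int => int => real" where
 "width2 a b x = ir (2 * b + 1 - x) * ir (x + 1 - 2 * a)"

text \<open>The inner staircase is enlarged by one unit on one side at a time. A step adds two
  opposite charges, which raises \<open>pot\<close> by \<open>ln (y + 2) - ln (y + 1)\<close>, while
  half of the logarithm of \<open>width2\<close> grows by half of
  \<open>ln (y + 3) - ln (y + 1)\<close>; concavity of \<open>ln\<close> compares the two.\<close>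

lemma pot_monotone:
 assumes AB: "A < B" and ext: "a <= A" "B <= b" and x: "2 * A < x" "x < 2 * B"
 shows "pot A B x - ln (width2 A B x) / 2 <= pot a b x - ln (width2 a b x) / 2"
proof -
 have w: "ln (width2 a b x) = ln (ir (2 * b + 1 - x)) + ln (ir (x + 1 - 2 * a))"
  if "2 * a < x" "x < 2 * b" for a b
  using that unfolding width2_def by (intro ln_mult_pos) auto
 have r: "pot A B x - ln (width2 A B x) / 2 <= pot A b x - ln (width2 A b x) / 2"
  using ext(2)
 proof (induction b rule: int_ge_induct)
  case (step b)
  have y: "0 < ir (2 * b - x)" using step.hyps x by auto
  show ?case
   using step ln_step_bounds(1)[OF y] pot_extend_right[of A b x] AB x w[of A b] w[of A "b + 1"]
   by (simp add: algebra_simps add_divide_distrib diff_divide_distrib)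
 qed simp
 have "pot A b x - ln (width2 A b x) / 2 <= pot a b x - ln (width2 a b x) / 2"
  using ext(1)
 proof (induction a rule: int_le_induct)
  case (step a)
  have y: "0 < ir (x - 2 * a)" using step.hyps x by auto
  show ?case
   using step ln_step_bounds(1)[OF y] pot_extend_left[of a b x] AB ext x w[of a b] w[of "a - 1" b]
   by (simp add: algebra_simps add_divide_distrib diff_divide_distrib)
 qed simp
 then show ?thesis using r by simp
qed

text \<open>Where ordered profiles touch at a corner of the lower one, the neighbouring counts are
  squeezed together. So the upper profile has a corner there as well, and the negative interactions
  with adjacent columns are the same on both sides. All other columns interact with the right sign,
  and \<open>pot_monotone\<close> compares the initial rates.\<close>

lemma rate_comparison:
 assumes vT: "valid A B m" and vD: "valid a b d" and AB: "A < B" and ext: "a <= A" "B <= b"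
  and le: "\<And>w. m w <= d w" and x: "x \<in> corners A B m" and eq: "m x = d x"
 shows "x \<in> corners a b d" "rate A B m x * sqrt (width2 a b x / width2 A B x) <= rate a b d x"
proof -
 have ab: "a < b" using AB ext by simp
 have xr: "2 * A < x" "x < 2 * B" using corners_subset[OF vT AB] x by auto
 have xr': "2 * a < x" "x < 2 * b" using xr ext by auto
 have cT: "curv A B m x = - 1" using x by (simp add: corners_def)
 have cD: "- 1 <= curv a b d x" using curv_range[OF vD ab, of x] by auto
 have n: "d (x - 1) = m (x - 1) \<and> d (x + 1) = m (x + 1)" and cD': "curv a b d x = - 1"
  using cT cD le[of "x - 1"] le[of "x + 1"] eq
  unfolding curv_inside[OF xr] curv_inside[OF xr'] by linarith+
 show xc: "x \<in> corners a b d" using cD' by (simp add: corners_def)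
 have "(\<Sum>w\<in>{2*A..2*B}. real (m w) * interaction x w) = (\<Sum>w\<in>{2*a..2*b}. real (m w) * interaction x w)"
  by (rule sum.mono_neutral_left) (use ext valid_outside[OF vT] in auto)
 also have "\<dots> <= (\<Sum>w\<in>{2*a..2*b}. real (d w) * interaction x w)"
 proof (rule sum_mono)
  fix w
  consider "w = x - 1" | "w = x" | "w = x + 1" | "2 <= \<bar>x - w\<bar>" by linarith
  then show "real (m w) * interaction x w <= real (d w) * interaction x w"
   using n eq le[of w] interaction_nonneg[of x w]
   by cases (auto intro: mult_right_mono)
 qed
 finally have "ln (rate A B m x) + (pot a b x - pot A B x) <= ln (rate a b d x)"
  unfolding ln_rate[OF vT] ln_rate[OF vD] pot_def by simp
 moreover have "ln (sqrt (width2 a b x / width2 A B x)) <= pot a b x - pot A B x"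
 proof -
  have p: "0 < width2 a b x" "0 < width2 A B x" using xr xr' by (auto simp: width2_def intro!: mult_pos_pos)
  then have "ln (sqrt (width2 a b x / width2 A B x)) = (ln (width2 a b x) - ln (width2 A B x)) / 2"
   by (simp add: ln_sqrt ln_div)
  then show ?thesis using pot_monotone[OF AB ext xr] by (simp add: field_simps)
 qed
 ultimately have "ln (rate A B m x) + ln (sqrt (width2 a b x / width2 A B x)) <= ln (rate a b d x)" by simp
 moreover have "0 < sqrt (width2 a b x / width2 A B x)"
  using xr xr' by (auto simp: width2_def intro!: mult_pos_pos divide_pos_pos)
 ultimately have "ln (rate A B m x * sqrt (width2 a b x / width2 A B x)) <= ln (rate a b d x)"
  using ln_mult_pos[OF rate_pos \<open>0 < sqrt _\<close>] by simp
 then show "rate A B m x * sqrt (width2 a b x / width2 A B x) <= rate a b d x"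
  using \<open>0 < sqrt _\<close> by (subst (asm) ln_le_cancel_iff) (auto intro: mult_pos_pos)
qed

text \<open>Slowing the large staircase down by \<open>L' / L\<close> still leaves its rates above those of the windows.\<close>

definition dominated :: "nat => (nat => int) => (nat => int) => real => int => int => real => bool" where
 "dominated k A B L a b L' \<longleftrightarrow>
  (\<forall>i<k. a <= A i \<and> B i <= b) \<and>
  (\<forall>i<k. \<forall>j<k. i \<noteq> j --> {2 * A i<..<2 * B i} \<inter> {2 * A j<..<2 * B j} = {}) \<and>
  (\<forall>i<k. \<forall>x\<in>{2 * A i<..<2 * B i}. L' / L <= sqrt (width2 a b x / width2 (A i) (B i) x))"

definition below :: "nat => state => state => bool" where
 "below k ms ds \<longleftrightarrow> (\<forall>i<k. \<forall>x. ms i x <= ds 0 x)"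

abbreviation step1 where "step1 a b L \<equiv> step_pmf 1 (\<lambda>_. a) (\<lambda>_. b) L"
abbreviation path1 where "path1 a b L \<equiv> path_pmf 1 (\<lambda>_. a) (\<lambda>_. b) L"
abbreviation at1 where "at1 a b L \<equiv> at_pmf 1 (\<lambda>_. a) (\<lambda>_. b) L"
abbreviation ok1 where "ok1 a b L \<equiv> sys_ok 1 (\<lambda>_. a) (\<lambda>_. b) L"
abbreviation valid1 where "valid1 a b \<equiv> sys_valid 1 (\<lambda>_. a) (\<lambda>_. b)"

text \<open>Order can only be broken by a removal in a column of contact. \<open>C\<close> collects
  these moves: the large staircase copies them, which the rates allow, and disjointness of the
  windows keeps different moves different after copying. Elsewhere a strict inequality leaves room
  for the single box that one step removes.\<close>

lemma step_dominated:
 assumes dom: "dominated k A B L a b L'" and okT: "sys_ok k A B L" and okD: "ok1 a b L'"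
  and vT: "sys_valid k A B ms" and vD: "valid1 a b ds" and le: "below k ms ds"
 shows "rel_pmf (\<lambda>ms' ds'. sys_valid k A B ms' \<and> valid1 a b ds' \<and> below k ms' ds')
     (step_pmf k A B L ms) (step1 a b L' ds)"
proof -
 let ?D = "\<lambda>_ :: nat. a" and ?E = "\<lambda>_ :: nat. b"
 define C where "C = {Some (i, x) | i x. (i, x) \<in> sys_moves k A B ms \<and> ms i x = ds 0 x}"
 define phi :: "(nat \<times> int) option => (nat \<times> int) option" where "phi = map_option (\<lambda>(i, x). (0, x))"
 have L: "0 < L" "0 < L'" using okT okD by (auto simp: sys_ok_def)
 have mv: "i < k \<and> 2 * A i < x \<and> x < 2 * B i \<and> x \<in> corners (A i) (B i) (ms i)" if "(i, x) \<in> sys_moves k A B ms" for i x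
  using that okT vT corners_subset[of "A i" "B i" "ms i"] by (auto simp: sys_moves_def sys_ok_def sys_valid_def)
 have inj: "inj_on phi C"
 proof (rule inj_onI)
  fix u v assume "u \<in> C" "v \<in> C" and e: "phi u = phi v"
  then obtain i x j y where u: "u = Some (i, x)" "(i, x) \<in> sys_moves k A B ms"
   and v: "v = Some (j, y)" "(j, y) \<in> sys_moves k A B ms" by (auto simp: C_def)
  have "x = y" using e u v by (simp add: phi_def)
  moreover have "i = j"
  proof (rule ccontr)
   assume "i \<noteq> j"
   then have "{2 * A i<..<2 * B i} \<inter> {2 * A j<..<2 * B j} = {}"
    using dom mv[OF u(2)] mv[OF v(2)] unfolding dominated_def by blast
   then show False using mv[OF u(2)] mv[OF v(2)] \<open>x = y\<close> by auto
  qed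
  ultimately show "u = v" using u v by simp
 qed
 have "rel_pmf (\<lambda>u v. u \<in> C --> v = phi u) (move_pmf k A B L ms) (move_pmf 1 ?D ?E L' ds)"
 proof (rule rel_pmf_agree_on_inj[OF inj])
  fix u assume "u \<in> C"
  then obtain i x where u: "u = Some (i, x)" "(i, x) \<in> sys_moves k A B ms" "ms i x = ds 0 x" by (auto simp: C_def)
  have i: "i < k" "2 * A i < x" "x < 2 * B i" "x \<in> corners (A i) (B i) (ms i)" using mv[OF u(2)] by auto
  have vi: "valid (A i) (B i) (ms i)" "valid a b (ds 0)" "A i < B i" "a <= A i" "B i <= b" "\<And>w. ms i w <= ds 0 w"
   using vT vD okT dom le i by (auto simp: sys_ok_def sys_valid_def dominated_def below_def)
  note rc = rate_comparison[OF vi i(4) u(3)]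
  have "rate (A i) (B i) (ms i) x * (L' / L) <= rate (A i) (B i) (ms i) x * sqrt (width2 a b x / width2 (A i) (B i) x)"
   using dom i by (intro mult_left_mono less_imp_le[OF rate_pos]) (auto simp: dominated_def)
  also have "\<dots> <= rate a b (ds 0) x" by (rule rc(2))
  finally have "rate (A i) (B i) (ms i) x / L <= rate a b (ds 0) x / L'" using L by (simp add: field_simps)
  then show "pmf (move_pmf k A B L ms) u <= pmf (move_pmf 1 ?D ?E L' ds) (phi u)"
   using u rc(1) by (simp add: phi_def pmf_move_pmf(1)[OF okT vT] pmf_move_pmf(1)[OF okD vD] sys_moves_def del: One_nat_def)
 qed
 then have "rel_pmf (\<lambda>u v. u \<in> set_pmf (move_pmf k A B L ms) \<and> v \<in> set_pmf (move_pmf 1 ?D ?E L' ds) \<and> (u \<in> C --> v = phi u))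
  (move_pmf k A B L ms) (move_pmf 1 ?D ?E L' ds)"
  by (rule pmf.rel_mono_strong) auto
 then show ?thesis
  unfolding step_pmf_def pmf.rel_map
 proof (rule pmf.rel_mono_strong, elim conjE, intro conjI)
  fix u v assume u: "u \<in> set_pmf (move_pmf k A B L ms)" and v: "v \<in> set_pmf (move_pmf 1 ?D ?E L' ds)"
   and uv: "u \<in> C --> v = phi u"
  show "sys_valid k A B (do_move ms u)"
   by (rule sys_valid_step[OF okT vT]) (use u in \<open>simp add: step_pmf_def\<close>)
  show "valid1 a b (do_move ds v)"
   by (rule sys_valid_step[OF okD vD]) (use v in \<open>simp add: step_pmf_def\<close>)
  have mono: "ds 0 x <= do_move ds v 0 x" for x
   by (cases "(ds, v)" rule: do_move.cases) (auto simp: incr_def)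
  show "below k (do_move ms u) (do_move ds v)"
  proof (cases u)
   case None
   then show ?thesis using le mono by (auto simp: below_def intro: le_trans)
  next
   case (Some z)
   then obtain i x where ux: "u = Some (i, x)" by (cases z) auto
   then have um: "(i, x) \<in> sys_moves k A B ms" using u set_move_pmf[OF okT vT] by auto
   show ?thesis
   proof (cases "ms i x = ds 0 x")
    case True
    then have "u \<in> C" using ux um by (auto simp: C_def)
    then have "v = Some (0, x)" using uv ux by (simp add: phi_def)
    then show ?thesis using le ux True by (auto simp: below_def incr_def) (metis le_SucI)
   next
    case False
    then have "ms i x < ds 0 x" using le mv[OF um] by (auto simp: below_def le_less)
    then show ?thesis using le mono ux
     by (auto simp: below_def incr_def Suc_le_eq intro: le_trans less_le_trans)
   qed
  qed
 qed
qed

lemma path_dominated: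
 assumes dom: "dominated k A B L a b L'" and okT: "sys_ok k A B L" and okD: "ok1 a b L'"
  and "sys_valid k A B ms" "valid1 a b ds" "below k ms ds"
 shows "rel_pmf (list_all2 (below k)) (path_pmf k A B L s ms) (path1 a b L' s ds)"
 using assms(4-6)
proof (induction s arbitrary: ms ds)
 case (Suc s)
 show ?case
  unfolding path_pmf.simps
 proof (rule rel_pmf_bindI[OF step_dominated[OF dom okT okD Suc.prems]])
  fix ms' ds' assume "sys_valid k A B ms' \<and> valid1 a b ds' \<and> below k ms' ds'"
  then have "rel_pmf (list_all2 (below k)) (path_pmf k A B L s ms') (path1 a b L' s ds')"
   using Suc.IH by blast
  then show "rel_pmf (list_all2 (below k)) (map_pmf ((#) ms) (path_pmf k A B L s ms')) (map_pmf ((#) ds) (path1 a b L' s ds'))"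
   using Suc.prems(3) by (simp add: pmf.rel_map)
 qed
qed simp

subsection \<open>Removal words\<close>

text \<open>One jump of the chain with its clock forgotten; \<open>word_pmf\<close> lists the
  columns of successive jumps.\<close>

definition corner_pmf :: "int => int => (int => nat) => int pmf" where
 "corner_pmf a b m = embed_pmf (\<lambda>x. if x \<in> corners a b m
   then rate a b m x / (real (nbox a b) - real (removed a b m)) else 0)"

primrec word_pmf :: "int => int => nat => (int => nat) => int list pmf" where
 "word_pmf a b 0 m = return_pmf []"
| "word_pmf a b (Suc r) m = bind_pmf (corner_pmf a b m)
   (\<lambda>x. map_pmf (Cons x) (word_pmf a b r (m(x := m x + 1))))"

lemma removed_le:
 assumes "valid a b m" "a < b"
 shows "removed a b m <= nbox a b"
proof -
 have "0 <= (\<Sum>x\<in>corners a b m. rate a b m x)" by (intro sum_nonneg less_imp_le[OF rate_pos])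
 then show ?thesis using sum_rates[OF assms] by simp
qed

lemma pmf_corner_pmf:
 assumes v: "valid a b m" "a < b" and r: "removed a b m < nbox a b"
 shows "pmf (corner_pmf a b m) x
  = (if x \<in> corners a b m then rate a b m x / (real (nbox a b) - real (removed a b m)) else 0)"
 unfolding corner_pmf_def
proof (rule pmf_embed_pmf)
 let ?g = "\<lambda>x. if x \<in> corners a b m then rate a b m x / (real (nbox a b) - real (removed a b m)) else 0"
 have S: "finite (corners a b m)" by (rule finite_corners[OF v])
 show nn: "0 <= ?g x" for x using r less_imp_le[OF rate_pos] by auto
 have "(\<integral>\<^sup>+ x. ennreal (?g x) \<partial>count_space UNIV) = (\<Sum>x\<in>corners a b m. ennreal (?g x))"
  by (rule nn_integral_count_space') (use S in auto)
 also have "\<dots> = ennreal (\<Sum>x\<in>corners a b m. ?g x)" by (rule sum_ennreal) (rule nn)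
 also have "(\<Sum>x\<in>corners a b m. ?g x) = 1"
 proof -
  have "(\<Sum>x\<in>corners a b m. ?g x) = (\<Sum>x\<in>corners a b m. rate a b m x) / (real (nbox a b) - real (removed a b m))"
   unfolding sum_divide_distrib by (rule sum.cong) auto
  then show ?thesis using sum_rates[OF v] r by simp
 qed
 finally show "(\<integral>\<^sup>+ x. ennreal (?g x) \<partial>count_space UNIV) = 1" by simp
qed

lemma set_corner_pmf:
 assumes "valid a b m" "a < b" "removed a b m < nbox a b"
 shows "set_pmf (corner_pmf a b m) \<subseteq> corners a b m"
 using pmf_corner_pmf[OF assms] by (auto simp: set_pmf_iff split: if_splits)

definition sys_words :: "nat => (nat => int) => (nat => int) => state => (nat => int list) pmf" where
 "sys_words k A B ms = Pi_pmf {..<k} []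
  (\<lambda>i. word_pmf (A i) (B i) (nbox (A i) (B i) - removed (A i) (B i) (ms i)) (ms i))"

lemma sys_words_component:
 assumes ok: "sys_ok k A B L" and v: "sys_valid k A B ms" and i: "i < k"
  and r: "removed (A i) (B i) (ms i) < nbox (A i) (B i)"
 shows "sys_words k A B ms = bind_pmf (corner_pmf (A i) (B i) (ms i))
  (\<lambda>x. map_pmf (\<lambda>ws. ws(i := x # ws i)) (sys_words k A B (incr ms i x)))"
proof -
 let ?I = "{..<k} - {i}"
 define p where "p ms j = word_pmf (A j) (B j) (nbox (A j) (B j) - removed (A j) (B j) (ms j)) (ms j)" for ms :: state and j
 define Q where "Q = Pi_pmf ?I [] (p ms)"
 have vi: "valid (A i) (B i) (ms i)" "A i < B i" using ok v i by (auto simp: sys_ok_def sys_valid_def)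
 have ins: "{..<k} = insert i ?I" using i by auto
 have W: "sys_words k A B ms' = map_pmf (\<lambda>(y, f). f(i := y)) (pair_pmf (p ms' i) (Pi_pmf ?I [] (p ms')))" for ms'
  unfolding sys_words_def p_def[symmetric] by (subst ins, subst Pi_pmf_insert) auto
 have Q': "Pi_pmf ?I [] (p (incr ms i x)) = Q" for x
  unfolding Q_def by (rule Pi_pmf_cong) (auto simp: p_def incr_def)
 obtain n where n: "nbox (A i) (B i) - removed (A i) (B i) (ms i) = Suc n" using r by (metis Suc_diff_Suc)
 have pi: "p ms i = bind_pmf (corner_pmf (A i) (B i) (ms i)) (\<lambda>x. map_pmf (Cons x) (p (incr ms i x) i))"
 proof -
  have "p ms i = bind_pmf (corner_pmf (A i) (B i) (ms i)) (\<lambda>x. map_pmf (Cons x) (word_pmf (A i) (B i) n ((ms i)(x := ms i x + 1))))"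
   by (simp add: p_def n)
  also have "\<dots> = bind_pmf (corner_pmf (A i) (B i) (ms i)) (\<lambda>x. map_pmf (Cons x) (p (incr ms i x) i))"
  proof (rule bind_pmf_cong[OF refl])
   fix x assume "x \<in> set_pmf (corner_pmf (A i) (B i) (ms i))"
   then have "x \<in> corners (A i) (B i) (ms i)" using set_corner_pmf[OF vi r] by auto
   then have "removed (A i) (B i) (incr ms i x i) = Suc (removed (A i) (B i) (ms i))"
    using removed_upd[OF vi] by (simp add: incr_def)
   moreover have "nbox (A i) (B i) - Suc (removed (A i) (B i) (ms i)) = n" using n by simp
   ultimately show "map_pmf (Cons x) (word_pmf (A i) (B i) n ((ms i)(x := ms i x + 1))) = map_pmf (Cons x) (p (incr ms i x) i)"
    by (simp add: p_def incr_def)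
  qed
  finally show ?thesis .
 qed
 have "sys_words k A B ms = bind_pmf (corner_pmf (A i) (B i) (ms i))
  (\<lambda>x. map_pmf (\<lambda>(y, f). f(i := y)) (pair_pmf (map_pmf (Cons x) (p (incr ms i x) i)) Q))"
  unfolding W Q_def[symmetric] by (subst pi) (simp add: pair_pmf_def map_bind_pmf bind_assoc_pmf)
 also have "\<dots> = bind_pmf (corner_pmf (A i) (B i) (ms i))
  (\<lambda>x. map_pmf (\<lambda>ws. ws(i := x # ws i)) (sys_words k A B (incr ms i x)))"
  unfolding W Q' by (simp add: pair_map_pmf1 pmf.map_comp o_def case_prod_unfold)
 finally show ?thesis .
qed

text \<open>Independent words stay independent when the next move is revealed: it falls into window
  \<open>i\<close> with a weight proportional to the number of boxes remaining there, and by
  \<open>sys_words_component\<close> prepending its letter reproduces the product law. Summed over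
  the windows, the gains match the probability that a move happens at all.\<close>

lemma sys_words_moves:
 assumes ok: "sys_ok k A B L" and v: "sys_valid k A B ms"
 shows "sys_words k A B ms = bind_pmf (move_pmf k A B L ms)
  (\<lambda>u. case u of None => sys_words k A B ms
    | Some (i, x) => map_pmf (\<lambda>ws. ws(i := x # ws i)) (sys_words k A B (incr ms i x)))"
  (is "_ = bind_pmf ?M ?F")
proof (rule pmf_eqI)
 fix ws
 define w where "w = pmf (sys_words k A B ms) ws"
 define q where "q i x = pmf (map_pmf (\<lambda>ws. ws(i := x # ws i)) (sys_words k A B (incr ms i x))) ws" for i x
 define rem where "rem i = real (nbox (A i) (B i)) - real (removed (A i) (B i) (ms i))" for i
 have L: "0 < L" using ok by (simp add: sys_ok_def)
 have comp: "(\<Sum>x\<in>corners (A i) (B i) (ms i). rate (A i) (B i) (ms i) x * q i x) = rem i * w" if i: "i < k" for i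
 proof -
  have vi: "valid (A i) (B i) (ms i)" "A i < B i" using ok v i by (auto simp: sys_ok_def sys_valid_def)
  have fc: "finite (corners (A i) (B i) (ms i))" by (rule finite_corners[OF vi])
  show ?thesis
  proof (cases "removed (A i) (B i) (ms i) < nbox (A i) (B i)")
   case True
   then have r: "0 < rem i" by (simp add: rem_def)
   have "w = (\<Sum>x\<in>corners (A i) (B i) (ms i). q i x * pmf (corner_pmf (A i) (B i) (ms i)) x)"
    unfolding w_def q_def
    by (subst sys_words_component[OF ok v i True], subst pmf_bind, subst integral_measure_pmf_real[OF fc])
     (use set_corner_pmf[OF vi True] in auto)
   also have "\<dots> = (\<Sum>x\<in>corners (A i) (B i) (ms i). rate (A i) (B i) (ms i) x * q i x) / rem i"
    unfolding sum_divide_distrib by (rule sum.cong) (auto simp: pmf_corner_pmf[OF vi True] rem_def)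
   finally show ?thesis using r by (simp add: field_simps)
  next
   \<comment> \<open>An exhausted window has total rate zero; rates are positive, so it has no
     corner and both sides vanish.\<close>
   case False
   then have r0: "rem i = 0" using removed_le[OF vi] by (simp add: rem_def)
   then have "(\<Sum>x\<in>corners (A i) (B i) (ms i). rate (A i) (B i) (ms i) x) = 0"
    using sum_rates[OF vi] by (simp add: rem_def)
   then have "corners (A i) (B i) (ms i) = {}"
    using sum_pos[OF fc, of "rate (A i) (B i) (ms i)"] by fastforce
   then show ?thesis using r0 by simp
  qed
 qed
 have fin: "finite (insert None (Some ` sys_moves k A B ms))" using finite_sys_moves[OF ok v] by simp
 have "pmf (bind_pmf ?M ?F) ws = (\<Sum>u\<in>insert None (Some ` sys_moves k A B ms). pmf (?F u) ws * pmf ?M u)"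
  unfolding pmf_bind by (rule integral_measure_pmf_real[OF fin]) (use set_move_pmf[OF ok v] in auto)
 also have "\<dots> = w * pmf ?M None + (\<Sum>(i, x)\<in>sys_moves k A B ms. q i x * pmf ?M (Some (i, x)))"
  using finite_sys_moves[OF ok v] by (subst sum.insert) (auto simp: sum.reindex w_def q_def case_prod_unfold)
 also have "(\<Sum>(i, x)\<in>sys_moves k A B ms. q i x * pmf ?M (Some (i, x)))
  = (\<Sum>(i, x)\<in>sys_moves k A B ms. (rate (A i) (B i) (ms i) x * q i x) / L)"
  by (rule sum.cong) (auto simp: pmf_move_pmf(1)[OF ok v])
 also have "\<dots> = (\<Sum>i<k. rem i * w / L)"
  unfolding sum_moves[OF ok v] sum_divide_distrib[symmetric] by (simp add: comp)
 also have "w * pmf ?M None = w - (\<Sum>i<k. rem i * w / L)"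
  unfolding pmf_move_pmf(2)[OF ok v] rem_def[symmetric]
  by (simp add: algebra_simps sum_divide_distrib sum_distrib_left)
 finally show "pmf (sys_words k A B ms) ws = pmf (bind_pmf ?M ?F) ws" by (simp add: w_def)
qed

lemma removed_mono_path:
 assumes "p \<in> set_pmf (path_pmf k A B L s ms)" "t <= t'" "t' <= s"
 shows "removed a b ((p ! t) i) <= removed a b ((p ! t') i)"
 unfolding removed_def using path_mono_time[OF assms] by (intro sum_mono)

text \<open>The path is the family of words read at random speed: the number of removals in a window
  tells how long a prefix of its word has been read.\<close>

definition follows :: "nat => (nat => int) => (nat => int) => state => nat => state list => (nat => int list) => bool" where
 "follows k A B ms s p ws \<longleftrightarrow> (\<forall>t\<le>s. \<forall>i<k. \<forall>x. (p ! t) i x = ms i x +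
   count_list (take (removed (A i) (B i) ((p ! t) i) - removed (A i) (B i) (ms i)) (ws i)) x)"

text \<open>Order and time separate: the windows share a clock, yet the words they read are
  independent. Mixing draws its independence from here. The induction reveals one step on the path
  side and one letter, or none, on the word side.\<close>

lemma path_follows_words:
 assumes ok: "sys_ok k A B L"
 shows "sys_valid k A B ms ==> rel_pmf (follows k A B ms s) (path_pmf k A B L s ms) (sys_words k A B ms)"
proof (induction s arbitrary: ms)
 case 0
 then show ?case by (simp add: rel_pmf_return_pmf1 follows_def)
next
 case (Suc s)
 note v = Suc.prems
 let ?M = "move_pmf k A B L ms"
 have "rel_pmf (\<lambda>u u'. u = u' \<and> u \<in> set_pmf ?M) ?M ?M" by (rule rel_pmf_reflI) auto
 then show ?case
  unfolding path_pmf.simps step_pmf_def bind_map_pmf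
  apply (subst sys_words_moves[OF ok v])
 proof (rule rel_pmf_bindI)
  fix u u' assume "u = u' \<and> u \<in> set_pmf ?M"
  then have uu: "u' = u" "u \<in> set_pmf ?M" by auto
  show "rel_pmf (follows k A B ms (Suc s)) (map_pmf ((#) ms) (path_pmf k A B L s (do_move ms u)))
   (case u' of None => sys_words k A B ms
    | Some (i, x) => map_pmf (\<lambda>ws. ws(i := x # ws i)) (sys_words k A B (incr ms i x)))"
  proof (cases u)
   case None
   have "rel_pmf (follows k A B ms s) (path_pmf k A B L s ms) (sys_words k A B ms)" by (rule Suc.IH[OF v])
   then have "rel_pmf (\<lambda>p ws. follows k A B ms (Suc s) (ms # p) ws) (path_pmf k A B L s ms) (sys_words k A B ms)"
   proof (rule pmf.rel_mono_strong)
    fix p ws assume f: "follows k A B ms s p ws"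
    show "follows k A B ms (Suc s) (ms # p) ws"
     unfolding follows_def
    proof (intro allI impI)
     fix t i x assume "t <= Suc s" "i < k"
     then show "((ms # p) ! t) i x = ms i x +
      count_list (take (removed (A i) (B i) (((ms # p) ! t) i) - removed (A i) (B i) (ms i)) (ws i)) x"
      using f by (cases t) (auto simp: follows_def)
    qed
   qed
   then show ?thesis using None uu by (simp add: pmf.rel_map)
  next
   case (Some z)
   then obtain i x where u: "u = Some (i, x)" by (cases z) auto
   then have um: "(i, x) \<in> sys_moves k A B ms" using uu set_move_pmf[OF ok v] by auto
   let ?ms = "incr ms i x"
   have v': "sys_valid k A B ?ms" by (rule sys_valid_incr[OF ok v um])
   have i: "i < k" "x \<in> corners (A i) (B i) (ms i)" using um by (auto simp: sys_moves_def)
   have ri: "removed (A i) (B i) (?ms i) = Suc (removed (A i) (B i) (ms i))"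
    using removed_upd[of "A i" "B i" "ms i" x] i v ok by (simp add: incr_def sys_valid_def sys_ok_def)
   have "rel_pmf (follows k A B ?ms s) (path_pmf k A B L s ?ms) (sys_words k A B ?ms)" by (rule Suc.IH[OF v'])
   then have "rel_pmf (\<lambda>p ws. follows k A B ms (Suc s) (ms # p) (ws(i := x # ws i))) (path_pmf k A B L s ?ms) (sys_words k A B ?ms)"
   proof (rule pmf.rel_mono_strong)
    fix p ws assume p: "p \<in> set_pmf (path_pmf k A B L s ?ms)" and f: "follows k A B ?ms s p ws"
    have p0: "p ! 0 = ?ms" using p by (cases s) auto
    show "follows k A B ms (Suc s) (ms # p) (ws(i := x # ws i))"
     unfolding follows_def
    proof (intro allI impI)
     fix t j y assume t: "t <= Suc s" "j < k"
     show "((ms # p) ! t) j y = ms j y +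
      count_list (take (removed (A j) (B j) (((ms # p) ! t) j) - removed (A j) (B j) (ms j)) ((ws(i := x # ws i)) j)) y"
     proof (cases t)
      case (Suc t')
      then have t': "t' <= s" using t by simp
      have F: "(p ! t') j y = ?ms j y +
       count_list (take (removed (A j) (B j) ((p ! t') j) - removed (A j) (B j) (?ms j)) (ws j)) y"
       using f t' t(2) by (simp add: follows_def)
      show ?thesis
      proof (cases "j = i")
       case True
       have "removed (A i) (B i) (?ms i) <= removed (A i) (B i) ((p ! t') i)"
        using removed_mono_path[OF p, of 0 t' "A i" "B i" i] t' p0 by simp
       then have "removed (A i) (B i) ((p ! t') i) - removed (A i) (B i) (ms i)
        = Suc (removed (A i) (B i) ((p ! t') i) - removed (A i) (B i) (?ms i))"
        using ri by simp
       then show ?thesis using F Suc True by (simp add: incr_def)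
      qed (use F Suc in \<open>simp add: incr_def\<close>)
     qed simp
    qed
   qed
   then show ?thesis using u uu by (simp add: pmf.rel_map)
  qed
 qed
qed

lemma rel_pmf_union_bound:
 assumes R: "rel_pmf R p q" and Q: "finite Q"
  and imp: "\<And>x y. R x y ==> x \<in> X ==> y \<in> Y \<or> (\<exists>c\<in>Q. x \<in> Z c)"
 shows "pr p X <= pr q Y + (\<Sum>c\<in>Q. pr p (Z c))"
proof -
 have "pr p X <= pr p ((X - (\<Union>c\<in>Q. Z c)) \<union> (\<Union>c\<in>Q. Z c))"
  by (intro measure_pmf.finite_measure_mono) auto
 also have "\<dots> <= pr p (X - (\<Union>c\<in>Q. Z c)) + pr p (\<Union>c\<in>Q. Z c)"
  by (rule measure_Un_le) auto
 also have "pr p (\<Union>c\<in>Q. Z c) <= (\<Sum>c\<in>Q. pr p (Z c))"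
  by (rule measure_UNION_le) (use Q in auto)
 also have "pr p (X - (\<Union>c\<in>Q. Z c)) <= pr q {y. \<exists>x\<in>X - (\<Union>c\<in>Q. Z c). R x y}"
  by (rule rel_pmf_measureD[OF R])
 also have "\<dots> <= pr q Y"
  by (intro measure_pmf.finite_measure_mono) (use imp in auto)
 finally show ?thesis by simp
qed

lemma prob_path_at:
 assumes "t <= s"
 shows "pr (path_pmf k A B L s ms) {p. P (p ! t)} = pr (at_pmf k A B L t ms) {m. P m}"
 unfolding path_at[OF assms, symmetric] by (simp add: vimage_def)

definition zero_state :: state where "zero_state = (\<lambda>_ _. 0)"

lemma removed_zero [simp]: "removed a b (zero_state i) = 0" "removed a b (\<lambda>_. 0) = 0"
 by (simp_all add: removed_def zero_state_def)

lemma zero_state_apply: "zero_state i x = 0"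
 by (simp add: zero_state_def)

abbreviation late where
 "late k A B L s i g \<equiv> pr (at_pmf k A B L s zero_state) {ms. g < removed (A i) (B i) (ms i)}"
abbreviation early where
 "early k A B L s i g \<equiv> pr (at_pmf k A B L s zero_state) {ms. removed (A i) (B i) (ms i) < g}"
abbreviation late1 where
 "late1 a b L s g \<equiv> pr (at1 a b L s zero_state) {ms. g < removed a b (ms 0)}"
abbreviation early1 where
 "early1 a b L s g \<equiv> pr (at1 a b L s zero_state) {ms. removed a b (ms 0) < g}"

lemma sys_valid_zero: "sys_valid k A B zero_state"
 by (simp add: sys_valid_def zero_state_def valid_zero)

text \<open>Counts in a prefix grow with its length. Replacing the random length by the fixed
  \<open>g q\<close> therefore errs in the harmful direction only if more, respectively fewer, than
  \<open>g q\<close> boxes have gone.\<close>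

lemma path_word_comparison:
 fixes Q :: "'q set" and ci :: "'q => nat" and cx :: "'q => int" and cj g s :: "'q => nat"
 assumes ok: "sys_ok k A B L" and Q: "finite Q" and ci: "\<And>q. q \<in> Q ==> ci q < k" and s: "\<And>q. q \<in> Q ==> s q <= S"
 defines "PP \<equiv> pr (path_pmf k A B L S zero_state) {p. \<forall>q\<in>Q. cj q < (p ! s q) (ci q) (cx q)}"
  and "PW \<equiv> pr (sys_words k A B zero_state) {ws. \<forall>q\<in>Q. cj q < count_list (take (g q) (ws (ci q))) (cx q)}"
 shows "PP <= PW + (\<Sum>q\<in>Q. late k A B L (s q) (ci q) (g q))"
  and "PW <= PP + (\<Sum>q\<in>Q. early k A B L (s q) (ci q) (g q))"
proof -
 let ?P = "path_pmf k A B L S zero_state" and ?W = "sys_words k A B zero_state"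
 note F = path_follows_words[OF ok sys_valid_zero, of S]
 have take_mono: "count_list (take n ws) x <= count_list (take n' ws) x" if "n <= n'" for n n' x and ws :: "int list"
 proof -
  have "take n' ws = take n ws @ take (n' - n) (drop n ws)" using that by (metis le_add_diff_inverse take_add)
  then show ?thesis by simp
 qed
 have fol: "(p ! s q) (ci q) (cx q) = count_list (take (removed (A (ci q)) (B (ci q)) ((p ! s q) (ci q))) (ws (ci q))) (cx q)"
  if "follows k A B zero_state S p ws" "q \<in> Q" for p ws q
  using that ci s by (simp add: follows_def zero_state_apply)
 have eq: "pr ?P {p. P q (removed (A (ci q)) (B (ci q)) ((p ! s q) (ci q)))}
   = pr (at_pmf k A B L (s q) zero_state) {m. P q (removed (A (ci q)) (B (ci q)) (m (ci q)))}"
  if "q \<in> Q" for q and P :: "'q => nat => bool"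
  using prob_path_at[OF s[OF that], where P = "\<lambda>m. P q (removed (A (ci q)) (B (ci q)) (m (ci q)))"] .
 have "PP <= PW + (\<Sum>q\<in>Q. pr ?P {p. g q < removed (A (ci q)) (B (ci q)) ((p ! s q) (ci q))})"
  unfolding PP_def PW_def
 proof (rule rel_pmf_union_bound[OF F Q])
  fix p ws assume f: "follows k A B zero_state S p ws" and p: "p \<in> {p. \<forall>q\<in>Q. cj q < (p ! s q) (ci q) (cx q)}"
  show "ws \<in> {ws. \<forall>q\<in>Q. cj q < count_list (take (g q) (ws (ci q))) (cx q)} \<or>
   (\<exists>q\<in>Q. p \<in> {p. g q < removed (A (ci q)) (B (ci q)) ((p ! s q) (ci q))})"
  proof (rule disjCI)
   assume n: "\<not> (\<exists>q\<in>Q. p \<in> {p. g q < removed (A (ci q)) (B (ci q)) ((p ! s q) (ci q))})"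
   show "ws \<in> {ws. \<forall>q\<in>Q. cj q < count_list (take (g q) (ws (ci q))) (cx q)}"
   proof (intro CollectI ballI)
    fix q assume q: "q \<in> Q"
    then have "removed (A (ci q)) (B (ci q)) ((p ! s q) (ci q)) <= g q" using n by force
    from take_mono[OF this, of "ws (ci q)" "cx q"]
    have "(p ! s q) (ci q) (cx q) <= count_list (take (g q) (ws (ci q))) (cx q)" using fol[OF f q] by simp
    then show "cj q < count_list (take (g q) (ws (ci q))) (cx q)" using p q by fastforce
   qed
  qed
 qed
 then show "PP <= PW + (\<Sum>q\<in>Q. late k A B L (s q) (ci q) (g q))"
  using eq[of _ "\<lambda>q r. g q < r"] by simp
 have F': "rel_pmf (\<lambda>ws p. follows k A B zero_state S p ws) ?W ?P"
 proof -
  have "rel_pmf (conversep (follows k A B zero_state S)) ?W ?P" using F by (simp only: pmf.rel_flip)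
  then show ?thesis by (rule pmf.rel_mono_strong) simp
 qed
 have "pr ?W {ws. \<forall>q\<in>Q. cj q < count_list (take (g q) (ws (ci q))) (cx q)}
  <= pr ?P ({p. \<forall>q\<in>Q. cj q < (p ! s q) (ci q) (cx q)} \<union> (\<Union>q\<in>Q. {p. removed (A (ci q)) (B (ci q)) ((p ! s q) (ci q)) < g q}))"
 proof (rule order_trans[OF rel_pmf_measureD[OF F']], intro measure_pmf.finite_measure_mono subsetI)
  fix p assume "p \<in> {p. \<exists>ws\<in>{ws. \<forall>q\<in>Q. cj q < count_list (take (g q) (ws (ci q))) (cx q)}. follows k A B zero_state S p ws}"
  then obtain ws where f: "follows k A B zero_state S p ws" and w: "\<forall>q\<in>Q. cj q < count_list (take (g q) (ws (ci q))) (cx q)" by auto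
  show "p \<in> {p. \<forall>q\<in>Q. cj q < (p ! s q) (ci q) (cx q)} \<union> (\<Union>q\<in>Q. {p. removed (A (ci q)) (B (ci q)) ((p ! s q) (ci q)) < g q})"
  proof (cases "\<exists>q\<in>Q. removed (A (ci q)) (B (ci q)) ((p ! s q) (ci q)) < g q")
   case False
   have "cj q < (p ! s q) (ci q) (cx q)" if q: "q \<in> Q" for q
   proof -
    have "g q <= removed (A (ci q)) (B (ci q)) ((p ! s q) (ci q))" using False q by force
    from take_mono[OF this, of "ws (ci q)" "cx q"] show ?thesis using w q fol[OF f q] by fastforce
   qed
   then show ?thesis by auto
  qed auto
 qed simp
 also have "\<dots> <= PP + pr ?P (\<Union>q\<in>Q. {p. removed (A (ci q)) (B (ci q)) ((p ! s q) (ci q)) < g q})"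
  unfolding PP_def by (rule measure_Un_le) auto
 also have "\<dots> <= PP + (\<Sum>q\<in>Q. pr ?P {p. removed (A (ci q)) (B (ci q)) ((p ! s q) (ci q)) < g q})"
  by (intro add_left_mono measure_UNION_le) (use Q in auto)
 also have "(\<Sum>q\<in>Q. pr ?P {p. removed (A (ci q)) (B (ci q)) ((p ! s q) (ci q)) < g q})
   = (\<Sum>q\<in>Q. early k A B L (s q) (ci q) (g q))"
  using eq[of _ "\<lambda>q r. r < g q"] by simp
 finally show "PW <= PP + (\<Sum>q\<in>Q. early k A B L (s q) (ci q) (g q))"
  unfolding PW_def .
qed

subsection \<open>Number of removed boxes\<close>

abbreviation expect :: "'a pmf => ('a => real) => real" where
 "expect p f \<equiv> measure_pmf.expectation p f"

lemma expectation_step: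
 assumes ok: "sys_ok k A B L" and v: "sys_valid k A B ms"
 shows "expect (step_pmf k A B L ms) h
  = h ms + (\<Sum>i<k. \<Sum>x\<in>corners (A i) (B i) (ms i). rate (A i) (B i) (ms i) x / L * (h (incr ms i x) - h ms))"
proof -
 let ?S = "sys_moves k A B ms"
 have fin: "finite ?S" by (rule finite_sys_moves[OF ok v])
 have "expect (step_pmf k A B L ms) h = (\<Sum>u\<in>insert None (Some ` ?S). h (do_move ms u) * pmf (move_pmf k A B L ms) u)"
  unfolding step_pmf_def integral_map_pmf
  by (rule integral_measure_pmf_real) (use fin set_move_pmf[OF ok v] in auto)
 also have "\<dots> = h ms * pmf (move_pmf k A B L ms) None
   + (\<Sum>(i, x)\<in>?S. h (incr ms i x) * (rate (A i) (B i) (ms i) x / L))"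
  using fin by (subst sum.insert)
   (auto simp: sum.reindex case_prod_unfold pmf_move_pmf(1)[OF ok v] intro!: sum.cong)
 also have "pmf (move_pmf k A B L ms) None = 1 - (\<Sum>(i, x)\<in>?S. rate (A i) (B i) (ms i) x / L)"
  unfolding pmf_move_pmf(2)[OF ok v] sum_move_rates[OF ok v] ..
 finally have "expect (step_pmf k A B L ms) h
  = h ms + (\<Sum>(i, x)\<in>?S. rate (A i) (B i) (ms i) x / L * (h (incr ms i x) - h ms))"
  by (simp add: algebra_simps diff_divide_distrib sum_subtractf sum_distrib_left case_prod_unfold)
 then show ?thesis unfolding sum_moves[OF ok v] .
qed

lemma expectation_at_Suc:
 assumes ok: "sys_ok k A B L" and v: "sys_valid k A B ms0"
  and g: "\<And>ms. sys_valid k A B ms ==> expect (step_pmf k A B L ms) h = g ms"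
 shows "expect (at_pmf k A B L (Suc s) ms0) h = expect (at_pmf k A B L s ms0) g"
proof -
 let ?p = "at_pmf k A B L s ms0"
 have fin: "finite (set_pmf ?p)" by (rule finite_set_at_pmf[OF ok v])
 note va = sys_valid_at[OF ok v, of s]
 have "expect (at_pmf k A B L (Suc s) ms0) h = (\<Sum>a\<in>set_pmf ?p. pmf ?p a *\<^sub>R expect (step_pmf k A B L a) h)"
  unfolding at_pmf.simps
  by (rule pmf_expectation_bind[OF fin]) (use finite_set_step_pmf[OF ok] va in auto)
 also have "\<dots> = (\<Sum>a\<in>set_pmf ?p. g a * pmf ?p a)"
  by (rule sum.cong) (use g va in auto)
 also have "\<dots> = expect ?p g"
  by (rule integral_measure_pmf_real[OF fin, symmetric]) auto
 finally show ?thesis .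
qed

lemma expectation_step_removed:
 fixes h :: "nat => real"
 assumes ok: "sys_ok k A B L" and v: "sys_valid k A B ms" and i: "i < k"
 defines "r \<equiv> removed (A i) (B i) (ms i)"
 shows "expect (step_pmf k A B L ms) (\<lambda>ms. h (removed (A i) (B i) (ms i)))
  = h r + (real (nbox (A i) (B i)) - real r) / L * (h (Suc r) - h r)"
proof -
 have vi: "valid (A j) (B j) (ms j)" "A j < B j" if "j < k" for j using ok v that by (auto simp: sys_ok_def sys_valid_def)
 have "(\<Sum>x\<in>corners (A j) (B j) (ms j). rate (A j) (B j) (ms j) x / L *
    (h (removed (A i) (B i) (incr ms j x i)) - h r))
   = (if j = i then (real (nbox (A i) (B i)) - real r) / L * (h (Suc r) - h r) else 0)" if j: "j < k" for j
 proof (cases "j = i")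
  case True
  have "(\<Sum>x\<in>corners (A i) (B i) (ms i). rate (A i) (B i) (ms i) x / L *
    (h (removed (A i) (B i) (incr ms i x i)) - h r))
   = (\<Sum>x\<in>corners (A i) (B i) (ms i). rate (A i) (B i) (ms i) x) / L * (h (Suc r) - h r)"
   unfolding sum_divide_distrib sum_distrib_right
   by (rule sum.cong) (auto simp: incr_def removed_upd[OF vi[OF i], unfolded Suc_eq_plus1[symmetric]] r_def)
  then show ?thesis using True sum_rates[OF vi[OF i]] by (simp add: r_def)
 qed (simp add: incr_def r_def)
 then show ?thesis
  unfolding expectation_step[OF ok v] r_def[symmetric] using i by simp
qed

text \<open>The remaining boxes form a pure death chain with linear rate, whose falling factorials
  are eigenfunctions; two of them suffice for a variance.\<close>

lemma expectation_remaining: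
 assumes ok: "sys_ok k A B L" and i: "i < k"
 defines "N \<equiv> real (nbox (A i) (B i))" and "M \<equiv> \<lambda>ms :: state. real (nbox (A i) (B i)) - real (removed (A i) (B i) (ms i))"
 shows "expect (at_pmf k A B L s zero_state) M = N * (1 - 1 / L) ^ s"
  and "expect (at_pmf k A B L s zero_state) (\<lambda>ms. M ms * (M ms - 1)) = N * (N - 1) * (1 - 2 / L) ^ s"
proof -
 have s1: "expect (step_pmf k A B L ms) M = (1 - 1 / L) * M ms" if "sys_valid k A B ms" for ms
  using expectation_step_removed[OF ok that i, of "\<lambda>r. real (nbox (A i) (B i)) - real r"]
  by (simp add: M_def algebra_simps diff_divide_distrib)
 have s2: "expect (step_pmf k A B L ms) (\<lambda>ms. M ms * (M ms - 1)) = (1 - 2 / L) * (M ms * (M ms - 1))"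
  if "sys_valid k A B ms" for ms
 proof -
  have "expect (step_pmf k A B L ms) (\<lambda>ms. M ms * (M ms - 1))
   = M ms * (M ms - 1) + M ms / L * ((M ms - 1) * (M ms - 2) - M ms * (M ms - 1))"
   using expectation_step_removed[OF ok that i, of "\<lambda>r. (real (nbox (A i) (B i)) - real r) * (real (nbox (A i) (B i)) - real r - 1)"]
   by (simp add: M_def algebra_simps)
  also have "\<dots> = (1 - 2 / L) * (M ms * (M ms - 1))"
   by (simp add: algebra_simps add_divide_distrib diff_divide_distrib)
  finally show ?thesis .
 qed
 show "expect (at_pmf k A B L s zero_state) M = N * (1 - 1 / L) ^ s"
 proof (induction s)
  case (Suc s)
  have "expect (at_pmf k A B L (Suc s) zero_state) M = expect (at_pmf k A B L s zero_state) (\<lambda>ms. (1 - 1 / L) * M ms)"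
   by (rule expectation_at_Suc[OF ok sys_valid_zero s1])
  then show ?case using Suc by simp
 qed (simp add: M_def N_def)
 show "expect (at_pmf k A B L s zero_state) (\<lambda>ms. M ms * (M ms - 1)) = N * (N - 1) * (1 - 2 / L) ^ s"
 proof (induction s)
  case (Suc s)
  have "expect (at_pmf k A B L (Suc s) zero_state) (\<lambda>ms. M ms * (M ms - 1))
   = expect (at_pmf k A B L s zero_state) (\<lambda>ms. (1 - 2 / L) * (M ms * (M ms - 1)))"
   by (rule expectation_at_Suc[OF ok sys_valid_zero s2])
  then show ?case using Suc by simp
 qed (simp add: M_def N_def)
qed

lemma power_one_minus_bounds:
 fixes L :: real
 assumes "1 <= L"
 shows "1 - real s / L <= (1 - 1 / L) ^ s" "(1 - 1 / L) ^ s <= exp (- (real s / L))"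
  "(1 - 1 / L) ^ s <= 1 - real s / L + (real s / L)\<^sup>2"
proof -
 show "1 - real s / L <= (1 - 1 / L) ^ s"
  using Bernoulli_inequality[of "- (1 / L)" s] assms by simp
 have "(1 - 1 / L) ^ s <= exp (- (1 / L)) ^ s"
  using exp_ge_add_one_self[of "- (1 / L)"] assms by (intro power_mono) auto
 also have "\<dots> = exp (- (real s / L))" by (simp flip: exp_of_nat_mult)
 finally show e: "(1 - 1 / L) ^ s <= exp (- (real s / L))" .
 define y where "y = real s / L"
 have y: "0 <= y" using assms by (simp add: y_def)
 have "exp (- y) <= 1 / (1 + y)"
  using exp_ge_add_one_self[of y] y by (simp add: exp_minus field_simps)
 also have "\<dots> <= 1 - y + y\<^sup>2"
 proof -
  have "1 <= (1 - y + y\<^sup>2) * (1 + y)" using y by (simp add: power2_eq_square algebra_simps)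
  then show ?thesis using y by (simp add: divide_le_eq)
 qed
 finally show "(1 - 1 / L) ^ s <= 1 - real s / L + (real s / L)\<^sup>2" using e unfolding y_def by linarith
qed

text \<open>Chebyshev's inequality for the remaining count. Its variance is at most
  \<open>nbox * s / L\<close>, because \<open>1 - 2 / L\<close> is below the square of
  \<open>1 - 1 / L\<close>. Half of \<open>dl\<close> pays for replacing the true mean by the linear
  one, the other half for the fluctuations.\<close>

lemma removed_concentration:
 assumes ok: "sys_ok k A B L" and i: "i < k" and L: "2 <= L"
  and d: "0 < dl" "real (nbox (A i) (B i)) * (real s / L)\<^sup>2 <= dl / 2"
 shows "pr (at_pmf k A B L s zero_state)
   {ms. dl <= \<bar>real (removed (A i) (B i) (ms i)) - real (nbox (A i) (B i)) * real s / L\<bar>}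
  <= 4 * (real (nbox (A i) (B i)) * real s / L) / dl\<^sup>2"
proof -
 let ?p = "at_pmf k A B L s zero_state"
 define N where "N = real (nbox (A i) (B i))"
 define M where "M ms = N - real (removed (A i) (B i) (ms i))" for ms :: state
 define y where "y = real s / L"
 define e where "e = (1 - 1 / L) ^ s"
 have fin: "finite (set_pmf ?p)" by (rule finite_set_at_pmf[OF ok sys_valid_zero])
 note int [simp] = integrable_measure_pmf_finite[OF fin]
 have N0: "0 <= N" by (simp add: N_def)
 have EM: "expect ?p M = N * e"
  using expectation_remaining(1)[OF ok i, of s] unfolding M_def N_def e_def .
 have "expect ?p (\<lambda>ms. (M ms)\<^sup>2) = expect ?p (\<lambda>ms. M ms * (M ms - 1)) + expect ?p M"
  by (subst Bochner_Integration.integral_add[symmetric]) (auto simp: power2_eq_square algebra_simps)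
 also have "expect ?p (\<lambda>ms. M ms * (M ms - 1)) = N * (N - 1) * (1 - 2 / L) ^ s"
  using expectation_remaining(2)[OF ok i, of s] unfolding M_def N_def .
 also have "N * (N - 1) * (1 - 2 / L) ^ s <= N * (N - 1) * e\<^sup>2"
 proof (rule mult_left_mono)
  have "1 - 2 / L <= (1 - 1 / L)\<^sup>2" by (simp add: power2_eq_square algebra_simps)
  then have "(1 - 2 / L) ^ s <= ((1 - 1 / L)\<^sup>2) ^ s" using L by (intro power_mono) auto
  then show "(1 - 2 / L) ^ s <= e\<^sup>2" by (simp add: e_def mult.commute flip: power_mult)
  show "0 <= N * (N - 1)"
   unfolding N_def by (cases "nbox (A i) (B i)") auto
 qed
 finally have E2: "expect ?p (\<lambda>ms. (M ms)\<^sup>2) <= N * (N - 1) * e\<^sup>2 + N * e" using EM by simp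
 have e01: "0 <= e" "e <= 1" using L by (auto simp: e_def intro!: power_le_one)
 have e_low: "1 - y <= e" and e_up: "e <= 1 - y + y\<^sup>2"
  using power_one_minus_bounds[of L s] L by (auto simp: e_def y_def)
 have "measure_pmf.variance ?p M = expect ?p (\<lambda>ms. (M ms)\<^sup>2) - (expect ?p M)\<^sup>2"
  by (rule measure_pmf.variance_eq) auto
 also have "\<dots> <= N * e * (1 - e)" using E2 EM by (simp add: power2_eq_square algebra_simps)
 also have "\<dots> <= N * 1 * y" using e01 e_low N0 by (intro mult_mono) auto
 finally have var: "measure_pmf.variance ?p M <= N * y" by simp
 have "{ms. dl <= \<bar>real (removed (A i) (B i) (ms i)) - N * y\<bar>} \<subseteq> {ms \<in> space (measure_pmf ?p). dl / 2 <= \<bar>M ms - expect ?p M\<bar>}"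
 proof
  fix ms assume "ms \<in> {ms. dl <= \<bar>real (removed (A i) (B i) (ms i)) - N * y\<bar>}"
  then have D: "dl <= \<bar>real (removed (A i) (B i) (ms i)) - N * y\<bar>" by simp
  have "N * e - (N - N * y) = N * (e - (1 - y))" by (simp add: algebra_simps)
  then have "\<bar>N * e - (N - N * y)\<bar> = N * \<bar>e - (1 - y)\<bar>" using N0 by (simp add: abs_mult)
  also have "\<dots> <= N * y\<^sup>2" using e_low e_up N0 by (intro mult_left_mono) auto
  also have "\<dots> <= dl / 2" using d by (simp add: N_def y_def)
  finally have "\<bar>N * e - (N - N * y)\<bar> <= dl / 2" .
  moreover have "\<bar>r - u\<bar> <= \<bar>N - r - v\<bar> + \<bar>v - (N - u)\<bar>" for r u v :: real by linarith
  from this[of "real (removed (A i) (B i) (ms i))" "N * y" "N * e"]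
  have "dl <= \<bar>M ms - N * e\<bar> + \<bar>N * e - (N - N * y)\<bar>" using D unfolding M_def by (rule order_trans[rotated])
  moreover have "d <= 2 * u" if "v <= d / 2" "d <= u + v" for d u v :: real using that by linarith
  ultimately have "dl <= 2 * \<bar>M ms - expect ?p M\<bar>" unfolding EM by blast
  then show "ms \<in> {ms \<in> space (measure_pmf ?p). dl / 2 <= \<bar>M ms - expect ?p M\<bar>}" by simp
 qed
 then have "pr ?p {ms. dl <= \<bar>real (removed (A i) (B i) (ms i)) - N * y\<bar>}
  <= pr ?p {ms \<in> space (measure_pmf ?p). dl / 2 <= \<bar>M ms - expect ?p M\<bar>}"
  by (intro measure_pmf.finite_measure_mono) auto
 also have "\<dots> <= measure_pmf.variance ?p M / (dl / 2)\<^sup>2"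
  by (rule measure_pmf.Chebyshev_inequality) (use d in auto)
 also have "\<dots> <= N * y / (dl / 2)\<^sup>2" using var by (intro divide_right_mono) auto
 also have "\<dots> = 4 * (N * y) / dl\<^sup>2" by (simp add: power2_eq_square)
 finally show ?thesis by (simp add: N_def y_def)
qed

text \<open>The rates in a window depend on its own profile only and all windows share
  \<open>L\<close>, so forgetting the others merely turns their moves into idle steps.\<close>

lemma at_pmf_component:
 assumes ok: "sys_ok k A B L" and i: "i < k" and ok1: "ok1 (A i) (B i) L"
 shows "map_pmf (\<lambda>ms. ms i) (at_pmf k A B L s zero_state) = map_pmf (\<lambda>ms. ms 0) (at1 (A i) (B i) L s zero_state)"
proof -
 define G where "G m = map_pmf (\<lambda>ms. ms 0) (step1 (A i) (B i) L (\<lambda>_. m))" for m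
 have stepG: "map_pmf (\<lambda>ms. ms j) (step_pmf k' A' B' L ms) = G (ms j)"
  if ok': "sys_ok k' A' B' L" and v: "sys_valid k' A' B' ms" and j: "j < k'" "A' j = A i" "B' j = B i" for k' A' B' j ms
 proof -
  define f where "f j u = (case u of None => None | Some (i', x) => if i' = j then Some x else None)"
   for j :: nat and u :: "(nat \<times> int) option"
  have dm: "do_move ms u j = (case f j u of None => ms j | Some x => (ms j)(x := ms j x + 1))" for ms j u
   by (cases "(ms, u)" rule: do_move.cases) (auto simp: f_def incr_def)
  have pf: "pmf (map_pmf (f j) p) (Some x) = pmf p (Some (j, x))" for p j x
  proof -
   have "f j -` {Some x} = {Some (j, x)}" by (auto simp: f_def split: option.splits if_splits)
   then show ?thesis by (simp add: pmf_map measure_pmf_single)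
  qed
  have v1: "valid1 (A i) (B i) (\<lambda>_. ms j)" using v j by (auto simp: sys_valid_def)
  have eq: "map_pmf (f j) (move_pmf k' A' B' L ms) = map_pmf (f 0) (move_pmf 1 (\<lambda>_. A i) (\<lambda>_. B i) L (\<lambda>_. ms j))"
  proof (rule spmf_eqI)
   fix x
   show "spmf (map_pmf (f j) (move_pmf k' A' B' L ms)) x = spmf (map_pmf (f 0) (move_pmf 1 (\<lambda>_. A i) (\<lambda>_. B i) L (\<lambda>_. ms j))) x"
    unfolding pf pmf_move_pmf(1)[OF ok' v] pmf_move_pmf(1)[OF ok1 v1] using j by (simp add: sys_moves_def)
  qed
  have "map_pmf (\<lambda>ms. ms j) (step_pmf k' A' B' L ms)
   = map_pmf (\<lambda>o'. case o' of None => ms j | Some x => (ms j)(x := ms j x + 1)) (map_pmf (f j) (move_pmf k' A' B' L ms))"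
   by (simp add: step_pmf_def pmf.map_comp o_def dm)
  also have "\<dots> = G (ms j)"
   unfolding eq by (simp add: G_def step_pmf_def pmf.map_comp o_def dm del: One_nat_def)
  finally show ?thesis .
 qed
 show ?thesis
 proof (induction s)
  case 0
  show ?case by (simp add: zero_state_def)
 next
  case (Suc s)
  have "map_pmf (\<lambda>ms. ms i) (at_pmf k A B L (Suc s) zero_state)
   = bind_pmf (at_pmf k A B L s zero_state) (\<lambda>ms. G (ms i))"
   unfolding at_pmf.simps map_bind_pmf
   by (rule bind_pmf_cong[OF refl]) (use stepG[OF ok _ i] sys_valid_at[OF ok sys_valid_zero] in auto)
  also have "\<dots> = bind_pmf (map_pmf (\<lambda>ms. ms i) (at_pmf k A B L s zero_state)) G" by (simp add: bind_map_pmf)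
  also have "\<dots> = bind_pmf (at1 (A i) (B i) L s zero_state) (\<lambda>ms. G (ms 0))"
   unfolding Suc by (simp add: bind_map_pmf)
  also have "\<dots> = map_pmf (\<lambda>ms. ms 0) (at1 (A i) (B i) L (Suc s) zero_state)"
   unfolding at_pmf.simps map_bind_pmf
   by (rule bind_pmf_cong[OF refl]) (use stepG[OF ok1, of _ 0] sys_valid_at[OF ok1 sys_valid_zero] in auto)
  finally show ?case .
 qed
qed

section \<open>Translation of staircases\<close>

definition shift_state :: "int => state => state" where
 "shift_state c ms = (\<lambda>i x. ms i (x + 2 * c))"

lemma curv_shift: "curv (a + c) (b + c) m (x + 2 * c) = curv a b (\<lambda>x. m (x + 2 * c)) x"
proof -
 have "m (x - 1 + 2 * c) = m (x + 2 * c - 1)" "m (x + 1 + 2 * c) = m (x + 2 * c + 1)"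
  by (rule arg_cong[of _ _ m], simp)+
 then show ?thesis by (simp add: curv_def curv0_def)
qed

lemma rate_shift: "rate (a + c) (b + c) m (x + 2 * c) = rate a b (\<lambda>x. m (x + 2 * c)) x"
proof -
 have "(\<Sum>w\<in>{2*(a+c)..2*(b+c)}. ir (curv (a + c) (b + c) m w) * ln \<bar>ir (x + 2 * c - w)\<bar>)
  = (\<Sum>w\<in>{2*a..2*b}. ir (curv (a + c) (b + c) m (w + 2 * c)) * ln \<bar>ir (x - w)\<bar>)"
  by (rule sum.reindex_bij_witness[of _ "\<lambda>w. w + 2 * c" "\<lambda>w. w - 2 * c"]) (auto simp: algebra_simps)
 then show ?thesis by (simp add: rate_def curv_shift)
qed

lemma corners_shift: "x + 2 * c \<in> corners (a + c) (b + c) m \<longleftrightarrow> x \<in> corners a b (\<lambda>x. m (x + 2 * c))"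
 by (simp add: corners_def curv_shift)

lemma valid_shift: "valid (a + c) (b + c) m ==> valid a b (\<lambda>x. m (x + 2 * c))"
proof -
 assume v: "valid (a + c) (b + c) m"
 have e: "x + 1 + 2 * c = x + 2 * c + 1" "x - 1 + 2 * c = x + 2 * c - 1" for x by auto
 show ?thesis
  unfolding valid_def e
 proof (intro conjI allI impI)
  fix x assume "x <= 2 * a \<or> 2 * b <= x"
  then show "m (x + 2 * c) = 0" using valid_outside[OF v, of "x + 2 * c"] by auto
 next
  fix x :: int assume "odd x" "2 * a < x" "x < 2 * b"
  then have "odd (x + 2 * c)" "2 * (a + c) < x + 2 * c" "x + 2 * c < 2 * (b + c)" by auto
  note o = valid_odd[OF v this]
  show "m (x + 2 * c + 1) <= m (x + 2 * c)" "m (x + 2 * c) <= m (x + 2 * c + 1) + 1"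
   "m (x + 2 * c - 1) <= m (x + 2 * c)" "m (x + 2 * c) <= m (x + 2 * c - 1) + 1" by (rule o)+
 qed
qed

lemma at_pmf_shift:
 assumes ok: "ok1 a b L" and ok': "ok1 (a + c) (b + c) L"
 shows "map_pmf (shift_state c) (at1 (a + c) (b + c) L s zero_state) = at1 a b L s zero_state"
proof (induction s)
 case 0
 show ?case by (simp add: shift_state_def zero_state_def)
next
 case (Suc s)
 have st: "map_pmf (shift_state c) (step1 (a + c) (b + c) L ms) = step1 a b L (shift_state c ms)"
  if v': "valid1 (a + c) (b + c) ms" for ms
 proof -
  define f where "f = map_option (\<lambda>(i :: nat, x). (i, x - 2 * c))"
  have v: "valid1 a b (shift_state c ms)" using v' valid_shift by (auto simp: sys_valid_def shift_state_def)
  have dm: "shift_state c (do_move ms u) = do_move (shift_state c ms) (f u)" for u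
   by (cases "(ms, u)" rule: do_move.cases) (auto simp: f_def incr_def shift_state_def fun_eq_iff)
  have "map_pmf f (move_pmf 1 (\<lambda>_. a + c) (\<lambda>_. b + c) L ms) = move_pmf 1 (\<lambda>_. a) (\<lambda>_. b) L (shift_state c ms)"
  proof (rule spmf_eqI)
   fix z :: "nat \<times> int"
   obtain i x where z: "z = (i, x)" by (cases z)
   have "f -` {Some (i, x)} = {Some (i, x + 2 * c)}"
    by (auto simp: f_def)
   then have "pmf (map_pmf f (move_pmf 1 (\<lambda>_. a + c) (\<lambda>_. b + c) L ms)) (Some (i, x))
    = pmf (move_pmf 1 (\<lambda>_. a + c) (\<lambda>_. b + c) L ms) (Some (i, x + 2 * c))"
    by (simp add: pmf_map measure_pmf_single)
   then show "spmf (map_pmf f (move_pmf 1 (\<lambda>_. a + c) (\<lambda>_. b + c) L ms)) z = spmf (move_pmf 1 (\<lambda>_. a) (\<lambda>_. b) L (shift_state c ms)) z"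
    unfolding z pmf_move_pmf(1)[OF ok' v'] pmf_move_pmf(1)[OF ok v]
    by (cases "i = 0") (simp_all add: sys_moves_def corners_shift rate_shift shift_state_def)
  qed
  then show ?thesis
   by (simp add: step_pmf_def pmf.map_comp o_def dm) (metis (no_types, lifting) pmf.map_comp o_def pmf.map_cong0)
 qed
 have "map_pmf (shift_state c) (at1 (a + c) (b + c) L (Suc s) zero_state)
  = bind_pmf (at1 (a + c) (b + c) L s zero_state) (\<lambda>ms. step1 a b L (shift_state c ms))"
  unfolding at_pmf.simps map_bind_pmf
  by (rule bind_pmf_cong[OF refl]) (use st sys_valid_at[OF ok' sys_valid_zero] in auto)
 also have "\<dots> = bind_pmf (map_pmf (shift_state c) (at1 (a + c) (b + c) L s zero_state)) (step1 a b L)"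
  by (simp add: bind_map_pmf)
 finally show ?case unfolding Suc by simp
qed

subsection \<open>Smoothed rates\<close>

declare One_nat_def [simp del]

text \<open>One-sided product of the alternating charges around an odd column of the full staircase;
  the initial rate there is \<open>wallis p * wallis q\<close>, with \<open>p\<close> and
  \<open>q\<close> measuring the distances to the two ends.\<close>

primrec wallis :: "nat => real" where
 "wallis 0 = 1"
| "wallis (Suc t) = wallis t * (real (2 * t + 3) / real (2 * t + 2))"

lemma wallis_pos: "0 < wallis t"
 by (induction t) auto

text \<open>By Wallis's product this is \<open>sqrt (2 / pi)\<close>, which makes
  \<open>rate_const\<close> equal to \<open>2 / pi\<close>.\<close>

definition wallis_const :: real where
 "wallis_const = (SUP t. wallis t / sqrt (2 * real t + 2))"

lemma wallis_ratio:
 fixes w c d p q :: real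
 assumes "w * (c * q) <= w * (d * p)" "0 < c" "0 < p" "0 < q"
 shows "w / p <= w * (d / c) / q"
 using assms by (simp add: field_simps)

lemma wallis_ratio':
 fixes w c d p q :: real
 assumes "w * (d * p) <= w * (c * q)" "0 < c" "0 < p" "0 < q"
 shows "w * (d / c) / q <= w / p"
 using assms by (simp add: field_simps)

text \<open>Two normalisations, one increasing and one decreasing, trap the sequence. Their common
  limit then bounds every term on both sides, so that all later estimates hold at each finite
  size.\<close>

lemma wallis_mono:
 assumes "t <= s"
 shows "wallis t / sqrt (2 * real t + 2) <= wallis s / sqrt (2 * real s + 2)"
  and "wallis s / sqrt (2 * real s + 1) <= wallis t / sqrt (2 * real t + 1)"
proof -
 have 1: "wallis t / sqrt (2 * real t + 2) <= wallis (Suc t) / sqrt (2 * real (Suc t) + 2)" for t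
 proof -
  have "(2 * real t + 2) * sqrt (2 * real t + 4) <= (2 * real t + 3) * sqrt (2 * real t + 2)"
  proof (rule power2_le_imp_le)
   show "((2 * real t + 2) * sqrt (2 * real t + 4))\<^sup>2 <= ((2 * real t + 3) * sqrt (2 * real t + 2))\<^sup>2"
    unfolding power_mult_distrib by (simp add: power2_eq_square algebra_simps)
  qed auto
  then have "wallis t * ((2 * real t + 2) * sqrt (2 * real t + 4)) <= wallis t * ((2 * real t + 3) * sqrt (2 * real t + 2))"
   using wallis_pos[of t] by (intro mult_left_mono) auto
  from wallis_ratio[OF this] show ?thesis by (simp add: add.commute)
 qed
 have 2: "wallis (Suc t) / sqrt (2 * real (Suc t) + 1) <= wallis t / sqrt (2 * real t + 1)" for t
 proof -
  have "(2 * real t + 3) * sqrt (2 * real t + 1) <= (2 * real t + 2) * sqrt (2 * real t + 3)"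
  proof (rule power2_le_imp_le)
   show "((2 * real t + 3) * sqrt (2 * real t + 1))\<^sup>2 <= ((2 * real t + 2) * sqrt (2 * real t + 3))\<^sup>2"
    unfolding power_mult_distrib by (simp add: power2_eq_square algebra_simps)
  qed auto
  then have "wallis t * ((2 * real t + 3) * sqrt (2 * real t + 1)) <= wallis t * ((2 * real t + 2) * sqrt (2 * real t + 3))"
   using wallis_pos[of t] by (intro mult_left_mono) auto
  from wallis_ratio'[OF this] show ?thesis by (simp add: add.commute)
 qed
 show "wallis t / sqrt (2 * real t + 2) <= wallis s / sqrt (2 * real s + 2)"
  by (rule lift_Suc_mono_le[of "\<lambda>t. wallis t / sqrt (2 * real t + 2)", OF 1 assms])
 show "wallis s / sqrt (2 * real s + 1) <= wallis t / sqrt (2 * real t + 1)"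
  by (rule lift_Suc_antimono_le[of "\<lambda>t. wallis t / sqrt (2 * real t + 1)", OF 2 assms])
qed

lemma wallis_cross: "wallis s / sqrt (2 * real s + 2) <= wallis t / sqrt (2 * real t + 1)"
proof -
 have d: "wallis s / sqrt (2 * real s + 2) <= wallis s / sqrt (2 * real s + 1)" for s
  using wallis_pos[of s] by (intro divide_left_mono mult_pos_pos) auto
 show ?thesis
 proof (cases "s <= t")
  case True
  then show ?thesis using wallis_mono(1)[of s t] d[of t] by linarith
 next
  case False
  then show ?thesis using wallis_mono(2)[of t s] d[of s] by linarith
 qed
qed

lemma wallis_bounds:
 "wallis_const * sqrt (2 * real t + 1) <= wallis t" "wallis t <= wallis_const * sqrt (2 * real t + 2)"
 "0 < wallis_const"
proof -
 have bdd: "bdd_above (range (\<lambda>t. wallis t / sqrt (2 * real t + 2)))"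
  by (rule bdd_aboveI2[OF wallis_cross[of _ 0]])
 have le: "wallis t / sqrt (2 * real t + 2) <= wallis_const" for t
  unfolding wallis_const_def by (rule cSUP_upper[OF UNIV_I bdd])
 have ge: "wallis_const <= wallis t / sqrt (2 * real t + 1)"
  unfolding wallis_const_def by (rule cSUP_least) (auto simp: wallis_cross)
 show "wallis_const * sqrt (2 * real t + 1) <= wallis t" using ge by (simp add: field_simps)
 show "wallis t <= wallis_const * sqrt (2 * real t + 2)" using le[of t] by (simp add: field_simps)
 have "0 < wallis 0 / sqrt (2 * real 0 + 2)" by simp
 then show "0 < wallis_const" using le[of 0] by linarith
qed

definition rate_const :: real where "rate_const = wallis_const\<^sup>2"

lemma rate_const_pos: "0 < rate_const"
 using wallis_bounds(3) by (simp add: rate_const_def)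

lemma pot_odd: "pot (c - int p) (c + 1 + int q) (2 * c + 1) = ln (wallis p) + ln (wallis q)"
proof -
 have R: "pot c (c + 1 + int q) (2 * c + 1) = ln (wallis q)"
 proof (induction q)
  case 0
  have "{2 * c..2 * (c + 1)} = {2 * c, 2 * c + 1, 2 * c + 2}" by auto
  then show ?case by (simp add: pot_def)
 next
  case (Suc t)
  have e: "c + 1 + int (Suc t) = c + 1 + int t + 1" by simp
  have "pot c (c + 1 + int (Suc t)) (2 * c + 1) = pot c (c + 1 + int t) (2 * c + 1)
   - ln (ir (2 * (c + 1 + int t) + 1 - (2 * c + 1))) + ln (ir (2 * (c + 1 + int t) + 2 - (2 * c + 1)))"
   unfolding e by (rule pot_extend_right) auto
  also have "\<dots> = ln (wallis t) - ln (real (2 * t + 2)) + ln (real (2 * t + 3))"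
   unfolding Suc by (simp add: algebra_simps)
  also have "\<dots> = ln (wallis (Suc t))" using wallis_pos[of t] by (simp add: ln_mult ln_div)
  finally show ?case .
 qed
 show ?thesis
 proof (induction p)
  case (Suc t)
  have e: "c - int (Suc t) = c - int t - 1" by simp
  have "pot (c - int (Suc t)) (c + 1 + int q) (2 * c + 1) = pot (c - int t) (c + 1 + int q) (2 * c + 1)
   - ln (ir (2 * c + 1 + 1 - 2 * (c - int t))) + ln (ir (2 * c + 1 + 2 - 2 * (c - int t)))"
   unfolding e by (rule pot_extend_left) auto
  also have "\<dots> = ln (wallis t) + ln (wallis q) - ln (real (2 * t + 2)) + ln (real (2 * t + 3))"
   unfolding Suc by (simp add: algebra_simps)
  also have "\<dots> = ln (wallis (Suc t)) + ln (wallis q)" using wallis_pos[of t] by (simp add: ln_mult ln_div)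
  finally show ?case .
 qed (simp add: R)
qed

lemma rate_zero: "rate a b (\<lambda>_. 0) x = exp (pot a b x)"
 by (simp add: rate_def pot_def curv_def)

lemma initial_rate_bounds:
 assumes x: "odd x" "2 * a < x" "x < 2 * b"
 shows "rate_const * sqrt (ir ((2 * b - x) * (x - 2 * a))) <= rate a b (\<lambda>_. 0) x"
  and "rate a b (\<lambda>_. 0) x <= rate_const * sqrt (width2 a b x)"
proof -
 obtain c where c: "x = 2 * c + 1" using x(1) by (auto elim: oddE)
 define p where "p = nat (c - a)"
 define q where "q = nat (b - c - 1)"
 have ab: "a = c - int p" "b = c + 1 + int q" using x(2,3) unfolding c p_def q_def by simp_all
 have r: "rate a b (\<lambda>_. 0) x = wallis p * wallis q"
  unfolding rate_zero c ab pot_odd using wallis_pos by (simp add: exp_add)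
 have w: "width2 a b x = (2 * real p + 2) * (2 * real q + 2)"
  "ir ((2 * b - x) * (x - 2 * a)) = (2 * real p + 1) * (2 * real q + 1)"
 proof -
  have "2 * b + 1 - x = 2 * int q + 2" "x + 1 - 2 * a = 2 * int p + 2" "2 * b - x = 2 * int q + 1" "x - 2 * a = 2 * int p + 1"
   unfolding ab c by simp_all
  then show "width2 a b x = (2 * real p + 2) * (2 * real q + 2)"
   "ir ((2 * b - x) * (x - 2 * a)) = (2 * real p + 1) * (2 * real q + 1)"
   unfolding width2_def by (simp_all only: of_int_mult of_int_add of_int_numeral of_int_1 of_int_of_nat_eq mult.commute)
 qed
 have "rate_const * sqrt (ir ((2 * b - x) * (x - 2 * a)))
  = (wallis_const * sqrt (2 * real p + 1)) * (wallis_const * sqrt (2 * real q + 1))"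
  unfolding w rate_const_def by (simp only: real_sqrt_mult power2_eq_square mult_ac)
 also have "\<dots> <= wallis p * wallis q"
  by (rule mult_mono[OF wallis_bounds(1) wallis_bounds(1) less_imp_le[OF wallis_pos]])
   (simp add: less_imp_le[OF wallis_bounds(3)])
 finally show "rate_const * sqrt (ir ((2 * b - x) * (x - 2 * a))) <= rate a b (\<lambda>_. 0) x" unfolding r .
 have "wallis p * wallis q <= (wallis_const * sqrt (2 * real p + 2)) * (wallis_const * sqrt (2 * real q + 2))"
  by (rule mult_mono[OF wallis_bounds(2) wallis_bounds(2) _ less_imp_le[OF wallis_pos]])
   (simp add: less_imp_le[OF wallis_bounds(3)])
 also have "\<dots> = rate_const * sqrt (width2 a b x)"
  unfolding w rate_const_def by (simp only: real_sqrt_mult power2_eq_square mult_ac)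
 finally show "rate a b (\<lambda>_. 0) x <= rate_const * sqrt (width2 a b x)" unfolding r .
qed

lemma corners_zero:
 assumes "a < b"
 shows "corners a b (\<lambda>_. 0) = {x. odd x \<and> 2 * a < x \<and> x < 2 * b}"
proof (rule set_eqI)
 fix x
 show "x \<in> corners a b (\<lambda>_. 0) \<longleftrightarrow> x \<in> {x. odd x \<and> 2 * a < x \<and> x < 2 * b}"
  unfolding corner_cases[OF valid_zero assms, of x] by (cases "odd x") simp_all
qed

text \<open>The Poisson kernel without the factor \<open>1 / pi\<close>; it is minus the imaginary
  part of \<open>1 / (z - x)\<close> at \<open>z = i * eps\<close>.\<close>

definition poisson :: "real => int => real" where
 "poisson eps x = eps / ((ir x)\<^sup>2 + eps\<^sup>2)"

text \<open>The smoothed rate is the imaginary part of the resolvent at height \<open>eps\<close>, which hardly changes as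
 long as the number of removed boxes is small compared with the square of \<open>eps\<close>.\<close>

definition smooth_rate :: "int => int => real => (int => nat) => real" where
 "smooth_rate a b eps m = (\<Sum>x\<in>corners a b m. rate a b m x * poisson eps x)"

section \<open>The resolvent of a profile\<close>

definition resolvent :: "int => int => (int => nat) => complex => complex" where
 "resolvent a b m z = (\<Prod>x\<in>peaks a b m. z - of_int x) / (\<Prod>x\<in>corners a b m. z - of_int x)"

lemma resolvent_powi:
 assumes v: "valid a b m" and ab: "a < b"
 shows "resolvent a b m z = (\<Prod>x\<in>{2*a..2*b}. (z - of_int x) powi curv a b m x)"
proof -
 let ?X = "peaks a b m" and ?Y = "corners a b m" and ?I = "{2*a..2*b}"
 have sub: "?X \<subseteq> ?I" "?Y \<subseteq> ?I" using peaks_subset[OF v] corners_subset[OF v ab] by auto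
 have "(z - of_int x) powi curv a b m x
  = (if x \<in> ?X then z - of_int x else 1) * (if x \<in> ?Y then inverse (z - of_int x) else 1)" for x
  using curv_range[OF v ab, of x] by (auto simp: peaks_def corners_def power_int_def)
 then have "(\<Prod>x\<in>?I. (z - of_int x) powi curv a b m x)
  = (\<Prod>x\<in>?I. if x \<in> ?X then z - of_int x else 1) * (\<Prod>x\<in>?I. if x \<in> ?Y then inverse (z - of_int x) else 1)"
  by (simp add: prod.distrib)
 also have "\<dots> = (\<Prod>x\<in>?X. z - of_int x) * (\<Prod>x\<in>?Y. inverse (z - of_int x))"
  using sub by (simp add: prod.inter_restrict[symmetric] Int_absorb1)
 finally show ?thesis by (simp add: resolvent_def divide_inverse prod_inversef[symmetric] o_def)
qed

lemma power_int_curvature: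
 fixes u :: "'a::field"
 assumes "u \<noteq> 0"
 shows "u powi (i + 2 * int p - int q - int r) = u powi i * (u\<^sup>2) ^ p / u ^ q / u ^ r"
proof -
 have "u powi (2 * int p) = u powi int (2 * p)" by simp
 also have "\<dots> = (u\<^sup>2) ^ p" by (simp only: power_int_of_nat power_mult)
 finally have e: "u powi (2 * int p) = (u\<^sup>2) ^ p" .
 have "u powi (i + 2 * int p - int q - int r) = u powi i * u powi (2 * int p) / u powi int q / u powi int r"
  using assms by (simp only: power_int_diff power_int_add simp_thms)
 then show ?thesis unfolding e power_int_of_nat .
qed

text \<open>A removal in column \<open>x\<close> adds a second difference to the charges, which
  multiplies the resolvent by \<open>u ^ 2 / ((u - 1) * (u + 1))\<close> with
  \<open>u = z - x\<close>. The index shifts produce no boundary terms, as no box is ever removed at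
  the ends.\<close>

lemma resolvent_ratio:
 assumes v: "valid a b m" and ab: "a < b" and z: "Im z \<noteq> 0"
 shows "resolvent a b m z = resolvent a b (\<lambda>_. 0) z * (\<Prod>x\<in>{2*a..2*b}. (1 + 1 / ((z - of_int x)\<^sup>2 - 1)) ^ m x)"
proof -
 let ?I = "{2*a..2*b}"
 have nz: "z - of_int x \<noteq> 0" for x
  using z by (metis Im_complex_of_real complex_Im_of_int diff_eq_diff_eq diff_self)
 have sh1: "(\<Prod>x\<in>?I. (z - of_int x) ^ m (x - 1)) = (\<Prod>x\<in>?I. (z - of_int (x + 1)) ^ m x)"
 proof -
  have "(\<Prod>x\<in>?I. (z - of_int x) ^ m (x - 1)) = (\<Prod>x\<in>{2*a-1..2*b-1}. (z - of_int (x + 1)) ^ m x)"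
   by (rule prod.reindex_bij_witness[of _ "\<lambda>x. x + 1" "\<lambda>x. x - 1"]) auto
  also have "\<dots> = (\<Prod>x\<in>{2*a-1..2*b}. (z - of_int (x + 1)) ^ m x)"
   by (rule prod.mono_neutral_left) (auto simp: valid_outside[OF v])
  also have "\<dots> = (\<Prod>x\<in>?I. (z - of_int (x + 1)) ^ m x)"
   by (rule prod.mono_neutral_right) (auto simp: valid_outside[OF v])
  finally show ?thesis .
 qed
 have sh2: "(\<Prod>x\<in>?I. (z - of_int x) ^ m (x + 1)) = (\<Prod>x\<in>?I. (z - of_int (x - 1)) ^ m x)"
 proof -
  have "(\<Prod>x\<in>?I. (z - of_int x) ^ m (x + 1)) = (\<Prod>x\<in>{2*a+1..2*b+1}. (z - of_int (x - 1)) ^ m x)"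
   by (rule prod.reindex_bij_witness[of _ "\<lambda>x. x - 1" "\<lambda>x. x + 1"]) auto
  also have "\<dots> = (\<Prod>x\<in>{2*a..2*b+1}. (z - of_int (x - 1)) ^ m x)"
   by (rule prod.mono_neutral_left) (auto simp: valid_outside[OF v])
  also have "\<dots> = (\<Prod>x\<in>?I. (z - of_int (x - 1)) ^ m x)"
   by (rule prod.mono_neutral_right) (auto simp: valid_outside[OF v])
  finally show ?thesis .
 qed
 have fac: "(z - of_int x)\<^sup>2 / ((z - of_int (x + 1)) * (z - of_int (x - 1))) = 1 + 1 / ((z - of_int x)\<^sup>2 - 1)" for x
 proof -
  have e: "(z - of_int (x + 1)) * (z - of_int (x - 1)) = (z - of_int x)\<^sup>2 - 1"
   by (simp add: power2_eq_square algebra_simps)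
  have "(z - of_int x)\<^sup>2 - 1 \<noteq> 0" unfolding e[symmetric] using nz[of "x + 1"] nz[of "x - 1"] by simp
  then show ?thesis unfolding e by (simp add: field_simps)
 qed
 have "(z - of_int x) powi curv a b m x = (z - of_int x) powi curv0 a b x * ((z - of_int x)\<^sup>2) ^ m x
   / ((z - of_int x) ^ m (x - 1)) / ((z - of_int x) ^ m (x + 1))" for x
  unfolding curv_def by (rule power_int_curvature) (rule nz)
 then have "resolvent a b m z = (\<Prod>x\<in>?I. (z - of_int x) powi curv0 a b x) * (\<Prod>x\<in>?I. ((z - of_int x)\<^sup>2) ^ m x)
   / (\<Prod>x\<in>?I. (z - of_int x) ^ m (x - 1)) / (\<Prod>x\<in>?I. (z - of_int x) ^ m (x + 1))"
  unfolding resolvent_powi[OF v ab] by (simp add: prod.distrib prod_dividef)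
 also have "\<dots> = (\<Prod>x\<in>?I. (z - of_int x) powi curv0 a b x)
   * (\<Prod>x\<in>?I. ((z - of_int x)\<^sup>2 / ((z - of_int (x + 1)) * (z - of_int (x - 1)))) ^ m x)"
  unfolding sh1 sh2 by (simp add: prod_dividef power_divide power_mult_distrib prod.distrib)
 also have "\<dots> = (\<Prod>x\<in>?I. (z - of_int x) powi curv0 a b x) * (\<Prod>x\<in>?I. (1 + 1 / ((z - of_int x)\<^sup>2 - 1)) ^ m x)"
  unfolding fac ..
 finally show ?thesis
  unfolding resolvent_powi[OF valid_zero ab] by (simp add: curv_def)
qed

lemma smooth_rate_Im:
 assumes v: "valid a b m" and ab: "a < b" and e: "0 < eps"
 shows "smooth_rate a b eps m = Im (resolvent a b m (\<i> * of_real eps)) - eps"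
proof -
 define z where "z = \<i> * complex_of_real eps"
 have z: "z \<notin> of_int ` corners a b m" using e by (auto simp: z_def complex_eq_iff)
 have "Im (complex_of_real r / (z - of_int x)) = - (r * poisson eps x)" for r x
  using e by (simp add: z_def poisson_def Im_divide power2_eq_square add.commute)
 then show ?thesis
  unfolding resolvent_def z_def[symmetric] resolvent_identity[OF v ab z] smooth_rate_def
  by (simp add: sum_negf Im_sum) (simp add: z_def)
qed

lemma norm_resolvent_zero:
 assumes ab: "a < b" and e: "0 < eps"
 shows "norm (resolvent a b (\<lambda>_. 0) (\<i> * of_real eps)) <= eps + \<bar>ir (a + b)\<bar> + real (nbox a b) / eps"
proof -
 define z where "z = \<i> * complex_of_real eps"
 let ?Y = "corners a b (\<lambda>_. 0)" and ?r = "rate a b (\<lambda>_. 0)"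
 have z: "z \<notin> of_int ` ?Y" using e by (auto simp: z_def complex_eq_iff)
 have zx: "eps <= norm (z - of_int x)" for x
  using abs_Im_le_cmod[of "z - of_int x"] e by (simp add: z_def)
 have "norm (resolvent a b (\<lambda>_. 0) z) <= norm z + norm (of_int (a + b) :: complex) + (\<Sum>x\<in>?Y. norm (complex_of_real (?r x) / (z - of_int x)))"
  unfolding resolvent_def resolvent_identity[OF valid_zero ab z]
  by (intro order_trans[OF norm_triangle_ineq4] add_mono norm_sum order_refl)
 also have "(\<Sum>x\<in>?Y. norm (complex_of_real (?r x) / (z - of_int x))) <= (\<Sum>x\<in>?Y. ?r x / eps)"
  using zx e less_imp_le[OF rate_pos] by (intro sum_mono) (auto simp: norm_divide intro!: frac_le)
 also have "(\<Sum>x\<in>?Y. ?r x / eps) = real (nbox a b) / eps"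
  using sum_rates[OF valid_zero ab] by (simp flip: sum_divide_distrib)
 also have "norm z = eps" using e by (simp add: z_def norm_mult)
 also have "norm (of_int (a + b) :: complex) = \<bar>ir (a + b)\<bar>" by (rule norm_of_int)
 finally show ?thesis by (simp add: z_def)
qed

lemma norm_prod_minus_one:
 fixes f :: "'a => complex"
 assumes "finite S"
 shows "norm ((\<Prod>p\<in>S. 1 + f p) - 1) <= (\<Prod>p\<in>S. 1 + norm (f p)) - 1"
 using assms
proof (induction S)
 case (insert x S)
 let ?P = "\<Prod>p\<in>S. 1 + f p" and ?Q = "\<Prod>p\<in>S. 1 + norm (f p)"
 have "norm ?P <= ?Q"
  unfolding prod_norm[symmetric] by (rule prod_mono) (auto intro: order_trans[OF norm_triangle_ineq])
 then have P: "norm (f x * ?P) <= norm (f x) * ?Q" by (simp add: norm_mult mult_left_mono)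
 have eq: "(\<Prod>p\<in>insert x S. 1 + f p) - 1 = (?P - 1) + f x * ?P"
  using insert.hyps by (simp add: algebra_simps)
 have "norm ((\<Prod>p\<in>insert x S. 1 + f p) - 1) <= (?Q - 1) + norm (f x) * ?Q"
  unfolding eq using norm_triangle_ineq[of "?P - 1" "f x * ?P"] insert.IH P by linarith
 also have "\<dots> = (\<Prod>p\<in>insert x S. 1 + norm (f p)) - 1"
  using insert.hyps by (simp add: algebra_simps)
 finally show ?case .
qed simp

lemma norm_prod_powers_minus_one:
 fixes u :: "int => complex"
 assumes I: "finite I" and u: "\<And>x. x \<in> I ==> norm (u x) <= dl"
 shows "norm ((\<Prod>x\<in>I. (1 + u x) ^ m x) - 1) <= exp (real (\<Sum>x\<in>I. m x) * dl) - 1"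
proof -
 let ?S = "SIGMA x:I. {..<m x}"
 have "(\<Prod>x\<in>I. (1 + u x) ^ m x) = (\<Prod>x\<in>I. \<Prod>i<m x. 1 + u x)" by simp
 also have "\<dots> = (\<Prod>(x, i)\<in>?S. 1 + u x)" by (rule prod.Sigma) (use I in auto)
 finally have "norm ((\<Prod>x\<in>I. (1 + u x) ^ m x) - 1) = norm ((\<Prod>p\<in>?S. 1 + u (fst p)) - 1)"
  by (simp add: case_prod_unfold)
 also have "\<dots> <= (\<Prod>p\<in>?S. 1 + norm (u (fst p))) - 1" by (rule norm_prod_minus_one) (use I in auto)
 also have "(\<Prod>p\<in>?S. 1 + norm (u (fst p))) <= (\<Prod>p\<in>?S. exp dl)"
 proof (rule prod_mono)
  fix p assume "p \<in> ?S"
  then have "norm (u (fst p)) <= dl" using u by auto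
  then show "0 <= 1 + norm (u (fst p)) \<and> 1 + norm (u (fst p)) <= exp dl"
   using exp_ge_add_one_self[of dl] norm_ge_zero[of "u (fst p)"] by linarith
 qed
 also have "(\<Prod>p\<in>?S. exp dl) = exp (real (\<Sum>x\<in>I. m x) * dl)"
 proof -
  have "(\<Prod>p\<in>?S. exp dl) = exp dl ^ (\<Sum>x\<in>I. m x)" using I by simp
  then show ?thesis by (simp only: exp_of_nat_mult)
 qed
 finally show ?thesis by simp
qed

text \<open>At height \<open>eps\<close> each factor of \<open>resolvent_ratio\<close> is within
  \<open>1 / eps ^ 2\<close> of one, wherever its box was removed, so the product is controlled by
  the number of factors alone.\<close>

lemma smooth_rate_stable:
 assumes v: "valid a b m" and ab: "a < b" and e: "0 < eps"
 shows "\<bar>smooth_rate a b eps m - smooth_rate a b eps (\<lambda>_. 0)\<bar>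
  <= (eps + \<bar>ir (a + b)\<bar> + real (nbox a b) / eps) * (exp (real (removed a b m) / eps\<^sup>2) - 1)"
proof -
 define z where "z = \<i> * complex_of_real eps"
 define u where "u x = 1 / ((z - of_int x)\<^sup>2 - 1)" for x :: int
 let ?R0 = "resolvent a b (\<lambda>_. 0) z"
 have u: "norm (u x) <= 1 / eps\<^sup>2" for x
 proof -
  have "(z - of_int x)\<^sup>2 - 1 = (z - of_int (x + 1)) * (z - of_int (x - 1))"
   by (simp add: power2_eq_square algebra_simps)
  then have "norm ((z - of_int x)\<^sup>2 - 1) = norm (z - of_int (x + 1)) * norm (z - of_int (x - 1))"
   by (simp only: norm_mult)
  also have "eps * eps <= norm (z - of_int (x + 1)) * norm (z - of_int (x - 1))"
   using abs_Im_le_cmod[of "z - of_int (x + 1)"] abs_Im_le_cmod[of "z - of_int (x - 1)"] e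
   by (intro mult_mono) (auto simp: z_def)
  finally have "eps\<^sup>2 <= norm ((z - of_int x)\<^sup>2 - 1)" by (simp add: power2_eq_square)
  then have "1 / norm ((z - of_int x)\<^sup>2 - 1) <= 1 / eps\<^sup>2" using e by (intro frac_le) auto
  then show ?thesis unfolding u_def norm_divide by simp
 qed
 have "resolvent a b m z - ?R0 = ?R0 * ((\<Prod>x\<in>{2*a..2*b}. (1 + u x) ^ m x) - 1)"
  using resolvent_ratio[OF v ab, of z] e by (simp add: u_def z_def algebra_simps)
 then have "norm (resolvent a b m z - ?R0) = norm ?R0 * norm ((\<Prod>x\<in>{2*a..2*b}. (1 + u x) ^ m x) - 1)"
  by (simp add: norm_mult)
 also have "\<dots> <= (eps + \<bar>ir (a + b)\<bar> + real (nbox a b) / eps) * (exp (real (removed a b m) / eps\<^sup>2) - 1)"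
  using norm_resolvent_zero[OF ab e] norm_prod_powers_minus_one[of "{2*a..2*b}" u "1 / eps\<^sup>2" m] u e
  by (intro mult_mono) (auto simp: z_def removed_def)
 finally have "norm (resolvent a b m z - ?R0)
  <= (eps + \<bar>ir (a + b)\<bar> + real (nbox a b) / eps) * (exp (real (removed a b m) / eps\<^sup>2) - 1)" .
 moreover have "\<bar>Im (resolvent a b m z) - Im ?R0\<bar> <= norm (resolvent a b m z - ?R0)"
  using abs_Im_le_cmod[of "resolvent a b m z - ?R0"] by simp
 ultimately show ?thesis
  unfolding smooth_rate_Im[OF v ab e] smooth_rate_Im[OF valid_zero ab e] z_def[symmetric] by simp
qed

text \<open>The compensator formula: one step adds, in conditional mean, the weighted sum of the
  rates divided by \<open>L\<close>.\<close>

lemma expectation_weighted: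
 assumes ok: "ok1 a b L"
 shows "expect (at1 a b L s zero_state) (\<lambda>ms. \<Sum>x\<in>{2*a..2*b}. P x * real (ms 0 x))
  = (\<Sum>t<s. expect (at1 a b L t zero_state) (\<lambda>ms. \<Sum>x\<in>corners a b (ms 0). rate a b (ms 0) x * P x)) / L"
proof (induction s)
 case 0
 show ?case by (simp add: zero_state_apply)
next
 case (Suc s)
 let ?h = "\<lambda>ms :: state. \<Sum>x\<in>{2*a..2*b}. P x * real (ms 0 x)"
 let ?S = "\<lambda>ms :: state. \<Sum>x\<in>corners a b (ms 0). rate a b (ms 0) x * P x"
 let ?p = "at1 a b L s zero_state"
 note int [simp] = integrable_measure_pmf_finite[OF finite_set_at_pmf[OF ok sys_valid_zero, of s]]
 have st: "expect (step1 a b L ms) ?h = ?h ms + ?S ms / L" if v: "valid1 a b ms" for ms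
 proof -
  have vm: "valid a b (ms 0)" "a < b" using v ok by (auto simp: sys_valid_def sys_ok_def)
  have "?h (incr ms 0 x) - ?h ms = P x" if "x \<in> corners a b (ms 0)" for x
  proof -
   have x: "x \<in> {2*a..2*b}" using corners_subset[OF vm] that by auto
   have "?h (incr ms 0 x) - ?h ms = (\<Sum>w\<in>{2*a..2*b}. if w = x then P x else 0)"
    unfolding sum_subtractf[symmetric] by (rule sum.cong) (auto simp: incr_def algebra_simps)
   then show ?thesis using x by simp
  qed
  moreover have "{..<1::nat} = {0}" by auto
  ultimately show ?thesis
   unfolding expectation_step[OF ok v] by (simp add: sum_divide_distrib)
 qed
 have "expect (at1 a b L (Suc s) zero_state) ?h = expect ?p (\<lambda>ms. ?h ms + ?S ms / L)"
  by (rule expectation_at_Suc[OF ok sys_valid_zero st])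
 also have "\<dots> = expect ?p ?h + expect ?p ?S / L" by simp
 finally show ?case unfolding Suc by (simp add: add_divide_distrib)
qed

lemma expectation_removed_le:
 assumes ok: "sys_ok k A B L" and i: "i < k" and L: "1 <= L"
 shows "expect (at_pmf k A B L s zero_state) (\<lambda>ms. real (removed (A i) (B i) (ms i))) <= real (nbox (A i) (B i)) * real s / L"
proof -
 let ?p = "at_pmf k A B L s zero_state" and ?N = "real (nbox (A i) (B i))"
 note int [simp] = integrable_measure_pmf_finite[OF finite_set_at_pmf[OF ok sys_valid_zero, of s]]
 have "expect ?p (\<lambda>ms. ?N - real (removed (A i) (B i) (ms i))) = ?N * (1 - 1 / L) ^ s"
  by (rule expectation_remaining(1)[OF ok i])
 then have "expect ?p (\<lambda>ms. real (removed (A i) (B i) (ms i))) = ?N * (1 - (1 - 1 / L) ^ s)"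
  by (simp add: algebra_simps)
 also have "\<dots> <= ?N * (real s / L)"
  using power_one_minus_bounds(1)[OF L, of s] by (intro mult_left_mono) auto
 finally show ?thesis by simp
qed

text \<open>The bound of \<open>smooth_rate_stable\<close> after
  \<open>exp r - 1 <= r * exp r\<close>, with the crude \<open>r <= nbox a b / eps ^ 2\<close> in
  the exponent. This makes it linear in the number of removals, so that the bound
  \<open>nbox a b * y\<close> for their mean can be inserted.\<close>

definition smoothing_error :: "int => int => real => real => real" where
 "smoothing_error a b eps y = (eps + \<bar>ir (a + b)\<bar> + real (nbox a b) / eps)
   * (real (nbox a b) * y / eps\<^sup>2 * exp (real (nbox a b) / eps\<^sup>2))"

lemma smoothing_estimate:
 assumes ok: "ok1 a b L" and L: "1 <= L" and e: "0 < eps"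
 shows "\<bar>expect (at1 a b L s zero_state) (\<lambda>ms. \<Sum>x\<in>{2*a..2*b}. poisson eps x * real (ms 0 x))
  - real s / L * smooth_rate a b eps (\<lambda>_. 0)\<bar> <= real s / L * smoothing_error a b eps (real s / L)"
proof -
 let ?p = "\<lambda>t. at1 a b L t zero_state" and ?S0 = "smooth_rate a b eps (\<lambda>_. 0)" and ?N = "real (nbox a b)"
 have ab: "a < b" using ok by (simp add: sys_ok_def)
 define B0 where "B0 = eps + \<bar>ir (a + b)\<bar> + ?N / eps"
 have B0: "0 <= B0" using e by (simp add: B0_def)
 have one: "\<bar>expect (?p t) (\<lambda>ms. smooth_rate a b eps (ms 0)) - ?S0\<bar> <= smoothing_error a b eps (real s / L)" if t: "t < s" for t
 proof -
  have fin: "finite (set_pmf (?p t))" by (rule finite_set_at_pmf[OF ok sys_valid_zero])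
  note int [simp] = integrable_measure_pmf_finite[OF fin]
  have "\<bar>expect (?p t) (\<lambda>ms. smooth_rate a b eps (ms 0)) - ?S0\<bar> = \<bar>expect (?p t) (\<lambda>ms. smooth_rate a b eps (ms 0) - ?S0)\<bar>"
   by simp
  also have "\<dots> <= expect (?p t) (\<lambda>ms. \<bar>smooth_rate a b eps (ms 0) - ?S0\<bar>)"
   by (rule integral_abs_bound)
  also have "\<dots> <= expect (?p t) (\<lambda>ms. B0 * (real (removed a b (ms 0)) / eps\<^sup>2 * exp (?N / eps\<^sup>2)))"
  proof (rule integral_mono_AE)
   show "AE ms in ?p t. \<bar>smooth_rate a b eps (ms 0) - ?S0\<bar> <= B0 * (real (removed a b (ms 0)) / eps\<^sup>2 * exp (?N / eps\<^sup>2))"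
   proof (rule AE_pmfI)
    fix ms assume "ms \<in> set_pmf (?p t)"
    then have v: "valid a b (ms 0)" using sys_valid_at[OF ok sys_valid_zero] by (auto simp: sys_valid_def)
    define r where "r = real (removed a b (ms 0)) / eps\<^sup>2"
    have r: "0 <= r" "r <= ?N / eps\<^sup>2"
     using removed_le[OF v ab] by (auto simp: r_def intro!: divide_right_mono)
    have "exp r - 1 <= r * exp r"
    proof -
     have "1 - r <= exp (- r)" using exp_ge_add_one_self[of "- r"] by simp
     then have "(1 - r) * exp r <= exp (- r) * exp r" by (intro mult_right_mono) auto
     also have "\<dots> = 1" by (simp flip: exp_add)
     finally show ?thesis by (simp add: algebra_simps)
    qed
    also have "\<dots> <= r * exp (?N / eps\<^sup>2)" using r by (intro mult_left_mono) auto
    finally have "B0 * (exp r - 1) <= B0 * (r * exp (?N / eps\<^sup>2))" using B0 by (rule mult_left_mono)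
    then show "\<bar>smooth_rate a b eps (ms 0) - ?S0\<bar> <= B0 * (real (removed a b (ms 0)) / eps\<^sup>2 * exp (?N / eps\<^sup>2))"
     using smooth_rate_stable[OF v ab e] unfolding B0_def r_def by linarith
   qed
  qed auto
  also have "\<dots> = B0 * (exp (?N / eps\<^sup>2) / eps\<^sup>2) * expect (?p t) (\<lambda>ms. real (removed a b (ms 0)))"
   by (subst integral_mult_right_zero[symmetric]) (simp add: mult_ac)
  also have "\<dots> <= B0 * (exp (?N / eps\<^sup>2) / eps\<^sup>2) * (?N * (real s / L))"
  proof (rule mult_left_mono)
   have "expect (?p t) (\<lambda>ms. real (removed a b (ms 0))) <= ?N * real t / L"
    using expectation_removed_le[OF ok _ L, of 0 t] by simp
   also have "\<dots> <= ?N * real s / L" using t L by (intro divide_right_mono mult_left_mono) auto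
   finally show "expect (?p t) (\<lambda>ms. real (removed a b (ms 0))) <= ?N * (real s / L)" by simp
  qed (use B0 in auto)
  finally show ?thesis by (simp add: smoothing_error_def B0_def mult_ac)
 qed
 have "expect (?p s) (\<lambda>ms. \<Sum>x\<in>{2*a..2*b}. poisson eps x * real (ms 0 x)) - real s / L * ?S0
  = (\<Sum>t<s. expect (?p t) (\<lambda>ms. smooth_rate a b eps (ms 0)) - ?S0) / L"
  unfolding expectation_weighted[OF ok] smooth_rate_def[symmetric] by (simp add: sum_subtractf diff_divide_distrib)
 then have "\<bar>expect (?p s) (\<lambda>ms. \<Sum>x\<in>{2*a..2*b}. poisson eps x * real (ms 0 x)) - real s / L * ?S0\<bar>
  = \<bar>\<Sum>t<s. expect (?p t) (\<lambda>ms. smooth_rate a b eps (ms 0)) - ?S0\<bar> / L" using L by simp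
 also have "\<dots> <= (\<Sum>t<s. smoothing_error a b eps (real s / L)) / L"
  using L one by (intro divide_right_mono order_trans[OF sum_abs] sum_mono) auto
 finally show ?thesis by simp
qed

subsection \<open>Column means\<close>

lemma poisson_pos: "0 < eps ==> 0 < poisson eps x"
 by (simp add: poisson_def add_nonneg_pos)

lemma poisson_minus [simp]: "poisson eps (- x) = poisson eps x"
 by (simp add: poisson_def)

lemma poisson_antimono:
 assumes "0 < eps" "\<bar>x\<bar> <= \<bar>y\<bar>"
 shows "poisson eps y <= poisson eps x"
proof -
 have "\<bar>ir x\<bar> <= \<bar>ir y\<bar>" using assms(2) by linarith
 then have "(ir x)\<^sup>2 <= (ir y)\<^sup>2" by (simp only: abs_le_square_iff)
 then show ?thesis using assms(1) unfolding poisson_def by (intro divide_left_mono mult_pos_pos add_nonneg_pos) auto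
qed

lemma poisson_le: "0 < eps ==> poisson eps x <= 1 / eps"
 using poisson_antimono[of eps 0 x] by (simp add: poisson_def power2_eq_square)

lemma poisson_le_far:
 assumes "0 < eps" "0 < r" "r <= \<bar>ir x\<bar>"
 shows "poisson eps x <= eps / r\<^sup>2"
proof -
 have "r\<^sup>2 <= (ir x)\<^sup>2" using assms by (simp add: abs_le_square_iff[symmetric])
 then show ?thesis using assms(1,2) unfolding poisson_def by (intro divide_left_mono mult_pos_pos) (auto intro: order_trans add_pos_pos add_nonneg_pos)
qed

text \<open>The corners of the full staircase are the odd columns, so this is the weight that the
  initial smoothed rate sees near the origin.\<close>

definition odd_mass :: "real => nat => real" where
 "odd_mass eps l = (\<Sum>x\<in>{x\<in>{-(2 * int l + 1)..2 * int l + 1}. odd x}. poisson eps x)"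

text \<open>A pair mean can be traded against a sum over columns only if the columns
  \<open>2 * j\<close> and \<open>2 * j + 1\<close> share one weight: the smaller Poisson weight for
  upper bounds on pair means, the larger one for lower bounds.\<close>

definition pair_min :: "real => int => real" where
 "pair_min eps j = min (poisson eps (2 * j)) (poisson eps (2 * j + 1))"

definition pair_max :: "real => int => real" where
 "pair_max eps j = max (poisson eps (2 * j)) (poisson eps (2 * j + 1))"

lemma odd_mass_Suc: "odd_mass eps (Suc l) = odd_mass eps l + 2 * poisson eps (2 * int l + 3)"
proof -
 have eq: "{x\<in>{-(2 * int (Suc l) + 1)..2 * int (Suc l) + 1}. odd x}
  = insert (2 * int l + 3) (insert (- (2 * int l + 3)) {x\<in>{-(2 * int l + 1)..2 * int l + 1}. odd x})"
 proof (rule set_eqI)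
  fix x :: int
  show "x \<in> {x\<in>{-(2 * int (Suc l) + 1)..2 * int (Suc l) + 1}. odd x} \<longleftrightarrow>
   x \<in> insert (2 * int l + 3) (insert (- (2 * int l + 3)) {x\<in>{-(2 * int l + 1)..2 * int l + 1}. odd x})"
   by (simp only: mem_Collect_eq insert_iff atLeastAtMost_iff of_nat_Suc) presburger
 qed
 have fin: "finite {x\<in>{-(2 * int l + 1)..2 * int l + 1}. odd x}"
  by (rule finite_subset[of _ "{-(2 * int l + 1)..2 * int l + 1}"]) auto
 have "odd_mass eps (Suc l) = poisson eps (2 * int l + 3) + (poisson eps (- (2 * int l + 3)) + odd_mass eps l)"
  unfolding odd_mass_def eq
  by (subst sum.insert, use fin in simp, simp, subst sum.insert) (use fin in simp_all)
 then show ?thesis unfolding poisson_minus by simp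
qed

lemma odd_mass_0: "odd_mass eps 0 = 2 * poisson eps 1"
proof -
 have "{x\<in>{-(2 * int 0 + 1)..2 * int 0 + 1}. odd x} = {1, - 1 :: int}" by auto presburger
 then show ?thesis by (simp add: odd_mass_def)
qed

lemma sum_symmetric_Suc:
 fixes f :: "int => real"
 shows "(\<Sum>j\<in>{- int (Suc l)..int (Suc l)}. f j) = (\<Sum>j\<in>{- int l..int l}. f j) + f (int l + 1) + f (- (int l + 1))"
proof -
 have "{- int (Suc l)..int (Suc l)} = insert (int l + 1) (insert (- (int l + 1)) {- int l..int l})" by auto
 then show ?thesis by (subst \<open>_ = _\<close>, subst sum.insert; (subst sum.insert)?) auto
qed

text \<open>The kernel decreases away from the origin, so matching each pair with a nearby odd
  column loses no more than one value of the kernel, which is at most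
  \<open>1 / eps\<close>.\<close>

lemma pair_min_sum:
 assumes e: "0 < eps"
 shows "odd_mass eps l - 1 / eps <= (\<Sum>j\<in>{- int l..int l}. pair_min eps j)"
proof (induction l)
 case 0
 have "poisson eps 1 <= poisson eps 0" "poisson eps 1 <= 1 / eps" using e by (auto intro: poisson_antimono poisson_le)
 then show ?case by (simp add: odd_mass_0 pair_min_def)
next
 case (Suc l)
 have "pair_min eps (int l + 1) = poisson eps (2 * int l + 3)"
  using poisson_antimono[OF e, of "2 * (int l + 1)" "2 * int l + 3"] by (simp add: pair_min_def algebra_simps)
 moreover have "poisson eps (2 * int l + 3) <= pair_min eps (- (int l + 1))"
  using poisson_antimono[OF e, of "2 * (- (int l + 1))" "2 * int l + 3"]
   poisson_antimono[OF e, of "2 * (- (int l + 1)) + 1" "2 * int l + 3"] by (simp add: pair_min_def)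
 ultimately show ?case using Suc unfolding sum_symmetric_Suc odd_mass_Suc by linarith
qed

lemma pair_max_sum:
 assumes e: "0 < eps"
 shows "(\<Sum>j\<in>{- int l..int l}. pair_max eps j) <= odd_mass eps l + 1 / eps"
proof -
 have "(\<Sum>j\<in>{- int l..int l}. pair_max eps j) <= odd_mass eps l + 1 / eps - 2 * poisson eps (2 * int l + 1)"
 proof (induction l)
  case 0
  have "poisson eps 1 <= poisson eps 0" "poisson eps 0 <= 1 / eps" using e by (auto intro: poisson_antimono poisson_le)
  then show ?case by (simp add: odd_mass_0 pair_max_def)
 next
  case (Suc l)
  have "pair_max eps (int l + 1) <= poisson eps (2 * int l + 1)"
   using poisson_antimono[OF e, of "2 * int l + 1" "2 * (int l + 1)"]
    poisson_antimono[OF e, of "2 * int l + 1" "2 * (int l + 1) + 1"] by (simp add: pair_max_def)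
  moreover have "pair_max eps (- (int l + 1)) <= poisson eps (2 * int l + 1)"
   using poisson_antimono[OF e, of "2 * int l + 1" "2 * (- (int l + 1))"]
    poisson_antimono[OF e, of "2 * int l + 1" "2 * (- (int l + 1)) + 1"] by (simp add: pair_max_def)
  moreover have "2 * int (Suc l) + 1 = 2 * int l + 3" by simp
  ultimately show ?case using Suc unfolding sum_symmetric_Suc odd_mass_Suc by (simp add: add.commute)
 qed
 then show ?thesis using poisson_pos[OF e, of "2 * int l + 1"] by linarith
qed

text \<open>Columns within \<open>eps\<close> of the origin have weight at least
  \<open>1 / (2 * eps)\<close>, and the pairs to the right alone number at least
  \<open>(eps - 1) / 2\<close>; the constant \<open>1 / 8\<close> leaves slack for
  \<open>eps >= 4\<close>.\<close>

lemma pair_min_sum_lower: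
 assumes e: "4 <= eps" "eps <= 2 * real l + 1"
 shows "1 / 8 <= (\<Sum>j\<in>{- int l..int l}. pair_min eps j)"
proof -
 define J where "J = nat \<lfloor>(eps - 1) / 2\<rfloor>"
 have J: "real J <= (eps - 1) / 2" "(eps - 1) / 2 - 1 <= real J"
 proof -
  have "real J = ir \<lfloor>(eps - 1) / 2\<rfloor>" using e unfolding J_def by simp
  then show "real J <= (eps - 1) / 2" "(eps - 1) / 2 - 1 <= real J" by linarith+
 qed
 then have "real J <= real l" using e by argo
 then have Jl: "J <= l" by simp
 have "1 / (2 * eps) <= pair_min eps j" if j: "j \<in> {0..int J}" for j
 proof -
  have x: "\<bar>ir x\<bar> <= eps ==> 1 / (2 * eps) <= poisson eps x" for x
  proof -
   assume "\<bar>ir x\<bar> <= eps"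
   then have "(ir x)\<^sup>2 <= eps\<^sup>2" using e by (simp add: abs_le_square_iff[symmetric])
   then have "eps / (eps\<^sup>2 + eps\<^sup>2) <= poisson eps x"
    using e unfolding poisson_def by (intro divide_left_mono mult_pos_pos add_nonneg_pos add_pos_pos) auto
   then show ?thesis using e by (simp add: power2_eq_square)
  qed
  have "ir j <= real J" "0 <= ir j" using j by auto
  then have "\<bar>ir (2 * j)\<bar> <= eps" "\<bar>ir (2 * j + 1)\<bar> <= eps" using J by auto
  then show ?thesis using x by (simp add: pair_min_def)
 qed
 then have "(\<Sum>j\<in>{0..int J}. 1 / (2 * eps)) <= (\<Sum>j\<in>{0..int J}. pair_min eps j)" by (rule sum_mono)
 also have "\<dots> <= (\<Sum>j\<in>{- int l..int l}. pair_min eps j)"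
  using Jl e poisson_pos[of eps] by (intro sum_mono2) (auto simp: pair_min_def less_imp_le)
 finally have "(real J + 1) / (2 * eps) <= (\<Sum>j\<in>{- int l..int l}. pair_min eps j)" by simp
 moreover have "1 / 8 <= (real J + 1) / (2 * eps)" using J e by (simp add: field_simps)
 ultimately show ?thesis by linarith
qed

section \<open>Means of columns and of pairs of columns\<close>

definition colmean :: "int => int => real => nat => int => real" where
 "colmean a b L s x = expect (at1 a b L s zero_state) (\<lambda>ms. real (ms 0 x))"

lemma colmean_nonneg: "0 <= colmean a b L s x"
 unfolding colmean_def by (rule integral_nonneg_AE) simp

lemma colmean_shift:
 assumes "ok1 a b L" "ok1 (a + c) (b + c) L"
 shows "colmean (a + c) (b + c) L s (x + 2 * c) = colmean a b L s x"
 unfolding colmean_def at_pmf_shift[OF assms, symmetric] by (simp add: shift_state_def)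

lemma rel_pmf_expect_mono:
 assumes R: "rel_pmf R p q" and le: "\<And>x y. R x y ==> f x <= g y"
  and int: "integrable (measure_pmf p) f" "integrable (measure_pmf q) g"
 shows "expect p f <= expect q g"
proof -
 obtain pq where pq: "\<And>x y. (x, y) \<in> set_pmf pq ==> R x y" "map_pmf fst pq = p" "map_pmf snd pq = q"
  using R by (auto elim: rel_pmf.cases)
 have "expect pq (\<lambda>z. f (fst z)) <= expect pq (\<lambda>z. g (snd z))"
 proof (rule integral_mono_AE)
  show "integrable (measure_pmf pq) (\<lambda>z. f (fst z))" using int(1) unfolding pq(2)[symmetric] by simp
  show "integrable (measure_pmf pq) (\<lambda>z. g (snd z))" using int(2) unfolding pq(3)[symmetric] by simp
  show "AE z in pq. f (fst z) <= g (snd z)" using pq(1) le by (intro AE_pmfI) auto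
 qed
 then show ?thesis unfolding pq(2,3)[symmetric] by simp
qed

lemma at_dominated:
 assumes dom: "dominated k A B L a b L'" and okT: "sys_ok k A B L" and okD: "ok1 a b L'"
 shows "rel_pmf (below k) (at_pmf k A B L s zero_state) (at1 a b L' s zero_state)"
proof -
 have "below k zero_state zero_state" by (simp add: below_def zero_state_apply)
 from path_dominated[OF dom okT okD sys_valid_zero sys_valid_zero this]
 have "rel_pmf (list_all2 (below k)) (path_pmf k A B L s zero_state) (path1 a b L' s zero_state)" .
 then have "rel_pmf (\<lambda>p q. below k (p ! s) (q ! s)) (path_pmf k A B L s zero_state) (path1 a b L' s zero_state)"
 proof (rule pmf.rel_mono_strong)
  fix p q assume p: "p \<in> set_pmf (path_pmf k A B L s zero_state)" and l: "list_all2 (below k) p q"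
  show "below k (p ! s) (q ! s)" using list_all2_nthD[OF l, of s] length_path[OF p] by simp
 qed
 then show ?thesis
  using path_at[of s s k A B L zero_state] path_at[of s s 1 "\<lambda>_. a" "\<lambda>_. b" L' zero_state]
  by (simp add: pmf.rel_map flip: path_at[of s s])
qed

lemma colmean_mono:
 assumes dom: "dominated 1 (\<lambda>_. a) (\<lambda>_. b) L a' b' L'" and ok: "ok1 a b L" and ok': "ok1 a' b' L'"
 shows "colmean a b L s x <= colmean a' b' L' s x"
 unfolding colmean_def
proof (rule rel_pmf_expect_mono[OF at_dominated[OF dom ok ok']])
 show "integrable (measure_pmf (at1 a b L s zero_state)) (\<lambda>ms. real (ms 0 x))"
  by (rule integrable_measure_pmf_finite[OF finite_set_at_pmf[OF ok sys_valid_zero]])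
 show "integrable (measure_pmf (at1 a' b' L' s zero_state)) (\<lambda>ms. real (ms 0 x))"
  by (rule integrable_measure_pmf_finite[OF finite_set_at_pmf[OF ok' sys_valid_zero]])
qed (auto simp: below_def)

lemma colmean_sum:
 assumes ok: "ok1 a b L"
 shows "expect (at1 a b L s zero_state) (\<lambda>ms. \<Sum>x\<in>I. P x * real (ms 0 x)) = (\<Sum>x\<in>I. P x * colmean a b L s x)"
proof -
 note int [simp] = integrable_measure_pmf_finite[OF finite_set_at_pmf[OF ok sys_valid_zero, of s]]
 show ?thesis unfolding colmean_def by (simp add: Bochner_Integration.integral_sum)
qed

lemma smoothing_estimate':
 assumes ok: "ok1 a b L" and L: "1 <= L" and e: "0 < eps"
 shows "\<bar>(\<Sum>x\<in>{2*a..2*b}. poisson eps x * colmean a b L s x) - real s / L * smooth_rate a b eps (\<lambda>_. 0)\<bar>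
  <= real s / L * smoothing_error a b eps (real s / L)"
 using smoothing_estimate[OF ok L e, of s] unfolding colmean_sum[OF ok] .

lemma colmean_total:
 assumes ok: "ok1 a b L" and L: "1 <= L"
 shows "(\<Sum>x\<in>{2*a..2*b}. colmean a b L s x) <= real (nbox a b) * real s / L"
proof -
 have "(\<Sum>x\<in>{2*a..2*b}. colmean a b L s x) = expect (at1 a b L s zero_state) (\<lambda>ms. real (removed a b (ms 0)))"
  using colmean_sum[OF ok, where I = "{2*a..2*b}" and P = "\<lambda>_. 1"] by (simp add: removed_def)
 then show ?thesis using expectation_removed_le[OF ok _ L, of 0 s] by simp
qed

lemma sum_pairs:
 fixes f :: "int => real"
 shows "(\<Sum>j\<in>{- int l..int l}. f (2 * j) + f (2 * j + 1)) = (\<Sum>x\<in>{- 2 * int l..2 * int l + 1}. f x)"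
proof (induction l)
 case 0
 have "{- 2 * int 0..2 * int 0 + 1} = {0, 1}" by auto
 then show ?case by simp
next
 case (Suc l)
 have "{- 2 * int (Suc l)..2 * int (Suc l) + 1}
  = {2 * int l + 2, 2 * int l + 3, - (2 * int l) - 2, - (2 * int l) - 1} \<union> {- 2 * int l..2 * int l + 1}"
  by auto
 then have "(\<Sum>x\<in>{- 2 * int (Suc l)..2 * int (Suc l) + 1}. f x)
  = (\<Sum>x\<in>{2 * int l + 2, 2 * int l + 3, - (2 * int l) - 2, - (2 * int l) - 1}. f x) + (\<Sum>x\<in>{- 2 * int l..2 * int l + 1}. f x)"
  by (simp only:) (rule sum.union_disjoint, auto)
 also have "(\<Sum>x\<in>{2 * int l + 2, 2 * int l + 3, - (2 * int l) - 2, - (2 * int l) - 1}. f x)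
  = f (2 * int l + 2) + f (2 * int l + 3) + f (- (2 * int l) - 2) + f (- (2 * int l) - 1)"
  by (subst sum.insert; (subst sum.insert)?; (subst sum.insert)?) (auto simp: algebra_simps)
 moreover have fs: "f (2 * (int l + 1)) = f (2 * int l + 2)" "f (2 * (int l + 1) + 1) = f (2 * int l + 3)"
  "f (2 * - (int l + 1)) = f (- (2 * int l) - 2)" "f (2 * - (int l + 1) + 1) = f (- (2 * int l) - 1)"
  by (rule arg_cong[of _ _ f], simp)+
 ultimately show ?case
  unfolding sum_symmetric_Suc Suc using fs by linarith
qed

lemma ok1_iff: "ok1 a b L \<longleftrightarrow> a < b \<and> real (nbox a b) <= L \<and> 0 < L"
 by (simp add: sys_ok_def sys_box_def)

lemma dominated1_iff:
 "dominated 1 (\<lambda>_. a) (\<lambda>_. b) L a' b' L' \<longleftrightarrow> a' <= a \<and> b <= b' \<and>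
  (\<forall>x\<in>{2 * a<..<2 * b}. L' / L <= sqrt (width2 a' b' x / width2 a b x))"
 by (simp add: dominated_def)

lemma width2_pos: "2 * a < x ==> x < 2 * b ==> 0 < width2 a b x"
 unfolding width2_def by (intro mult_pos_pos) auto

lemma width2_mono:
 assumes "a' <= a" "b <= b'" "2 * a < x" "x < 2 * b"
 shows "width2 a b x <= width2 a' b' x"
 unfolding width2_def using assms by (intro mult_mono) auto

lemma dominated_same_clock:
 assumes "a' <= a" "b <= b'" "0 < L"
 shows "dominated 1 (\<lambda>_. a) (\<lambda>_. b) L a' b' L"
 unfolding dominated1_iff
proof (intro conjI ballI)
 fix x assume x: "x \<in> {2 * a<..<2 * b}"
 then have "1 <= width2 a' b' x / width2 a b x"
  using width2_mono[OF assms(1,2), of x] width2_pos[of a x b] by simp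
 then show "L / L <= sqrt (width2 a' b' x / width2 a b x)" using assms(3) by simp
qed (use assms in auto)

lemma eighth: "x / (1 / 8) = 8 * x" for x :: real
 by simp

lemma nbox_shift: "nbox (a + j) (b + j) = nbox a b"
 by (simp add: nbox_def)

text \<open>Translates of a staircase move columns by even amounts, so the pair at the origin is the
  smallest unit whose translates cover columns of both parities.\<close>

definition pairmean :: "int => int => real => nat => real" where
 "pairmean a b L s = colmean a b L s 0 + colmean a b L s 1"

lemma pairmean_shift:
 assumes "ok1 a b L" "ok1 (a + j) (b + j) L"
 shows "pairmean (a - 0 + j) (b + j) L s = colmean a b L s (2 * - j) + colmean a b L s (2 * - j + 1)"
 using colmean_shift[OF assms, of s "2 * - j"] colmean_shift[OF assms, of s "2 * - j + 1"]
 by (simp add: pairmean_def)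

text \<open>Near the origin the semicircle is at most \<open>sig\<close>. Far away the Poisson
  weight is small, and the crude bounds \<open>W\<close> for the semicircle and
  \<open>2 * b - 2 * a\<close> for the number of corners suffice.\<close>

lemma initial_smooth_upper:
 assumes ab: "a < b" and e: "0 < eps" and sig: "0 <= sig" and W: "0 <= W"
  and near: "\<And>x. \<bar>x\<bar> <= 2 * int l + 1 ==> 2 * a < x ==> x < 2 * b ==> width2 a b x <= sig\<^sup>2"
  and far: "\<And>x. 2 * a < x ==> x < 2 * b ==> width2 a b x <= W\<^sup>2"
 shows "smooth_rate a b eps (\<lambda>_. 0)
  <= rate_const * sig * odd_mass eps l + rate_const * W * ir (2 * b - 2 * a) * (eps / (2 * real l + 1)\<^sup>2)"
proof -
 let ?Y = "corners a b (\<lambda>_. 0)" and ?I = "{x\<in>{-(2 * int l + 1)..2 * int l + 1}. odd x}"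
 have fin: "finite ?Y" by (rule finite_corners[OF valid_zero ab])
 have fI: "finite ?I" by (rule finite_subset[of _ "{-(2 * int l + 1)..2 * int l + 1}"]) auto
 note C = rate_const_pos
 have "smooth_rate a b eps (\<lambda>_. 0) <= (\<Sum>x\<in>?Y. (if x \<in> ?I then rate_const * sig * poisson eps x else 0)
   + rate_const * W * (eps / (2 * real l + 1)\<^sup>2))"
  unfolding smooth_rate_def
 proof (rule sum_mono)
  fix x assume "x \<in> ?Y"
  then have x: "odd x" "2 * a < x" "x < 2 * b" by (auto simp: corners_zero[OF ab])
  have r: "rate a b (\<lambda>_. 0) x <= rate_const * sqrt (width2 a b x)" by (rule initial_rate_bounds(2)[OF x])
  have P: "0 <= poisson eps x" using poisson_pos[OF e] by (simp add: less_imp_le)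
  have nn: "0 <= rate_const * W * (eps / (2 * real l + 1)\<^sup>2)" using C W e by simp
  show "rate a b (\<lambda>_. 0) x * poisson eps x <= (if x \<in> ?I then rate_const * sig * poisson eps x else 0)
   + rate_const * W * (eps / (2 * real l + 1)\<^sup>2)"
  proof (cases "x \<in> ?I")
   case True
   then have "\<bar>x\<bar> <= 2 * int l + 1" by auto
   then have "sqrt (width2 a b x) <= sig" using near x sig by (intro real_le_lsqrt) auto
   then have "rate a b (\<lambda>_. 0) x <= rate_const * sig" using r C by (meson mult_left_mono less_imp_le order_trans)
   then have "rate a b (\<lambda>_. 0) x * poisson eps x <= rate_const * sig * poisson eps x" using P by (rule mult_right_mono)
   then show ?thesis using True nn by simp
  next
   case False
   then have "2 * int l + 1 <= \<bar>x\<bar>" using x by auto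
   then have "2 * real l + 1 <= \<bar>ir x\<bar>" by linarith
   then have p: "poisson eps x <= eps / (2 * real l + 1)\<^sup>2" using e by (intro poisson_le_far) auto
   have "sqrt (width2 a b x) <= W" using far x W by (intro real_le_lsqrt) auto
   then have "rate a b (\<lambda>_. 0) x <= rate_const * W" using r C by (meson mult_left_mono less_imp_le order_trans)
   then have "rate a b (\<lambda>_. 0) x * poisson eps x <= rate_const * W * (eps / (2 * real l + 1)\<^sup>2)"
    using p P C W by (intro mult_mono) auto
   then show ?thesis unfolding if_not_P[OF False] by simp
  qed
 qed
 also have "\<dots> = (\<Sum>x\<in>?Y \<inter> ?I. rate_const * sig * poisson eps x) + real (card ?Y) * (rate_const * W * (eps / (2 * real l + 1)\<^sup>2))"
  using fin by (simp add: sum.distrib sum.inter_restrict)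
 also have "(\<Sum>x\<in>?Y \<inter> ?I. rate_const * sig * poisson eps x) <= (\<Sum>x\<in>?I. rate_const * sig * poisson eps x)"
  using fI C sig poisson_pos[OF e] by (intro sum_mono2) (auto simp: less_imp_le)
 also have "(\<Sum>x\<in>?I. rate_const * sig * poisson eps x) = rate_const * sig * odd_mass eps l"
  by (simp add: odd_mass_def sum_distrib_left)
 also have "real (card ?Y) * (rate_const * W * (eps / (2 * real l + 1)\<^sup>2))
   <= ir (2 * b - 2 * a) * (rate_const * W * (eps / (2 * real l + 1)\<^sup>2))"
 proof (rule mult_right_mono)
  have "card ?Y <= card {2 * a<..<2 * b}" by (rule card_mono) (use corners_subset[OF valid_zero ab] in auto)
  then show "real (card ?Y) <= ir (2 * b - 2 * a)" using ab by simp
 qed (use C W e in simp)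
 finally show ?thesis by (simp add: mult_ac)
qed

lemma initial_smooth_lower:
 assumes ab: "a < b" and e: "0 < eps" and sig: "0 <= sig" and win: "2 * a < - (2 * int l + 1)" "2 * int l + 1 < 2 * b"
  and near: "\<And>x. \<bar>x\<bar> <= 2 * int l + 1 ==> sig\<^sup>2 <= ir ((2 * b - x) * (x - 2 * a))"
 shows "rate_const * sig * odd_mass eps l <= smooth_rate a b eps (\<lambda>_. 0)"
proof -
 let ?Y = "corners a b (\<lambda>_. 0)" and ?I = "{x\<in>{-(2 * int l + 1)..2 * int l + 1}. odd x}"
 have fin: "finite ?Y" by (rule finite_corners[OF valid_zero ab])
 have sub: "?I \<subseteq> ?Y" using win by (auto simp: corners_zero[OF ab])
 have "rate_const * sig * odd_mass eps l = (\<Sum>x\<in>?I. rate_const * sig * poisson eps x)"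
  by (simp add: odd_mass_def sum_distrib_left)
 also have "\<dots> <= (\<Sum>x\<in>?I. rate a b (\<lambda>_. 0) x * poisson eps x)"
 proof (rule sum_mono)
  fix x assume x: "x \<in> ?I"
  then have "x \<in> ?Y" using sub by auto
  then have x': "odd x" "2 * a < x" "x < 2 * b" by (auto simp: corners_zero[OF ab])
  have "sig <= sqrt (ir ((2 * b - x) * (x - 2 * a)))"
   using near[of x] x by (intro real_le_rsqrt) auto
  then have "rate_const * sig <= rate a b (\<lambda>_. 0) x"
   using initial_rate_bounds(1)[OF x'] rate_const_pos by (meson mult_left_mono less_imp_le order_trans)
  then show "rate_const * sig * poisson eps x <= rate a b (\<lambda>_. 0) x * poisson eps x"
   using poisson_pos[OF e, of x] by (intro mult_right_mono) auto
 qed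
 also have "\<dots> <= (\<Sum>x\<in>?Y. rate a b (\<lambda>_. 0) x * poisson eps x)"
  using fin sub poisson_pos[OF e] by (intro sum_mono2) (auto simp: less_imp_le)
 finally show ?thesis by (simp add: smooth_rate_def)
qed

text \<open>The staircase is contained in all the translates \<open>(a' + j, b' + j)\<close>; averaging over \<open>j\<close>
 with weights close to a Poisson kernel makes the conservation law of \<open>smoothing_estimate\<close> applicable.\<close>

lemma pairmean_upper_raw:
 assumes ok: "ok1 a b L" and ok': "ok1 a' b' L" and L: "1 <= L"
  and ext: "a' = a - int l" "b' = b + int l" and win: "2 * a' <= - 2 * int l" "2 * int l + 1 <= 2 * b'"
  and e: "4 <= eps" "eps <= 2 * real l + 1" and sig: "0 <= sig" and W: "0 <= W"
  and near: "\<And>x. \<bar>x\<bar> <= 2 * int l + 1 ==> 2 * a' < x ==> x < 2 * b' ==> width2 a' b' x <= sig\<^sup>2"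
  and far: "\<And>x. 2 * a' < x ==> x < 2 * b' ==> width2 a' b' x <= W\<^sup>2"
 shows "pairmean a b L s <= real s / L * (rate_const * sig
  + 8 * (rate_const * sig / eps + rate_const * W * ir (2 * b' - 2 * a') * (eps / (2 * real l + 1)\<^sup>2)
      + smoothing_error a' b' eps (real s / L)))"
proof -
 let ?J = "{- int l..int l}" and ?c = "colmean a' b' L s"
 define q where "q = (\<Sum>j\<in>?J. pair_min eps j)"
 define t where "t = real s / L"
 define R where "R = rate_const * W * ir (2 * b' - 2 * a') * (eps / (2 * real l + 1)\<^sup>2)"
 define E where "E = smoothing_error a' b' eps (real s / L)"
 have e0: "0 < eps" using e by simp
 have ab: "a < b" and ab': "a' < b'" and L0: "0 < L" using ok ok' by (auto simp: ok1_iff)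
 have q8: "1 / 8 <= q" unfolding q_def by (rule pair_min_sum_lower[OF e])
 have t0: "0 <= t" using L0 by (simp add: t_def)
 have pm: "pairmean a b L s <= ?c (2 * j) + ?c (2 * j + 1)" if j: "j \<in> ?J" for j
 proof -
  have okj: "ok1 (a' + - j) (b' + - j) L"
   using ok' unfolding ok1_iff nbox_shift by simp
  have "dominated 1 (\<lambda>_. a) (\<lambda>_. b) L (a' + - j) (b' + - j) L"
   by (rule dominated_same_clock) (use j ext L0 in auto)
  then have "pairmean a b L s <= pairmean (a' + - j) (b' + - j) L s"
   unfolding pairmean_def by (intro add_mono colmean_mono[OF _ ok okj])
  also have "\<dots> = ?c (2 * j) + ?c (2 * j + 1)"
   using pairmean_shift[OF ok' okj, of s] by simp
  finally show ?thesis .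
 qed
 have "q * pairmean a b L s = (\<Sum>j\<in>?J. pair_min eps j * pairmean a b L s)"
  by (simp add: q_def sum_distrib_right)
 also have "\<dots> <= (\<Sum>j\<in>?J. poisson eps (2 * j) * ?c (2 * j) + poisson eps (2 * j + 1) * ?c (2 * j + 1))"
 proof (rule sum_mono)
  fix j assume j: "j \<in> ?J"
  have p0: "0 <= pair_min eps j" using poisson_pos[OF e0] by (simp add: pair_min_def less_imp_le)
  have "pair_min eps j * pairmean a b L s <= pair_min eps j * (?c (2 * j) + ?c (2 * j + 1))"
   using pm[OF j] p0 by (rule mult_left_mono)
  also have "\<dots> <= poisson eps (2 * j) * ?c (2 * j) + poisson eps (2 * j + 1) * ?c (2 * j + 1)"
   unfolding distrib_left using colmean_nonneg by (intro add_mono mult_right_mono) (auto simp: pair_min_def)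
  finally show "pair_min eps j * pairmean a b L s <= poisson eps (2 * j) * ?c (2 * j) + poisson eps (2 * j + 1) * ?c (2 * j + 1)" .
 qed
 also have "\<dots> = (\<Sum>x\<in>{- 2 * int l..2 * int l + 1}. poisson eps x * ?c x)"
  by (rule sum_pairs)
 also have "\<dots> <= (\<Sum>x\<in>{2*a'..2*b'}. poisson eps x * ?c x)"
  using win poisson_pos[OF e0] colmean_nonneg by (intro sum_mono2) (auto intro!: mult_nonneg_nonneg simp: less_imp_le)
 also have "\<dots> <= t * (smooth_rate a' b' eps (\<lambda>_. 0) + E)"
  using smoothing_estimate'[OF ok' L e0, of s] by (simp add: t_def E_def algebra_simps abs_le_iff)
 also have "\<dots> <= t * (rate_const * sig * odd_mass eps l + R + E)"
  using initial_smooth_upper[OF ab' e0 sig W near far] t0 by (intro mult_left_mono) (auto simp: R_def)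
 also have "\<dots> <= t * (rate_const * sig * (q + 1 / eps) + R + E)"
  using pair_min_sum[OF e0, of l] rate_const_pos sig t0
  by (intro mult_left_mono add_right_mono) (auto simp: q_def)
 finally have main: "q * pairmean a b L s <= t * (rate_const * sig * (q + 1 / eps) + R + E)" .
 have X0: "0 <= rate_const * sig / eps + R + E"
 proof -
  have "0 <= E" using e0 L0 unfolding E_def smoothing_error_def t_def
   by (intro mult_nonneg_nonneg add_nonneg_nonneg divide_nonneg_nonneg) auto
  moreover have "0 <= R" unfolding R_def using rate_const_pos W ab' e0 by (intro mult_nonneg_nonneg) auto
  ultimately show ?thesis using rate_const_pos sig e0 by simp
 qed
 have "pairmean a b L s <= t * (rate_const * sig * (q + 1 / eps) + R + E) / q"
  using main q8 by (simp add: field_simps)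
 also have "\<dots> = t * (rate_const * sig + (rate_const * sig / eps + R + E) / q)"
  using q8 by (simp add: field_simps)
 also have "\<dots> <= t * (rate_const * sig + 8 * (rate_const * sig / eps + R + E))"
 proof (intro mult_left_mono add_left_mono)
  have "(rate_const * sig / eps + R + E) / q <= (rate_const * sig / eps + R + E) / (1 / 8)"
   using X0 q8 by (intro divide_left_mono) auto
  then show "(rate_const * sig / eps + R + E) / q <= 8 * (rate_const * sig / eps + R + E)"
   by (simp only: eighth)
 qed (rule t0)
 finally show ?thesis by (simp add: t_def R_def E_def)
qed

text \<open>The mirror image of the upper bound: translates of a smaller staircase, with a clock
  \<open>L'\<close> of its own, lie inside the given one, and the weights are
  \<open>pair_max\<close>. Columns outside the range of translates must now be discarded, which the
  tail of the kernel times the total number of removals pays for.\<close>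

lemma pairmean_lower_raw:
 assumes ok: "ok1 a b L" and ok': "ok1 a' b' L'" and L': "1 <= L'"
  and dom: "\<And>j. j \<in> {- int l..int l} ==> dominated 1 (\<lambda>_. a' + j) (\<lambda>_. b' + j) L' a b L"
  and win: "2 * a' < - (2 * int l + 1)" "2 * int l + 1 < 2 * b'"
  and e: "4 <= eps" "eps <= 2 * real l + 1" and sig: "0 <= sig"
  and near: "\<And>x. \<bar>x\<bar> <= 2 * int l + 1 ==> sig\<^sup>2 <= ir ((2 * b' - x) * (x - 2 * a'))"
 shows "real s / L' * (rate_const * sig
  - 8 * (rate_const * sig / eps + real (nbox a' b') * (eps / (2 * real l + 1)\<^sup>2) + smoothing_error a' b' eps (real s / L')))
  <= pairmean a b L s"
proof -
 let ?J = "{- int l..int l}" and ?c = "colmean a' b' L' s"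
 define q where "q = (\<Sum>j\<in>?J. pair_max eps j)"
 define t where "t = real s / L'"
 define R where "R = real (nbox a' b') * (eps / (2 * real l + 1)\<^sup>2)"
 define E where "E = smoothing_error a' b' eps (real s / L')"
 have e0: "0 < eps" using e by simp
 have ab: "a < b" and ab': "a' < b'" and L0: "0 < L'" using ok ok' by (auto simp: ok1_iff)
 have "(\<Sum>j\<in>?J. pair_min eps j) <= q" unfolding q_def by (rule sum_mono) (simp add: pair_min_def pair_max_def)
 then have q8: "1 / 8 <= q" using pair_min_sum_lower[OF e] by linarith
 have t0: "0 <= t" using L0 by (simp add: t_def)
 have pm: "?c (2 * j) + ?c (2 * j + 1) <= pairmean a b L s" if j: "j \<in> ?J" for j
 proof -
  have okj: "ok1 (a' + - j) (b' + - j) L'" using ok' unfolding ok1_iff nbox_shift by simp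
  have "?c (2 * j) + ?c (2 * j + 1) = pairmean (a' + - j) (b' + - j) L' s"
   using pairmean_shift[OF ok' okj, of s] by simp
  also have "\<dots> <= pairmean a b L s"
   unfolding pairmean_def by (intro add_mono colmean_mono[OF dom okj ok]) (use j in auto)
  finally show ?thesis .
 qed
 have far: "poisson eps x <= eps / (2 * real l + 1)\<^sup>2" if "x \<notin> {- 2 * int l..2 * int l + 1}" for x
 proof -
  have "2 * int l + 1 <= \<bar>x\<bar>" using that by auto
  then have "2 * real l + 1 <= \<bar>ir x\<bar>" by linarith
  then show ?thesis using e0 by (intro poisson_le_far) auto
 qed
 have "t * (smooth_rate a' b' eps (\<lambda>_. 0) - E) <= (\<Sum>x\<in>{2*a'..2*b'}. poisson eps x * ?c x)"
  using smoothing_estimate'[OF ok' L' e0, of s] by (simp add: t_def E_def algebra_simps abs_le_iff)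
 also have "\<dots> <= (\<Sum>x\<in>{2*a'..2*b'}. (if x \<in> {- 2 * int l..2 * int l + 1} then poisson eps x * ?c x else 0)
   + eps / (2 * real l + 1)\<^sup>2 * ?c x)"
 proof (rule sum_mono)
  fix x
  have "0 <= eps / (2 * real l + 1)\<^sup>2 * ?c x" using e0 colmean_nonneg by simp
  then show "poisson eps x * ?c x <= (if x \<in> {- 2 * int l..2 * int l + 1} then poisson eps x * ?c x else 0) + eps / (2 * real l + 1)\<^sup>2 * ?c x"
   using mult_right_mono[OF far[of x] colmean_nonneg[of a' b' L' s x]] by auto
 qed
 also have "\<dots> = (\<Sum>x\<in>{2*a'..2*b'} \<inter> {- 2 * int l..2 * int l + 1}. poisson eps x * ?c x)
   + eps / (2 * real l + 1)\<^sup>2 * (\<Sum>x\<in>{2*a'..2*b'}. ?c x)"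
  unfolding sum.distrib sum_distrib_left by (subst sum.inter_restrict) auto
 also have "\<dots> <= (\<Sum>x\<in>{- 2 * int l..2 * int l + 1}. poisson eps x * ?c x) + eps / (2 * real l + 1)\<^sup>2 * (real (nbox a' b') * real s / L')"
  using poisson_pos[OF e0] colmean_nonneg colmean_total[OF ok' L', of s] e0
  by (intro add_mono sum_mono2 mult_left_mono) (auto intro!: mult_nonneg_nonneg simp: less_imp_le)
 also have "(\<Sum>x\<in>{- 2 * int l..2 * int l + 1}. poisson eps x * ?c x)
  = (\<Sum>j\<in>?J. poisson eps (2 * j) * ?c (2 * j) + poisson eps (2 * j + 1) * ?c (2 * j + 1))"
  by (rule sum_pairs[symmetric])
 also have "\<dots> <= (\<Sum>j\<in>?J. pair_max eps j * pairmean a b L s)"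
 proof (rule sum_mono)
  fix j assume j: "j \<in> ?J"
  have p0: "0 <= pair_max eps j" using poisson_pos[OF e0] by (simp add: pair_max_def less_imp_le le_max_iff_disj)
  have "poisson eps (2 * j) * ?c (2 * j) + poisson eps (2 * j + 1) * ?c (2 * j + 1) <= pair_max eps j * (?c (2 * j) + ?c (2 * j + 1))"
   unfolding distrib_left using colmean_nonneg by (intro add_mono mult_right_mono) (auto simp: pair_max_def)
  also have "\<dots> <= pair_max eps j * pairmean a b L s"
   using pm[OF j] p0 by (rule mult_left_mono)
  finally show "poisson eps (2 * j) * ?c (2 * j) + poisson eps (2 * j + 1) * ?c (2 * j + 1) <= pair_max eps j * pairmean a b L s" .
 qed
 also have "\<dots> = q * pairmean a b L s" by (simp add: q_def sum_distrib_right)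
 finally have 1: "t * (smooth_rate a' b' eps (\<lambda>_. 0) - E) <= q * pairmean a b L s + t * R"
  by (simp add: t_def R_def mult_ac)
 have "rate_const * sig * (q - 1 / eps) <= rate_const * sig * odd_mass eps l"
  using pair_max_sum[OF e0, of l] rate_const_pos sig by (intro mult_left_mono) (auto simp: q_def)
 also have "\<dots> <= smooth_rate a' b' eps (\<lambda>_. 0)" by (rule initial_smooth_lower[OF ab' e0 sig win near])
 finally have "t * (rate_const * sig * (q - 1 / eps) - E) <= t * (smooth_rate a' b' eps (\<lambda>_. 0) - E)"
  using t0 by (intro mult_left_mono) auto
 with 1 have main: "t * (rate_const * sig * (q - 1 / eps) - R - E) <= q * pairmean a b L s"
  by (simp add: algebra_simps)
 have X0: "0 <= rate_const * sig / eps + R + E"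
 proof -
  have "0 <= E" using e0 L0 unfolding E_def smoothing_error_def t_def
   by (intro mult_nonneg_nonneg add_nonneg_nonneg divide_nonneg_nonneg) auto
  moreover have "0 <= R" unfolding R_def using e0 by (intro mult_nonneg_nonneg) auto
  ultimately show ?thesis using rate_const_pos sig e0 by simp
 qed
 have "t * (rate_const * sig - 8 * (rate_const * sig / eps + R + E)) <= t * (rate_const * sig - (rate_const * sig / eps + R + E) / q)"
 proof (intro mult_left_mono diff_left_mono)
  have "(rate_const * sig / eps + R + E) / q <= (rate_const * sig / eps + R + E) / (1 / 8)"
   using X0 q8 by (intro divide_left_mono) auto
  then show "(rate_const * sig / eps + R + E) / q <= 8 * (rate_const * sig / eps + R + E)"
   by (simp only: eighth)
 qed (rule t0)
 also have "\<dots> = t * (rate_const * sig * (q - 1 / eps) - R - E) / q"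
  using q8 by (simp add: field_simps)
 also have "\<dots> <= pairmean a b L s" using main q8 by (simp add: field_simps)
 finally show ?thesis by (simp add: t_def R_def E_def)
qed

section \<open>Explicit bounds for pair means\<close>

abbreviation side :: "int => int => real" where
 "side a b \<equiv> ir (b - a + 1)"

text \<open>With \<open>eps\<close> a fixed fraction of \<open>n\<close> and \<open>y\<close> of
  order \<open>1 / n\<close> the bound does not grow with \<open>n\<close>, whereas the main term to
  which it is compared is of order \<open>n\<close>.\<close>

lemma smoothing_error_le:
 assumes K: "1 <= K" and n: "0 < n" and N: "real (nbox a b) <= 2 * n\<^sup>2" and c: "\<bar>ir (a + b)\<bar> <= n"
  and y: "0 <= y" "y * n <= Y"
 shows "smoothing_error a b (n / K ^ 3) y <= 4 * (1 + K ^ 3) * K ^ 6 * exp (2 * K ^ 6) * Y"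
proof -
 define eps where "eps = n / K ^ 3"
 define N where "N = real (nbox a b)"
 have K0: "0 < K" using K by simp
 have e0: "0 < eps" using n K0 by (simp add: eps_def)
 have en: "eps <= n" using n K by (simp add: eps_def divide_le_eq one_le_power)
 have e2: "eps\<^sup>2 = n\<^sup>2 / K ^ 6" by (simp add: eps_def power_divide flip: power_mult)
 have n1: "N / eps <= 2 * n * K ^ 3"
 proof -
  have "N / eps <= 2 * n\<^sup>2 / eps" using N e0 by (intro divide_right_mono) (auto simp: N_def)
  also have "\<dots> = 2 * n * K ^ 3" using n K0 by (simp add: eps_def power2_eq_square)
  finally show ?thesis .
 qed
 have n2: "N / eps\<^sup>2 <= 2 * K ^ 6"
 proof -
  have "N / eps\<^sup>2 <= 2 * n\<^sup>2 / eps\<^sup>2" using N by (intro divide_right_mono) (auto simp: N_def)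
  also have "\<dots> = 2 * K ^ 6" using n K0 unfolding e2 by simp
  finally show ?thesis .
 qed
 have "N * y / eps\<^sup>2 = N / eps\<^sup>2 * y" by simp
 also have "\<dots> <= 2 * K ^ 6 * (Y / n)" using n2 y n K0 by (intro mult_mono) (auto simp: pos_le_divide_eq)
 finally have n3: "N * y / eps\<^sup>2 <= 2 * K ^ 6 * (Y / n)" .
 have Y: "0 <= Y" using y n by (meson mult_nonneg_nonneg less_imp_le order_trans)
 have h1: "eps + \<bar>ir (a + b)\<bar> + N / eps <= 2 * n * (1 + K ^ 3)"
  using n1 en c by (simp add: algebra_simps)
 have h2: "N * y / eps\<^sup>2 * exp (N / eps\<^sup>2) <= 2 * K ^ 6 * (Y / n) * exp (2 * K ^ 6)"
  using n3 n2 y n K0 Y by (intro mult_mono) (auto simp: N_def)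
 have "smoothing_error a b eps y <= 2 * n * (1 + K ^ 3) * (2 * K ^ 6 * (Y / n) * exp (2 * K ^ 6))"
  unfolding smoothing_error_def N_def[symmetric]
  by (rule mult_mono[OF h1 h2]) (use e0 y n K0 Y in \<open>auto simp: N_def\<close>)
 also have "\<dots> = 4 * (1 + K ^ 3) * K ^ 6 * exp (2 * K ^ 6) * Y" using n by simp
 finally show ?thesis by (simp add: eps_def)
qed

text \<open>The origin of the scales. Translates by up to \<open>n / K\<close> change the semicircle
  by a fraction that vanishes with \<open>K\<close>. The kernel must be narrower: with width
  \<open>n / K ^ 3\<close> its value at distance \<open>n / K\<close> is about
  \<open>1 / (K * n)\<close>, and \<open>n\<close> columns with rates of order \<open>n\<close> then
  contribute only order \<open>n / K\<close>.\<close>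

lemma window_bounds:
 fixes n :: real and K :: nat
 assumes K: "6 <= K" and n: "4 * real K ^ 3 <= n"
 defines "l \<equiv> nat \<lfloor>n / real K\<rfloor>" and "eps \<equiv> n / real K ^ 3"
 shows "real l <= n / real K" "n / real K <= 2 * real l + 1" "4 <= eps" "eps <= 2 * real l + 1"
  "eps / (2 * real l + 1)\<^sup>2 <= 1 / (real K * n)" "2 * real l + 1 <= 3 * n / real K" "1 <= l"
proof -
 have K0: "0 < real K" "6 <= real K" using K by auto
 have Kp: "real K <= real K ^ 3" using K0 by (intro self_le_power) auto
 have n0: "0 < n" "real K <= n" using n Kp K0 by linarith+
 have l: "real l = ir \<lfloor>n / real K\<rfloor>" using n0 K0 by (simp add: l_def)
 show l1: "real l <= n / real K" unfolding l by linarith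
 have l2: "n / real K - 1 < real l" unfolding l by linarith
 have nk: "1 <= n / real K" using n0 K0 by simp
 show "1 <= l" using nk by (simp add: l_def le_nat_floor)
 then have "1 <= real l" by simp
 then show l3: "n / real K <= 2 * real l + 1" using l2 by linarith
 show "2 * real l + 1 <= 3 * n / real K" using l1 nk by simp
 show "4 <= eps" using n K0 by (simp add: eps_def pos_le_divide_eq)
 have "eps <= n / real K" unfolding eps_def using n0 K0 Kp by (intro divide_left_mono mult_pos_pos) auto
 then show "eps <= 2 * real l + 1" using l3 by simp
 have "eps / (2 * real l + 1)\<^sup>2 <= eps / (n / real K)\<^sup>2"
  using l3 n0 K0 by (intro divide_left_mono power_mono mult_pos_pos) (auto simp: eps_def)
 also have "\<dots> = 1 / (real K * n)"
  using n0 K0 by (simp add: eps_def power2_eq_square power3_eq_cube)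
 finally show "eps / (2 * real l + 1)\<^sup>2 <= 1 / (real K * n)" .
qed

lemma width2_le_square: "width2 a b x <= (side a b)\<^sup>2"
proof -
 have "0 <= (ir (2 * b + 1 - x) - ir (x + 1 - 2 * a))\<^sup>2" by simp
 then have "4 * width2 a b x <= (ir (2 * b + 1 - x) + ir (x + 1 - 2 * a))\<^sup>2"
  by (simp add: width2_def power2_eq_square algebra_simps)
 also have "\<dots> = (2 * side a b)\<^sup>2" by (simp add: algebra_simps)
 also have "\<dots> = 4 * (side a b)\<^sup>2" by (simp only: power_mult_distrib) simp
 finally show ?thesis by simp
qed

text \<open>A bulk condition: \<open>eta\<close> is the fraction of the side by which column 0 stays
  away from both ends.\<close>

definition ample :: "real => real => int => int => bool" where
 "ample n0 eta a b \<longleftrightarrow> n0 <= side a b \<and> eta * side a b <= ir (2 * b + 1) \<and> eta * side a b <= ir (1 - 2 * a)"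

text \<open>\<open>K\<close> is fixed first, in terms of \<open>dl\<close>, to make the geometric
  and tail errors small; then the side is taken large enough to suppress the terms divided by
  \<open>n\<close>. The factor 2 in the hypothesis on \<open>L\<close> leaves room for the enlarged
  staircase that contains the translates.\<close>

lemma pairmean_upper:
 assumes eta: "0 < eta" and dl: "0 < dl" and Y: "0 <= Y"
 shows "\<exists>n0. \<forall>a b L s. ample n0 eta a b --> 2 * real (nbox a b) <= L -->
  real s / L * side a b <= Y -->
  pairmean a b L s <= rate_const * (real s / L * sqrt (width2 a b 0)) + dl"
proof -
 define C where "C = rate_const"
 have C: "0 < C" using rate_const_pos by (simp add: C_def)
 \<comment> \<open>140 is twice 70, the sum of the constants 6 from \<open>T1\<close> and 64 from
   \<open>T3\<close>. These errors may use half of \<open>dl\<close>, the terms collected in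
   \<open>D\<close> the other half.\<close>
 obtain K1 :: nat where K1: "(140 * C * Y / dl)\<^sup>2 <= real K1" using real_arch_simple by blast
 define K where "K = max 6 K1"
 have K6: "6 <= K" and K1': "(140 * C * Y / dl)\<^sup>2 <= real K" using K1 by (auto simp: K_def)
 have K0: "0 < real K" "1 <= real K" using K6 by auto
 have sK: "1 <= sqrt (real K)" using K0 by simp
 have Ksmall: "70 * C * Y / sqrt (real K) <= dl / 2"
 proof -
  have "140 * C * Y / dl <= sqrt (real K)" by (rule real_le_rsqrt[OF K1'])
  then show ?thesis using dl sK by (simp add: field_simps)
 qed
 define M where "M = 4 * (1 + real K ^ 3) * real K ^ 6 * exp (2 * real K ^ 6) * Y"
 define D where "D = 56 * C * Y * real K ^ 3 + 8 * Y * M"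
 define n0 where "n0 = max (4 * real K ^ 3) (max (3 / eta) (2 * D / dl))"
 show ?thesis
 proof (intro exI allI impI)
  fix a b :: int and L :: real and s :: nat
  define n where "n = side a b"
  assume amp: "ample n0 eta a b" and L2: "2 * real (nbox a b) <= L" and sY: "real s / L * side a b <= Y"
  then have A1: "eta * n <= ir (2 * b + 1)" and A2: "eta * n <= ir (1 - 2 * a)"
   and nK: "4 * real K ^ 3 <= n" and neta: "3 / eta <= n" and nD: "2 * D / dl <= n"
   by (auto simp: ample_def n0_def n_def)
  have K3: "1 <= real K ^ 3" using K0 by (simp add: one_le_power)
  have n4: "4 <= n" using nK K3 by linarith
  have n3: "3 <= eta * n" using neta eta by (simp add: field_simps)
  have b1: "1 <= b" and a0: "a <= 0" using A1 A2 n3 unfolding n_def by linarith+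
  have ab: "a < b" using b1 a0 by simp
  have nb: "real (nbox a b) = n * (n - 1) / 2" unfolding real_nbox[OF less_imp_le[OF ab]] n_def by simp
  have "12 <= n * (n - 1)" using mult_mono[of 4 n 3 "n - 1"] n4 by simp
  then have L1: "1 <= L" "0 < L" using L2 nb by auto
  define l where "l = nat \<lfloor>n / real K\<rfloor>"
  define eps where "eps = n / real K ^ 3"
  note w = window_bounds[OF K6 nK, folded l_def eps_def]
  define t where "t = real s / L"
  define sig where "sig = sqrt (width2 a b 0)"
  have t0: "0 <= t" using L1 by (simp add: t_def)
  have tn: "t * n <= Y" using sY by (simp add: t_def n_def)
  have w0: "0 <= width2 a b 0" using width2_pos[of a 0 b] a0 b1 by (cases "a = 0") (auto simp: width2_def)
  have sig: "0 <= sig" "sig <= n" "sig\<^sup>2 = width2 a b 0"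
   using w0 width2_le_square[of a b 0] n4 by (auto simp: sig_def n_def intro: real_le_lsqrt)
  define a' where "a' = a - int l"
  define b' where "b' = b + int l"
  have n': "ir (b' - a' + 1) = n + 2 * real l" by (simp add: a'_def b'_def n_def)
  have lK6: "real l <= n / 6"
  proof -
   have "n / real K <= n / 6" using K6 n4 by (intro divide_left_mono) auto
   then show ?thesis using w(1) by linarith
  qed
  have ab': "a' < b'" using ab by (simp add: a'_def b'_def)
  have nb': "real (nbox a' b') <= 2 * real (nbox a b)"
  proof -
   have "real (nbox a' b') = (n + 2 * real l) * (n + 2 * real l - 1) / 2"
    unfolding real_nbox[OF less_imp_le[OF ab']] of_int_mult n'[symmetric] by simp
   also have "\<dots> <= (4 / 3 * n) * (4 / 3 * n - 1) / 2"
    using lK6 n4 by (intro divide_right_mono mult_mono) auto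
   also have "\<dots> <= n * (n - 1)"
    using mult_right_mono[of 4 n "n"] n4 by (simp add: field_simps)
   finally show ?thesis using nb by simp
  qed
  have ok: "ok1 a b L" using ab L1 L2 by (simp add: ok1_iff)
  have ok': "ok1 a' b' L" using ab' L1 L2 nb' by (simp add: ok1_iff)
  \<comment> \<open>Over the window \<open>width2\<close> exceeds its central value by at most
    \<open>36 * n ^ 2 / K\<close>; under the square root this costs
    \<open>6 * n / sqrt K\<close>.\<close>
  define sig1 where "sig1 = sig + 6 * n / sqrt (real K)"
  have sig1: "0 <= sig1" "sig1 <= 7 * n"
  proof -
   show "0 <= sig1" using sig n4 K0 by (simp add: sig1_def)
   have "6 * n / sqrt (real K) <= 6 * n / 1" using sK n4 by (intro divide_left_mono) auto
   then show "sig1 <= 7 * n" using sig by (simp add: sig1_def)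
  qed
  have near: "width2 a' b' x <= sig1\<^sup>2" if x: "\<bar>x\<bar> <= 2 * int l + 1" "2 * a' < x" "x < 2 * b'" for x
  proof -
   define e where "e = 5 * n / real K"
   have e: "0 <= e" "4 * real l + 1 <= e" using w(1,6,7) n4 K0 by (auto simp: e_def)
   have "\<bar>ir x\<bar> <= 2 * real l + 1" using x(1) by linarith
   then have "ir (2 * b' + 1 - x) <= ir (2 * b + 1) + e"
    "ir (x + 1 - 2 * a') <= ir (1 - 2 * a) + e"
    using e by (auto simp: a'_def b'_def)
   then have "width2 a' b' x <= (ir (2 * b + 1) + e) * (ir (1 - 2 * a) + e)"
    unfolding width2_def using x b1 e by (intro mult_mono) auto
   also have "\<dots> = sig\<^sup>2 + (e * (2 * n) + e\<^sup>2)"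
    unfolding sig(3) by (simp add: width2_def n_def power2_eq_square algebra_simps)
   also have "e * (2 * n) + e\<^sup>2 <= 36 * n\<^sup>2 / real K"
   proof -
    have "e\<^sup>2 = 25 * n\<^sup>2 / real K / real K" by (simp add: e_def power2_eq_square)
    also have "\<dots> <= 25 * n\<^sup>2 / real K / 1" using K0 by (intro divide_left_mono) auto
    finally have "e\<^sup>2 <= 25 * (n\<^sup>2 / real K)" by simp
    moreover have "e * (2 * n) = 10 * (n\<^sup>2 / real K)" by (simp add: e_def power2_eq_square)
    moreover have "0 <= n\<^sup>2 / real K" by simp
    ultimately have "e * (2 * n) + e\<^sup>2 <= 36 * (n\<^sup>2 / real K)" by linarith
    then show ?thesis by simp
   qed
   also have "sig\<^sup>2 + 36 * n\<^sup>2 / real K <= sig1\<^sup>2"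
   proof -
    have "sig1\<^sup>2 = sig\<^sup>2 + 2 * sig * (6 * n / sqrt (real K)) + 36 * n\<^sup>2 / real K"
     using K0 by (simp add: sig1_def power2_sum power_divide power_mult_distrib)
    moreover have "0 <= 2 * sig * (6 * n / sqrt (real K))" using sig n4 K0 by simp
    ultimately show ?thesis by linarith
   qed
   finally show ?thesis by simp
  qed
  have far: "width2 a' b' x <= (2 * n)\<^sup>2" for x
  proof -
   have "width2 a' b' x <= (n + 2 * real l)\<^sup>2" using width2_le_square[of a' b' x] n' by simp
   also have "\<dots> <= (2 * n)\<^sup>2" using lK6 n4 by (intro power_mono) auto
   finally show ?thesis .
  qed
  define R where "R = rate_const * (2 * n) * ir (2 * b' - 2 * a') * (eps / (2 * real l + 1)\<^sup>2)"
  define E where "E = smoothing_error a' b' eps t"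
  have raw: "pairmean a b L s <= t * (C * sig1 + 8 * (C * sig1 / eps + R + E))"
   unfolding t_def C_def R_def E_def
   by (rule pairmean_upper_raw[OF ok ok' L1(1) a'_def b'_def _ _ w(3,4) sig1(1) _ near far])
    (use a0 b1 n4 in \<open>auto simp: a'_def b'_def\<close>)
  have T1: "t * (C * sig1) <= C * (t * sig) + 6 * C * Y / sqrt (real K)"
  proof -
   have "t * (C * sig1) = C * (t * sig) + 6 * C * (t * n) / sqrt (real K)" by (simp add: sig1_def algebra_simps)
   also have "6 * C * (t * n) / sqrt (real K) <= 6 * C * Y / sqrt (real K)"
    using tn C K0 by (intro divide_right_mono mult_left_mono) auto
   finally show ?thesis by simp
  qed
  have T2: "t * (8 * (C * sig1 / eps)) <= 56 * C * Y * real K ^ 3 / n"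
  proof -
   have "t * (8 * (C * sig1 / eps)) <= t * (8 * (C * (7 * n) / eps))"
    using t0 C sig1 w(3) by (intro mult_left_mono divide_right_mono) auto
   also have "\<dots> = 56 * C * (t * n) * real K ^ 3 / n" using n4 K0 by (simp add: eps_def)
   also have "\<dots> <= 56 * C * Y * real K ^ 3 / n"
    using tn C K0 n4 by (intro divide_right_mono mult_right_mono mult_left_mono) auto
   finally show ?thesis .
  qed
  have T3: "t * (8 * R) <= 64 * C * Y / sqrt (real K)"
  proof -
   have d: "ir (2 * b' - 2 * a') <= 4 * n" using n' lK6 n4 by simp
   have "R <= C * (2 * n) * (4 * n) * (1 / (real K * n))"
    unfolding R_def C_def[symmetric] using w(5,3) d C n4 ab' by (intro mult_mono) auto
   also have "\<dots> = 8 * C * n / real K" using n4 by (simp add: field_simps)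
   finally have "t * (8 * R) <= t * (8 * (8 * C * n / real K))" using t0 by (intro mult_left_mono) auto
   also have "\<dots> = 64 * C * (t * n) / real K" by simp
   also have "\<dots> <= 64 * C * Y / real K" using tn C K0 by (intro divide_right_mono mult_left_mono) auto
   also have "\<dots> <= 64 * C * Y / sqrt (real K)"
   proof (intro divide_left_mono mult_pos_pos)
    show "sqrt (real K) <= real K" using K0 by (intro real_le_lsqrt) (auto simp: self_le_power)
   qed (use C Y K0 in auto)
   finally show ?thesis .
  qed
  have T4: "t * (8 * E) <= 8 * Y * M / n"
  proof -
   have "real (nbox a' b') <= 2 * n\<^sup>2"
    using nb' nb n4 by (simp add: power2_eq_square algebra_simps)
   moreover have "\<bar>ir (a' + b')\<bar> <= n"
    using a0 b1 by (auto simp: a'_def b'_def n_def)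
   ultimately have "E <= M"
    unfolding E_def M_def eps_def by (intro smoothing_error_le) (use K0 n4 t0 tn in auto)
   then have "t * (8 * E) <= t * (8 * M)" using t0 by (intro mult_left_mono) auto
   also have "\<dots> = 8 * (t * n) * M / n" using n4 by simp
   also have "\<dots> <= 8 * Y * M / n"
    using tn n4 Y K0 by (intro divide_right_mono mult_right_mono mult_left_mono) (auto simp: M_def)
   finally show ?thesis .
  qed
  have "D / n <= dl / 2" using nD dl n4 by (simp add: field_simps)
  then have "56 * C * Y * real K ^ 3 / n + 8 * Y * M / n <= dl / 2" by (simp add: D_def add_divide_distrib)
  moreover have "t * (C * sig1 + 8 * (C * sig1 / eps + R + E)) = t * (C * sig1) + t * (8 * (C * sig1 / eps)) + t * (8 * R) + t * (8 * E)"
   by (simp add: algebra_simps)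
  moreover have "6 * C * Y / sqrt (real K) + 64 * C * Y / sqrt (real K) = 70 * C * Y / sqrt (real K)"
   by (simp flip: add_divide_distrib)
  ultimately have "pairmean a b L s <= C * (t * sig) + dl" using raw T1 T2 T3 T4 Ksmall by linarith
  then show "pairmean a b L s <= rate_const * (real s / L * sqrt (width2 a b 0)) + dl"
   by (simp add: C_def t_def sig_def)
 qed
qed

text \<open>The comparison staircase of half-width \<open>h'\<close> is fixed, with its own errors
  within two thirds of \<open>dl\<close>, before \<open>h\<close> grows. Around it the large
  staircase is flat up to a relative error \<open>G / n\<close>, which the clock \<open>L'\<close>
  absorbs and the last third of \<open>dl\<close> pays for.\<close>

lemma pairmean_lower:
 assumes dl: "0 < dl" and Y: "0 <= Y" and B: "0 <= B"
 shows "\<exists>h0. \<forall>h M L s. h0 <= h --> \<bar>M\<bar> <= B --> real (nbox (M - h) (M + h)) <= L -->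
  real s / L * ir (2 * h + 1) <= Y -->
  rate_const * (real s / L * ir (2 * h + 1)) - dl <= pairmean (M - h) (M + h) L s"
proof -
 define C where "C = rate_const"
 have C: "0 < C" using rate_const_pos by (simp add: C_def)
 obtain K1 :: nat where K1: "3 * (2 * C * Y + 4 * Y) / dl <= real K1" using real_arch_simple by blast
 define K where "K = max 6 K1"
 have K6: "6 <= K" and "3 * (2 * C * Y + 4 * Y) / dl <= real K" using K1 by (auto simp: K_def)
 then have K0: "0 < real K" "1 <= real K" and Ksmall: "(2 * C * Y + 4 * Y) / real K <= dl / 3"
  using dl by (auto simp: field_simps)
 have K3: "1 <= real K ^ 3" using K0 by (simp add: one_le_power)
 define M0 where "M0 = 4 * (1 + real K ^ 3) * real K ^ 6 * exp (2 * real K ^ 6) * Y"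
 define D where "D = 2 * C * Y + 8 * C * Y * real K ^ 3 + 8 * Y * M0"
 obtain H1 :: nat where H1: "max (4 * real K ^ 3) (3 * D / dl) <= real H1" using real_arch_simple by blast
 define h' where "h' = int H1"
 define n' where "n' = ir (2 * h' + 1)"
 have nK: "4 * real K ^ 3 <= n'" and nD: "3 * D / dl <= n'" using H1 by (auto simp: n'_def h'_def)
 have n4: "4 <= n'" using nK K3 by linarith
 have Dsmall: "D / n' <= dl / 3" using nD dl n4 by (simp add: field_simps)
 define l where "l = nat \<lfloor>n' / real K\<rfloor>"
 define eps where "eps = n' / real K ^ 3"
 note w = window_bounds[OF K6 nK, folded l_def eps_def]
 have lK6: "real l <= n' / 6"
 proof -
  have "n' / real K <= n' / 6" using K6 n4 by (intro divide_left_mono) auto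
  then show ?thesis using w(1) by linarith
 qed
 \<comment> \<open>A margin covering the shift by \<open>M\<close>, of size at most
   \<open>B\<close>, and the extent of all translates of the small staircase.\<close>
 define G where "G = 2 * ir B + 3 * n'"
 have G: "0 < G" using B n4 by (simp add: G_def)
 obtain h0 :: nat where h0: "G + 3 * C * Y * G / dl < real h0" using reals_Archimedean2 by blast
 have ab': "- h' < h'" using n4 by (simp add: n'_def)
 have nb': "real (nbox (- h') h') = n' * (n' - 1) / 2"
  unfolding real_nbox[OF less_imp_le[OF ab']] by (simp add: n'_def)
 show ?thesis
 proof (intro exI allI impI)
  fix h M :: int and L :: real and s :: nat
  define n where "n = ir (2 * h + 1)"
  define a where "a = M - h"
  define b where "b = M + h"
  assume hh: "int h0 <= h" and MB: "\<bar>M\<bar> <= B" and "real (nbox (M - h) (M + h)) <= L"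
   and "real s / L * ir (2 * h + 1) <= Y"
  then have NL: "real (nbox a b) <= L" and sY: "real s / L * n <= Y" by (simp_all add: a_def b_def n_def)
  have hr: "real h0 <= ir h" using hh by linarith
  have CYG: "0 <= 3 * C * Y * G / dl" using C Y G dl by simp
  have nG: "G < n" using hr h0 CYG by (simp add: n_def)
  have nG': "3 * C * Y * G / dl < n" using hr h0 G by (simp add: n_def)
  have n0: "0 < n" using nG G by simp
  define g where "g = n - G"
  have g: "0 < g" "g <= n" using nG G by (simp_all add: g_def)
  have Gh: "G < ir h" using hr h0 CYG by simp
  have n'_h': "n' = 2 * ir h' + 1" by (simp add: n'_def)
  have ab: "a < b" using Gh G by (simp add: a_def b_def)
  have nb: "real (nbox a b) = n * (n - 1) / 2"
   unfolding real_nbox[OF less_imp_le[OF ab]] by (simp add: n_def a_def b_def)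
  have n12: "12 < n" using nG n4 B by (simp add: G_def)
  have "1 * 1 <= n * ((n - 1) / 2)" using n12 by (intro mult_mono) auto
  then have L1: "1 <= L" "0 < L" using NL nb by auto
  \<comment> \<open>Chosen so that \<open>L / L' = g / n'\<close>, a lower bound for the ratio of
    the semicircles on the small staircase.\<close>
  define L' where "L' = L * n' / g"
  have L'0: "0 < L'" using L1 g n4 by (simp add: L'_def)
  have LL: "L / L' = g / n'" using L1 g n4 by (simp add: L'_def)
  have ok: "ok1 a b L" using ab NL L1 by (simp add: ok1_iff)
  have N'L': "real (nbox (- h') h') <= L'"
  proof -
   have "n' * (n' - 1) / 2 <= n' * (n - 1) / 2" using nG n4 B by (simp add: G_def)
   also have "\<dots> = (n * (n - 1) / 2) * n' / n" using n0 by simp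
   also have "\<dots> <= L * n' / n" using NL nb n4 n0 by (intro divide_right_mono mult_right_mono) auto
   also have "\<dots> <= L * n' / g" using g n0 L1 n4 by (intro divide_left_mono mult_pos_pos) auto
   finally show ?thesis unfolding nb' L'_def .
  qed
  have ok': "ok1 (- h') h' L'" using ab' N'L' L'0 by (simp add: ok1_iff)
  have "1 * 1 <= n' * ((n' - 1) / 2)" using n4 by (intro mult_mono) auto
  then have L'1: "1 <= L'" using N'L' nb' by simp
  have dom: "dominated 1 (\<lambda>_. - h' + j) (\<lambda>_. h' + j) L' a b L" if j: "j \<in> {- int l..int l}" for j
   unfolding dominated1_iff
  proof (intro conjI ballI)
   have jr: "\<bar>ir j\<bar> <= n' / 6" using j lK6 by auto
   have MBr: "\<bar>ir M\<bar> <= ir B" using MB by linarith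
   have "ir a <= ir (- h' + j)" "ir (h' + j) <= ir b"
    using jr MBr Gh B n4 by (auto simp: a_def b_def G_def n'_h')
   then show "a <= - h' + j" "h' + j <= b" by linarith+
   fix x assume x: "x \<in> {2 * (- h' + j)<..<2 * (h' + j)}"
   have x': "ir x <= 2 * ir h' + 2 * ir j" "- 2 * ir h' + 2 * ir j <= ir x"
    using x by auto
   have gx: "g <= ir (2 * b + 1 - x)" "g <= ir (x + 1 - 2 * a)"
    using x' jr MBr unfolding g_def G_def a_def b_def n_def n'_h' by simp_all
   have wD: "g\<^sup>2 <= width2 a b x" unfolding width2_def power2_eq_square using gx g by (intro mult_mono) auto
   have wT: "0 < width2 (- h' + j) (h' + j) x" using x by (intro width2_pos) auto
   have wT': "width2 (- h' + j) (h' + j) x <= n'\<^sup>2"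
    using width2_le_square[of "- h' + j" "h' + j" x] by (simp add: n'_def)
   have "(g / n')\<^sup>2 <= width2 a b x / width2 (- h' + j) (h' + j) x"
    unfolding power_divide using wD wT wT' order_trans[OF zero_le_power2 wD] by (intro frac_le) auto
   then show "L / L' <= sqrt (width2 a b x / width2 (- h' + j) (h' + j) x)"
    unfolding LL by (rule real_le_rsqrt)
  qed
  define sig where "sig = 2 * ir h' - 2 * real l - 1"
  have sig: "0 <= sig" "sig <= n'" "n' - 2 - 2 * n' / real K <= sig"
  proof -
   have s: "sig = n' - 2 - 2 * real l" by (simp add: sig_def n'_h')
   show "0 <= sig" "sig <= n'" using lK6 n4 unfolding s by linarith+
   have "2 * n' / real K = 2 * (n' / real K)" by simp
   then show "n' - 2 - 2 * n' / real K <= sig" using w(1) unfolding s by linarith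
  qed
  have near: "sig\<^sup>2 <= ir ((2 * h' - x) * (x - 2 * (- h')))" if "\<bar>x\<bar> <= 2 * int l + 1" for x
  proof -
   have "\<bar>ir x\<bar> <= 2 * real l + 1" using that by linarith
   then have "sig * sig <= ir (2 * h' - x) * ir (x - 2 * (- h'))"
    using sig by (intro mult_mono) (auto simp: sig_def)
   then show ?thesis by (simp add: power2_eq_square)
  qed
  have hl: "2 * real l + 1 < 2 * ir h'" using lK6 n4 by (simp add: n'_h')
  have hl': "2 * int l + 1 < 2 * h'" using hl by linarith
  define t where "t = real s / L'"
  define y where "y = real s / L * n"
  have y: "0 <= y" "y <= Y" using sY L1 n0 by (simp_all add: y_def)
  define zet where "zet = G / n"
  have zet: "0 <= zet" "zet <= 1" using G nG n0 by (simp_all add: zet_def)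
  have t0: "0 <= t" using L'0 by (simp add: t_def)
  have ty: "t * n' = y * (1 - zet)"
   using n0 n4 L1 g by (simp add: t_def y_def zet_def L'_def g_def field_simps)
  have tY: "t * n' <= Y" using y zet unfolding ty by (meson mult_left_le order_trans diff_le_eq le_add_same_cancel1)
  define R where "R = real (nbox (- h') h') * (eps / (2 * real l + 1)\<^sup>2)"
  define E where "E = smoothing_error (- h') h' eps t"
  have raw: "t * (C * sig - 8 * (C * sig / eps + R + E)) <= pairmean a b L s"
   unfolding t_def C_def R_def E_def
   by (rule pairmean_lower_raw[OF ok ok' L'1 dom _ _ w(3,4) sig(1) near]) (use hl' in auto)
  have T1: "C * y - C * Y * zet - 2 * C * Y / real K - 2 * C * Y / n' <= t * (C * sig)"
  proof -
   have "t * (C * (n' - 2 - 2 * n' / real K)) <= t * (C * sig)"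
    using sig t0 C by (intro mult_left_mono) auto
   moreover have "t * (C * (n' - 2 - 2 * n' / real K)) = C * (t * n') - 2 * C * (t * n') / n' - 2 * C * (t * n') / real K"
    using n4 by (simp add: algebra_simps)
   moreover have "2 * C * (t * n') / n' <= 2 * C * Y / n'" using tY C n4 by (intro divide_right_mono mult_left_mono) auto
   moreover have "2 * C * (t * n') / real K <= 2 * C * Y / real K" using tY C K0 by (intro divide_right_mono mult_left_mono) auto
   moreover have "C * y - C * Y * zet <= C * (t * n')"
   proof -
    have "y * zet <= Y * zet" using y zet by (intro mult_right_mono)
    then have "C * (y * zet) <= C * (Y * zet)" using C by (intro mult_left_mono) auto
    then show ?thesis unfolding ty by (simp add: algebra_simps)
   qed
   moreover have "d - c' - b' <= q"
    if "p <= q" "p = a - b - c" "b <= b'" "c <= c'" "d <= a" for p q a b c d b' c' :: real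
    using that by linarith
   ultimately show ?thesis by blast
  qed
  have T2: "t * (8 * (C * sig / eps)) <= 8 * C * Y * real K ^ 3 / n'"
  proof -
   have "t * (8 * (C * sig / eps)) <= t * (8 * (C * n' / eps))"
    using t0 C sig w(3) by (intro mult_left_mono divide_right_mono) auto
   also have "\<dots> = 8 * C * (t * n') * real K ^ 3 / n'" using n4 K0 by (simp add: eps_def)
   also have "\<dots> <= 8 * C * Y * real K ^ 3 / n'"
    using tY C K0 n4 by (intro divide_right_mono mult_right_mono mult_left_mono) auto
   finally show ?thesis .
  qed
  have T3: "t * (8 * R) <= 4 * Y / real K"
  proof -
   have "R <= n' * n' / 2 * (1 / (real K * n'))"
    unfolding R_def nb' using w(5,3) n4 by (intro mult_mono divide_right_mono) auto
   also have "\<dots> = n' / (2 * real K)" using n4 by simp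
   finally have "t * (8 * R) <= t * (8 * (n' / (2 * real K)))" using t0 by (intro mult_left_mono) auto
   also have "\<dots> = 4 * (t * n') / real K" by simp
   also have "\<dots> <= 4 * Y / real K" using tY K0 by (intro divide_right_mono mult_left_mono) auto
   finally show ?thesis .
  qed
  have T4: "t * (8 * E) <= 8 * Y * M0 / n'"
  proof -
   have "real (nbox (- h') h') <= 2 * n'\<^sup>2" unfolding nb' using n4 by (simp add: power2_eq_square field_simps)
   then have "E <= M0"
    unfolding E_def M0_def eps_def by (intro smoothing_error_le) (use K0 n4 t0 tY in auto)
   then have "t * (8 * E) <= t * (8 * M0)" using t0 by (intro mult_left_mono) auto
   also have "\<dots> = 8 * (t * n') * M0 / n'" using n4 by simp
   also have "\<dots> <= 8 * Y * M0 / n'"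
    using tY n4 Y K0 by (intro divide_right_mono mult_right_mono mult_left_mono) (auto simp: M0_def)
   finally show ?thesis .
  qed
  have Z: "C * Y * zet <= dl / 3" using nG' n0 dl by (simp add: zet_def field_simps)
  have DD: "2 * C * Y / n' + 8 * C * Y * real K ^ 3 / n' + 8 * Y * M0 / n' <= dl / 3"
   using Dsmall by (simp add: D_def add_divide_distrib)
  have KK: "2 * C * Y / real K + 4 * Y / real K <= dl / 3" using Ksmall by (simp add: add_divide_distrib)
  have "t * (C * sig - 8 * (C * sig / eps + R + E)) = t * (C * sig) - t * (8 * (C * sig / eps)) - t * (8 * R) - t * (8 * E)"
   by (simp add: algebra_simps)
  then have "C * y - dl <= pairmean a b L s" using raw T1 T2 T3 T4 Z DD KK by linarith
  then show "rate_const * (real s / L * ir (2 * h + 1)) - dl <= pairmean (M - h) (M + h) L s"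
   by (simp add: C_def y_def n_def a_def b_def)
 qed
qed

subsection \<open>Comparison of windows\<close>

definition word_prob :: "int => int => 'q set => ('q => int) => ('q => nat) => ('q => nat) => real" where
 "word_prob a b Q cx cj g = pr (word_pmf a b (nbox a b) (\<lambda>_. 0))
  {w. \<forall>q\<in>Q. cj q < count_list (take (g q) w) (cx q)}"

definition path_prob :: "nat => (nat => int) => (nat => int) => real => nat => 'q set => ('q => nat) => ('q => int) => ('q => nat) => ('q => nat) => real" where
 "path_prob k A B L S Q ci cx cj s = pr (path_pmf k A B L S zero_state)
  {p. \<forall>q\<in>Q. cj q < (p ! s q) (ci q) (cx q)}"

lemma sys_words_product:
 assumes "finite Q" "\<And>q. q \<in> Q ==> ci q < k"
 shows "pr (sys_words k A B zero_state) {ws. \<forall>q\<in>Q. cj q < count_list (take (g q) (ws (ci q))) (cx q)}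
  = (\<Prod>i<k. word_prob (A i) (B i) {q\<in>Q. ci q = i} cx cj g)"
proof -
 have "{ws. \<forall>q\<in>Q. cj q < count_list (take (g q) (ws (ci q))) (cx q)}
  = Pi {..<k} (\<lambda>i. {w. \<forall>q\<in>{q\<in>Q. ci q = i}. cj q < count_list (take (g q) w) (cx q)})"
  using assms(2) by (auto simp: Pi_def)
 then show ?thesis
  unfolding sys_words_def by (simp add: measure_Pi_pmf_Pi word_prob_def removed_def zero_state_def)
qed

lemma expect_component:
 assumes ok: "sys_ok k A B L" and i: "i < k"
 shows "expect (at_pmf k A B L s zero_state) (\<lambda>ms. real (ms i x)) = colmean (A i) (B i) L s x"
proof -
 have ok1: "ok1 (A i) (B i) L"
 proof -
  have "nbox (A i) (B i) <= sys_box k A B"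
   unfolding sys_box_def using i by (intro member_le_sum) auto
  then have "real (nbox (A i) (B i)) <= real (sys_box k A B)" by simp
  then show ?thesis unfolding ok1_iff using ok i by (auto simp: sys_ok_def)
 qed
 have "expect (at_pmf k A B L s zero_state) (\<lambda>ms. real (ms i x)) = expect (map_pmf (\<lambda>ms. ms i) (at_pmf k A B L s zero_state)) (\<lambda>m. real (m x))"
  by simp
 also have "\<dots> = colmean (A i) (B i) L s x"
  unfolding at_pmf_component[OF ok i ok1] colmean_def by simp
 finally show ?thesis .
qed

text \<open>In the ordered coupling, whenever the event holds at \<open>s2\<close> in the large
  staircase and fails at \<open>s1\<close> in the windows, some count is larger by at least one. The
  probability of this is therefore at most the sum of the differences of means.\<close>

lemma path_prob_comparison:
 assumes dom: "dominated k A B L a b L'" and okT: "sys_ok k A B L" and okD: "ok1 a b L'"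
  and Q: "finite Q" and ci: "\<And>q. q \<in> Q ==> ci q < k" and s: "\<And>q. q \<in> Q ==> s1 q <= s2 q \<and> s2 q <= S"
 shows "path_prob k A B L S Q ci cx cj s1 <= path_prob 1 (\<lambda>_. a) (\<lambda>_. b) L' S Q (\<lambda>_. 0) cx cj s1"
  and "path_prob 1 (\<lambda>_. a) (\<lambda>_. b) L' S Q (\<lambda>_. 0) cx cj s2 <= path_prob k A B L S Q ci cx cj s1
   + (\<Sum>q\<in>Q. colmean a b L' (s2 q) (cx q) - colmean (A (ci q)) (B (ci q)) L (s1 q) (cx q))"
proof -
 let ?T = "path_pmf k A B L S zero_state" and ?D = "path1 a b L' S zero_state"
 have "below k zero_state zero_state" by (simp add: below_def zero_state_apply)
 then have R0: "rel_pmf (list_all2 (below k)) ?T ?D"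
  by (rule path_dominated[OF dom okT okD sys_valid_zero sys_valid_zero])
 have R: "rel_pmf (\<lambda>p q. \<forall>t\<le>S. \<forall>t'\<le>S. t <= t' --> (\<forall>i<k. \<forall>x. (p ! t) i x <= (q ! t') 0 x)) ?T ?D"
  using R0
 proof (rule pmf.rel_mono_strong)
  fix p q assume p: "p \<in> set_pmf ?T" and q: "q \<in> set_pmf ?D" and l: "list_all2 (below k) p q"
  show "\<forall>t\<le>S. \<forall>t'\<le>S. t <= t' --> (\<forall>i<k. \<forall>x. (p ! t) i x <= (q ! t') 0 x)"
  proof (intro allI impI)
   fix t t' i x assume t: "t <= S" "t' <= S" "t <= t'" "i < k"
   have "below k (p ! t) (q ! t)" using list_all2_nthD[OF l, of t] length_path[OF p] t by simp
   then have "(p ! t) i x <= (q ! t) 0 x" using t by (simp add: below_def)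
   also have "\<dots> <= (q ! t') 0 x" by (rule path_mono_time[OF q t(3,2)])
   finally show "(p ! t) i x <= (q ! t') 0 x" .
  qed
 qed
 show "path_prob k A B L S Q ci cx cj s1 <= path_prob 1 (\<lambda>_. a) (\<lambda>_. b) L' S Q (\<lambda>_. 0) cx cj s1"
  unfolding path_prob_def
 proof (rule order_trans[OF rel_pmf_measureD[OF R]], intro measure_pmf.finite_measure_mono subsetI)
  fix y assume "y \<in> {y. \<exists>p\<in>{p. \<forall>q\<in>Q. cj q < (p ! s1 q) (ci q) (cx q)}. \<forall>t\<le>S. \<forall>t'\<le>S. t <= t' --> (\<forall>i<k. \<forall>x. (p ! t) i x <= (y ! t') 0 x)}"
  then obtain p where p: "\<forall>q\<in>Q. cj q < (p ! s1 q) (ci q) (cx q)"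
   and le: "\<forall>t\<le>S. \<forall>t'\<le>S. t <= t' --> (\<forall>i<k. \<forall>x. (p ! t) i x <= (y ! t') 0 x)" by auto
  have "cj q < (y ! s1 q) 0 (cx q)" if q: "q \<in> Q" for q
  proof -
   have "s1 q <= S" using s[OF q] by linarith
   then have "(p ! s1 q) (ci q) (cx q) <= (y ! s1 q) 0 (cx q)" using le ci[OF q] by blast
   then show ?thesis using p q by (meson less_le_trans)
  qed
  then show "y \<in> {p. \<forall>q\<in>Q. cj q < (p ! s1 q) 0 (cx q)}" by auto
 qed simp
 define E1 where "E1 = {p :: state list. \<forall>q\<in>Q. cj q < (p ! s1 q) (ci q) (cx q)}"
 define E2 where "E2 = {p :: state list. \<forall>q\<in>Q. cj q < (p ! s2 q) 0 (cx q)}"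
 \<comment> \<open>Subtracting the indicators turns the second claim into a pointwise inequality
   between \<open>f\<close> and \<open>g\<close> on coupled paths, of which only the expectation has
   to be taken.\<close>
 define f where "f p = (\<Sum>q\<in>Q. real ((p ! s1 q) (ci q) (cx q))) - indicator E1 p" for p :: "state list"
 define g where "g p = (\<Sum>q\<in>Q. real ((p ! s2 q) 0 (cx q))) - indicator E2 p" for p :: "state list"
 have fin: "finite (set_pmf (path_pmf k A B L s ms))" if "sys_ok k A B L" "sys_valid k A B ms" for k A B L s ms
  using that(2)
 proof (induction s arbitrary: ms)
  case (Suc s)
  then show ?case using finite_set_step_pmf[OF that(1)] sys_valid_step[OF that(1)] by auto
 qed simp
 have int1: "integrable (measure_pmf ?T) h" for h :: "state list => real"
  by (rule integrable_measure_pmf_finite[OF fin[OF okT sys_valid_zero]])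
 have int2: "integrable (measure_pmf ?D) h" for h :: "state list => real"
  by (rule integrable_measure_pmf_finite[OF fin[OF okD sys_valid_zero]])
 have "expect ?T f <= expect ?D g"
 proof (rule rel_pmf_expect_mono[OF R _ int1 int2])
  fix x y :: "state list" assume "\<forall>t\<le>S. \<forall>t'\<le>S. t <= t' --> (\<forall>i<k. \<forall>w. (x ! t) i w <= (y ! t') 0 w)"
  then have le: "(x ! s1 q) (ci q) (cx q) <= (y ! s2 q) 0 (cx q)" if "q \<in> Q" for q
   using s[OF that] ci[OF that] by (meson order_trans)
  show "f x <= g y"
  proof (cases "y \<in> E2 \<and> x \<notin> E1")
   case True
   then obtain c where c: "c \<in> Q" "(x ! s1 c) (ci c) (cx c) <= cj c" "cj c < (y ! s2 c) 0 (cx c)"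
    by (auto simp: E1_def E2_def not_less)
   have "(\<Sum>q\<in>Q. real ((x ! s1 q) (ci q) (cx q))) = real ((x ! s1 c) (ci c) (cx c)) + (\<Sum>q\<in>Q - {c}. real ((x ! s1 q) (ci q) (cx q)))"
    by (rule sum.remove[OF Q c(1)])
   moreover have "(\<Sum>q\<in>Q. real ((y ! s2 q) 0 (cx q))) = real ((y ! s2 c) 0 (cx c)) + (\<Sum>q\<in>Q - {c}. real ((y ! s2 q) 0 (cx q)))"
    by (rule sum.remove[OF Q c(1)])
   moreover have "(\<Sum>q\<in>Q - {c}. real ((x ! s1 q) (ci q) (cx q))) <= (\<Sum>q\<in>Q - {c}. real ((y ! s2 q) 0 (cx q)))"
    by (rule sum_mono) (use le in auto)
   ultimately show ?thesis using c True by (simp add: f_def g_def)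
  next
   case False
   then have "indicator E2 y <= (indicator E1 x :: real)" by (auto simp: indicator_def)
   moreover have "(\<Sum>q\<in>Q. real ((x ! s1 q) (ci q) (cx q))) <= (\<Sum>q\<in>Q. real ((y ! s2 q) 0 (cx q)))"
    by (rule sum_mono) (use le in auto)
   ultimately show ?thesis by (simp add: f_def g_def)
  qed
 qed
 moreover have "expect ?T f = (\<Sum>q\<in>Q. colmean (A (ci q)) (B (ci q)) L (s1 q) (cx q)) - path_prob k A B L S Q ci cx cj s1"
 proof -
  have "expect ?T (\<lambda>p. real ((p ! s1 q) (ci q) (cx q))) = colmean (A (ci q)) (B (ci q)) L (s1 q) (cx q)" if q: "q \<in> Q" for q
  proof -
   have "s1 q <= S" using s[OF q] by linarith
   then have "expect ?T (\<lambda>p. real ((p ! s1 q) (ci q) (cx q))) = expect (at_pmf k A B L (s1 q) zero_state) (\<lambda>ms. real (ms (ci q) (cx q)))"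
    unfolding path_at[of "s1 q" S, symmetric, OF \<open>s1 q <= S\<close>] by simp
   then show ?thesis using expect_component[OF okT ci[OF q]] by simp
  qed
  then show ?thesis
   unfolding f_def by (simp add: int1 path_prob_def E1_def)
 qed
 moreover have "expect ?D g = (\<Sum>q\<in>Q. colmean a b L' (s2 q) (cx q)) - path_prob 1 (\<lambda>_. a) (\<lambda>_. b) L' S Q (\<lambda>_. 0) cx cj s2"
 proof -
  have "expect ?D (\<lambda>p. real ((p ! s2 q) 0 (cx q))) = colmean a b L' (s2 q) (cx q)" if q: "q \<in> Q" for q
  proof -
   have "s2 q <= S" using s[OF q] by linarith
   then have "expect ?D (\<lambda>p. real ((p ! s2 q) 0 (cx q))) = expect (at1 a b L' (s2 q) zero_state) (\<lambda>ms. real (ms 0 (cx q)))"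
    unfolding path_at[of "s2 q" S, symmetric, OF \<open>s2 q <= S\<close>] by simp
   then show ?thesis by (simp add: colmean_def)
  qed
  then show ?thesis
   unfolding g_def by (simp add: int2 path_prob_def E2_def)
 qed
 ultimately show "path_prob 1 (\<lambda>_. a) (\<lambda>_. b) L' S Q (\<lambda>_. 0) cx cj s2 <= path_prob k A B L S Q ci cx cj s1
   + (\<Sum>q\<in>Q. colmean a b L' (s2 q) (cx q) - colmean (A (ci q)) (B (ci q)) L (s1 q) (cx q))"
  by (simp add: sum_subtractf)
qed

text \<open>The times \<open>s1\<close> and \<open>s2\<close> bracket the moment when the prescribed
  numbers of boxes have gone, in both systems. Each word probability lies between the path
  probabilities at these times up to a clock error, windows lag behind the staircase, and the
  surplus of means bounds the staircase at \<open>s2\<close> by the windows at \<open>s1\<close>.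
  Either direction passes through three errors.\<close>

lemma word_prob_sandwich:
 assumes dom: "dominated k A B L a b L'" and okT: "sys_ok k A B L" and okD: "ok1 a b L'"
  and Q: "finite Q" and ci: "\<And>q. q \<in> Q ==> ci q < k" and s: "\<And>q. q \<in> Q ==> s1 q <= s2 q"
  and T1: "\<And>q. q \<in> Q ==> late k A B L (s1 q) (ci q) (f q) <= e"
  and T2: "\<And>q. q \<in> Q ==> early k A B L (s2 q) (ci q) (f q) <= e"
  and D1: "\<And>q. q \<in> Q ==> late1 a b L' (s1 q) (g q) <= e"
  and D2: "\<And>q. q \<in> Q ==> early1 a b L' (s2 q) (g q) <= e"
  and diff: "\<And>q. q \<in> Q ==> colmean a b L' (s2 q) (cx q) - colmean (A (ci q)) (B (ci q)) L (s1 q) (cx q) <= e"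
 shows "\<bar>word_prob a b Q cx cj g - (\<Prod>i<k. word_prob (A i) (B i) {q\<in>Q. ci q = i} cx cj f)\<bar> <= 3 * real (card Q) * e"
proof -
 define S where "S = (\<Sum>q\<in>Q. s2 q)"
 have S: "s1 q <= S" "s2 q <= S" if "q \<in> Q" for q
 proof -
  show "s2 q <= S" unfolding S_def by (rule member_le_sum[OF that]) (use Q in auto)
  then show "s1 q <= S" using s[OF that] by simp
 qed
 let ?PT = "path_prob k A B L S Q ci cx cj" and ?PD = "path_prob 1 (\<lambda>_. a) (\<lambda>_. b) L' S Q (\<lambda>_. 0) cx cj"
 let ?WT = "\<Prod>i<k. word_prob (A i) (B i) {q\<in>Q. ci q = i} cx cj f" and ?WD = "word_prob a b Q cx cj g"
 have WT: "pr (sys_words k A B zero_state) {ws. \<forall>q\<in>Q. cj q < count_list (take (f q) (ws (ci q))) (cx q)} = ?WT"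
  by (rule sys_words_product[OF Q ci])
 have WD: "pr (sys_words 1 (\<lambda>_. a) (\<lambda>_. b) zero_state) {ws. \<forall>q\<in>Q. cj q < count_list (take (g q) (ws 0)) (cx q)} = ?WD"
  using sys_words_product[OF Q, of "\<lambda>_. 0" 1 "\<lambda>_. a" "\<lambda>_. b" cj g cx] by (simp add: lessThan_Suc One_nat_def)
 have sum_e: "(\<Sum>q\<in>Q. h q) <= real (card Q) * e" if "\<And>q. q \<in> Q ==> h q <= e" for h :: "'a => real"
  using sum_bounded_above[of Q h e] that by simp
 have 1: "?PT s1 <= ?WT + real (card Q) * e"
 proof -
  have "?PT s1 <= ?WT + (\<Sum>q\<in>Q. late k A B L (s1 q) (ci q) (f q))"
   unfolding path_prob_def WT[symmetric] by (rule path_word_comparison(1)[OF okT Q]) (use ci S in auto)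
  moreover have "(\<Sum>q\<in>Q. late k A B L (s1 q) (ci q) (f q)) <= real (card Q) * e"
   by (rule sum_e, erule T1)
  ultimately show ?thesis by linarith
 qed
 have 2: "?WT <= ?PT s2 + real (card Q) * e"
 proof -
  have "?WT <= ?PT s2 + (\<Sum>q\<in>Q. early k A B L (s2 q) (ci q) (f q))"
   unfolding path_prob_def WT[symmetric] by (rule path_word_comparison(2)[OF okT Q]) (use ci S in auto)
  moreover have "(\<Sum>q\<in>Q. early k A B L (s2 q) (ci q) (f q)) <= real (card Q) * e"
   by (rule sum_e, erule T2)
  ultimately show ?thesis by linarith
 qed
 have 3: "?PD s1 <= ?WD + real (card Q) * e"
 proof -
  have "?PD s1 <= ?WD + (\<Sum>q\<in>Q. late1 a b L' (s1 q) (g q))"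
   unfolding path_prob_def WD[symmetric] by (rule path_word_comparison(1)[OF okD Q]) (use ci S in auto)
  moreover have "(\<Sum>q\<in>Q. late1 a b L' (s1 q) (g q)) <= real (card Q) * e"
   by (rule sum_e, erule D1)
  ultimately show ?thesis by linarith
 qed
 have 4: "?WD <= ?PD s2 + real (card Q) * e"
 proof -
  have "?WD <= ?PD s2 + (\<Sum>q\<in>Q. early1 a b L' (s2 q) (g q))"
   unfolding path_prob_def WD[symmetric] by (rule path_word_comparison(2)[OF okD Q]) (use ci S in auto)
  moreover have "(\<Sum>q\<in>Q. early1 a b L' (s2 q) (g q)) <= real (card Q) * e"
   by (rule sum_e, erule D2)
  ultimately show ?thesis by linarith
 qed
 have 5: "?PT s1 <= ?PD s1" by (rule path_prob_comparison(1)[OF dom okT okD Q, where ?s2.0 = s1]) (use ci S in auto)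
 have 6: "?PT s2 <= ?PD s2" by (rule path_prob_comparison(1)[OF dom okT okD Q, where ?s2.0 = s2]) (use ci S in auto)
 have 7: "?PD s2 <= ?PT s1 + real (card Q) * e"
 proof -
  have "?PD s2 <= ?PT s1 + (\<Sum>q\<in>Q. colmean a b L' (s2 q) (cx q) - colmean (A (ci q)) (B (ci q)) L (s1 q) (cx q))"
   by (rule path_prob_comparison(2)[OF dom okT okD Q]) (use ci s S in auto)
  moreover have "(\<Sum>q\<in>Q. colmean a b L' (s2 q) (cx q) - colmean (A (ci q)) (B (ci q)) L (s1 q) (cx q)) <= real (card Q) * e"
   by (rule sum_e, erule diff)
  ultimately show ?thesis by linarith
 qed
 show ?thesis using 1 2 3 4 5 6 7 by linarith
qed

lemma removed_deviation:
 assumes ok: "sys_ok k A B L" and i: "i < k" and L: "2 <= L" and gam: "0 < gam" and n: "0 < n"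
  and N: "real (nbox (A i) (B i)) * (real s / L) <= Z * n"
  and N2: "real (nbox (A i) (B i)) * (real s / L)\<^sup>2 <= gam * n / 2"
 shows "real (nbox (A i) (B i)) * (real s / L) + gam * n <= real g ==>
  late k A B L s i g <= 4 * Z / (gam\<^sup>2 * n)"
  and "real g <= real (nbox (A i) (B i)) * (real s / L) - gam * n ==>
  early k A B L s i g <= 4 * Z / (gam\<^sup>2 * n)"
proof -
 let ?p = "at_pmf k A B L s zero_state" and ?N = "real (nbox (A i) (B i))"
 have "pr ?p {ms. gam * n <= \<bar>real (removed (A i) (B i) (ms i)) - ?N * real s / L\<bar>}
  <= 4 * (?N * real s / L) / (gam * n)\<^sup>2"
  by (rule removed_concentration[OF ok i L]) (use gam n N2 in auto)
 also have "\<dots> <= 4 * (Z * n) / (gam * n)\<^sup>2" using N by (intro divide_right_mono) auto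
 also have "\<dots> = 4 * Z / (gam\<^sup>2 * n)" using n by (simp add: power2_eq_square)
 finally have P: "pr ?p {ms. gam * n <= \<bar>real (removed (A i) (B i) (ms i)) - ?N * real s / L\<bar>} <= 4 * Z / (gam\<^sup>2 * n)" .
 show "pr ?p {m. g < removed (A i) (B i) (m i)} <= 4 * Z / (gam\<^sup>2 * n)" if g: "?N * (real s / L) + gam * n <= real g"
 proof (rule order_trans[OF _ P], intro measure_pmf.finite_measure_mono subsetI)
  fix m assume "m \<in> {m. g < removed (A i) (B i) (m i)}"
  then have "real g <= real (removed (A i) (B i) (m i))" by simp
  then show "m \<in> {ms. gam * n <= \<bar>real (removed (A i) (B i) (ms i)) - ?N * real s / L\<bar>}" using g by simp
 qed simp
 show "pr ?p {m. removed (A i) (B i) (m i) < g} <= 4 * Z / (gam\<^sup>2 * n)" if g: "real g <= ?N * (real s / L) - gam * n"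
 proof (rule order_trans[OF _ P], intro measure_pmf.finite_measure_mono subsetI)
  fix m assume "m \<in> {m. removed (A i) (B i) (m i) < g}"
  then have "real (removed (A i) (B i) (m i)) <= real g" by simp
  then show "m \<in> {ms. gam * n <= \<bar>real (removed (A i) (B i) (ms i)) - ?N * real s / L\<bar>}" using g by simp
 qed simp
qed

lemma removed_shift: "removed (a + c) (b + c) m = removed a b (\<lambda>x. m (x + 2 * c))"
 unfolding removed_def
 by (rule sum.reindex_bij_witness[of _ "\<lambda>x. x + 2 * c" "\<lambda>x. x - 2 * c"]) auto

lemma corner_pmf_shift:
 assumes v: "valid (a + c) (b + c) m" "a < b" and r: "removed (a + c) (b + c) m < nbox a b"
 shows "corner_pmf (a + c) (b + c) m = map_pmf (\<lambda>x. x + 2 * c) (corner_pmf a b (\<lambda>x. m (x + 2 * c)))"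
proof (rule pmf_eqI)
 fix y
 have v': "valid a b (\<lambda>x. m (x + 2 * c))" by (rule valid_shift[OF v(1)])
 have ab: "a + c < b + c" using v(2) by simp
 define x where "x = y - 2 * c"
 have y: "y = x + 2 * c" by (simp add: x_def)
 have "pmf (map_pmf (\<lambda>x. x + 2 * c) (corner_pmf a b (\<lambda>x. m (x + 2 * c)))) (x + 2 * c) = pmf (corner_pmf a b (\<lambda>x. m (x + 2 * c))) x"
  by (rule pmf_map_inj') (simp add: inj_def)
 then show "pmf (corner_pmf (a + c) (b + c) m) y = pmf (map_pmf (\<lambda>x. x + 2 * c) (corner_pmf a b (\<lambda>x. m (x + 2 * c)))) y"
  using r unfolding y pmf_corner_pmf[OF v(1) ab r[folded nbox_shift[of a c b]]]
  by (subst \<open>pmf (map_pmf _ _) _ = _\<close>, subst pmf_corner_pmf[OF v' v(2)])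
   (simp_all add: removed_shift corners_shift rate_shift nbox_shift)
qed

lemma word_pmf_shift:
 assumes "valid (a + c) (b + c) m" "a < b" "removed (a + c) (b + c) m + r <= nbox a b"
 shows "word_pmf (a + c) (b + c) r m = map_pmf (map (\<lambda>x. x + 2 * c)) (word_pmf a b r (\<lambda>x. m (x + 2 * c)))"
 using assms(1,3)
proof (induction r arbitrary: m)
 case (Suc r)
 have rm: "removed (a + c) (b + c) m < nbox a b" using Suc.prems by simp
 have ab: "a + c < b + c" using assms(2) by simp
 have v': "valid a b (\<lambda>x. m (x + 2 * c))" by (rule valid_shift[OF Suc.prems(1)])
 have rm': "removed a b (\<lambda>x. m (x + 2 * c)) < nbox a b" using rm by (simp add: removed_shift)
 have "word_pmf (a + c) (b + c) (Suc r) m = bind_pmf (corner_pmf a b (\<lambda>x. m (x + 2 * c)))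
  (\<lambda>x. map_pmf (Cons (x + 2 * c)) (word_pmf (a + c) (b + c) r (m(x + 2 * c := m (x + 2 * c) + 1))))"
  by (simp add: corner_pmf_shift[OF Suc.prems(1) assms(2) rm] bind_map_pmf)
 also have "\<dots> = bind_pmf (corner_pmf a b (\<lambda>x. m (x + 2 * c)))
  (\<lambda>x. map_pmf (Cons (x + 2 * c)) (map_pmf (map (\<lambda>x. x + 2 * c)) (word_pmf a b r ((\<lambda>x. m (x + 2 * c))(x := m (x + 2 * c) + 1)))))"
 proof (rule bind_pmf_cong[OF refl])
  fix x assume "x \<in> set_pmf (corner_pmf a b (\<lambda>x. m (x + 2 * c)))"
  then have "x \<in> corners a b (\<lambda>x. m (x + 2 * c))" using set_corner_pmf[OF v' assms(2) rm'] by auto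
  then have xc: "x + 2 * c \<in> corners (a + c) (b + c) m" by (simp add: corners_shift)
  have funeq: "(\<lambda>y. (m(x + 2 * c := m (x + 2 * c) + 1)) (y + 2 * c)) = (\<lambda>x. m (x + 2 * c))(x := m (x + 2 * c) + 1)" by auto
  have le: "removed (a + c) (b + c) (m(x + 2 * c := m (x + 2 * c) + 1)) + r <= nbox a b"
   using removed_upd[OF Suc.prems(1) ab xc] Suc.prems(2) by simp
  have ih: "word_pmf (a + c) (b + c) r (m(x + 2 * c := m (x + 2 * c) + 1))
   = map_pmf (map (\<lambda>x. x + 2 * c)) (word_pmf a b r (\<lambda>y. (m(x + 2 * c := m (x + 2 * c) + 1)) (y + 2 * c)))"
   by (rule Suc.IH[OF valid_upd[OF Suc.prems(1) ab xc] le])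
  show "map_pmf (Cons (x + 2 * c)) (word_pmf (a + c) (b + c) r (m(x + 2 * c := m (x + 2 * c) + 1)))
   = map_pmf (Cons (x + 2 * c)) (map_pmf (map (\<lambda>x. x + 2 * c)) (word_pmf a b r ((\<lambda>x. m (x + 2 * c))(x := m (x + 2 * c) + 1))))"
   unfolding ih funeq ..
 qed
 finally show ?case by (simp add: map_bind_pmf pmf.map_comp o_def)
qed simp

lemma count_list_map_add: "count_list (map (\<lambda>x. x + d) ws) (x + d) = count_list ws x" for d :: int
 by (induction ws) auto

lemma word_prob_shift:
 assumes "a < b"
 shows "word_prob (a + c) (b + c) Q (\<lambda>q. cx q + 2 * c) cj g = word_prob a b Q cx cj g"
proof -
 have "word_pmf (a + c) (b + c) (nbox a b) (\<lambda>_. 0) = map_pmf (map (\<lambda>x. x + 2 * c)) (word_pmf a b (nbox a b) (\<lambda>_. 0))"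
  by (rule word_pmf_shift[OF valid_zero assms]) simp
 then show ?thesis
  unfolding word_prob_def nbox_shift by (simp add: vimage_def take_map count_list_map_add)
qed

lemma word_prob_cong:
 assumes "\<And>q. q \<in> Q ==> cx q = cx' q" "\<And>q. q \<in> Q ==> g q = g' q"
 shows "word_prob a b Q cx cj g = word_prob a b Q cx' cj g'"
proof -
 have "{w. \<forall>q\<in>Q. cj q < count_list (take (g q) w) (cx q)} = {w. \<forall>q\<in>Q. cj q < count_list (take (g' q) w) (cx' q)}"
  using assms by auto
 then show ?thesis by (simp add: word_prob_def)
qed

lemma colmean_time_mono:
 assumes ok: "ok1 a b L" and s: "s <= s'"
 shows "colmean a b L s x <= colmean a b L s' x"
proof -
 let ?P = "path1 a b L s' zero_state"
 have R: "rel_pmf (\<lambda>p q. p = q \<and> p \<in> set_pmf ?P) ?P ?P" by (rule rel_pmf_reflI) auto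
 have e: "colmean a b L t x = expect ?P (\<lambda>p. real ((p ! t) 0 x))" if "t <= s'" for t
  unfolding colmean_def path_at[OF that, symmetric] by simp
 have fin: "integrable (measure_pmf ?P) (\<lambda>p. real ((p ! t) 0 x))" if "t <= s'" for t
 proof -
  have "integrable (measure_pmf (at1 a b L t zero_state)) (\<lambda>ms. real (ms 0 x))"
   by (rule integrable_measure_pmf_finite[OF finite_set_at_pmf[OF ok sys_valid_zero]])
  then show ?thesis unfolding path_at[OF that, symmetric] by simp
 qed
 show ?thesis
  unfolding e[OF s] e[OF order_refl]
  by (rule rel_pmf_expect_mono[OF R _ fin[OF s] fin[OF order_refl]]) (use s path_mono_time in auto)
qed

text \<open>Both columns of the pair have a nonnegative surplus, so either one is bounded by their
  sum, which is all that the smoothed estimates control.\<close>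

lemma colmean_diff_le_pair:
 assumes dom: "dominated 1 (\<lambda>_. A) (\<lambda>_. B) L a b L'" and ok: "ok1 A B L" and ok': "ok1 a b L'"
  and s: "s1 <= s2" and x: "x = 2 * c \<or> x = 2 * c + 1"
 shows "colmean a b L' s2 x - colmean A B L s1 x <= pairmean (a - c) (b - c) L' s2 - pairmean (A - c) (B - c) L s1"
proof -
 have le: "colmean A B L s1 y <= colmean a b L' s2 y" for y
  using colmean_mono[OF dom ok ok', of s1 y] colmean_time_mono[OF ok' s, of y] by linarith
 have sh: "pairmean (a - c) (b - c) L s = colmean a b L s (2 * c) + colmean a b L s (2 * c + 1)"
  if "ok1 a b L" for a b L s
 proof -
  have "ok1 (a + - c) (b + - c) L" using that unfolding ok1_iff nbox_shift by simp
  from pairmean_shift[OF that this, of s] show ?thesis by simp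
 qed
 show ?thesis unfolding sh[OF ok] sh[OF ok'] using x le[of "2 * c"] le[of "2 * c + 1"] by auto
qed

lemma width2_window:
 assumes X: "\<bar>ir x\<bar> <= X" and p: "0 < ir (2 * b + 1)" "0 < ir (1 - 2 * a)"
  and xi: "X <= xi * ir (2 * b + 1)" "X <= xi * ir (1 - 2 * a)" "xi <= 1" "0 <= xi"
 shows "(sqrt (width2 a b 0) * (1 - xi))\<^sup>2 <= width2 a b x" "width2 a b x <= (sqrt (width2 a b 0) * (1 + xi))\<^sup>2"
proof -
 have w0: "width2 a b 0 = ir (2 * b + 1) * ir (1 - 2 * a)" by (simp add: width2_def)
 have p0: "0 <= width2 a b 0" unfolding w0 using p by (intro mult_nonneg_nonneg) auto
 have up: "ir (2 * b + 1 - x) <= ir (2 * b + 1) * (1 + xi)" "ir (x + 1 - 2 * a) <= ir (1 - 2 * a) * (1 + xi)"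
  and lo: "ir (2 * b + 1) * (1 - xi) <= ir (2 * b + 1 - x)" "ir (1 - 2 * a) * (1 - xi) <= ir (x + 1 - 2 * a)"
  using X xi by (auto simp: algebra_simps)
 have l0: "0 <= ir (2 * b + 1) * (1 - xi)" "0 <= ir (1 - 2 * a) * (1 - xi)"
  by (intro mult_nonneg_nonneg; use p xi in linarith)+
 note x0 = order_trans[OF l0(1) lo(1)] order_trans[OF l0(2) lo(2)]
 have "(ir (2 * b + 1) * (1 - xi)) * (ir (1 - 2 * a) * (1 - xi)) <= width2 a b x"
  unfolding width2_def by (rule mult_mono[OF lo x0(1) l0(2)])
 then show "(sqrt (width2 a b 0) * (1 - xi))\<^sup>2 <= width2 a b x"
  using p0 by (simp add: power_mult_distrib w0 power2_eq_square mult_ac)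
 have "width2 a b x <= (ir (2 * b + 1) * (1 + xi)) * (ir (1 - 2 * a) * (1 + xi))"
  unfolding width2_def by (rule mult_mono[OF up order_trans[OF x0(1) up(1)] x0(2)])
 then show "width2 a b x <= (sqrt (width2 a b 0) * (1 + xi))\<^sup>2"
  using p0 by (simp add: power_mult_distrib w0 power2_eq_square mult_ac)
qed

lemma floor_steps:
 fixes L m tht :: real
 assumes "0 < L" "0 < m" "0 <= tht"
 defines "s \<equiv> nat \<lfloor>tht * L / m\<rfloor>"
 shows "real s / L * m <= tht" "tht - m / L <= real s / L * m"
proof -
 have "real s = ir \<lfloor>tht * L / m\<rfloor>" using assms by (simp add: s_def)
 then have "real s <= tht * L / m" "tht * L / m - 1 <= real s" by linarith+
 then have "real s * m <= tht * L" "tht * L - m <= real s * m"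
  using assms(1,2) by (simp_all add: pos_le_divide_eq pos_divide_le_eq algebra_simps)
 then have "real s * m / L <= tht" "tht <= (real s * m + m) / L"
  using assms(1) by (simp_all add: pos_le_divide_eq pos_divide_le_eq)
 then show "real s / L * m <= tht" "tht - m / L <= real s / L * m"
  by (simp_all add: add_divide_distrib)
qed

text \<open>\<open>g\<close> removals out of about \<open>n ^ 2 / 2\<close> take the time
  \<open>2 * g / n ^ 2\<close> in units of \<open>L\<close>, and rates near column 0 are
  proportional to \<open>sqrt (width2 a b 0)\<close>. The quotient is thus, up to a constant factor,
  the expected number of removals per column; for a centred staircase it is
  \<open>g / n\<close>.\<close>

definition times_near :: "'q set => ('q => real) => real => int => int => ('q => nat) => bool" where
 "times_near Q t rho a b g \<longleftrightarrow> (\<forall>q\<in>Q. \<bar>real (g q) * sqrt (width2 a b 0) / (side a b)\<^sup>2 - t q\<bar> <= rho)"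

definition approximates :: "'q set => ('q => int) => ('q => nat) => ('q => real) => real => real => real => real => bool" where
 "approximates Q cx cj t eta rho eps p \<longleftrightarrow> (\<exists>n0. \<forall>a b g. ample n0 eta a b --> times_near Q t rho a b g -->
  \<bar>word_prob a b Q cx cj g - p\<bar> <= eps)"

definition window_word_prob :: "int => 'q set => ('q => int) => ('q => nat) => ('q => real) => real" where
 "window_word_prob h Q cx cj t = word_prob (- h) h Q cx cj (\<lambda>q. nat \<lfloor>t q * ir (2 * h + 1)\<rfloor>)"

definition spaced :: "nat => int => (nat => int) => bool" where
 "spaced k D M \<longleftrightarrow> (\<forall>i<k. \<forall>j<k. i \<noteq> j --> D <= \<bar>M i - M j\<bar>)"

text \<open>The order of the quantifiers matters: \<open>rho\<close> and \<open>h0\<close> depend on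
  neither the positions \<open>M\<close> nor the staircase, so windows of one fixed size approximate
  all ample staircases. One window yields convergence as the size grows, several windows yield
  asymptotic independence. The tolerance \<open>rho1\<close> makes room between \<open>s1\<close>
  and \<open>s2\<close>, at the price of a surplus of means proportional to it.\<close>

lemma key_lemma:
 fixes t :: "'q => real"
 assumes Q: "finite Q" and "\<forall>q\<in>Q. ci q < k" and "\<forall>q\<in>Q. 0 < t q" and eps: "0 < eps" and eta: "0 < eta" "eta <= 1"
 shows "\<exists>rho>0. \<exists>h0. \<forall>h M. h0 <= h --> spaced k (2 * h) M -->
  approximates Q (\<lambda>q. cx q + 2 * M (ci q)) cj t eta rho eps (\<Prod>i<k. window_word_prob h {q\<in>Q. ci q = i} cx cj t)"
proof -
 have ci: "\<And>q. q \<in> Q ==> ci q < k" and tpos: "\<And>q. q \<in> Q ==> 0 < t q" using assms by auto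
 define C where "C = rate_const"
 have C: "0 < C" using rate_const_pos by (simp add: C_def)
 define e where "e = eps / (3 * (real (card Q) + 1))"
 have e: "0 < e" using eps by (simp add: e_def add_nonneg_pos)
 have e3: "3 * real (card Q) * e <= eps" using eps by (simp add: e_def field_simps)
 define T where "T = 1 + (\<Sum>q\<in>Q. t q)"
 have tT: "t q <= T" if "q \<in> Q" for q
  unfolding T_def using member_le_sum[OF that, of t] Q tpos by (simp add: less_imp_le)
 have T1: "1 <= T" unfolding T_def using tpos by (simp add: sum_nonneg less_imp_le)
 \<comment> \<open>Half of the smallest time keeps \<open>t q - rho1\<close> positive, and
   \<open>e / (12 * C)\<close> keeps \<open>6 * C * rho1\<close>, which bounds the surplus of means,
   below \<open>e / 2\<close>. The inserted 1 covers empty \<open>Q\<close> and bounds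
   \<open>rho1\<close> by one half.\<close>
 define rho1 where "rho1 = min (Min (insert 1 (t ` Q)) / 2) (e / (12 * C))"
 have "0 < Min (insert 1 (t ` Q))" using Q tpos by (subst Min_gr_iff) auto
 then have rho1: "0 < rho1" using e C by (simp add: rho1_def)
 have rho1_half: "rho1 <= 1 / 2"
 proof -
  have "Min (insert 1 (t ` Q)) <= 1" using Q by (intro Min_le) auto
  then show ?thesis by (simp add: rho1_def min_le_iff_disj)
 qed
 have rho1t: "rho1 < t q" if "q \<in> Q" for q
 proof -
  have "Min (insert 1 (t ` Q)) <= t q" using Q that by (intro Min_le) auto
  then have "rho1 <= t q / 2" by (simp add: rho1_def min_le_iff_disj)
  then show ?thesis using tpos[OF that] by linarith
 qed
 have rho1C: "6 * C * rho1 <= e / 2"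
 proof -
  have "rho1 <= e / (12 * C)" by (simp add: rho1_def)
  then show ?thesis using C by (simp add: field_simps)
 qed
 define YU where "YU = 8 * (T + 1) / eta"
 define YL where "YL = 2 * (T + 1)"
 have "0 < eta / 2" "0 < e / 4" "0 <= YU" "0 <= YL" using eta e T1 by (auto simp: YU_def YL_def)
 then obtain n1 where n1: "\<And>a b L s. ample n1 (eta / 2) a b ==> 2 * real (nbox a b) <= L ==> real s / L * side a b <= YU ==>
  pairmean a b L s <= C * (real s / L * sqrt (width2 a b 0)) + e / 4"
  using pairmean_upper[of "eta / 2" "e / 4" YU] unfolding C_def by blast
 define bet where "bet q = cx q div 2" for q
 define B where "B = (\<Sum>q\<in>Q. \<bar>bet q\<bar>)"
 have B0: "0 <= B" by (simp add: B_def sum_nonneg)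
 have betB: "\<bar>bet q\<bar> <= B" if "q \<in> Q" for q
  unfolding B_def by (rule member_le_sum[OF that]) (use Q in auto)
 obtain hL where hL: "\<And>h M L s. hL <= h ==> \<bar>M\<bar> <= B ==> real (nbox (M - h) (M + h)) <= L ==>
  real s / L * ir (2 * h + 1) <= YL ==>
  C * (real s / L * ir (2 * h + 1)) - e / 4 <= pairmean (M - h) (M + h) L s"
  using pairmean_lower[OF \<open>0 < e / 4\<close> \<open>0 <= YL\<close> B0] unfolding C_def by blast
 define gam where "gam = rho1 / 4"
 have gam: "0 < gam" using rho1 by (simp add: gam_def)
 \<comment> \<open>Three demands on the window size: the quadratic bias of the clock, its
   fluctuations, and the rounding of times and prefix lengths.\<close>
 define m0 where "m0 = max (16 * (T + 1)\<^sup>2 / rho1) (max (4 * (T + 1) / (gam\<^sup>2 * e)) (2 * (T + 3) / rho1))"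
 obtain H :: nat where H: "m0 <= real H" using real_arch_simple by blast
 define h0 where "h0 = max hL (max 1 (int H))"
 show ?thesis
 proof (rule exI[of _ gam], intro conjI gam, rule exI[of _ h0], intro allI impI)
  fix h :: int and M :: "nat => int"
  assume h: "h0 <= h" and far: "spaced k (2 * h) M"
  define m where "m = ir (2 * h + 1)"
  have hh: "hL <= h" "1 <= h" and mm: "m0 <= m" using h H by (auto simp: h0_def m_def)
  have m3: "3 <= m" using hh by (simp add: m_def)
  have mA: "16 * (T + 1)\<^sup>2 <= rho1 * m" and mB: "4 * (T + 1) / (gam\<^sup>2 * m) <= e" and mC: "2 * (T + 3) <= rho1 * m"
   using mm rho1 gam e m3 by (auto simp: m0_def field_simps)
  define A where "A i = M i - h" for i
  define BB where "BB i = M i + h" for i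
  define NT where "NT = m * (m - 1) / 2"
  have nbT: "real (nbox (c - h) (c + h)) = NT" for c
   using hh by (subst real_nbox) (auto simp: NT_def m_def algebra_simps)
  have NT0: "0 <= NT" using m3 by (simp add: NT_def)
  define Mm where "Mm = (\<Sum>i<k. \<bar>M i\<bar>)"
  have Mm: "\<bar>M i\<bar> <= Mm" if "i < k" for i unfolding Mm_def by (rule member_le_sum) (use that in auto)
  have Mm0: "0 <= Mm" by (simp add: Mm_def sum_nonneg)
  define X where "X = ir (2 * Mm + 2 * h + 2 * B + 2)"
  have X: "0 < X" using Mm0 hh B0 by (simp add: X_def)
  define n0 where "n0 = max n1 (max (8 * (T + 1) * X / (rho1 * eta)) (max (4 * (T + 1) / rho1)
    (max (64 * (T + 1)\<^sup>2 / (eta\<^sup>2 * rho1)) (8 * (T + 1) / (eta * gam\<^sup>2 * e)))))"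
  show "approximates Q (\<lambda>q. cx q + 2 * M (ci q)) cj t eta gam eps (\<Prod>i<k. window_word_prob h {q\<in>Q. ci q = i} cx cj t)"
   unfolding approximates_def
  proof (rule exI[of _ n0], intro allI impI)
   fix a b :: int and g :: "'q => nat"
   define n where "n = side a b"
   define sig where "sig = sqrt (width2 a b 0)"
   assume "ample n0 eta a b" and "times_near Q t gam a b g"
   then have nn0: "n0 <= n" and wb: "eta * n <= ir (2 * b + 1)" and wa: "eta * n <= ir (1 - 2 * a)"
    and g: "\<And>q. q \<in> Q ==> \<bar>real (g q) * sig / n\<^sup>2 - t q\<bar> <= gam" by (simp_all add: ample_def times_near_def n_def sig_def)
   have nn1: "n1 <= n" and nA: "8 * (T + 1) * X / (rho1 * eta) <= n" and nB: "4 * (T + 1) / rho1 <= n"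
    and nC: "64 * (T + 1)\<^sup>2 / (eta\<^sup>2 * rho1) <= n" and nD: "8 * (T + 1) / (eta * gam\<^sup>2 * e) <= n"
    using nn0 by (auto simp: n0_def)
   have n8: "8 <= n"
   proof -
    have "8 * 1 <= 4 * (T + 1) / rho1" using T1 rho1 rho1_half by (simp add: field_simps)
    then show ?thesis using nB by linarith
   qed
   \<comment> \<open>Relative displacement of all columns involved, as seen from the large
     staircase; across the windows the semicircle changes by factors between \<open>1 - xi\<close>
     and \<open>1 + xi\<close>.\<close>
   define xi where "xi = X / (eta * n)"
   have xi0: "0 < xi" using X eta n8 by (simp add: xi_def)
   have xi: "8 * (T + 1) * xi <= rho1"
    using nA rho1 eta n8 by (simp add: xi_def field_simps)
   have xi4: "xi <= 1 / 16"
   proof -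
    have "8 * 2 * xi <= 8 * (T + 1) * xi" using T1 xi0 by (intro mult_right_mono) auto
    then show ?thesis using xi rho1_half by linarith
   qed
   have Xxi: "X = xi * (eta * n)" using eta n8 by (simp add: xi_def)
   have en: "0 < eta * n" using eta n8 by simp
   have Xb: "X <= xi * ir (2 * b + 1)" and Xa: "X <= xi * ir (1 - 2 * a)"
    unfolding Xxi using wa wb xi0 by (auto intro: mult_left_mono)
   have pb: "0 < ir (2 * b + 1)" and pa: "0 < ir (1 - 2 * a)" using wa wb en by linarith+
   have X16: "16 * X <= eta * n" unfolding Xxi using mult_right_mono[OF xi4, of "eta * n"] en by simp
   have ab: "a < b" using n8 by (simp add: n_def)
   have sigw: "sig\<^sup>2 = width2 a b 0" "eta * n <= sig" "sig <= n"
   proof -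
    have w: "width2 a b 0 = ir (2 * b + 1) * ir (1 - 2 * a)" by (simp add: width2_def)
    have "(eta * n) * (eta * n) <= width2 a b 0" unfolding w using wa wb en by (intro mult_mono) auto
    then have s: "(eta * n)\<^sup>2 <= width2 a b 0" by (simp add: power2_eq_square)
    then show "eta * n <= sig" unfolding sig_def by (rule real_le_rsqrt)
    show "sig\<^sup>2 = width2 a b 0" using order_trans[OF zero_le_power2 s] by (simp add: sig_def)
    show "sig <= n" using width2_le_square[of a b 0] n8 by (auto simp: sig_def n_def intro: real_le_lsqrt)
   qed
   have sig0: "0 < sig" using sigw en by linarith
   define ND where "ND = n * (n - 1) / 2"
   have nbD: "real (nbox a b) = ND" unfolding real_nbox[OF less_imp_le[OF ab]] by (simp add: ND_def n_def)
   have ND0: "0 <= ND" using n8 by (simp add: ND_def)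
   \<comment> \<open>The speed of the staircase relative to the windows: the quotient of the
     semicircles, reduced by \<open>1 - xi\<close> so that domination holds in every window.\<close>
   define kp where "kp = sig * (1 - xi) / m"
   have kp: "0 < kp" using sig0 xi4 m3 by (simp add: kp_def)
   define L where "L = max (real k * NT) (max 2 (max (m\<^sup>2) (max (2 * ND / kp) (2 / kp))))"
   have L: "real k * NT <= L" "2 <= L" "m\<^sup>2 <= L" "2 * ND / kp <= L" "2 / kp <= L" by (auto simp: L_def)
   define LD where "LD = kp * L"
   have LD: "2 * ND <= LD" "2 <= LD" using L(4,5) kp by (auto simp: LD_def field_simps)
   define r where "r = m / L"
   have r: "0 < r" "r * m <= 1" "r <= rho1 / 2"
   proof -
    show "0 < r" using L m3 by (simp add: r_def)
    show rm: "r * m <= 1" using L m3 by (simp add: r_def power2_eq_square)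
    have "2 <= rho1 * m" by (rule order_trans[OF _ mC]) (use T1 in simp)
    then have "r * m <= rho1 / 2 * m" using rm by simp
    then show "r <= rho1 / 2" using m3 by simp
   qed
   \<comment> \<open>A window of side \<open>m\<close> has about \<open>m ^ 2 / 2\<close> boxes, so
     the time \<open>2 * t / m\<close> in units of \<open>L\<close> removes about
     \<open>t * m\<close> of them; hence the factor 2.\<close>
   define s1 where "s1 q = nat \<lfloor>2 * (t q - rho1) * L / m\<rfloor>" for q
   define s2 where "s2 q = nat \<lfloor>2 * (t q + rho1) * L / m\<rfloor>" for q
   define y1 where "y1 q = real (s1 q) / L * m" for q
   define y2 where "y2 q = real (s2 q) / L * m" for q
   have L0: "0 < L" "0 < LD" using L(2) LD(2) by linarith+
   have y1: "y1 q <= 2 * (t q - rho1)" "2 * (t q - rho1) - r <= y1 q" if "q \<in> Q" for q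
    using floor_steps[of L m "2 * (t q - rho1)"] L0 m3 rho1t[OF that] unfolding y1_def s1_def r_def by auto
   have y2: "y2 q <= 2 * (t q + rho1)" "2 * (t q + rho1) - r <= y2 q" if "q \<in> Q" for q
    using floor_steps[of L m "2 * (t q + rho1)"] L0 m3 rho1 tpos[OF that] unfolding y2_def s2_def r_def by auto
   have y0: "0 <= y1 q" "0 <= y2 q" for q using L0 m3 by (simp_all add: y1_def y2_def)
   have yT: "y1 q <= 2 * (T + 1)" "y2 q <= 2 * (T + 1)" if "q \<in> Q" for q
    using y1(1)[OF that] y2(1)[OF that] tT[OF that] rho1 rho1_half by simp_all
   have sT: "real (s1 q) / L = y1 q / m" "real (s2 q) / L = y2 q / m" for q
    using m3 by (simp_all add: y1_def y2_def)
   have sD: "real (s1 q) / LD = y1 q / (sig * (1 - xi))" "real (s2 q) / LD = y2 q / (sig * (1 - xi))" for q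
    using m3 sig0 xi4 L0 by (simp_all add: y1_def y2_def LD_def kp_def)
   have s12: "s1 q <= s2 q" for q
    unfolding s1_def s2_def using rho1 L0 m3 by (intro nat_mono floor_mono divide_right_mono mult_right_mono) auto
   have okT: "sys_ok k A BB L"
    using L L0 hh nbT by (auto simp: sys_ok_def sys_box_def A_def BB_def)
   have okD: "ok1 a b LD" using ab LD nbD ND0 L0 by (simp add: ok1_iff)
   have okTi: "ok1 (A i) (BB i) L" if "i < k" for i
   proof -
    have "1 * NT <= real k * NT" using that NT0 by (intro mult_right_mono) auto
    then show ?thesis using L L0 hh nbT by (simp add: ok1_iff A_def BB_def)
   qed
   have win: "\<bar>ir x\<bar> <= X" if "i < k" "2 * A i < x" "x < 2 * BB i" for i x
   proof -
    have "\<bar>x\<bar> <= 2 * Mm + 2 * h" using that Mm[OF that(1)] by (auto simp: A_def BB_def)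
    then show ?thesis using B0 unfolding X_def by linarith
   qed
   have kap: "LD / L <= sqrt (width2 a b x / width2 (A i) (BB i) x)"
    if i: "i < k" and x: "2 * A i < x" "x < 2 * BB i" for i x
   proof -
    have w: "(sig * (1 - xi))\<^sup>2 <= width2 a b x"
     unfolding sig_def by (rule width2_window(1)[OF win[OF i x] pb pa Xb Xa]) (use xi0 xi4 in auto)
    have wT: "0 < width2 (A i) (BB i) x" by (rule width2_pos[OF x])
    have wT': "width2 (A i) (BB i) x <= m\<^sup>2"
     using width2_le_square[of "A i" "BB i" x] by (simp add: A_def BB_def m_def)
    have "(sig * (1 - xi) / m)\<^sup>2 <= width2 a b x / width2 (A i) (BB i) x"
     unfolding power_divide using w wT wT' order_trans[OF zero_le_power2 w] by (intro frac_le) auto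
    then have "sig * (1 - xi) / m <= sqrt (width2 a b x / width2 (A i) (BB i) x)" by (rule real_le_rsqrt)
    then show ?thesis using L0 by (simp add: LD_def kp_def)
   qed
   have incl: "a <= A i" "BB i <= b" if "i < k" for i
   proof -
    have "ir (2 * Mm + 2 * h + 1) <= X" "X <= ir (1 - 2 * a)" "X <= ir (2 * b + 1)"
     using B0 X16 wa wb X by (auto simp: X_def)
    then have "2 * Mm + 2 * h + 1 <= 1 - 2 * a" "2 * Mm + 2 * h + 1 <= 2 * b + 1" by linarith+
    then show "a <= A i" "BB i <= b" using Mm[OF that] by (auto simp: A_def BB_def)
   qed
   have disj: "{2 * A i<..<2 * BB i} \<inter> {2 * A j<..<2 * BB j} = {}" if "i < k" "j < k" "i \<noteq> j" for i j
   proof -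
    have "2 * h <= \<bar>M i - M j\<bar>" using far that unfolding spaced_def by blast
    then show ?thesis by (auto simp: A_def BB_def)
   qed
   have dom: "dominated k A BB L a b LD"
    unfolding dominated_def using incl disj kap by auto
   have domi: "dominated 1 (\<lambda>_. A i) (\<lambda>_. BB i) L a b LD" if "i < k" for i
    unfolding dominated1_iff using incl[OF that] kap[OF that] by auto
   define f where "f q = nat \<lfloor>t q * m\<rfloor>" for q
   have f: "real (f q) <= t q * m" "t q * m - 1 <= real (f q)" if "q \<in> Q" for q
   proof -
    have "real (f q) = ir \<lfloor>t q * m\<rfloor>" using tpos[OF that] m3 by (simp add: f_def)
    then show "real (f q) <= t q * m" "t q * m - 1 <= real (f q)" by linarith+
   qed
   have nbTi: "real (nbox (A i) (BB i)) = NT" for i by (simp add: A_def BB_def nbT)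
   have NTs: "NT * (y / m) = (m - 1) * y / 2" for y using m3 by (simp add: NT_def)
   have TN: "NT * (y / m) <= (T + 1) * m" "NT * (y / m)\<^sup>2 <= gam * m / 2" if y: "0 <= y" "y <= 2 * (T + 1)" for y
   proof -
    have "(m - 1) * y <= m * (2 * (T + 1))" using y m3 by (intro mult_mono) auto
    then show "NT * (y / m) <= (T + 1) * m" unfolding NTs by (simp add: mult_ac)
    have "NT * (y / m)\<^sup>2 = (m - 1) / m * y\<^sup>2 / 2" using m3 by (simp add: NT_def power2_eq_square)
    also have "\<dots> <= 1 * (2 * (T + 1))\<^sup>2 / 2"
     using y m3 by (intro divide_right_mono mult_mono power_mono) auto
    also have "\<dots> <= gam * m / 2" using mA unfolding power_mult_distrib by (simp add: gam_def)
    finally show "NT * (y / m)\<^sup>2 <= gam * m / 2" .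
   qed
   have m0': "0 < m" using m3 by simp
   have T1': "pr (at_pmf k A BB L (s1 q) zero_state) {w. f q < removed (A (ci q)) (BB (ci q)) (w (ci q))} <= e"
    if q: "q \<in> Q" for q
   proof -
    have "NT * (y1 q / m) + gam * m <= real (f q)"
    proof -
     have "(m - 1) * y1 q <= m * y1 q" using y0 by (intro mult_right_mono) auto
     also have "\<dots> <= m * (2 * (t q - rho1))" using y1(1)[OF q] m3 by (intro mult_left_mono) auto
     finally have "(m - 1) * y1 q / 2 <= m * (2 * (t q - rho1)) / 2" by (rule divide_right_mono) simp
     moreover have "m * (2 * (t q - rho1)) / 2 = t q * m - rho1 * m" by (simp add: field_simps)
     ultimately have "NT * (y1 q / m) <= t q * m - rho1 * m" unfolding NTs by simp
     moreover have "2 <= rho1 * m" by (rule order_trans[OF _ mC]) (use T1 in simp)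
     ultimately show ?thesis using f[OF q] unfolding gam_def by linarith
    qed
    then have "pr (at_pmf k A BB L (s1 q) zero_state) {w. f q < removed (A (ci q)) (BB (ci q)) (w (ci q))}
     <= 4 * (T + 1) / (gam\<^sup>2 * m)"
     by (intro removed_deviation(1)[OF okT ci[OF q] L(2) gam m0'])
      (simp_all only: nbTi sT TN[OF y0(1) yT(1)[OF q]])
    then show ?thesis using mB by linarith
   qed
   have T2': "pr (at_pmf k A BB L (s2 q) zero_state) {w. removed (A (ci q)) (BB (ci q)) (w (ci q)) < f q} <= e"
    if q: "q \<in> Q" for q
   proof -
    have "real (f q) <= NT * (y2 q / m) - gam * m"
    proof -
     have "(m - 1) * (2 * (t q + rho1) - r) <= (m - 1) * y2 q" using y2(2)[OF q] m3 by (intro mult_left_mono) auto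
     moreover have "(m - 1) * (2 * (t q + rho1) - r) = 2 * (t q * m) + 2 * (rho1 * m) - 2 * (t q + rho1) - r * m + r"
      by (simp add: algebra_simps)
     ultimately have "2 * (t q * m) + 2 * (rho1 * m) - 2 * (t q + rho1) - 1 <= (m - 1) * y2 q"
      using r by linarith
     then have "t q * m + rho1 * m - (t q + rho1) - 1 / 2 <= NT * (y2 q / m)" unfolding NTs by (simp add: field_simps)
     moreover have "2 * t q + 2 * rho1 + 1 <= rho1 * m" by (rule order_trans[OF _ mC]) (use tT[OF q] rho1_half in simp)
     moreover have "0 < rho1 * m" using rho1 m3 by simp
     ultimately show ?thesis using f[OF q] unfolding gam_def by linarith
    qed
    then have "pr (at_pmf k A BB L (s2 q) zero_state) {w. removed (A (ci q)) (BB (ci q)) (w (ci q)) < f q}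
     <= 4 * (T + 1) / (gam\<^sup>2 * m)"
     by (intro removed_deviation(2)[OF okT ci[OF q] L(2) gam m0'])
      (simp_all only: nbTi sT TN[OF y0(2) yT(2)[OF q]])
    then show ?thesis using mB by linarith
   qed
   \<comment> \<open>The unit for positions in the word of the large staircase: the prefix belonging
     to time \<open>t\<close> has length about \<open>t * u\<close>.\<close>
   define u where "u = n\<^sup>2 / sig"
   have un: "n <= u" using sigw(3) sig0 n8 by (simp add: u_def power2_eq_square pos_le_divide_eq)
   have gu: "real (g q) <= (t q + gam) * u" "(t q - gam) * u <= real (g q)" if "q \<in> Q" for q
   proof -
    define W where "W = real (g q) * sig / n\<^sup>2"
    have W: "real (g q) = W * u" using sig0 n8 by (simp add: u_def W_def)
    have "t q - gam <= W" "W <= t q + gam" using g[OF that] unfolding W_def abs_diff_le_iff by auto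
    moreover have "0 <= u" using un n8 by linarith
    ultimately show "real (g q) <= (t q + gam) * u" "(t q - gam) * u <= real (g q)"
     unfolding W by (auto intro: mult_right_mono)
   qed
   define nu where "nu = 1 - 1 / n"
   have NDs: "ND * (y / (sig * (1 - xi))) = u / 2 * nu * y / (1 - xi)" for y
    using sig0 n8 xi4 by (simp add: ND_def u_def nu_def field_simps power2_eq_square)
   have nu: "0 <= nu" "nu <= 1" using n8 by (auto simp: nu_def)
   have x1: "0 < 1 - xi" using xi4 by simp
   have half: "eta * n / 2 <= sig * (1 - xi)"
   proof -
    have "(eta * n) * (1 / 2) <= sig * (1 - xi)" using sigw(2) xi4 en by (intro mult_mono) auto
    then show ?thesis by simp
   qed
   have yD: "y / (sig * (1 - xi)) <= 4 * (T + 1) / (eta * n)" if "0 <= y" "y <= 2 * (T + 1)" for y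
   proof -
    have "y / (sig * (1 - xi)) <= 2 * (T + 1) / (eta * n / 2)" using that half en by (intro frac_le) auto
    then show ?thesis by simp
   qed
   have DN: "ND * (y / (sig * (1 - xi))) <= 2 * (T + 1) / eta * n" "ND * (y / (sig * (1 - xi)))\<^sup>2 <= gam * n / 2"
    if y: "0 <= y" "y <= 2 * (T + 1)" for y
   proof -
    have nd: "ND <= n * n / 2" using n8 by (simp add: ND_def)
    have yp: "0 <= y / (sig * (1 - xi))" using y sig0 x1 by simp
    have "ND * (y / (sig * (1 - xi))) <= n * n / 2 * (4 * (T + 1) / (eta * n))"
     using nd yD[OF y] yp n8 by (intro mult_mono) auto
    also have "\<dots> = 2 * (T + 1) / eta * n" using n8 eta by (simp add: field_simps)
    finally show "ND * (y / (sig * (1 - xi))) <= 2 * (T + 1) / eta * n" .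
    have "ND * (y / (sig * (1 - xi)))\<^sup>2 <= n * n / 2 * (4 * (T + 1) / (eta * n))\<^sup>2"
     using nd yD[OF y] yp n8 by (intro mult_mono power_mono) auto
    also have "\<dots> = 8 * (T + 1)\<^sup>2 / eta\<^sup>2" using n8 eta by (simp add: field_simps power2_eq_square)
    also have "\<dots> <= gam * n / 2"
    proof -
     have "64 * (T + 1)\<^sup>2 <= n * (eta\<^sup>2 * rho1)" using nC eta rho1 by (simp add: pos_divide_le_eq)
     then show ?thesis using eta by (simp add: gam_def field_simps)
    qed
    finally show "ND * (y / (sig * (1 - xi)))\<^sup>2 <= gam * n / 2" .
   qed
   have eD: "4 * (2 * (T + 1) / eta) / (gam\<^sup>2 * n) <= e"
    using nD eta gam e n8 by (simp add: field_simps)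
   have n0': "0 < n" using n8 by simp
   have u0: "0 <= u" using un n8 by linarith
   have gamu: "gam * n <= gam * u" using un gam by simp
   have comb1: "p + w <= z" if "p <= x" "y = x + v" "y <= z" "w <= v" for p w x y z v :: real using that by linarith
   have comb2: "z <= p - w" if "x <= p" "y = x - v" "z <= y" "w <= v" for p w x y z v :: real using that by linarith
   have comb3: "x - y <= u - l + e / 2" if "x <= u + e / 4" "l - e / 4 <= y" for x y u l using that by linarith
   have D1': "late1 a b LD (s1 q) (g q) <= e" if q: "q \<in> Q" for q
   proof -
    have "u / 2 * nu * y1 q / (1 - xi) <= u * (t q - rho1 / 2)"
    proof -
     have "nu * y1 q <= 1 * (2 * (t q - rho1))" using nu y0 y1(1)[OF q] by (intro mult_mono) auto
     moreover have "2 * (t q - rho1) <= (2 * t q - rho1) * (1 - xi)"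
     proof -
      have "(2 * t q - rho1) * xi <= 2 * (T + 1) * xi"
       using tT[OF q] rho1 xi0 by (intro mult_right_mono) auto
      then show ?thesis using xi rho1 by (simp add: algebra_simps)
     qed
     ultimately have "nu * y1 q / (1 - xi) <= 2 * t q - rho1" using x1 by (simp add: pos_divide_le_eq)
     then have "u / 2 * (nu * y1 q / (1 - xi)) <= u / 2 * (2 * t q - rho1)" using u0 by (intro mult_left_mono) auto
     then show ?thesis by (simp add: algebra_simps)
    qed
    moreover have "(t q - gam) * u = u * (t q - rho1 / 2) + gam * u" by (simp add: gam_def algebra_simps)
    ultimately have "ND * (y1 q / (sig * (1 - xi))) + gam * n <= real (g q)"
     unfolding NDs by (rule comb1[OF _ _ gu(2)[OF q] gamu])
    then have "late1 a b LD (s1 q) (g q) <= 4 * (2 * (T + 1) / eta) / (gam\<^sup>2 * n)"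
     by (intro removed_deviation(1)[OF okD zero_less_one LD(2) gam n0'])
      (simp_all only: nbD sD DN[OF y0(1) yT(1)[OF q]])
    then show ?thesis using eD by linarith
   qed
   have D2': "early1 a b LD (s2 q) (g q) <= e" if q: "q \<in> Q" for q
   proof -
    have "u * (t q + rho1 / 2) <= u / 2 * nu * y2 q / (1 - xi)"
    proof -
     have "4 * (T + 1) <= n * rho1" using nB rho1 by (simp add: pos_divide_le_eq)
     then have "y2 q <= rho1 / 2 * n" using yT(2)[OF q] by (simp add: field_simps)
     then have "y2 q / n <= rho1 / 2" using n0' by (simp add: pos_divide_le_eq)
     moreover have "nu * y2 q = y2 q - y2 q / n" by (simp add: nu_def algebra_simps)
     moreover have "2 * t q + 2 * rho1 - r <= y2 q" using y2(2)[OF q] by (simp add: distrib_left)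
     ultimately have "2 * t q + rho1 <= nu * y2 q" using r(3) by linarith
     moreover have "nu * y2 q <= nu * y2 q / (1 - xi)"
     proof -
      have "0 <= nu * y2 q" using nu y0 by simp
      then have "nu * y2 q * (1 - xi) <= nu * y2 q * 1" using xi0 by (intro mult_left_mono) auto
      then show ?thesis using x1 by (simp add: pos_le_divide_eq)
     qed
     ultimately have "u / 2 * (2 * t q + rho1) <= u / 2 * (nu * y2 q / (1 - xi))" using u0 by (intro mult_left_mono) auto
     then show ?thesis by (simp add: algebra_simps)
    qed
    moreover have "(t q + gam) * u = u * (t q + rho1 / 2) - gam * u" by (simp add: gam_def algebra_simps)
    ultimately have "real (g q) <= ND * (y2 q / (sig * (1 - xi))) - gam * n"
     unfolding NDs by (rule comb2[OF _ _ gu(1)[OF q] gamu])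
    then have "early1 a b LD (s2 q) (g q) <= 4 * (2 * (T + 1) / eta) / (gam\<^sup>2 * n)"
     by (intro removed_deviation(2)[OF okD zero_less_one LD(2) gam n0'])
      (simp_all only: nbD sD DN[OF y0(2) yT(2)[OF q]])
    then show ?thesis using eD by linarith
   qed
   have diff: "colmean a b LD (s2 q) (cx q + 2 * M (ci q)) - colmean (A (ci q)) (BB (ci q)) L (s1 q) (cx q + 2 * M (ci q)) <= e"
    if q: "q \<in> Q" for q
   proof -
    define c' where "c' = bet q + M (ci q)"
    have xc: "cx q + 2 * M (ci q) = 2 * c' \<or> cx q + 2 * M (ci q) = 2 * c' + 1"
     unfolding c'_def bet_def by presburger
    have c'X: "ir (2 * \<bar>c'\<bar>) <= X"
    proof -
     have "\<bar>c'\<bar> <= Mm + B" using Mm[OF ci[OF q]] betB[OF q] by (simp add: c'_def)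
     then show ?thesis using hh unfolding X_def by linarith
    qed
    have wc: "width2 (a - c') (b - c') 0 <= (sig * (1 + xi))\<^sup>2"
    proof -
     have "width2 (a - c') (b - c') 0 = width2 a b (2 * c')" by (simp add: width2_def algebra_simps)
     also have "\<dots> <= (sig * (1 + xi))\<^sup>2" unfolding sig_def
      by (rule width2_window(2)[OF _ pb pa Xb Xa]) (use c'X xi0 xi4 in auto)
     finally show ?thesis .
    qed
    have sw: "sqrt (width2 (a - c') (b - c') 0) <= sig * (1 + xi)"
     using wc sig0 xi0 by (intro real_le_lsqrt) auto
    have bn: "ir (b - c' - (a - c') + 1) = n" by (simp add: n_def)
    have "pairmean (a - c') (b - c') LD (s2 q) <= C * (real (s2 q) / LD * sqrt (width2 (a - c') (b - c') 0)) + e / 4"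
    proof (rule n1)
     show "ample n1 (eta / 2) (a - c') (b - c')"
      unfolding ample_def bn using nn1 wa wb c'X X16 X by auto
     show "2 * real (nbox (a - c') (b - c')) <= LD"
      using LD(1) nbox_shift[of a "- c'" b] by (simp add: nbD)
     show "real (s2 q) / LD * ir (b - c' - (a - c') + 1) <= YU"
     proof -
      have "y2 q / (sig * (1 - xi)) * n <= 4 * (T + 1) / (eta * n) * n"
       using yD[OF y0(2) yT(2)[OF q]] n0' by (intro mult_right_mono) auto
      also have "\<dots> = 4 * (T + 1) / eta" using n0' by simp
      also have "\<dots> <= YU" unfolding YU_def using T1 eta by (intro divide_right_mono) auto
      finally show ?thesis unfolding bn sD .
     qed
    qed
    also have "real (s2 q) / LD * sqrt (width2 (a - c') (b - c') 0) <= 2 * t q + 3 * rho1"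
    proof -
     have "real (s2 q) / LD * sqrt (width2 (a - c') (b - c') 0) <= y2 q / (sig * (1 - xi)) * (sig * (1 + xi))"
      unfolding sD using y0 sig0 x1 sw by (intro mult_left_mono) auto
     also have "\<dots> = y2 q * (1 + xi) / (1 - xi)" using sig0 by simp
     also have "\<dots> <= 2 * t q + 3 * rho1"
     proof -
      have "y2 q * (1 + xi) <= (2 * (t q + rho1)) * (1 + xi)" using y2(1)[OF q] xi0 by (intro mult_right_mono) auto
      also have "\<dots> <= (2 * t q + 3 * rho1) * (1 - xi)"
      proof -
       have "(4 * t q + 5 * rho1) * xi <= 8 * (T + 1) * xi"
        using tT[OF q] T1 rho1_half xi0 by (intro mult_right_mono) auto
       then show ?thesis using xi by (simp add: algebra_simps)
      qed
      finally show ?thesis using x1 by (simp add: pos_divide_le_eq)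
     qed
     finally show ?thesis .
    qed
    finally have up: "pairmean (a - c') (b - c') LD (s2 q) <= C * (2 * t q + 3 * rho1) + e / 4"
     using C by simp
    have "C * (real (s1 q) / L * ir (2 * h + 1)) - e / 4 <= pairmean (- bet q - h) (- bet q + h) L (s1 q)"
    proof (rule hL[OF hh(1)])
     show "\<bar>- bet q\<bar> <= B" using betB[OF q] by simp
     show "real (nbox (- bet q - h) (- bet q + h)) <= L"
      using okTi[OF ci[OF q]] unfolding nbT by (simp add: ok1_iff nbTi)
     show "real (s1 q) / L * ir (2 * h + 1) <= YL"
      using yT(1)[OF q] unfolding y1_def m_def YL_def .
    qed
    moreover have "C * (2 * t q - 5 / 2 * rho1) <= C * (real (s1 q) / L * ir (2 * h + 1))"
     using y1(2)[OF q] r(3) C unfolding y1_def m_def[symmetric] by (intro mult_left_mono) auto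
    moreover have "- bet q - h = A (ci q) - c'" "- bet q + h = BB (ci q) - c'" by (simp_all add: A_def BB_def c'_def)
    ultimately have lo: "C * (2 * t q - 5 / 2 * rho1) - e / 4 <= pairmean (A (ci q) - c') (BB (ci q) - c') L (s1 q)" by simp
    have "colmean a b LD (s2 q) (cx q + 2 * M (ci q)) - colmean (A (ci q)) (BB (ci q)) L (s1 q) (cx q + 2 * M (ci q))
     <= pairmean (a - c') (b - c') LD (s2 q) - pairmean (A (ci q) - c') (BB (ci q) - c') L (s1 q)"
     by (rule colmean_diff_le_pair[OF domi[OF ci[OF q]] okTi[OF ci[OF q]] okD s12 xc])
    also have "\<dots> <= C * (2 * t q + 3 * rho1) - C * (2 * t q - 5 / 2 * rho1) + e / 2" by (rule comb3[OF up lo])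
    also have "\<dots> = 11 / 2 * (C * rho1) + e / 2" by (simp add: algebra_simps)
    also have "\<dots> <= 6 * C * rho1 + e / 2" using C rho1 by simp
    also have "\<dots> <= e" using rho1C by linarith
    finally show ?thesis .
   qed
   have "\<bar>word_prob a b Q (\<lambda>q. cx q + 2 * M (ci q)) cj g
     - (\<Prod>i<k. word_prob (A i) (BB i) {q\<in>Q. ci q = i} (\<lambda>q. cx q + 2 * M (ci q)) cj f)\<bar> <= 3 * real (card Q) * e"
    by (rule word_prob_sandwich[OF dom okT okD Q ci s12 T1' T2' D1' D2' diff])
   moreover have "word_prob (A i) (BB i) {q\<in>Q. ci q = i} (\<lambda>q. cx q + 2 * M (ci q)) cj f
     = window_word_prob h {q\<in>Q. ci q = i} cx cj t" for i
   proof -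
    have "word_prob (A i) (BB i) {q\<in>Q. ci q = i} (\<lambda>q. cx q + 2 * M (ci q)) cj f
     = word_prob (- h + M i) (h + M i) {q\<in>Q. ci q = i} (\<lambda>q. cx q + 2 * M i) cj f"
    proof -
     have "A i = - h + M i" "BB i = h + M i" by (simp_all add: A_def BB_def)
     then show ?thesis by (simp only:) (rule word_prob_cong, auto)
    qed
    also have "\<dots> = word_prob (- h) h {q\<in>Q. ci q = i} cx cj f"
     by (rule word_prob_shift) (use hh in simp)
    finally show ?thesis by (simp add: f_def[abs_def] m_def window_word_prob_def)
   qed
   ultimately show "\<bar>word_prob a b Q (\<lambda>q. cx q + 2 * M (ci q)) cj g - (\<Prod>i<k. window_word_prob h {q\<in>Q. ci q = i} cx cj t)\<bar> <= eps"
    using e3 by simp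
  qed
 qed
qed

subsection \<open>Linear extensions of the staircase\<close>

definition box :: "int => nat => hpoint" where
 "box x j = Abs_hpoint (x, 2 * int j + (if odd x then 1 else 2))"

definition hcol :: "hpoint => int" where "hcol z = fst (Rep_hpoint z)"

definition hidx :: "hpoint => nat" where "hidx z = nat ((snd (Rep_hpoint z) - 1) div 2)"

lemma Rep_box: "Rep_hpoint (box x j) = (x, 2 * int j + (if odd x then 1 else 2))"
 unfolding box_def by (rule Abs_hpoint_inverse) auto

lemma hcol_box [simp]: "hcol (box x j) = x" and hidx_box [simp]: "hidx (box x j) = j"
 by (simp_all add: hcol_def hidx_def Rep_box)

lemma snd_Rep: "snd (Rep_hpoint z) = 2 * int (hidx z) + (if odd (hcol z) then 1 else 2)"
proof -
 obtain x y where xy: "Rep_hpoint z = (x, y)" by fastforce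
 have "1 <= y" "even (x + y)" using Rep_hpoint[of z] by (auto simp: xy)
 then show ?thesis unfolding hcol_def hidx_def xy fst_conv snd_conv
  by (simp add: nat_0_le) presburger
qed

lemma box_eq: "box (hcol z) (hidx z) = z"
 using snd_Rep[of z] by (intro Rep_hpoint_inject[THEN iffD1]) (simp add: Rep_box hcol_def prod_eq_iff)

lemma hpoint_le_iff: "z <= w \<longleftrightarrow> \<bar>hcol z - hcol w\<bar> <= snd (Rep_hpoint w) - snd (Rep_hpoint z)"
 by (auto simp: less_eq_hpoint_def rot_le_def hcol_def)

definition stairs :: "int => int => hpoint set" where
 "stairs a b = {z. hcol z + snd (Rep_hpoint z) <= 2 * b \<and> snd (Rep_hpoint z) - hcol z <= - 2 * a}"

definition unfilled :: "int => int => (int => nat) => hpoint set" where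
 "unfilled a b m = {z \<in> stairs a b. m (hcol z) <= hidx z}"

text \<open>The second coordinate of the lowest remaining box of a column. In these terms the parity
  cases disappear: neighbouring heights differ by exactly one, and corners are the strict local
  minima.\<close>

definition height :: "(int => nat) => int => int" where
 "height m x = 2 * int (m x) + (if odd x then 1 else 2)"

lemma staircase_eq_stairs:
 assumes "2 * a = c - int n + 1" "2 * b = c + int n - 1"
 shows "staircase c n = stairs a b"
 unfolding staircase_def stairs_def rot_le_def hcol_def using assms by auto

lemma stairs_down: "w <= z ==> z \<in> stairs a b ==> w \<in> stairs a b"
 by (auto simp: stairs_def hpoint_le_iff)

lemma stairs_col: "z \<in> stairs a b ==> 2 * a < hcol z \<and> hcol z < 2 * b"
proof -
 assume "z \<in> stairs a b"
 moreover have "1 <= snd (Rep_hpoint z)" using snd_Rep[of z] by simp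
 ultimately show ?thesis by (auto simp: stairs_def)
qed

lemma finite_stairs: "finite (stairs a b)"
proof (rule finite_subset)
 show "stairs a b \<subseteq> (\<lambda>(x, j). box x j) ` ({2 * a..2 * b} \<times> {..nat (2 * b - 2 * a)})"
 proof
  fix z assume z: "z \<in> stairs a b"
  have "int (hidx z) <= 2 * b - 2 * a" using z stairs_col[OF z] snd_Rep[of z] by (auto simp: stairs_def split: if_splits)
  then have "(hcol z, hidx z) \<in> {2 * a..2 * b} \<times> {..nat (2 * b - 2 * a)}" using stairs_col[OF z] by auto
  then show "z \<in> (\<lambda>(x, j). box x j) ` ({2 * a..2 * b} \<times> {..nat (2 * b - 2 * a)})"
   by (rule rev_image_eqI) (simp add: box_eq)
 qed
qed simp

lemma height_step:
 assumes v: "valid a b m" and x: "2 * a <= x" "x < 2 * b"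
 shows "height m (x + 1) = height m x + 1 \<or> height m (x + 1) = height m x - 1"
proof (cases "odd x")
 case True
 have "2 * a < x" using True x by presburger
 from valid_odd[OF v True this x(2)] show ?thesis using True by (auto simp: height_def)
next
 case False
 then show ?thesis using valid_even(1)[OF v, of x] x by (auto simp: height_def)
qed

lemma height_lipschitz:
 assumes v: "valid a b m" and x: "2 * a <= x" "x + int d <= 2 * b"
 shows "\<bar>height m (x + int d) - height m x\<bar> <= int d"
 using x(2)
proof (induction d)
 case (Suc d)
 have "height m (x + int d + 1) = height m (x + int d) + 1 \<or> height m (x + int d + 1) = height m (x + int d) - 1"
  by (rule height_step[OF v]) (use x Suc.prems in auto)
 then show ?case using Suc by (auto simp: add.assoc add.commute[of 1])
qed simp

lemma height_lipschitz':
 assumes v: "valid a b m" and x: "2 * a <= x" "x <= 2 * b" "2 * a <= w" "w <= 2 * b"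
 shows "\<bar>height m w - height m x\<bar> <= \<bar>w - x\<bar>"
proof (cases "x <= w")
 case True
 show ?thesis using height_lipschitz[OF v x(1), of "nat (w - x)"] True x by simp
next
 case False
 show ?thesis using height_lipschitz[OF v x(3), of "nat (x - w)"] False x by (simp add: abs_minus_commute)
qed

lemma corner_height:
 assumes v: "valid a b m" and ab: "a < b"
 shows "x \<in> corners a b m \<longleftrightarrow> 2 * a < x \<and> x < 2 * b \<and> height m (x + 1) = height m x + 1 \<and> height m (x - 1) = height m x + 1"
 unfolding corner_cases[OF v ab, of x] by (auto simp: height_def)

lemma Rep_box_height: "snd (Rep_hpoint (box x (m x))) = height m x"
 by (simp add: Rep_box height_def)

lemma unfilled_height: "z \<in> unfilled a b m \<longleftrightarrow> z \<in> stairs a b \<and> height m (hcol z) <= snd (Rep_hpoint z)"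
 by (auto simp: unfilled_def height_def snd_Rep)

text \<open>Heights change by at most one per column and both neighbours of a corner are one higher,
  so a remaining box in another column is too high to lie below the corner box.\<close>

lemma corner_box_minimal:
 assumes v: "valid a b m" and ab: "a < b" and x: "x \<in> corners a b m"
 shows "box x (m x) \<in> unfilled a b m" and "w \<in> unfilled a b m ==> w <= box x (m x) ==> w = box x (m x)"
proof -
 have c: "2 * a < x" "x < 2 * b" "height m (x + 1) = height m x + 1" "height m (x - 1) = height m x + 1"
  using x corner_height[OF v ab, of x] by auto
 have "height m (x + 1) <= 2 + 2 * b - (x + 1)" "height m (x - 1) <= 2 + (x - 1) - 2 * a"
  using profile_bound(1)[OF v, of "x + 1"] profile_bound(2)[OF v, of "x - 1"] c by (simp_all add: height_def)
 then show "box x (m x) \<in> unfilled a b m"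
  using c by (simp add: unfilled_height stairs_def Rep_box_height)
 show "w = box x (m x)" if w: "w \<in> unfilled a b m" "w <= box x (m x)"
 proof -
  define y where "y = hcol w"
  have wT: "w \<in> stairs a b" and wh: "height m y <= snd (Rep_hpoint w)" using w(1) by (auto simp: unfilled_height y_def)
  have le: "\<bar>y - x\<bar> <= height m x - snd (Rep_hpoint w)" using w(2) by (simp add: hpoint_le_iff Rep_box_height y_def)
  have y: "2 * a < y" "y < 2 * b" using stairs_col[OF wT] by (auto simp: y_def)
  have "y = x"
  proof (rule ccontr)
   assume "y \<noteq> x"
   then consider "y < x" | "x < y" by linarith
   then show False
   proof cases
    case 1
    have "\<bar>height m y - height m (x - 1)\<bar> <= \<bar>y - (x - 1)\<bar>" by (rule height_lipschitz'[OF v]) (use c y in auto)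
    then show ?thesis using 1 le wh c by linarith
   next
    case 2
    have "\<bar>height m y - height m (x + 1)\<bar> <= \<bar>y - (x + 1)\<bar>" by (rule height_lipschitz'[OF v]) (use c y in auto)
    then show ?thesis using 2 le wh c by linarith
   qed
  qed
  then have "snd (Rep_hpoint w) = height m x" using le wh by simp
  then have "Rep_hpoint w = Rep_hpoint (box x (m x))"
   using \<open>y = x\<close> by (simp add: prod_eq_iff Rep_box_height) (simp add: y_def hcol_def Rep_box)
  then show ?thesis by (simp add: Rep_hpoint_inject)
 qed
qed

text \<open>A neighbouring column of smaller height would contain a remaining box below
  \<open>z\<close>, so both neighbours are higher.\<close>

lemma minimal_is_corner_box:
 assumes v: "valid a b m" and ab: "a < b" and z: "z \<in> unfilled a b m"
  and min: "\<And>w. w \<in> unfilled a b m ==> w <= z ==> w = z"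
 shows "hcol z \<in> corners a b m" "z = box (hcol z) (m (hcol z))"
proof -
 define x where "x = hcol z"
 have zT: "z \<in> stairs a b" and zh: "height m x <= snd (Rep_hpoint z)" using z by (auto simp: unfilled_height x_def)
 have x: "2 * a < x" "x < 2 * b" using stairs_col[OF zT] by (auto simp: x_def)
 have low: "box y (m y) = z" if "\<bar>y - x\<bar> <= snd (Rep_hpoint z) - height m y" for y
 proof (rule min)
  show le: "box y (m y) <= z" using that by (simp add: hpoint_le_iff Rep_box_height x_def)
  show "box y (m y) \<in> unfilled a b m" using stairs_down[OF le zT] by (simp add: unfilled_height Rep_box_height)
 qed
 have zx: "box x (m x) = z" using low[of x] zh by simp
 then show "z = box (hcol z) (m (hcol z))" by (simp add: x_def)
 have zs: "snd (Rep_hpoint z) = height m x" unfolding zx[symmetric] by (rule Rep_box_height)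
 have nb: "height m y \<noteq> height m x - 1" if "\<bar>y - x\<bar> = 1" for y
 proof
  assume "height m y = height m x - 1"
  then have "box y (m y) = z" using low[of y] that zs by simp
  then have "y = x" unfolding x_def by auto
  then show False using that by simp
 qed
 have "height m (x + 1) = height m x + 1" using height_step[OF v, of x] nb[of "x + 1"] x by auto
 moreover have "height m (x - 1) = height m x + 1" using height_step[OF v, of "x - 1"] nb[of "x - 1"] x by auto
 ultimately show "hcol z \<in> corners a b m" using x unfolding corner_height[OF v ab] x_def by auto
qed

section \<open>Linear extensions and the removal chain\<close>

definition linear_extensions :: "'a::order set => 'a list set" where
 "linear_extensions S = {zs. distinct zs \<and> set zs = S \<and> sorted_wrt (\<lambda>z w. \<not> w <= z) zs}"

lemma linear_extensions_empty: "linear_extensions {} = {[]}"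
 by (auto simp: linear_extensions_def)

lemma finite_linear_extensions: "finite S ==> finite (linear_extensions S)"
 by (rule finite_subset[OF _ finite_subset_distinct[of S]]) (auto simp: linear_extensions_def)

lemma linear_extensions_rec:
 assumes "S \<noteq> {}"
 shows "linear_extensions S = (\<Union>z\<in>{z\<in>S. \<forall>w\<in>S. w <= z --> w = z}. (#) z ` linear_extensions (S - {z}))"
proof (rule set_eqI)
 fix zs
 show "zs \<in> linear_extensions S \<longleftrightarrow> zs \<in> (\<Union>z\<in>{z\<in>S. \<forall>w\<in>S. w <= z --> w = z}. (#) z ` linear_extensions (S - {z}))"
 proof (cases zs)
  case Nil
  then show ?thesis using assms by (auto simp: linear_extensions_def)
 next
  case (Cons z ws)
  have "z # ws \<in> linear_extensions S \<longleftrightarrow> z \<in> S \<and> (\<forall>w\<in>S. w <= z --> w = z) \<and> ws \<in> linear_extensions (S - {z})"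
   by (auto simp: linear_extensions_def)
  then show ?thesis unfolding Cons by auto
 qed
qed

lemma unfilled_upd:
 "unfilled a b (m(x := m x + 1)) = unfilled a b m - {box x (m x)}"
proof -
 have key: "z = box x (m x) \<longleftrightarrow> hcol z = x \<and> hidx z = m x" for z using box_eq[of z] by auto
 show ?thesis
 proof (rule set_eqI)
  fix z
  show "z \<in> unfilled a b (m(x := m x + 1)) \<longleftrightarrow> z \<in> unfilled a b m - {box x (m x)}"
   by (cases "hcol z = x") (auto simp: unfilled_def key)
 qed
qed

lemma unfilled_extensions_rec:
 assumes v: "valid a b m" and ab: "a < b" and ne: "unfilled a b m \<noteq> {}"
 shows "linear_extensions (unfilled a b m)
  = (\<Union>x\<in>corners a b m. (#) (box x (m x)) ` linear_extensions (unfilled a b (m(x := m x + 1))))"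
proof -
 have "{z\<in>unfilled a b m. \<forall>w\<in>unfilled a b m. w <= z --> w = z} = (\<lambda>x. box x (m x)) ` corners a b m"
 proof (intro set_eqI iffI)
  fix z assume "z \<in> {z\<in>unfilled a b m. \<forall>w\<in>unfilled a b m. w <= z --> w = z}"
  then have z: "z \<in> unfilled a b m" "\<And>w. w \<in> unfilled a b m ==> w <= z ==> w = z" by auto
  have "hcol z \<in> corners a b m" "z = box (hcol z) (m (hcol z))"
   by (rule minimal_is_corner_box[OF v ab z(1)]; use z(2) in blast)+
  then show "z \<in> (\<lambda>x. box x (m x)) ` corners a b m" by (rule rev_image_eqI)
 next
  fix z assume "z \<in> (\<lambda>x. box x (m x)) ` corners a b m"
  then obtain x where x: "x \<in> corners a b m" "z = box x (m x)" by auto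
  show "z \<in> {z\<in>unfilled a b m. \<forall>w\<in>unfilled a b m. w <= z --> w = z}"
   unfolding x(2) mem_Collect_eq using corner_box_minimal(1)[OF v ab x(1)] corner_box_minimal(2)[OF v ab x(1)] by blast
 qed
 then show ?thesis unfolding linear_extensions_rec[OF ne] by (simp add: unfilled_upd)
qed

lemma finite_unfilled: "finite (unfilled a b m)"
 by (rule finite_subset[OF _ finite_stairs]) (auto simp: unfilled_def)

text \<open>Counted through the rates: they are positive, their total is
  \<open>nbox a b - removed a b m\<close>, and a nonempty remaining shape has a minimal box, hence a
  corner.\<close>

lemma unfilled_empty_iff:
 assumes v: "valid a b m" and ab: "a < b"
 shows "unfilled a b m = {} \<longleftrightarrow> removed a b m = nbox a b"
proof
 assume e: "unfilled a b m = {}"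
 have "corners a b m = {}" using corner_box_minimal(1)[OF v ab] e by blast
 then show "removed a b m = nbox a b" using sum_rates[OF v ab] by simp
next
 assume r: "removed a b m = nbox a b"
 have "corners a b m = {}"
 proof (rule ccontr)
  assume "corners a b m \<noteq> {}"
  then have "0 < (\<Sum>x\<in>corners a b m. rate a b m x)" by (intro sum_pos finite_corners[OF v ab]) auto
  then show False using sum_rates[OF v ab] r by simp
 qed
 show "unfilled a b m = {}"
 proof (rule ccontr)
  assume "unfilled a b m \<noteq> {}"
  then obtain z where z: "z \<in> unfilled a b m" "\<And>w. w \<in> unfilled a b m ==> w <= z ==> z = w"
   using finite_has_minimal[OF finite_unfilled, of a b m] by auto
  from minimal_is_corner_box(1)[OF v ab z(1)] z(2) \<open>corners a b m = {}\<close> show False by auto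
 qed
qed

text \<open>Transition probabilities and rates satisfy the same exchange relation \<open>rate_exchange\<close> and both
 sum to one after division by the number of remaining boxes, which forces them to agree.\<close>

lemma extensions_rate:
 assumes ab: "a < b"
 shows "valid a b m ==> r = nbox a b - removed a b m ==>
  0 < card (linear_extensions (unfilled a b m)) \<and>
  (\<forall>x\<in>corners a b m. rate a b m x * real (card (linear_extensions (unfilled a b m)))
   = real r * real (card (linear_extensions (unfilled a b (m(x := m x + 1))))))"
proof (induction r arbitrary: m)
 case 0
 have "unfilled a b m = {}" using unfilled_empty_iff[OF 0(1) ab] removed_le[OF 0(1) ab] 0(2) by simp
 moreover have "corners a b m = {}" using corner_box_minimal(1)[OF 0(1) ab] calculation by blast
 ultimately show ?case by (simp add: linear_extensions_empty)
next
 case (Suc r)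
 note v = Suc.prems(1)
 let ?u = "\<lambda>x. m(x := m x + 1)"
 define f where "f m = real (card (linear_extensions (unfilled a b m)))" for m
 have ne: "unfilled a b m \<noteq> {}" using unfilled_empty_iff[OF v ab] Suc.prems(2) by auto
 have IH: "0 < f (?u x)" "\<And>y. y \<in> corners a b (?u x) ==> rate a b (?u x) y * f (?u x) = real r * f ((?u x)(y := (?u x) y + 1))"
  if x: "x \<in> corners a b m" for x
 proof -
  have "r = nbox a b - removed a b (?u x)" using removed_upd[OF v ab x] Suc.prems(2) by simp
  from Suc.IH[of "?u x", OF valid_upd[OF v ab x] this]
  have IH: "0 < f (?u x) \<and> (\<forall>y\<in>corners a b (?u x). rate a b (?u x) y * f (?u x) = real r * f ((?u x)(y := (?u x) y + 1)))"
   unfolding f_def of_nat_0_less_iff .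
  show "0 < f (?u x)" by (rule conjunct1[OF IH])
  show "rate a b (?u x) y * f (?u x) = real r * f ((?u x)(y := (?u x) y + 1))" if "y \<in> corners a b (?u x)" for y
   by (rule bspec[OF conjunct2[OF IH] that])
 qed
 have fsum: "f m = (\<Sum>x\<in>corners a b m. f (?u x))"
 proof -
  have "card (linear_extensions (unfilled a b m)) = (\<Sum>x\<in>corners a b m. card ((#) (box x (m x)) ` linear_extensions (unfilled a b (?u x))))"
   unfolding unfilled_extensions_rec[OF v ab ne]
  proof (rule card_UN_disjoint[OF finite_corners[OF v ab]])
   show "\<forall>i\<in>corners a b m. finite ((#) (box i (m i)) ` linear_extensions (unfilled a b (?u i)))"
    by (intro ballI finite_imageI finite_linear_extensions finite_unfilled)
   show "\<forall>i\<in>corners a b m. \<forall>j\<in>corners a b m. i \<noteq> j -->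
     (#) (box i (m i)) ` linear_extensions (unfilled a b (?u i)) \<inter> (#) (box j (m j)) ` linear_extensions (unfilled a b (?u j)) = {}"
   proof (intro ballI impI equals0I)
    fix i j ws assume "i \<noteq> j"
     and "ws \<in> (#) (box i (m i)) ` linear_extensions (unfilled a b (?u i)) \<inter> (#) (box j (m j)) ` linear_extensions (unfilled a b (?u j))"
    then have "hd ws = box i (m i)" "hd ws = box j (m j)" by auto
    then have "hcol (hd ws) = i" "hcol (hd ws) = j" using hcol_box by metis+
    then show False using \<open>i \<noteq> j\<close> by simp
   qed
  qed
  then show ?thesis unfolding f_def by (simp add: card_image)
 qed
 have exch: "rate a b m x * f (?u y) = rate a b m y * f (?u x)" if x: "x \<in> corners a b m" and y: "y \<in> corners a b m" for x y
 proof (cases "x = y")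
  case False
  define alp bet alp' bet' K where "alp = rate a b m x" and "bet = rate a b m y" and "alp' = rate a b (?u x) y" and "bet' = rate a b (?u y) x"
   and "K = real r * f ((?u x)(y := m y + 1))"
  have K1: "alp' * f (?u x) = K" using IH(2)[OF x corner_upd[OF v ab x y False]] False by (simp add: K_def alp'_def)
  have tw: "(?u y)(x := m x + 1) = (?u x)(y := m y + 1)" using False by (simp add: fun_upd_twist)
  have K2: "bet' * f (?u y) = K"
   using IH(2)[OF y corner_upd[OF v ab y x]] False by (simp add: K_def bet'_def tw)
  have ex: "alp * alp' = bet * bet'" unfolding alp_def bet_def alp'_def bet'_def by (rule rate_exchange[OF v ab x y])
  have p: "0 < alp'" "0 < bet'" by (simp_all add: alp'_def bet'_def)
  \<comment> \<open>Both orders of removing \<open>x\<close> and \<open>y\<close> lead to the same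
    shape, whose count enters through \<open>K\<close>; the positive factors \<open>alp'\<close> and
    \<open>bet'\<close> cancel at the end.\<close>
  have "(alp * f (?u y)) * (alp' * bet') = (alp * alp') * (bet' * f (?u y))" by simp
  also have "\<dots> = (bet * bet') * (alp' * f (?u x))" unfolding ex K1 K2 ..
  also have "\<dots> = (bet * f (?u x)) * (alp' * bet')" by simp
  finally show ?thesis using p unfolding alp_def bet_def by simp
 qed simp
 have rem: "(\<Sum>y\<in>corners a b m. rate a b m y) = real (Suc r)"
  using sum_rates[OF v ab] removed_le[OF v ab] Suc.prems(2) by (simp add: of_nat_diff)
 have main: "rate a b m x * f m = real (Suc r) * f (?u x)" if x: "x \<in> corners a b m" for x
 proof -
  have "rate a b m x * f m = (\<Sum>y\<in>corners a b m. rate a b m y * f (?u x))"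
   unfolding fsum sum_distrib_left by (rule sum.cong[OF refl exch[OF x]])
  also have "\<dots> = real (Suc r) * f (?u x)" unfolding sum_distrib_right[symmetric] rem ..
  finally show ?thesis .
 qed
 have "corners a b m \<noteq> {}" using rem by (auto simp del: of_nat_Suc)
 then have "0 < f m" unfolding fsum using IH(1) by (intro sum_pos finite_corners[OF v ab])
 then show ?case using main unfolding f_def of_nat_0_less_iff by blast
qed

text \<open>It suffices to bound the uniform mass from above by the mass of the chain, as
  \<open>rel_pmf_agree_on\<close> on the whole type turns domination into equality. Hence only one
  term of the mixture over first corners has to be estimated.\<close>

lemma map_pmf_extensions_word:
 assumes ab: "a < b"
 shows "valid a b m ==> r = nbox a b - removed a b m ==>
  map_pmf (map hcol) (pmf_of_set (linear_extensions (unfilled a b m))) = word_pmf a b r m"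
proof (induction r arbitrary: m)
 case 0
 have "unfilled a b m = {}" using unfilled_empty_iff[OF 0(1) ab] removed_le[OF 0(1) ab] 0(2) by simp
 then show ?case by (simp add: linear_extensions_empty pmf_of_set_singleton)
next
 case (Suc r)
 note v = Suc.prems(1)
 let ?u = "\<lambda>x. m(x := m x + 1)" and ?E = "\<lambda>m. linear_extensions (unfilled a b m)"
 have ne: "unfilled a b m \<noteq> {}" using unfilled_empty_iff[OF v ab] Suc.prems(2) by auto
 have rlt: "removed a b m < nbox a b" using Suc.prems(2) by simp
 have rem: "real (nbox a b) - real (removed a b m) = real (Suc r)" using Suc.prems(2) rlt by (simp add: of_nat_diff)
 have c: "0 < card (?E m)" "\<And>x. x \<in> corners a b m ==> rate a b m x * real (card (?E m)) = real (Suc r) * real (card (?E (?u x)))"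
  using extensions_rate[OF ab v Suc.prems(2)] by auto
 have cu: "0 < card (?E (?u x))" "r = nbox a b - removed a b (?u x)" if x: "x \<in> corners a b m" for x
 proof -
  show r: "r = nbox a b - removed a b (?u x)" using removed_upd[OF v ab x] Suc.prems(2) by simp
  show "0 < card (?E (?u x))" using extensions_rate[OF ab valid_upd[OF v ab x] r] by auto
 qed
 let ?B = "bind_pmf (corner_pmf a b m) (\<lambda>x. map_pmf (Cons (box x (m x))) (pmf_of_set (?E (?u x))))"
 have fin: "finite (?E m)" for m by (intro finite_linear_extensions finite_unfilled)
 have neE: "?E m \<noteq> {}" using c(1) by auto
 have neEu: "?E (?u x) \<noteq> {}" if "x \<in> corners a b m" for x using cu(1)[OF that] by auto
 have "rel_pmf (\<lambda>zs ws. zs \<in> UNIV --> ws = zs) (pmf_of_set (?E m)) ?B"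
 proof (rule rel_pmf_agree_on)
  fix zs
  show "pmf (pmf_of_set (?E m)) zs <= pmf ?B zs"
  proof (cases "zs \<in> ?E m")
   case False
   then show ?thesis using neE fin by simp
  next
   case True
   then obtain x ws where x: "x \<in> corners a b m" and zs: "zs = box x (m x) # ws" and ws: "ws \<in> ?E (?u x)"
    unfolding unfilled_extensions_rec[OF v ab ne] by auto
   let ?g = "\<lambda>x. map_pmf (Cons (box x (m x))) (pmf_of_set (?E (?u x)))"
   have "pmf (?g x) zs = 1 / real (card (?E (?u x)))"
    unfolding zs using ws neEu[OF x] fin by (subst pmf_map_inj') auto
   moreover have "pmf (corner_pmf a b m) x = rate a b m x / real (Suc r)"
    using x unfolding pmf_corner_pmf[OF v ab rlt] rem by simp
   moreover have "rate a b m x / real (Suc r) * (1 / real (card (?E (?u x)))) = 1 / real (card (?E m))"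
    using c(2)[OF x] c(1) cu(1)[OF x] by (simp add: field_simps del: of_nat_Suc)
   ultimately have "1 / real (card (?E m)) = pmf (corner_pmf a b m) x * pmf (?g x) zs" by simp
   also have "\<dots> <= pmf ?B zs"
   proof -
    have "pmf (corner_pmf a b m) x * pmf (?g x) zs = measure_pmf.expectation (corner_pmf a b m) (\<lambda>y. indicator {x} y * pmf (?g x) zs)"
     by (simp add: measure_pmf_single)
    also have "\<dots> <= measure_pmf.expectation (corner_pmf a b m) (\<lambda>y. pmf (?g y) zs)"
     by (rule integral_mono)
      (auto intro!: measure_pmf.integrable_const_bound[where B = 1] simp: pmf_le_1 indicator_def)
    finally show ?thesis by (simp add: pmf_bind)
   qed
   finally show ?thesis using True neE fin by simp
  qed
 qed
 then have "rel_pmf (=) (pmf_of_set (?E m)) ?B" by (rule pmf.rel_mono_strong) auto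
 then have eq: "pmf_of_set (?E m) = ?B" by (simp add: pmf.rel_eq)
 have "map_pmf (map hcol) (pmf_of_set (?E m)) = bind_pmf (corner_pmf a b m) (\<lambda>x. map_pmf (Cons x) (map_pmf (map hcol) (pmf_of_set (?E (?u x)))))"
  unfolding eq by (simp add: map_bind_pmf pmf.map_comp o_def)
 also have "\<dots> = bind_pmf (corner_pmf a b m) (\<lambda>x. map_pmf (Cons x) (word_pmf a b r (?u x)))"
 proof (rule bind_pmf_cong[OF refl])
  fix x assume "x \<in> set_pmf (corner_pmf a b m)"
  then have x: "x \<in> corners a b m" using set_corner_pmf[OF v ab rlt] by auto
  show "map_pmf (Cons x) (map_pmf (map hcol) (pmf_of_set (?E (?u x)))) = map_pmf (Cons x) (word_pmf a b r (?u x))"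
   unfolding Suc.IH[of "?u x", OF valid_upd[OF v ab x] cu(2)[OF x]] ..
 qed
 finally show ?case by simp
qed

lemma length_word_pmf: "w \<in> set_pmf (word_pmf a b r m) ==> length w = r"
 by (induction r arbitrary: m w) auto

lemma unfilled_zero: "unfilled a b (\<lambda>_. 0) = stairs a b"
 by (simp add: unfilled_def)

text \<open>The number of boxes is read off from the chain: an extension lists every box once, and
  its word has length \<open>nbox a b\<close>.\<close>

lemma map_pmf_stairs_word:
 assumes ab: "a < b"
 shows "linear_extensions (stairs a b) \<noteq> {}"
  and "map_pmf (map hcol) (pmf_of_set (linear_extensions (stairs a b))) = word_pmf a b (nbox a b) (\<lambda>_. 0)"
  and "card (stairs a b) = nbox a b"
proof -
 let ?E = "linear_extensions (stairs a b)"
 have r: "nbox a b = nbox a b - removed a b (\<lambda>_. 0)" by simp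
 have "0 < card ?E" using extensions_rate[OF ab valid_zero r] by (simp add: unfilled_zero)
 then show ne: "?E \<noteq> {}" by auto
 have fin: "finite ?E" by (rule finite_linear_extensions[OF finite_stairs])
 show w: "map_pmf (map hcol) (pmf_of_set ?E) = word_pmf a b (nbox a b) (\<lambda>_. 0)"
  using map_pmf_extensions_word[OF ab valid_zero r] by (simp add: unfilled_zero)
 obtain zs where zs: "zs \<in> ?E" using ne by blast
 have "map hcol zs \<in> set_pmf (word_pmf a b (nbox a b) (\<lambda>_. 0))"
  unfolding w[symmetric] using zs ne fin by simp
 then have "length zs = nbox a b" using length_word_pmf by fastforce
 moreover have "distinct zs" "set zs = stairs a b" using zs by (auto simp: linear_extensions_def)
 ultimately show "card (stairs a b) = nbox a b" using distinct_card by metis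
qed

section \<open>Tableaux as ranks in linear extensions\<close>

definition list_rank :: "'a list => 'a => nat" where
 "list_rank zs = restrict (\<lambda>z. Suc (the_inv_into {..<length zs} ((!) zs) z)) (set zs)"

lemma list_rank_nth:
 assumes "distinct zs" "i < length zs"
 shows "list_rank zs (zs ! i) = Suc i"
proof -
 have "inj_on ((!) zs) {..<length zs}" using assms(1) by (simp add: inj_on_nth)
 then show ?thesis using assms(2) by (simp add: list_rank_def the_inv_into_f_f)
qed

lemma list_rank_bij:
 assumes S: "finite S"
 shows "bij_betw list_rank (linear_extensions S)
  {G \<in> extensional S. bij_betw G S {1..card S} \<and> mono_on S G}"
proof (rule bij_betwI')
 fix zs ws :: "'a list" assume zs: "zs \<in> linear_extensions S" and ws: "ws \<in> linear_extensions S"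
 show "list_rank zs = list_rank ws \<longleftrightarrow> zs = ws"
 proof
  assume eq: "list_rank zs = list_rank ws"
  have d: "distinct zs" "distinct ws" "set zs = S" "set ws = S" using zs ws by (auto simp: linear_extensions_def)
  have l: "length zs = length ws" using d distinct_card by metis
  show "zs = ws"
  proof (rule nth_equalityI[OF l])
   fix i assume i: "i < length zs"
   have "zs ! i \<in> set ws" using nth_mem[OF i] d(3,4) by simp
   then obtain j where j: "j < length ws" "ws ! j = zs ! i" by (auto simp: in_set_conv_nth)
   have "Suc i = Suc j" using list_rank_nth[OF d(1) i] list_rank_nth[OF d(2) j(1)] eq j(2) by simp
   then show "zs ! i = ws ! i" using j by simp
  qed
 qed simp
next
 fix zs :: "'a list" assume zs: "zs \<in> linear_extensions S"
 have d: "distinct zs" "set zs = S" and so: "sorted_wrt (\<lambda>z w. \<not> w <= z) zs"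
  using zs by (auto simp: linear_extensions_def)
 have l: "length zs = card S" using d distinct_card by metis
 have "bij_betw (list_rank zs) S {1..card S}"
 proof (rule bij_betw_imageI)
  show "inj_on (list_rank zs) S"
   unfolding d(2)[symmetric] by (auto simp: inj_on_def in_set_conv_nth list_rank_nth[OF d(1)])
  show "list_rank zs ` S = {1..card S}"
  proof (intro set_eqI iffI)
   fix k assume "k \<in> list_rank zs ` S"
   then show "k \<in> {1..card S}"
    unfolding d(2)[symmetric] using l d(2) by (auto simp: in_set_conv_nth list_rank_nth[OF d(1)])
  next
   fix k assume k: "k \<in> {1..card S}"
   then have i: "k - 1 < length zs" unfolding l by auto
   have "list_rank zs (zs ! (k - 1)) = k" using list_rank_nth[OF d(1) i] k by simp
   moreover have "zs ! (k - 1) \<in> S" using i d(2) nth_mem by blast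
   ultimately show "k \<in> list_rank zs ` S" by (intro rev_image_eqI) auto
  qed
 qed
 moreover have "mono_on S (list_rank zs)"
 proof (rule mono_onI)
  fix z w assume "z \<in> S" "w \<in> S" and le: "z <= w"
  then obtain i j where i: "i < length zs" "z = zs ! i" and j: "j < length zs" "w = zs ! j"
   unfolding d(2)[symmetric] by (auto simp: in_set_conv_nth)
  have "\<not> j < i" using sorted_wrt_nth_less[OF so, of j i] le i j by auto
  then show "list_rank zs z <= list_rank zs w" using list_rank_nth[OF d(1)] i j by simp
 qed
 moreover have "list_rank zs \<in> extensional S" by (simp add: list_rank_def d(2))
 ultimately show "list_rank zs \<in> {G \<in> extensional S. bij_betw G S {1..card S} \<and> mono_on S G}" by simp
next
 fix G assume "G \<in> {G \<in> extensional S. bij_betw G S {1..card S} \<and> mono_on S G}"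
 then have G: "G \<in> extensional S" "bij_betw G S {1..card S}" "mono_on S G" by auto
 define inv where "inv = the_inv_into S G"
 have inj: "inj_on G S" and im: "G ` S = {1..card S}" using G(2) by (auto simp: bij_betw_def)
 have inv: "inv k \<in> S" "G (inv k) = k" if "k \<in> {1..card S}" for k
  unfolding inv_def using the_inv_into_into[OF inj _ order_refl] f_the_inv_into_f[OF inj] that im by auto
 have inv': "inv (G z) = z" if "z \<in> S" for z unfolding inv_def by (rule the_inv_into_f_f[OF inj that])
 define zs where "zs = map (\<lambda>i. inv (Suc i)) [0..<card S]"
 have l: "length zs = card S" and nth: "\<And>i. i < card S ==> zs ! i = inv (Suc i)" by (simp_all add: zs_def)
 have d: "distinct zs" unfolding distinct_conv_nth l
 proof (intro allI impI)
  fix i j assume ij: "i < card S" "j < card S" "i \<noteq> j"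
  have "G (inv (Suc i)) = Suc i" "G (inv (Suc j)) = Suc j" using inv(2) ij by auto
  then show "zs ! i \<noteq> zs ! j" using nth ij by auto
 qed
 have st: "set zs = S"
 proof (rule card_subset_eq[OF S])
  show "set zs \<subseteq> S" unfolding zs_def using inv(1) by auto
  show "card (set zs) = card S" using distinct_card[OF d] l by simp
 qed
 have "sorted_wrt (\<lambda>z w. \<not> w <= z) zs" unfolding sorted_wrt_iff_nth_less
 proof (intro allI impI notI)
  fix i j assume ij: "i < j" "j < length zs" "zs ! j <= zs ! i"
  have k: "Suc i \<in> {1..card S}" "Suc j \<in> {1..card S}" using ij l by auto
  have "G (inv (Suc j)) <= G (inv (Suc i))"
   using mono_onD[OF G(3) inv(1)[OF k(2)] inv(1)[OF k(1)]] ij nth l by simp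
  then show False using inv(2) k ij by simp
 qed
 then have zs: "zs \<in> linear_extensions S" using d st by (simp add: linear_extensions_def)
 have "list_rank zs = G"
 proof (rule extensionalityI)
  show "list_rank zs \<in> extensional S" by (simp add: list_rank_def st)
  show "G \<in> extensional S" by (rule G(1))
  fix z assume z: "z \<in> S"
  have "G z \<in> {1..card S}" using im z by auto
  then have i: "G z - 1 < card S" "Suc (G z - 1) = G z" by auto
  have "zs ! (G z - 1) = z" using nth[OF i(1)] i(2) inv'[OF z] by simp
  then show "list_rank zs z = G z" using list_rank_nth[OF d, of "G z - 1"] i l by simp
 qed
 then show "\<exists>zs\<in>linear_extensions S. G = list_rank zs" using zs by auto
qed

text \<open>Boxes of a column are listed from bottom to top and \<open>j\<close> counts from 0, so
  reaching box \<open>j\<close> means having listed at least \<open>j + 1\<close> boxes of its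
  column.\<close>

lemma rank_le_iff_count:
 assumes zs: "zs \<in> linear_extensions (stairs a b)" and box: "box x j \<in> stairs a b"
 shows "list_rank zs (box x j) <= g \<longleftrightarrow> j < count_list (take g (map hcol zs)) x"
proof -
 have d: "distinct zs" "set zs = stairs a b" and so: "sorted_wrt (\<lambda>z w. \<not> w <= z) zs"
  using zs by (auto simp: linear_extensions_def)
 define C where "C = {i. i < g \<and> i < length zs \<and> hcol (zs ! i) = x}"
 have "C = {i. i < length (take g (map hcol zs)) \<and> x = take g (map hcol zs) ! i}" by (auto simp: C_def)
 then have cnt: "count_list (take g (map hcol zs)) x = card C"
  by (simp add: count_list_eq_length_filter length_filter_conv_card)
 have inj: "inj_on (\<lambda>i. hidx (zs ! i)) C"
 proof (rule inj_onI)
  fix i k assume ik: "i \<in> C" "k \<in> C" and "hidx (zs ! i) = hidx (zs ! k)"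
  then have "zs ! i = zs ! k" using box_eq[of "zs ! i"] box_eq[of "zs ! k"] by (simp add: C_def)
  then show "i = k" using ik d(1) by (simp add: C_def nth_eq_iff_index_eq)
 qed
 have fin: "finite C" by (simp add: C_def)
 have ord: "list_rank zs (box x i) <= list_rank zs (box x k)" if "i <= k" "box x k \<in> stairs a b" for i k
 proof -
  have le: "box x i <= box x k" using that(1) by (simp add: hpoint_le_iff Rep_box)
  have "mono_on (stairs a b) (list_rank zs)"
   using list_rank_bij[OF finite_stairs, of a b] zs by (auto simp: bij_betw_def)
  then show ?thesis using stairs_down[OF le that(2)] that(2) le by (rule mono_onD)
 qed
 have rank: "list_rank zs (zs ! i) = Suc i" if "i < length zs" for i by (rule list_rank_nth[OF d(1) that])
 show ?thesis
 proof
  assume r: "list_rank zs (box x j) <= g"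
  have "{..j} \<subseteq> (\<lambda>i. hidx (zs ! i)) ` C"
  proof
   fix k assume "k \<in> {..j}"
   then have k: "k <= j" by simp
   have "box x k \<in> stairs a b" by (rule stairs_down[OF _ box]) (use k in \<open>simp add: hpoint_le_iff Rep_box\<close>)
   then obtain i where i: "i < length zs" "zs ! i = box x k" unfolding d(2)[symmetric] by (auto simp: in_set_conv_nth)
   have "Suc i <= g" using rank[OF i(1)] ord[OF k box] r i(2) by simp
   then have "i \<in> C" using i by (simp add: C_def)
   then show "k \<in> (\<lambda>i. hidx (zs ! i)) ` C" by (rule rev_image_eqI) (simp add: i(2))
  qed
  then have "card {..j} <= card ((\<lambda>i. hidx (zs ! i)) ` C)" by (intro card_mono finite_imageI fin)
  then show "j < count_list (take g (map hcol zs)) x" using card_image_le[OF fin, of "\<lambda>i. hidx (zs ! i)"] cnt by simp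
 next
  assume c: "j < count_list (take g (map hcol zs)) x"
  show "list_rank zs (box x j) <= g"
  proof (rule ccontr)
   assume r: "\<not> list_rank zs (box x j) <= g"
   have "(\<lambda>i. hidx (zs ! i)) ` C \<subseteq> {..<j}"
   proof
    fix k assume "k \<in> (\<lambda>i. hidx (zs ! i)) ` C"
    then obtain i where i: "i \<in> C" "k = hidx (zs ! i)" by auto
    have z: "zs ! i = box x k" using box_eq[of "zs ! i"] i by (simp add: C_def)
    have "zs ! i \<in> stairs a b" using i(1) d(2) nth_mem[of i zs] by (simp add: C_def)
    then have "\<not> j <= k" using ord[of j k] rank[of i] i(1) r z by (auto simp: C_def)
    then show "k \<in> {..<j}" by simp
   qed
   then have "card ((\<lambda>i. hidx (zs ! i)) ` C) <= card {..<j}" by (intro card_mono) auto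
   then have "card C <= j" unfolding card_image[OF inj] by simp
   then show False using c cnt by simp
  qed
 qed
qed

lemma staircase_params:
 assumes "2 <= n" and c: "2 * a = c - int n + 1" "2 * b = c + int n - 1"
 shows "a < b" "n choose 2 = nbox a b" "int n = b - a + 1"
proof -
 show n: "int n = b - a + 1" using c by simp
 then show ab: "a < b" using assms(1) by simp
 have "int (n * (n - 1) div 2) = (b - a + 1) * (b - a) div 2"
  using n assms(1) by (simp add: zdiv_int of_nat_diff)
 then show "n choose 2 = nbox a b" unfolding choose_two nbox_def by simp
qed

lemma pmf_of_set_tableaux:
 assumes n: "2 <= n" and c: "2 * a = c - int n + 1" "2 * b = c + int n - 1"
 shows "pmf_of_set (staircase_tableaux c n) = map_pmf list_rank (pmf_of_set (linear_extensions (stairs a b)))"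
proof -
 note p = staircase_params[OF n c]
 have "staircase_tableaux c n = {G \<in> extensional (stairs a b). bij_betw G (stairs a b) {1..card (stairs a b)} \<and> mono_on (stairs a b) G}"
  unfolding staircase_tableaux_def staircase_eq_stairs[OF c] map_pmf_stairs_word(3)[OF p(1)] p(2) ..
 then show ?thesis
  using map_pmf_of_set_bij_betw[OF list_rank_bij[OF finite_stairs] map_pmf_stairs_word(1)[OF p(1)]
   finite_linear_extensions[OF finite_stairs]] by simp
qed

lemma tableau_word_prob:
 assumes n: "2 <= n" and c: "2 * a = c - int n + 1" "2 * b = c + int n - 1"
  and box: "\<And>q. q \<in> Q ==> box (cx q) (cj q) \<in> staircase c n"
 shows "measure (uniform_tableau c n) {G. \<forall>q\<in>Q. G (box (cx q) (cj q)) <= g q} = word_prob a b Q cx cj g"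
proof -
 note ab = staircase_params(1)[OF n c]
 let ?E = "linear_extensions (stairs a b)"
 have E: "set_pmf (pmf_of_set ?E) = ?E"
  using map_pmf_stairs_word(1)[OF ab] finite_linear_extensions[OF finite_stairs] by (rule set_pmf_of_set)
 have box': "box (cx q) (cj q) \<in> stairs a b" if "q \<in> Q" for q using box[OF that] staircase_eq_stairs[OF c] by simp
 have "measure (uniform_tableau c n) {G. \<forall>q\<in>Q. G (box (cx q) (cj q)) <= g q}
  = pr (pmf_of_set ?E) {zs. \<forall>q\<in>Q. list_rank zs (box (cx q) (cj q)) <= g q}"
  unfolding uniform_tableau_def pmf_of_set_tableaux[OF n c] by (simp add: vimage_def)
 also have "\<dots> = pr (pmf_of_set ?E) {zs. \<forall>q\<in>Q. cj q < count_list (take (g q) (map hcol zs)) (cx q)}"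
  by (rule measure_pmf.finite_measure_eq_AE) (auto simp: AE_measure_pmf_iff E rank_le_iff_count[OF _ box'])
 also have "\<dots> = word_prob a b Q cx cj g"
  unfolding word_prob_def map_pmf_stairs_word(2)[OF ab, symmetric] by (simp add: vimage_def)
 finally show ?thesis .
qed

subsection \<open>Limits of window probabilities\<close>

lemma word_prob_image: "word_prob a b (f ` Q) cx cj g = word_prob a b Q (cx \<circ> f) (cj \<circ> f) (g \<circ> f)"
 by (simp add: word_prob_def)

text \<open>For a symmetric staircase \<open>sqrt (width2 (- h) h 0)\<close> equals the side, so
  only the rounding error \<open>1 / m\<close> remains.\<close>

lemma window_times_near:
 assumes t: "\<And>q. q \<in> Q ==> 0 < t q" and rho: "0 < rho"
 shows "\<exists>h1. \<forall>h\<ge>h1. ample n0 1 (- h) h \<and> times_near Q t rho (- h) h (\<lambda>q. nat \<lfloor>t q * ir (2 * h + 1)\<rfloor>)"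
proof (rule exI[of _ "\<lceil>max (max 1 n0) (1 / rho)\<rceil>"], intro allI impI)
 fix h assume "\<lceil>max (max 1 n0) (1 / rho)\<rceil> <= h"
 then have "max (max 1 n0) (1 / rho) <= ir h" by (simp add: ceiling_le_iff)
 then have h: "1 <= ir h" "n0 <= ir h" "1 / rho <= ir h" by auto
 define m where "m = ir (2 * h + 1)"
 have m: "0 < m" "1 / rho <= m" using h by (simp_all add: m_def)
 have w: "width2 (- h) h 0 = m\<^sup>2" "ir (h - - h + 1) = m"
  by (simp_all add: width2_def m_def power2_eq_square algebra_simps)
 have "\<bar>real (nat \<lfloor>t q * m\<rfloor>) * sqrt (m\<^sup>2) / m\<^sup>2 - t q\<bar> <= rho" if "q \<in> Q" for q
 proof -
  have "real (nat \<lfloor>t q * m\<rfloor>) = ir \<lfloor>t q * m\<rfloor>" using t[OF that] m by simp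
  then have "\<bar>real (nat \<lfloor>t q * m\<rfloor>) - t q * m\<bar> <= 1" by linarith
  then have "\<bar>real (nat \<lfloor>t q * m\<rfloor>) - t q * m\<bar> / m <= 1 / m" using m by (intro divide_right_mono) auto
  also have "\<dots> <= rho" using m rho by (simp add: field_simps)
  also have "\<bar>real (nat \<lfloor>t q * m\<rfloor>) - t q * m\<bar> / m = \<bar>(real (nat \<lfloor>t q * m\<rfloor>) - t q * m) / m\<bar>" using m by simp
  also have "(real (nat \<lfloor>t q * m\<rfloor>) - t q * m) / m = real (nat \<lfloor>t q * m\<rfloor>) * sqrt (m\<^sup>2) / m\<^sup>2 - t q"
   using m by (simp add: power2_eq_square diff_divide_distrib)
  finally show ?thesis .
 qed
 then show "ample n0 1 (- h) h \<and> times_near Q t rho (- h) h (\<lambda>q. nat \<lfloor>t q * ir (2 * h + 1)\<rfloor>)"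
  unfolding ample_def times_near_def w m_def[symmetric] using h by (simp add: m_def)
qed

lemma approximates_window:
 assumes "approximates Q cx cj t 1 rho eps p" "\<forall>q\<in>Q. 0 < t q" "0 < rho"
 shows "\<exists>h1. \<forall>h\<ge>h1. \<bar>window_word_prob h Q cx cj t - p\<bar> <= eps"
proof -
 obtain n0 where n0: "\<And>a b g. ample n0 1 a b ==> times_near Q t rho a b g ==> \<bar>word_prob a b Q cx cj g - p\<bar> <= eps"
  using assms(1) unfolding approximates_def by blast
 obtain h1 where "\<And>h. h1 <= h ==> ample n0 1 (- h) h \<and> times_near Q t rho (- h) h (\<lambda>q. nat \<lfloor>t q * ir (2 * h + 1)\<rfloor>)"
  using window_times_near[of Q t rho n0] assms by blast
 then show ?thesis unfolding window_word_prob_def using n0 by blast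
qed

lemma approximates_trans:
 assumes "approximates Q cx cj t eta rho eps p" "\<bar>p - p'\<bar> <= dl"
 shows "approximates Q cx cj t eta rho (eps + dl) p'"
proof -
 have "\<bar>w - p'\<bar> <= eps + dl" if "\<bar>w - p\<bar> <= eps" for w using that assms(2) by linarith
 then show ?thesis using assms(1) unfolding approximates_def by meson
qed

definition window_prob :: "int => (hpoint \<times> real) set => real" where
 "window_prob h A = window_word_prob h A (hcol \<circ> fst) (hidx \<circ> fst) snd"

definition limit_prob :: "(hpoint \<times> real) set => real" where
 "limit_prob A = lim (\<lambda>h. window_prob (int h) A)"

definition thresholds :: "(hpoint \<times> real) set => bool" where
 "thresholds A \<longleftrightarrow> finite A \<and> (\<forall>q\<in>A. 0 < snd q)"

abbreviation approx_prob :: "(hpoint \<times> real) set => real => real => real => real => bool" where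
 "approx_prob A \<equiv> approximates A (hcol \<circ> fst) (hidx \<circ> fst) snd"

lemma window_prob_near:
 assumes A: "thresholds A" and eps: "0 < eps" and eta: "0 < eta" "eta <= 1"
 shows "\<exists>rho>0. \<exists>h0. \<forall>h\<ge>h0. approx_prob A eta rho eps (window_prob h A)"
proof -
 have A': "finite A" "\<forall>q\<in>A. (0 :: nat) < 1" "\<forall>q\<in>A. 0 < snd q" using A by (auto simp: thresholds_def)
 obtain rho h0 where rho: "0 < rho" and K: "\<forall>h (M :: nat => int). h0 <= h --> spaced 1 (2 * h) M -->
  approximates A (\<lambda>q. (hcol \<circ> fst) q + 2 * M 0) (hidx \<circ> fst) snd eta rho eps (\<Prod>i<1. window_word_prob h {q\<in>A. (0 :: nat) = i} (hcol \<circ> fst) (hidx \<circ> fst) snd)"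
  using key_lemma[OF A' eps eta, of "hcol \<circ> fst" "hidx \<circ> fst"] by (elim exE conjE) (rule that)
 show ?thesis
 proof (rule exI[of _ rho], intro conjI rho, rule exI[of _ h0], intro allI impI)
  fix h assume "h0 <= h"
  from K[THEN spec[of _ h], THEN spec[of _ "\<lambda>_. 0"], THEN mp, OF this]
  show "approx_prob A eta rho eps (window_prob h A)"
   unfolding window_prob_def by (simp add: lessThan_Suc One_nat_def comp_def spaced_def)
 qed
qed

lemma window_prob_near_window:
 assumes A: "thresholds A" and eps: "0 < eps"
 shows "\<exists>h0. \<forall>h\<ge>h0. \<exists>h1. \<forall>h'\<ge>h1. \<bar>window_prob h' A - window_prob h A\<bar> <= eps"
proof -
 obtain rho h0 where "0 < rho" "\<And>h. h0 <= h ==> approx_prob A 1 rho eps (window_prob h A)"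
  using window_prob_near[OF A eps zero_less_one order_refl] by blast
 then show ?thesis using approximates_window[of A _ _ snd rho eps] A unfolding window_prob_def thresholds_def by blast
qed

text \<open>The Cauchy criterion: one window of suitable size approximates all sufficiently large
  ones.\<close>

lemma window_prob_tendsto:
 assumes A: "thresholds A"
 shows "(\<lambda>h. window_prob (int h) A) \<longlonglongrightarrow> limit_prob A"
proof -
 have "Cauchy (\<lambda>h. window_prob (int h) A)"
 proof (rule metric_CauchyI)
  fix e :: real assume e: "0 < e"
  then have "0 < e / 3" by simp
  from window_prob_near_window[OF A this] obtain h0 h1 where h1: "\<And>h'. h1 <= h' ==> \<bar>window_prob h' A - window_prob h0 A\<bar> <= e / 3"
   by blast
  show "\<exists>M. \<forall>m\<ge>M. \<forall>n\<ge>M. dist (window_prob (int m) A) (window_prob (int n) A) < e"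
  proof (intro exI[of _ "nat h1"] allI impI)
   fix m n assume "nat h1 <= m" "nat h1 <= n"
   then have "h1 <= int m" "h1 <= int n" by auto
   from h1[OF this(1)] h1[OF this(2)] show "dist (window_prob (int m) A) (window_prob (int n) A) < e"
    using e unfolding dist_real_def by linarith
  qed
 qed
 then have "convergent (\<lambda>h. window_prob (int h) A)" by (rule Cauchy_convergent)
 then show ?thesis unfolding limit_prob_def by (simp add: convergent_LIMSEQ_iff)
qed

lemma limit_prob_le:
 assumes A: "thresholds A" and near: "\<And>h. h1 <= h ==> \<bar>window_prob h A - p\<bar> <= eps"
 shows "\<bar>limit_prob A - p\<bar> <= eps"
proof (rule LIMSEQ_le_const2)
 show "(\<lambda>h. \<bar>window_prob (int h) A - p\<bar>) \<longlonglongrightarrow> \<bar>limit_prob A - p\<bar>"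
  by (intro tendsto_intros window_prob_tendsto A)
 show "\<exists>N. \<forall>n\<ge>N. \<bar>window_prob (int n) A - p\<bar> <= eps"
  by (rule exI[of _ "nat h1"], intro allI impI, rule near) simp
qed

lemma limit_prob_approx:
 assumes A: "thresholds A" and eps: "0 < eps" and eta: "0 < eta" "eta <= 1"
 shows "\<exists>rho>0. approx_prob A eta rho eps (limit_prob A)"
proof -
 have e2: "0 < eps / 2" using eps by simp
 obtain h1 where h1: "\<And>h. h1 <= h ==> \<exists>h2. \<forall>h'\<ge>h2. \<bar>window_prob h' A - window_prob h A\<bar> <= eps / 2"
  using window_prob_near_window[OF A e2] by blast
 obtain rho h0 where rho: "0 < rho" "\<And>h. h0 <= h ==> approx_prob A eta rho (eps / 2) (window_prob h A)"
  using window_prob_near[OF A e2 eta] by blast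
 define h where "h = max h0 h1"
 have "\<bar>limit_prob A - window_prob h A\<bar> <= eps / 2" using h1[of h] limit_prob_le[OF A] unfolding h_def by fastforce
 then have "\<bar>window_prob h A - limit_prob A\<bar> <= eps / 2" by linarith
 from approximates_trans[OF rho(2) this] show ?thesis using rho(1) by (auto simp: h_def)
qed

text \<open>The tolerance \<open>rho\<close> of the approximation absorbs a perturbation of the
  thresholds by \<open>rho / 2\<close>, since times near the perturbed ones are still near the
  original ones. Consequently the limit law charges no boundary at a positive threshold.\<close>

lemma limit_prob_continuous:
 assumes A: "thresholds A" and eps: "0 < eps"
 shows "\<exists>dl>0. \<forall>f. (\<forall>q\<in>A. fst (f q) = fst q \<and> 0 < snd (f q) \<and> \<bar>snd (f q) - snd q\<bar> <= dl) -->
  \<bar>limit_prob (f ` A) - limit_prob A\<bar> <= eps"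
proof -
 obtain rho n0 where rho: "0 < rho" and n0: "\<And>a b g. ample n0 1 a b ==> times_near A snd rho a b g ==>
   \<bar>word_prob a b A (hcol \<circ> fst) (hidx \<circ> fst) g - limit_prob A\<bar> <= eps"
  using limit_prob_approx[OF A eps zero_less_one order_refl] unfolding approximates_def by blast
 show ?thesis
 proof (rule exI[of _ "rho / 2"], intro conjI allI impI)
  show rho2: "0 < rho / 2" using rho by simp
  fix f assume f: "\<forall>q\<in>A. fst (f q) = fst q \<and> 0 < snd (f q) \<and> \<bar>snd (f q) - snd q\<bar> <= rho / 2"
  have fA: "thresholds (f ` A)" using A f by (auto simp: thresholds_def)
  have eq: "window_prob h (f ` A) = word_prob (- h) h A (hcol \<circ> fst) (hidx \<circ> fst) (\<lambda>q. nat \<lfloor>snd (f q) * ir (2 * h + 1)\<rfloor>)" for h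
  proof -
   have "{w. \<forall>q\<in>A. (hidx \<circ> fst) (f q) < count_list (take (nat \<lfloor>snd (f q) * ir (2 * h + 1)\<rfloor>) w) ((hcol \<circ> fst) (f q))}
    = {w. \<forall>q\<in>A. (hidx \<circ> fst) q < count_list (take (nat \<lfloor>snd (f q) * ir (2 * h + 1)\<rfloor>) w) ((hcol \<circ> fst) q)}"
    using f by auto
   then show ?thesis unfolding window_prob_def window_word_prob_def word_prob_def by simp
  qed
  obtain h1 where h1: "\<And>h. h1 <= h ==> ample n0 1 (- h) h \<and>
    times_near A (snd \<circ> f) (rho / 2) (- h) h (\<lambda>q. nat \<lfloor>(snd \<circ> f) q * ir (2 * h + 1)\<rfloor>)"
   using window_times_near[of A "snd \<circ> f" "rho / 2" n0] f rho2 by auto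
  have halves: "\<bar>x - z\<bar> <= r" if "\<bar>x - y\<bar> <= r / 2" "\<bar>y - z\<bar> <= r / 2" for x y z r :: real using that by linarith
  have "times_near A snd rho a b g" if "times_near A (snd \<circ> f) (rho / 2) a b g" for a b g
   using that f halves unfolding times_near_def comp_def by blast
  then have "\<bar>window_prob h (f ` A) - limit_prob A\<bar> <= eps" if "h1 <= h" for h
   unfolding eq using n0 h1[OF that] by simp
  then show "\<bar>limit_prob (f ` A) - limit_prob A\<bar> <= eps" by (rule limit_prob_le[OF fA])
 qed
qed

definition move_point :: "int => hpoint => hpoint" where
 "move_point c z = box (hcol z + 2 * c) (hidx z)"

text \<open>A large window is compared with \<open>k\<close> windows of a fixed half-width
  \<open>h\<close> inside it, and centres at distance \<open>2 * h\<close> make these disjoint.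
  Indexing by \<open>Sigma\<close> keeps equal thresholds of different windows apart.\<close>

lemma limit_prob_product:
 fixes A :: "nat => (hpoint \<times> real) set"
 assumes A: "\<And>i. i < k ==> thresholds (A i)" and eps: "0 < eps"
 shows "\<exists>D. \<forall>M. spaced k D M -->
  \<bar>limit_prob (\<Union>i<k. map_prod (move_point (M i)) id ` A i) - (\<Prod>i<k. limit_prob (A i))\<bar> <= eps"
proof -
 define Q where "Q = Sigma {..<k} A"
 define cx where "cx = hcol \<circ> fst \<circ> (snd :: nat \<times> hpoint \<times> real => hpoint \<times> real)"
 define cj where "cj = hidx \<circ> fst \<circ> (snd :: nat \<times> hpoint \<times> real => hpoint \<times> real)"
 define t where "t = snd \<circ> (snd :: nat \<times> hpoint \<times> real => hpoint \<times> real)"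
 have fin: "finite Q" unfolding Q_def using A by (intro finite_SigmaI) (auto simp: thresholds_def)
 have e2: "0 < eps / 2" using eps by simp
 have P1: "\<forall>q\<in>Q. fst q < k" by (auto simp: Q_def)
 have P2: "\<forall>q\<in>Q. 0 < t q"
 proof
  fix q assume "q \<in> Q"
  then show "0 < t q" using A[of "fst q"] by (fastforce simp: Q_def t_def thresholds_def)
 qed
 have comp: "window_word_prob h {q\<in>Q. fst q = i} cx cj t = window_prob h (A i)" if "i < k" for h i
 proof -
  have "{q\<in>Q. fst q = i} = Pair i ` A i" using that by (auto simp: Q_def)
  then show ?thesis by (simp add: word_prob_image window_prob_def window_word_prob_def cx_def cj_def t_def comp_def)
 qed
 have prodW: "(\<Prod>i<k. window_word_prob h {q\<in>Q. fst q = i} cx cj t) = (\<Prod>i<k. window_prob h (A i))" for h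
  by (rule prod.cong[OF refl], rule comp) simp
 obtain rho h0 where rho: "0 < rho" and K: "\<And>h M. h0 <= h ==> spaced k (2 * h) M ==>
  approximates Q (\<lambda>q. cx q + 2 * M (fst q)) cj t 1 rho (eps / 2) (\<Prod>i<k. window_prob h (A i))"
  using key_lemma[OF fin P1 P2 e2 zero_less_one order_refl, of cx cj] unfolding prodW by blast
 have "(\<lambda>h. \<Prod>i<k. window_prob (int h) (A i)) \<longlonglongrightarrow> (\<Prod>i<k. limit_prob (A i))"
  by (intro tendsto_prod window_prob_tendsto A) simp
 from LIMSEQ_D[OF this e2] obtain N where N: "\<And>h. N <= h ==> \<bar>(\<Prod>i<k. window_prob (int h) (A i)) - (\<Prod>i<k. limit_prob (A i))\<bar> < eps / 2"
  by auto
 define h where "h = max (nat h0) N"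
 have hh: "h0 <= int h" "N <= h" by (auto simp: h_def)
 show ?thesis
 proof (intro exI[of _ "2 * int h"] allI impI)
  fix M :: "nat => int" assume far: "spaced k (2 * int h) M"
  define f where "f q = map_prod (move_point (M (fst q))) id (snd q)" for q :: "nat \<times> hpoint \<times> real"
  define B where "B = (\<Union>i<k. map_prod (move_point (M i)) id ` A i)"
  have B: "B = f ` Q" unfolding B_def Q_def f_def by force
  have tB: "thresholds B" using P2 fin unfolding B thresholds_def by (auto simp: f_def t_def)
  obtain h1 where h1: "\<And>h'. h1 <= h' ==>
    \<bar>window_word_prob h' Q (\<lambda>q. cx q + 2 * M (fst q)) cj t - (\<Prod>i<k. window_prob (int h) (A i))\<bar> <= eps / 2"
   using approximates_window[OF K[OF hh(1) far] P2 rho] by blast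
  have "window_prob h' B = window_word_prob h' Q (\<lambda>q. cx q + 2 * M (fst q)) cj t" for h'
   unfolding B window_prob_def window_word_prob_def word_prob_image
   by (simp add: comp_def f_def cx_def cj_def t_def move_point_def)
  then have "\<bar>limit_prob B - (\<Prod>i<k. window_prob (int h) (A i))\<bar> <= eps / 2" using h1 by (intro limit_prob_le[OF tB]) simp
  then show "\<bar>limit_prob (\<Union>i<k. map_prod (move_point (M i)) id ` A i) - (\<Prod>i<k. limit_prob (A i))\<bar> <= eps"
   using N[OF hh(2)] unfolding B_def[symmetric] by linarith
 qed
qed

section \<open>Tightness of the limit\<close>

lemma word_prob_lower:
 assumes dom: "dominated 1 (\<lambda>_. A) (\<lambda>_. B) L a b L'" and okT: "ok1 A B L" and okD: "ok1 a b L'" and Q: "finite Q"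
  and T: "early1 A B L s f <= e"
  and D: "late1 a b L' s g <= e"
 shows "word_prob A B Q cx cj (\<lambda>_. f) <= word_prob a b Q cx cj (\<lambda>_. g) + 2 * real (card Q) * e"
proof -
 have sw: "pr (sys_words 1 (\<lambda>_. A) (\<lambda>_. B) zero_state) {ws. \<forall>q\<in>Q. cj q < count_list (take h (ws 0)) (cx q)}
  = word_prob A B Q cx cj (\<lambda>_. h)" for A B h
  using sys_words_product[OF Q, of "\<lambda>_. 0" 1 "\<lambda>_. A" "\<lambda>_. B" cj "\<lambda>_. h" cx] by (simp add: lessThan_Suc One_nat_def)
 let ?P = "\<lambda>A B L. path_prob 1 (\<lambda>_. A) (\<lambda>_. B) L s Q (\<lambda>_. 0) cx cj (\<lambda>_. s)"
 have "word_prob A B Q cx cj (\<lambda>_. f) <= ?P A B L + (\<Sum>q\<in>Q. early1 A B L s f)"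
  unfolding path_prob_def sw[symmetric] by (rule path_word_comparison(2)[OF okT Q]) auto
 moreover have "?P a b L' <= word_prob a b Q cx cj (\<lambda>_. g) + (\<Sum>q\<in>Q. late1 a b L' s g)"
  unfolding path_prob_def sw[symmetric] by (rule path_word_comparison(1)[OF okD Q]) auto
 moreover have "?P A B L <= ?P a b L'"
  by (rule path_prob_comparison(1)[OF dom okT okD Q, where ?s2.0 = "\<lambda>_. s"]) auto
 moreover have "(\<Sum>q\<in>Q. early1 A B L s f) <= real (card Q) * e"
  "(\<Sum>q\<in>Q. late1 a b L' s g) <= real (card Q) * e"
  using mult_left_mono[OF T, of "real (card Q)"] mult_left_mono[OF D, of "real (card Q)"] by simp_all
 ultimately show ?thesis by linarith
qed

text \<open>Markov's inequality for the number of remaining boxes, whose mean decays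
  exponentially.\<close>

lemma prob_not_all_removed:
 assumes ok: "ok1 a b L" and L: "1 <= L"
 shows "early1 a b L s (nbox a b) <= real (nbox a b) * exp (- (real s / L))"
proof -
 let ?p = "at1 a b L s zero_state" and ?M = "\<lambda>ms :: state. real (nbox a b) - real (removed a b (ms 0))"
 have ab: "a < b" using ok by (simp add: ok1_iff)
 have le: "removed a b (ms 0) <= nbox a b" if "ms \<in> set_pmf ?p" for ms
  using sys_valid_at[OF ok sys_valid_zero, of s] that removed_le[OF _ ab] by (auto simp: sys_valid_def)
 have int: "integrable (measure_pmf ?p) h" for h :: "state => real"
  by (rule integrable_measure_pmf_finite[OF finite_set_at_pmf[OF ok sys_valid_zero]])
 have "pr ?p {m. removed a b (m 0) < nbox a b} = expect ?p (indicator {m. removed a b (m 0) < nbox a b})" by simp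
 also have "\<dots> <= expect ?p ?M"
  by (rule integral_mono_AE[OF int int]) (use le in \<open>auto simp: AE_measure_pmf_iff indicator_def\<close>)
 also have "\<dots> = real (nbox a b) * (1 - 1 / L) ^ s"
  using expectation_remaining(1)[OF ok zero_less_one, of s] by simp
 also have "\<dots> <= real (nbox a b) * exp (- (real s / L))"
  by (intro mult_left_mono power_one_minus_bounds(2)[OF L]) simp
 finally show ?thesis .
qed

lemma set_pmf_tableaux:
 assumes n: "2 <= n" and c: "2 * a = c - int n + 1" "2 * b = c + int n - 1"
 shows "set_pmf (pmf_of_set (staircase_tableaux c n)) = staircase_tableaux c n"
proof -
 note p = staircase_params[OF n c]
 have bij: "bij_betw list_rank (linear_extensions (stairs a b)) (staircase_tableaux c n)"
  unfolding staircase_tableaux_def staircase_eq_stairs[OF c] p(2) map_pmf_stairs_word(3)[OF p(1), symmetric]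
  by (rule list_rank_bij[OF finite_stairs])
 have "finite (staircase_tableaux c n)"
  using bij_betw_finite[OF bij] finite_linear_extensions[OF finite_stairs] by blast
 moreover have "staircase_tableaux c n \<noteq> {}" using bij map_pmf_stairs_word(1)[OF p(1)] by (auto simp: bij_betw_def)
 ultimately show ?thesis by (intro set_pmf_of_set)
qed

lemma word_prob_full:
 assumes h: "1 <= h" and box: "\<And>q. q \<in> Q ==> box (cx q) (cj q) \<in> stairs (- h) h"
 shows "word_prob (- h) h Q cx cj (\<lambda>_. nbox (- h) h) = 1"
proof -
 define n where "n = nat (2 * h + 1)"
 have n: "2 <= n" and c: "2 * (- h) = 0 - int n + 1" "2 * h = 0 + int n - 1" using h by (auto simp: n_def)
 note p = staircase_params[OF n c]
 have box': "box (cx q) (cj q) \<in> staircase 0 n" if "q \<in> Q" for q using box[OF that] staircase_eq_stairs[OF c] by simp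
 have "word_prob (- h) h Q cx cj (\<lambda>_. nbox (- h) h)
  = measure (uniform_tableau 0 n) {G. \<forall>q\<in>Q. G (box (cx q) (cj q)) <= nbox (- h) h}"
  by (rule tableau_word_prob[OF n c box', symmetric])
 also have "\<dots> = 1"
  unfolding uniform_tableau_def
 proof (rule measure_pmf.prob_eq_1[THEN iffD2])
  show "AE G in measure_pmf (pmf_of_set (staircase_tableaux 0 n)). G \<in> {G. \<forall>q\<in>Q. G (box (cx q) (cj q)) <= nbox (- h) h}"
   unfolding AE_measure_pmf_iff set_pmf_tableaux[OF n c] p(2)[symmetric]
   using box' by (auto simp: staircase_tableaux_def bij_betw_def)
 qed simp
 finally show ?thesis .
qed

text \<open>A fixed staircase containing \<open>z\<close> is emptied by time \<open>y\<close> except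
  with probability \<open>eps / 2\<close>. Larger windows run ahead of it once their clock is
  adjusted, and by that time they have removed about \<open>m * y * n\<close> boxes, a number
  proportional to their side \<open>n\<close>. So \<open>z\<close> is likely to be removed before
  index \<open>t * n\<close>.\<close>

lemma limit_prob_tight:
 assumes eps: "0 < eps"
 shows "\<exists>t>0. 1 - eps <= limit_prob {(z, t)}"
proof -
 define h1 where "h1 = \<bar>hcol z\<bar> + snd (Rep_hpoint z) + 1"
 have y1: "1 <= snd (Rep_hpoint z)" using snd_Rep[of z] by simp
 have h1: "1 <= h1" using y1 by (simp add: h1_def)
 have zs: "box (hcol z) (hidx z) \<in> stairs (- h1) h1" unfolding box_eq stairs_def h1_def using y1 by auto
 define m where "m = ir (2 * h1 + 1)"
 have m: "3 <= m" using h1 by (simp add: m_def)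
 define N where "N = real (nbox (- h1) h1)"
 obtain y :: nat where "N / (eps / 2) <= real y" using real_arch_simple by blast
 then have "N / (eps / 2) <= exp (real y)" using exp_ge_add_one_self[of "real y"] by linarith
 then have y: "N * exp (- real y) <= eps / 2" using eps by (simp add: exp_minus field_simps)
 \<comment> \<open>One of the two extra units allows for the deviation of the clock, the other for
   rounding.\<close>
 define t where "t = m * real y + 2"
 have t: "0 < t" using m by (simp add: t_def add_nonneg_pos)
 have th: "thresholds {(z, t)}" using t by (simp add: thresholds_def)
 define X where "X = max (2 * m) (max (8 * m * real y / eps) (4 * m\<^sup>2 * (real y)\<^sup>2))"
 have "1 - eps <= window_prob (int h) {(z, t)}" if "nat \<lceil>X\<rceil> <= h" for h
 proof -
  define n where "n = ir (2 * int h + 1)"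
  have "X <= real h" using that by linarith
  then have "X <= n" by (simp add: n_def)
  then have n: "2 * m <= n" "8 * m * real y / eps <= n" "4 * m\<^sup>2 * (real y)\<^sup>2 <= n" by (auto simp: X_def)
  have n6: "6 <= n" using n m by linarith
  have hh1: "h1 <= int h" using n(1) h1 by (simp add: m_def n_def)
  \<comment> \<open>Every column of the fixed staircase is at least \<open>n / 2\<close> away from
    both ends of the large one, so the semicircles have ratio at least
    \<open>n / (2 * m)\<close>.\<close>
  define kp where "kp = n / (2 * m)"
  have kp: "1 <= kp" using n m by (simp add: kp_def)
  define ND where "ND = real (nbox (- int h) (int h))"
  have ND: "ND = n * (n - 1) / 2" unfolding ND_def using hh1 h1 by (subst real_nbox) (auto simp: n_def algebra_simps)
  obtain L :: nat where L: "max 2 (max N ND) <= real L" using real_arch_simple by blast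
  then have L: "2 <= real L" "N <= real L" "ND <= real L" by auto
  have kpL: "real L <= kp * real L" using kp L(1) by (simp add: mult_le_cancel_right1)
  have okT: "ok1 (- h1) h1 (real L)" using L h1 by (simp add: ok1_iff N_def)
  have okD: "ok1 (- int h) (int h) (kp * real L)"
   unfolding ok1_iff ND_def[symmetric] using order_trans[OF L(3) kpL] less_le_trans[OF _ kpL, of 0] L(1) hh1 h1 by auto
  have dom: "dominated 1 (\<lambda>_. - h1) (\<lambda>_. h1) (real L) (- int h) (int h) (kp * real L)"
   unfolding dominated1_iff
  proof (intro conjI ballI)
   fix x assume x: "x \<in> {2 * - h1<..<2 * h1}"
   have wT: "0 < width2 (- h1) h1 x" by (rule width2_pos) (use x in auto)
   have wT': "width2 (- h1) h1 x <= m\<^sup>2" using width2_le_square[of "- h1" h1 x] by (simp add: m_def)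
   have "n / 2 <= ir (2 * int h + 1 - x)" "n / 2 <= ir (x + 1 - 2 * (- int h))"
    using x n(1) by (auto simp: m_def n_def)
   then have w: "(n / 2) * (n / 2) <= width2 (- int h) (int h) x"
    unfolding width2_def using n6 by (intro mult_mono) auto
   have "kp\<^sup>2 = (n / 2) * (n / 2) / m\<^sup>2" using m by (simp add: kp_def power2_eq_square field_simps)
   also have "\<dots> <= width2 (- int h) (int h) x / width2 (- h1) h1 x"
    using w wT wT' n6 order_trans[OF _ w, of 0] by (intro frac_le) auto
   finally have "kp <= sqrt (width2 (- int h) (int h) x / width2 (- h1) h1 x)" by (rule real_le_rsqrt)
   then show "kp * real L / real L <= sqrt (width2 (- int h) (int h) x / width2 (- h1) h1 x)" using L(1) by simp
  qed (use hh1 in auto)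
  define s where "s = y * L"
  have sT: "real s / real L = real y" using L(1) by (simp add: s_def)
  have sD: "real s / (kp * real L) = 2 * m * real y / n" using L(1) n6 m by (simp add: s_def kp_def)
  define g where "g = nat \<lfloor>t * n\<rfloor>"
  have "real g = ir \<lfloor>t * n\<rfloor>" using t n6 by (simp add: g_def)
  then have g: "t * n - 1 <= real g" by linarith
  have T: "early1 (- h1) h1 (real L) s (nbox (- h1) h1) <= eps / 2"
   using prob_not_all_removed[OF okT, of s] L(1) y unfolding sT N_def by linarith
  have NDy: "ND * (2 * m * real y / n) = (n - 1) * (m * real y)" using n6 by (simp add: ND)
  have D: "late1 (- int h) (int h) (kp * real L) s g <= eps / 2"
  proof -
   have "late1 (- int h) (int h) (kp * real L) s g <= 4 * (m * real y) / (1\<^sup>2 * n)"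
   proof (rule removed_deviation(1)[OF okD zero_less_one])
    show "2 <= kp * real L" using L(1) kpL by linarith
    show "(0::real) < 1" "0 < n" using n6 by auto
    have my: "0 <= m * real y" using m by simp
    show "real (nbox (- int h) (int h)) * (real s / (kp * real L)) <= m * real y * n"
     unfolding ND_def[symmetric] sD NDy using mult_right_mono[of "n - 1" n "m * real y"] my by (simp add: mult.commute)
    show "real (nbox (- int h) (int h)) * (real s / (kp * real L)) + 1 * n <= real g"
    proof -
     have "(n - 1) * (m * real y) <= m * real y * n" using mult_right_mono[of "n - 1" n "m * real y"] my by (simp add: mult.commute)
     moreover have "t * n = m * real y * n + 2 * n" by (simp add: t_def algebra_simps)
     ultimately show ?thesis unfolding ND_def[symmetric] sD NDy using g n6 by linarith
    qed
    have "ND * (2 * m * real y / n)\<^sup>2 = (n - 1) / n * (2 * m\<^sup>2 * (real y)\<^sup>2)"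
     using n6 by (simp add: ND field_simps power2_eq_square)
    also have "\<dots> <= 1 * (2 * m\<^sup>2 * (real y)\<^sup>2)" using n6 by (intro mult_right_mono) auto
    also have "\<dots> <= 1 * n / 2" using n(3) by simp
    finally show "real (nbox (- int h) (int h)) * (real s / (kp * real L))\<^sup>2 <= 1 * n / 2"
     unfolding ND_def[symmetric] sD .
   qed
   also have "\<dots> <= eps / 2" using n(2) n6 eps by (simp add: field_simps)
   finally show ?thesis .
  qed
  have "word_prob (- h1) h1 {(z, t)} (hcol \<circ> fst) (hidx \<circ> fst) (\<lambda>_. nbox (- h1) h1)
   <= word_prob (- int h) (int h) {(z, t)} (hcol \<circ> fst) (hidx \<circ> fst) (\<lambda>_. g) + 2 * real (card {(z, t)}) * (eps / 2)"
   by (rule word_prob_lower[OF dom okT okD _ T D]) simp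
  moreover have "word_prob (- h1) h1 {(z, t)} (hcol \<circ> fst) (hidx \<circ> fst) (\<lambda>_. nbox (- h1) h1) = 1"
   by (rule word_prob_full[OF h1]) (use zs in auto)
  moreover have "word_prob (- int h) (int h) {(z, t)} (hcol \<circ> fst) (hidx \<circ> fst) (\<lambda>_. g) = window_prob (int h) {(z, t)}"
   unfolding window_prob_def window_word_prob_def by (rule word_prob_cong) (auto simp: g_def n_def)
  ultimately show ?thesis by simp
 qed
 then have "1 - eps <= limit_prob {(z, t)}"
  by (intro LIMSEQ_le_const[OF window_prob_tendsto[OF th]] exI[of _ "nat \<lceil>X\<rceil>"] allI impI)
 then show ?thesis using t by blast
qed

section \<open>Finite tableaux with a moving centre\<close>

abbreviation tableau_prob :: "int => nat => (hpoint \<times> real) set => real" where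
 "tableau_prob c n A \<equiv> measure (uniform_tableau c n) {G. \<forall>q\<in>A. extend_tableau c n G (fst q) / of_nat n <= ennreal (snd q)}"

lemma tableau_event:
 assumes n: "2 <= n" and c: "2 * a = c - int n + 1" "2 * b = c + int n - 1"
  and A: "thresholds A" and st: "\<And>q. q \<in> A ==> fst q \<in> staircase c n"
 shows "tableau_prob c n A
  = word_prob a b A (hcol \<circ> fst) (hidx \<circ> fst) (\<lambda>q. nat \<lfloor>snd q * real n\<rfloor>)"
proof -
 have "extend_tableau c n G (fst q) / of_nat n <= ennreal (snd q) \<longleftrightarrow> G (box ((hcol \<circ> fst) q) ((hidx \<circ> fst) q)) <= nat \<lfloor>snd q * real n\<rfloor>"
  if q: "q \<in> A" for G q
 proof -
  have t: "0 < snd q" using A q by (auto simp: thresholds_def)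
  have "extend_tableau c n G (fst q) / of_nat n = ennreal (real (G (fst q)) / real n)"
   using st[OF q] n by (simp add: extend_tableau_def divide_ennreal ennreal_of_nat_eq_real_of_nat)
  also have "\<dots> <= ennreal (snd q) \<longleftrightarrow> real (G (fst q)) / real n <= snd q" using t by simp
  also have "\<dots> \<longleftrightarrow> real (G (fst q)) <= snd q * real n" using n by (simp add: pos_divide_le_eq)
  also have "\<dots> \<longleftrightarrow> G (fst q) <= nat \<lfloor>snd q * real n\<rfloor>" using t by (simp add: le_nat_iff le_floor_iff)
  finally show ?thesis by (simp add: box_eq)
 qed
 then have "{G. \<forall>q\<in>A. extend_tableau c n G (fst q) / of_nat n <= ennreal (snd q)}
  = {G. \<forall>q\<in>A. G (box ((hcol \<circ> fst) q) ((hidx \<circ> fst) q)) <= nat \<lfloor>snd q * real n\<rfloor>}" by blast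
 then show ?thesis using tableau_word_prob[OF n c, of A "hcol \<circ> fst" "hidx \<circ> fst"] st by (simp add: box_eq)
qed

text \<open>The ends of the staircase are at distances \<open>n + k n\<close> and
  \<open>n - k n\<close> from column 0, up to the offsets in \<open>width2\<close>. So
  \<open>sqrt (width2 a b 0) / n\<close> tends to \<open>sqrt (1 - u\<^sup>2)\<close>, and this
  factor multiplies the thresholds.\<close>

lemma tableau_limit:
 fixes k :: "nat => int"
 assumes u: "\<bar>u\<bar> < 1" and odd: "\<And>n. 2 <= n ==> odd (k n + int n)"
  and lim: "(\<lambda>n. ir (k n) / real n) \<longlonglongrightarrow> u" and A: "thresholds A"
 shows "(\<lambda>n. tableau_prob (k n) n A)
  \<longlonglongrightarrow> limit_prob (map_prod id ((*) (sqrt (1 - u\<^sup>2))) ` A)"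
proof (rule LIMSEQ_I)
 fix eps :: real assume "0 < eps"
 then have eps: "0 < eps / 2" by simp
 define w where "w = sqrt (1 - u\<^sup>2)"
 have w: "0 < w" using u by (simp add: w_def abs_square_less_1)
 define f :: "hpoint \<times> real => hpoint \<times> real" where "f = map_prod id ((*) w)"
 have B: "thresholds (f ` A)" using A w by (auto simp: thresholds_def f_def)
 \<comment> \<open>Half the distance of \<bar>u\<bar> from 1, so that column 0 stays in the bulk for
   large \<open>n\<close>.\<close>
 define eta where "eta = (1 - \<bar>u\<bar>) / 2"
 have eta: "0 < eta" "eta <= 1" using u by (auto simp: eta_def)
 obtain rho n0 where rho: "0 < rho" and K: "\<And>a b g. ample n0 eta a b ==> times_near (f ` A) snd rho a b g ==>
   \<bar>word_prob a b (f ` A) (hcol \<circ> fst) (hidx \<circ> fst) g - limit_prob (f ` A)\<bar> <= eps / 2"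
  using limit_prob_approx[OF B eps eta] unfolding approximates_def by blast
 have E1: "\<forall>\<^sub>F n in sequentially. n0 <= real n" by (rule eventually_ge_at_top[THEN eventually_compose_filterlim]) (rule filterlim_real_sequentially)
 have E2: "\<forall>\<^sub>F n in sequentially. 2 <= n" by (rule eventually_ge_at_top)
 have E3: "\<forall>\<^sub>F n in sequentially. \<bar>ir (k n)\<bar> <= (1 - eta) * real n"
 proof -
  have "(\<lambda>n. \<bar>ir (k n) / real n\<bar>) \<longlonglongrightarrow> \<bar>u\<bar>" by (intro tendsto_intros lim)
  moreover have "\<bar>u\<bar> < 1 - eta" using u by (simp add: eta_def field_simps)
  ultimately have "\<forall>\<^sub>F n in sequentially. \<bar>ir (k n) / real n\<bar> < 1 - eta" by (rule order_tendstoD(2))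
  then show ?thesis using E2
  proof eventually_elim
   case (elim n)
   then have "\<bar>ir (k n)\<bar> / real n < 1 - eta" by simp
   then show ?case using elim(2) by (simp add: pos_divide_less_eq)
  qed
 qed
 have E4: "\<forall>\<^sub>F n in sequentially. \<forall>q\<in>A. \<bar>real (nat \<lfloor>snd q * real n\<rfloor>) / real n * sqrt (1 - (ir (k n) / real n)\<^sup>2) - snd (f q)\<bar> <= rho"
 proof (rule eventually_ball_finite)
  show "finite A" using A by (simp add: thresholds_def)
  show "\<forall>q\<in>A. \<forall>\<^sub>F n in sequentially. \<bar>real (nat \<lfloor>snd q * real n\<rfloor>) / real n * sqrt (1 - (ir (k n) / real n)\<^sup>2) - snd (f q)\<bar> <= rho"
  proof
   fix q assume "q \<in> A"
   then have t: "0 < snd q" using A by (auto simp: thresholds_def)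
   have "(\<lambda>n. real (nat \<lfloor>snd q * real n\<rfloor>) / real n) \<longlonglongrightarrow> snd q"
   proof (rule tendsto_sandwich[of "\<lambda>n. snd q - 1 / real n" _ _ "\<lambda>n. snd q"])
    have fl: "snd q * real n - 1 <= real (nat \<lfloor>snd q * real n\<rfloor>)" "real (nat \<lfloor>snd q * real n\<rfloor>) <= snd q * real n" for n
    proof -
     have "real (nat \<lfloor>snd q * real n\<rfloor>) = ir \<lfloor>snd q * real n\<rfloor>" using t by simp
     then show "snd q * real n - 1 <= real (nat \<lfloor>snd q * real n\<rfloor>)" "real (nat \<lfloor>snd q * real n\<rfloor>) <= snd q * real n" by linarith+
    qed
    show "\<forall>\<^sub>F n in sequentially. snd q - 1 / real n <= real (nat \<lfloor>snd q * real n\<rfloor>) / real n"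
     using E2
    proof eventually_elim
     case (elim n)
     have "(snd q * real n - 1) / real n <= real (nat \<lfloor>snd q * real n\<rfloor>) / real n" by (intro divide_right_mono fl) simp
     then show ?case using elim by (simp add: diff_divide_distrib)
    qed
    show "\<forall>\<^sub>F n in sequentially. real (nat \<lfloor>snd q * real n\<rfloor>) / real n <= snd q"
     using E2
    proof eventually_elim
     case (elim n)
     then show ?case using fl(2)[of n] by (simp add: pos_divide_le_eq)
    qed
    show "(\<lambda>n. snd q - 1 / real n) \<longlonglongrightarrow> snd q"
     using tendsto_diff[OF tendsto_const lim_1_over_n, of "snd q"] by simp
   qed simp
   moreover have "(\<lambda>n. sqrt (1 - (ir (k n) / real n)\<^sup>2)) \<longlonglongrightarrow> w"
    unfolding w_def by (intro tendsto_intros lim)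
   ultimately have "(\<lambda>n. real (nat \<lfloor>snd q * real n\<rfloor>) / real n * sqrt (1 - (ir (k n) / real n)\<^sup>2)) \<longlonglongrightarrow> snd q * w"
    by (intro tendsto_mult)
   then have "\<forall>\<^sub>F n in sequentially. dist (real (nat \<lfloor>snd q * real n\<rfloor>) / real n * sqrt (1 - (ir (k n) / real n)\<^sup>2)) (snd q * w) < rho"
    using rho by (rule tendstoD)
   then show "\<forall>\<^sub>F n in sequentially. \<bar>real (nat \<lfloor>snd q * real n\<rfloor>) / real n * sqrt (1 - (ir (k n) / real n)\<^sup>2) - snd (f q)\<bar> <= rho"
   proof eventually_elim
    case (elim n)
    have "snd (f q) = snd q * w" by (simp add: f_def snd_map_prod)
    then show ?case using elim unfolding dist_real_def by simp
   qed
  qed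
 qed
 have E5: "\<forall>\<^sub>F n in sequentially. \<forall>q\<in>A. \<bar>ir (hcol (fst q))\<bar> + ir (snd (Rep_hpoint (fst q))) + 1 <= eta * real n"
 proof (rule eventually_ball_finite)
  show "finite A" using A by (simp add: thresholds_def)
  have "filterlim (\<lambda>n. eta * real n) at_top sequentially" by (rule filterlim_tendsto_pos_mult_at_top[OF tendsto_const eta(1) filterlim_real_sequentially])
  then show "\<forall>q\<in>A. \<forall>\<^sub>F n in sequentially. \<bar>ir (hcol (fst q))\<bar> + ir (snd (Rep_hpoint (fst q))) + 1 <= eta * real n"
   by (auto simp: filterlim_at_top)
 qed
 have "\<forall>\<^sub>F n in sequentially. \<bar>tableau_prob (k n) n A - limit_prob (f ` A)\<bar> <= eps / 2"
  using E1 E2 E3 E4 E5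
 proof eventually_elim
  case (elim n)
  define a where "a = (k n - int n + 1) div 2"
  define b where "b = (k n + int n - 1) div 2"
  have c: "2 * a = k n - int n + 1" "2 * b = k n + int n - 1" using odd[OF elim(2)] unfolding a_def b_def by presburger+
  have ba: "side a b = real n" using staircase_params(3)[OF elim(2) c] by simp
  have ab1: "ir (2 * b + 1) = real n + ir (k n)" "ir (1 - 2 * a) = real n - ir (k n)"
   unfolding c by simp_all
  have kn: "ir (k n) <= (1 - eta) * real n" "- ((1 - eta) * real n) <= ir (k n)" using elim(3) by linarith+
  then have e1: "eta * real n <= real n + ir (k n)" and e2: "eta * real n <= real n - ir (k n)" by (simp_all add: algebra_simps)
  have st: "fst q \<in> staircase (k n) n" if "q \<in> A" for q
  proof -
   have "\<bar>ir (hcol (fst q))\<bar> + ir (snd (Rep_hpoint (fst q))) + 1 <= eta * real n" using elim(5) that by blast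
   then have "\<bar>ir (hcol (fst q))\<bar> + ir (snd (Rep_hpoint (fst q))) + 1 <= ir (2 * b + 1)"
    "\<bar>ir (hcol (fst q))\<bar> + ir (snd (Rep_hpoint (fst q))) + 1 <= ir (1 - 2 * a)" using e1 e2 unfolding ab1 by linarith+
   then have "\<bar>hcol (fst q)\<bar> + snd (Rep_hpoint (fst q)) <= 2 * b" "\<bar>hcol (fst q)\<bar> + snd (Rep_hpoint (fst q)) <= - 2 * a" by linarith+
   then show ?thesis unfolding staircase_eq_stairs[OF c] stairs_def by auto
  qed
  define g where "g q = nat \<lfloor>snd q / w * real n\<rfloor>" for q :: "hpoint \<times> real"
  have gf: "g (f q) = nat \<lfloor>snd q * real n\<rfloor>" for q using w by (simp add: g_def f_def snd_map_prod)
  have sig: "sqrt (width2 a b 0) / real n = sqrt (1 - (ir (k n) / real n)\<^sup>2)"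
  proof -
   have "width2 a b 0 = (real n + ir (k n)) * (real n - ir (k n))" unfolding width2_def ab1[symmetric] by simp
   also have "\<dots> = (real n)\<^sup>2 * (1 - (ir (k n) / real n)\<^sup>2)" using elim(2) by (simp add: field_simps power2_eq_square)
   finally show ?thesis using elim(2) by (simp add: real_sqrt_mult)
  qed
  have "\<bar>word_prob a b (f ` A) (hcol \<circ> fst) (hidx \<circ> fst) g - limit_prob (f ` A)\<bar> <= eps / 2"
  proof (rule K)
   show "times_near (f ` A) snd rho a b g"
    unfolding times_near_def
   proof
    fix p assume "p \<in> f ` A"
    then obtain q where q: "q \<in> A" "p = f q" by auto
    have "real (g p) * sqrt (width2 a b 0) / (side a b)\<^sup>2
     = real (nat \<lfloor>snd q * real n\<rfloor>) / real n * (sqrt (width2 a b 0) / real n)"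
     unfolding ba q(2) gf by (simp add: power2_eq_square)
    then show "\<bar>real (g p) * sqrt (width2 a b 0) / (side a b)\<^sup>2 - snd p\<bar> <= rho"
     using elim(4) q unfolding sig by simp
   qed
   show "ample n0 eta a b" unfolding ample_def ba ab1 using elim(1) e1 e2 by auto
  qed
  moreover have "word_prob a b (f ` A) (hcol \<circ> fst) (hidx \<circ> fst) g = word_prob a b A (hcol \<circ> fst) (hidx \<circ> fst) (\<lambda>q. nat \<lfloor>snd q * real n\<rfloor>)"
   unfolding word_prob_image by (simp add: comp_def gf) (simp add: f_def)
  moreover have "tableau_prob (k n) n A
   = word_prob a b A (hcol \<circ> fst) (hidx \<circ> fst) (\<lambda>q. nat \<lfloor>snd q * real n\<rfloor>)"
   by (rule tableau_event[OF elim(2) c A]) (rule st)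
  ultimately show ?case by simp
 qed
 then obtain N where N: "\<And>n. N <= n ==> \<bar>tableau_prob (k n) n A - limit_prob (f ` A)\<bar> <= eps / 2"
  by (auto simp: eventually_sequentially)
 show "\<exists>no. \<forall>n\<ge>no. norm (tableau_prob (k n) n A
  - limit_prob (map_prod id ((*) (sqrt (1 - u\<^sup>2))) ` A)) < eps"
 proof (intro exI[of _ N] allI impI)
  fix n assume "N <= n"
  then show "norm (tableau_prob (k n) n A
   - limit_prob (map_prod id ((*) (sqrt (1 - u\<^sup>2))) ` A)) < eps"
   using N[of n] eps unfolding f_def w_def real_norm_def by linarith
 qed
qed

subsection \<open>The limit field\<close>

text \<open>Coding countably many bits in a single real number reduces tightness and subsequential limits to
 Helly's theorem on the line.\<close>

definition cantor_code :: "(nat => bool) => real" where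
 "cantor_code bet = (\<Sum>i. of_bool (bet i) * (2 / 3) * (1 / 3) ^ i)"

text \<open>On the Cantor set this is half of the first ternary digit. The linear piece over the
  middle third makes it continuous, hence usable as a test function for weak convergence.\<close>

definition digit :: "real => real" where "digit x = max 0 (min 1 (3 * x - 1))"

definition cantor_bit :: "nat => real => real" where
 "cantor_bit i x = digit (((\<lambda>x. 3 * x - 2 * digit x) ^^ i) x)"

lemma cantor_summable: "summable (\<lambda>i. of_bool (bet i) * (2 / 3) * (1 / 3 :: real) ^ i)"
proof (rule summable_comparison_test')
 show "summable (\<lambda>i. 2 / 3 * (1 / 3 :: real) ^ i)" by (intro summable_mult summable_geometric) simp
 show "norm (of_bool (bet i) * (2 / 3) * (1 / 3 :: real) ^ i) <= 2 / 3 * (1 / 3) ^ i" if "0 <= i" for i by simp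
qed

lemma cantor_code_bounds: "0 <= cantor_code bet" "cantor_code bet <= 1"
proof -
 show "0 <= cantor_code bet" unfolding cantor_code_def by (rule suminf_nonneg[OF cantor_summable]) simp
 have g: "summable (\<lambda>i. 2 / 3 * (1 / 3 :: real) ^ i)" by (intro summable_mult summable_geometric) simp
 have "cantor_code bet <= (\<Sum>i. 2 / 3 * (1 / 3) ^ i)"
  unfolding cantor_code_def by (rule suminf_le[OF _ cantor_summable g]) simp
 also have "\<dots> = 2 / 3 * (1 / (1 - 1 / 3))" by (subst suminf_mult) (auto simp: suminf_geometric intro!: summable_geometric)
 finally show "cantor_code bet <= 1" by simp
qed

lemma cantor_code_step: "3 * cantor_code bet = 2 * of_bool (bet 0) + cantor_code (\<lambda>i. bet (Suc i))"
proof -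
 let ?f = "\<lambda>i. of_bool (bet i) * (2 / 3) * (1 / 3 :: real) ^ i"
 have "cantor_code bet = ?f 0 + (\<Sum>i. ?f (Suc i))"
  unfolding cantor_code_def using suminf_split_head[OF cantor_summable[of bet]] by simp
 also have "(\<Sum>i. ?f (Suc i)) = (\<Sum>i. 1 / 3 * (of_bool (bet (Suc i)) * (2 / 3) * (1 / 3) ^ i))" by (simp add: mult_ac)
 also have "\<dots> = 1 / 3 * cantor_code (\<lambda>i. bet (Suc i))"
  unfolding cantor_code_def by (rule suminf_mult[OF cantor_summable])
 finally show ?thesis by simp
qed

lemma digit_code: "digit (cantor_code bet) = of_bool (bet 0)"
 using cantor_code_step[of bet] cantor_code_bounds[of "\<lambda>i. bet (Suc i)"] by (simp add: digit_def)

lemma cantor_bit_code: "cantor_bit i (cantor_code bet) = of_bool (bet i)"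
proof -
 have "((\<lambda>x. 3 * x - 2 * digit x) ^^ i) (cantor_code bet) = cantor_code (\<lambda>j. bet (i + j))" for bet
 proof (induction i arbitrary: bet)
  case (Suc i)
  have "3 * cantor_code bet - 2 * digit (cantor_code bet) = cantor_code (\<lambda>j. bet (Suc j))"
   by (simp add: digit_code cantor_code_step)
  then show ?case using Suc.IH[of "\<lambda>j. bet (Suc j)"] by (simp add: funpow_Suc_right del: funpow.simps)
 qed simp
 then show ?thesis by (simp add: cantor_bit_def digit_code)
qed

lemma continuous_digit: "continuous_on UNIV digit"
 unfolding digit_def by (intro continuous_intros)

lemma continuous_cantor_bit: "continuous_on UNIV (cantor_bit i)"
proof -
 have "continuous_on UNIV ((\<lambda>x. 3 * x - 2 * digit x) ^^ i)"
 proof (induction i)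
  case (Suc i)
  have "continuous_on UNIV (\<lambda>x. 3 * x - 2 * digit x)" by (intro continuous_intros continuous_digit)
  from continuous_on_compose[OF Suc continuous_on_subset[OF this]] show ?case by (simp add: comp_def)
 qed (simp add: id_def)
 from continuous_on_compose[OF this continuous_on_subset[OF continuous_digit]] show ?thesis
  by (simp add: cantor_bit_def[abs_def] comp_def)
qed

lemma cantor_bit_range: "0 <= cantor_bit i x" "cantor_bit i x <= 1"
 by (auto simp: cantor_bit_def digit_def)

lemma cantor_bit_measurable [measurable]: "cantor_bit i \<in> borel_measurable borel"
 by (rule borel_measurable_continuous_onI[OF continuous_cantor_bit])

definition word_bits :: "int => int list => nat => bool" where
 "word_bits h w i = (case from_nat i :: hpoint \<times> rat of (z, q) =>
  hidx z < count_list (take (nat \<lfloor>of_rat q * ir (2 * h + 1)\<rfloor>) w) (hcol z))"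

definition rat_thresholds :: "(hpoint \<times> rat) set => bool" where
 "rat_thresholds A \<longleftrightarrow> finite A \<and> (\<forall>q\<in>A. 0 < snd q)"

lemma thresholds_of_rat: "rat_thresholds A ==> thresholds (map_prod id of_rat ` A)"
 by (auto simp: rat_thresholds_def thresholds_def)

lemma count_take_mono: "n <= n' ==> count_list (take n ws) x <= count_list (take n' ws) x"
proof -
 assume "n <= n'"
 then have "take n' ws = take n ws @ take (n' - n) (drop n ws)" by (metis le_add_diff_inverse take_add)
 then show ?thesis by simp
qed

lemma window_prob_mono:
 assumes "0 <= h" "t <= t'"
 shows "window_prob h {(z, t)} <= window_prob h {(z, t')}" "window_prob h {(z, t), (z, t')} = window_prob h {(z, t)}"
proof -
 have "nat \<lfloor>t * ir (2 * h + 1)\<rfloor> <= nat \<lfloor>t' * ir (2 * h + 1)\<rfloor>"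
  using assms by (intro nat_mono floor_mono mult_right_mono) auto
 note le = count_take_mono[OF this]
 show "window_prob h {(z, t)} <= window_prob h {(z, t')}"
  unfolding window_prob_def window_word_prob_def word_prob_def
  by (rule measure_pmf.finite_measure_mono) (use le less_le_trans in \<open>fastforce+\<close>)
 have "{w. \<forall>q\<in>{(z, t), (z, t')}. (hidx \<circ> fst) q < count_list (take (nat \<lfloor>snd q * ir (2 * h + 1)\<rfloor>) w) ((hcol \<circ> fst) q)}
  = {w. \<forall>q\<in>{(z, t)}. (hidx \<circ> fst) q < count_list (take (nat \<lfloor>snd q * ir (2 * h + 1)\<rfloor>) w) ((hcol \<circ> fst) q)}"
  using le less_le_trans by fastforce
 then show "window_prob h {(z, t), (z, t')} = window_prob h {(z, t)}"
  unfolding window_prob_def window_word_prob_def word_prob_def by simp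
qed

lemma limit_prob_mono:
 assumes "0 < t" "t <= t'"
 shows "limit_prob {(z, t)} <= limit_prob {(z, t')}" "limit_prob {(z, t), (z, t')} = limit_prob {(z, t)}"
proof -
 have th: "thresholds {(z, t)}" "thresholds {(z, t')}" using assms by (auto simp: thresholds_def)
 show "limit_prob {(z, t)} <= limit_prob {(z, t')}"
  by (rule LIMSEQ_le[OF window_prob_tendsto[OF th(1)] window_prob_tendsto[OF th(2)]])
   (use window_prob_mono(1)[OF _ assms(2)] in auto)
 show "limit_prob {(z, t), (z, t')} = limit_prob {(z, t)}"
  unfolding limit_prob_def using window_prob_mono(2)[OF _ assms(2)] by simp
qed

text \<open>All codes lie in the unit interval, so tightness is automatic. Products of bits are
  continuous functions of the code, whence joint probabilities pass to the limit; that the limiting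
  bits still take only the values 0 and 1 follows from the test function
  \<open>b * (1 - b)\<close>.\<close>

lemma bit_measure_exists:
 "\<exists>mu. real_distribution mu \<and>
  (\<forall>A. rat_thresholds A --> measure mu {x. \<forall>p\<in>A. cantor_bit (to_nat p) x = 1} = limit_prob (map_prod id of_rat ` A))"
proof -
 define W where "W h = measure_pmf (word_pmf (- int h) (int h) (nbox (- int h) (int h)) (\<lambda>_. 0))" for h
 define X where "X h w = cantor_code (word_bits (int h) w)" for h w
 define mus where "mus h = distr (W h) borel (X h)" for h
 have X: "X h \<in> borel_measurable (W h)" for h by (simp add: W_def)
 have W: "prob_space (W h)" for h unfolding W_def by (rule prob_space_measure_pmf)
 have rd: "real_distribution (mus h)" for h
  unfolding mus_def by (rule prob_space.real_distribution_distr[OF W X])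
 have "tight mus"
  unfolding tight_def
 proof (intro conjI allI impI rd)
  fix eps :: real assume eps: "0 < eps"
  show "\<exists>a b. a < b \<and> (\<forall>n. 1 - eps < measure (mus n) {a<..b})"
  proof (rule exI[of _ "-1"], rule exI[of _ 1], intro conjI allI)
   fix n
   interpret W: prob_space "W n" by (rule W)
   have "- 1 < X n w \<and> X n w <= 1" for w
    unfolding X_def using cantor_code_bounds[of "word_bits (int n) w"] by linarith
   then have "X n -` {-1<..1} \<inter> space (W n) = space (W n)" by auto
   then have "measure (mus n) {-1<..1} = 1"
    unfolding mus_def by (subst measure_distr[OF X]) (auto simp: W.prob_space)
   then show "1 - eps < measure (mus n) {-1<..1}" using eps by simp
  qed simp
 qed
 from tight_imp_convergent_subsubsequence[OF this strict_mono_id]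
 obtain r mu where r: "strict_mono r" and mu: "real_distribution mu" and wc: "weak_conv_m (mus \<circ> id \<circ> r) mu" by blast
 interpret mu: real_distribution mu by (rule mu)
 have conv: "(\<lambda>n. integral\<^sup>L (W (r n)) (\<lambda>w. f (X (r n) w))) \<longlonglongrightarrow> integral\<^sup>L mu f"
  if f: "continuous_on UNIV f" "\<And>x. norm (f x) <= B" for f :: "real => real" and B
 proof -
  have "(\<lambda>n. integral\<^sup>L ((mus \<circ> id \<circ> r) n) f) \<longlonglongrightarrow> integral\<^sup>L mu f"
   by (rule weak_conv_imp_integral_bdd_continuous_conv[OF _ mu wc])
    (use rd f in \<open>auto simp: continuous_on_eq_continuous_at\<close>)
  moreover have "integral\<^sup>L (mus n) f = integral\<^sup>L (W n) (\<lambda>w. f (X n w))" for n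
   unfolding mus_def by (rule integral_distr[OF X borel_measurable_continuous_onI[OF f(1)]])
  ultimately show ?thesis by simp
 qed
 have bits: "AE x in mu. cantor_bit i x = 0 \<or> cantor_bit i x = 1" for i
 proof -
  let ?f = "\<lambda>x. cantor_bit i x * (1 - cantor_bit i x)"
  have nn: "0 <= ?f x" for x using cantor_bit_range[of i x] by (intro mult_nonneg_nonneg) auto
  have "norm (?f x) <= 1" for x
   using nn[of x] cantor_bit_range[of i x] mult_mono[of "cantor_bit i x" 1 "1 - cantor_bit i x" 1] by simp
  moreover have "continuous_on UNIV ?f" by (intro continuous_intros continuous_cantor_bit)
  ultimately have "(\<lambda>n. integral\<^sup>L (W (r n)) (\<lambda>w. ?f (X (r n) w))) \<longlonglongrightarrow> integral\<^sup>L mu ?f"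
   by (intro conv[of _ 1])
  moreover have "?f (X n w) = 0" for n w unfolding X_def cantor_bit_code by simp
  ultimately have "(\<lambda>n. 0) \<longlonglongrightarrow> integral\<^sup>L mu ?f" by simp
  then have "integral\<^sup>L mu ?f = 0" by (simp add: LIMSEQ_const_iff)
  moreover have "integrable mu ?f"
   by (rule mu.integrable_const_bound[where B = 1]) (use \<open>\<And>x. norm (?f x) <= 1\<close> in auto)
  ultimately have "AE x in mu. ?f x = 0" using nn by (subst (asm) integral_nonneg_eq_0_iff_AE) auto
  then show ?thesis by eventually_elim auto
 qed
 have "measure mu {x. \<forall>p\<in>A. cantor_bit (to_nat p) x = 1} = limit_prob (map_prod id of_rat ` A)"
  if A: "rat_thresholds A" for A
 proof -
  have fin: "finite A" using A by (simp add: rat_thresholds_def)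
  let ?f = "\<lambda>x. \<Prod>p\<in>A. cantor_bit (to_nat p) x"
  have "norm (?f x) <= 1" for x
   unfolding prod_norm[symmetric] by (rule prod_le_1) (use cantor_bit_range in auto)
  moreover have "continuous_on UNIV ?f" by (intro continuous_on_prod continuous_cantor_bit)
  ultimately have "(\<lambda>n. integral\<^sup>L (W (r n)) (\<lambda>w. ?f (X (r n) w))) \<longlonglongrightarrow> integral\<^sup>L mu ?f"
   by (intro conv[of _ 1])
  moreover have "integral\<^sup>L (W n) (\<lambda>w. ?f (X n w)) = window_prob (int n) (map_prod id of_rat ` A)" for n
  proof -
   have "?f (X n w) = indicator {w. \<forall>p\<in>A. word_bits (int n) w (to_nat p)} w" for w
    unfolding X_def cantor_bit_code using fin by (auto simp: indicator_def prod_zero_iff)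
   then have "integral\<^sup>L (W n) (\<lambda>w. ?f (X n w)) = measure (W n) {w. \<forall>p\<in>A. word_bits (int n) w (to_nat p)}"
    by (simp add: W_def)
   also have "{w. \<forall>p\<in>A. word_bits (int n) w (to_nat p)}
    = {w. \<forall>q\<in>map_prod id of_rat ` A. (hidx \<circ> fst) q < count_list (take (nat \<lfloor>snd q * ir (2 * int n + 1)\<rfloor>) w) ((hcol \<circ> fst) q)}"
    by (auto simp: word_bits_def)
   finally show ?thesis by (simp add: W_def window_prob_def window_word_prob_def word_prob_def)
  qed
  ultimately have "(\<lambda>n. window_prob (int (r n)) (map_prod id of_rat ` A)) \<longlonglongrightarrow> integral\<^sup>L mu ?f" by simp
  moreover have "(\<lambda>n. window_prob (int (r n)) (map_prod id of_rat ` A)) \<longlonglongrightarrow> limit_prob (map_prod id of_rat ` A)"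
   using LIMSEQ_subseq_LIMSEQ[OF window_prob_tendsto[OF thresholds_of_rat[OF A]] r] by (simp add: comp_def)
  ultimately have I: "integral\<^sup>L mu ?f = limit_prob (map_prod id of_rat ` A)" by (rule LIMSEQ_unique)
  have "AE x in mu. \<forall>p\<in>A. cantor_bit (to_nat p) x = 0 \<or> cantor_bit (to_nat p) x = 1"
   by (rule AE_finite_allI[OF fin bits])
  then have "AE x in mu. ?f x = indicator {x. \<forall>p\<in>A. cantor_bit (to_nat p) x = 1} x"
  proof eventually_elim
   case (elim x)
   then show ?case using fin by (auto simp: indicator_def prod_zero_iff intro!: prod.neutral)
  qed
  moreover have S: "{x. \<forall>p\<in>A. cantor_bit (to_nat p) x = 1} \<in> sets mu"
  proof -
   have "{x \<in> space borel. \<forall>p\<in>A. cantor_bit (to_nat p) x = 1} \<in> sets borel"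
    using fin by measurable
   then show ?thesis by simp
  qed
  ultimately have "integral\<^sup>L mu ?f = integral\<^sup>L mu (indicator {x. \<forall>p\<in>A. cantor_bit (to_nat p) x = 1})"
   by (intro integral_cong_AE) auto
  then show ?thesis using I S by simp
 qed
 then show ?thesis using mu by blast
qed

section \<open>The field as a function of the bits\<close>

definition open_rats :: "real => hpoint => rat set" where
 "open_rats x z = {q. 0 < q \<and> cantor_bit (to_nat (z, q)) x = 1}"

text \<open>A bit stands for the event that the field at \<open>z\<close> is at most
  \<open>q\<close>, so the value is recovered as the infimum of the thresholds with bit 1. The
  default 0 is used only on a null set, by tightness.\<close>

definition limit_field :: "real => hpoint => real" where
 "limit_field x z = (if open_rats x z = {} then 0 else Inf (of_rat ` open_rats x z))"

lemma open_rats_bdd: "bdd_below (of_rat ` open_rats x z :: real set)"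
 by (rule bdd_belowI[of _ 0]) (auto simp: open_rats_def less_imp_le)

lemma limit_field_nonneg: "0 <= limit_field x z"
 unfolding limit_field_def by (auto intro!: cInf_greatest simp: open_rats_def less_imp_le)

lemma limit_field_measurable: "limit_field \<in> borel_measurable borel"
proof (rule measurable_coordinatewise_then_product)
 fix z
 show "(\<lambda>x. limit_field x z) \<in> borel_measurable borel"
 proof (rule borel_measurableI_less)
  fix y :: real
  define S where "S q = {x. cantor_bit (to_nat (z, q)) x = 1}" for q :: rat
  have S: "S q \<in> sets borel" for q
  proof -
   have "{x \<in> space borel. cantor_bit (to_nat (z, q)) x = 1} \<in> sets borel" by measurable
   then show ?thesis by (simp add: S_def)
  qed
  have "{x \<in> space borel. limit_field x z < y} = (if y <= 0 then {} else (\<Inter>q\<in>{0<..}. - S q) \<union> (\<Union>q\<in>{q. 0 < q \<and> of_rat q < y}. S q))"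
  proof (cases "y <= 0")
   case True
   then show ?thesis using order_trans[OF True limit_field_nonneg] by (auto simp: not_less)
  next
   case False
   have "limit_field x z < y \<longleftrightarrow> (\<forall>q>0. x \<notin> S q) \<or> (\<exists>q. 0 < q \<and> of_rat q < y \<and> x \<in> S q)" for x
   proof (cases "open_rats x z = {}")
    case True
    then have "\<forall>q>0. x \<notin> S q" by (auto simp: open_rats_def S_def)
    then show ?thesis using True False by (simp add: limit_field_def)
   next
    case ne: False
    have "limit_field x z < y \<longleftrightarrow> (\<exists>q\<in>open_rats x z. of_rat q < y)"
     unfolding limit_field_def using ne cInf_less_iff[OF _ open_rats_bdd, of x z y] by auto
    then show ?thesis using ne by (auto simp: open_rats_def S_def)
   qed
   then show ?thesis using False by auto
  qed
  moreover have "(\<Inter>q\<in>{0<..}. - S q) \<in> sets borel"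
   by (intro sets.countable_INT' countableI_type borel_comp) (auto intro!: exI[of _ 1] borel_comp S)
  moreover have "(\<Union>q\<in>{q. 0 < q \<and> of_rat q < y}. S q) \<in> sets borel"
   by (intro sets.countable_UN' countableI_type) (auto intro: S)
  ultimately show "{x \<in> space borel. limit_field x z < y} \<in> sets borel" by auto
 qed
qed

lemma of_rat_between:
 fixes x y :: real
 assumes "x < y"
 obtains q :: rat where "x < of_rat q" "of_rat q < y"
 using of_rat_dense[OF assms] by blast

text \<open>Outside a null set the bits are monotone in the threshold and eventually 1. The event
  then lies between bit events at rational thresholds slightly below and slightly above, whose
  probabilities are close by \<open>limit_prob_continuous\<close>.\<close>

lemma limit_field_distribution:
 "\<exists>mu. real_distribution mu \<and>
  (\<forall>A. thresholds A --> measure mu {x. \<forall>q\<in>A. limit_field x (fst q) <= snd q} = limit_prob A)"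
proof -
 obtain mu where mu: "real_distribution mu"
  and P: "\<And>A. rat_thresholds A ==> measure mu {x. \<forall>p\<in>A. cantor_bit (to_nat p) x = 1} = limit_prob (map_prod id of_rat ` A)"
  using bit_measure_exists by blast
 interpret mu: real_distribution mu by (rule mu)
 define b where "b z q x \<longleftrightarrow> cantor_bit (to_nat (z, q)) x = 1" for z :: hpoint and q :: rat and x
 have Sb: "{x. b z q x} \<in> sets mu" for z q
 proof -
  have "{x \<in> space borel. cantor_bit (to_nat (z, q)) x = 1} \<in> sets borel" by measurable
  then show ?thesis by (simp add: b_def)
 qed
 have SA: "{x. \<forall>p\<in>A. b (f p) (g p) x} \<in> sets mu" if "finite A" for A :: "(hpoint \<times> real) set" and f g
 proof -
  have "{x. \<forall>p\<in>A. b (f p) (g p) x} = space mu - (\<Union>p\<in>A. space mu - {x. b (f p) (g p) x})" by auto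
  also have "\<dots> \<in> sets mu" using that Sb by (intro sets.Diff sets.finite_UN) auto
  finally show ?thesis .
 qed
 \<comment> \<open>The joint probability of both bits equals that of the first one, because in the
   windows the smaller threshold implies the larger one.\<close>
 have mono: "AE x in mu. b z q x --> b z q' x" if "0 < q" "q <= q'" for z q q'
 proof -
  have r: "(0 :: real) < of_rat q" "(of_rat q :: real) <= of_rat q'" using that by (simp_all add: of_rat_less_eq)
  have "measure mu {x. b z q x} = limit_prob {(z, of_rat q)}"
   using P[of "{(z, q)}"] that by (simp add: rat_thresholds_def b_def)
  moreover have "measure mu {x. b z q x \<and> b z q' x} = limit_prob {(z, of_rat q), (z, of_rat q')}"
   using P[of "{(z, q), (z, q')}"] that by (simp add: rat_thresholds_def b_def)
  moreover have I: "{x. b z q x \<and> b z q' x} = {x. b z q x} \<inter> {x. b z q' x}" by auto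
  ultimately have "measure mu ({x. b z q x} - {x. b z q x \<and> b z q' x}) = 0"
   using limit_prob_mono(2)[OF r, of z] Sb by (subst mu.finite_measure_Diff) auto
  moreover have "{x. b z q x} - {x. b z q x \<and> b z q' x} \<in> sets mu" unfolding I using Sb by auto
  ultimately have "AE x in mu. x \<notin> {x. b z q x} - {x. b z q x \<and> b z q' x}"
   by (intro AE_not_in) (simp add: null_setsI mu.emeasure_eq_measure)
  then show ?thesis by eventually_elim auto
 qed
 have ex: "AE x in mu. \<exists>q>0. b z q x" for z
 proof -
  let ?N = "\<Inter>q\<in>{0<..}. {x. \<not> b z q x}"
  have SN: "{x. \<not> b z q x} \<in> sets mu" for q using sets.compl_sets[OF Sb[of z q]] by (simp add: set_diff_eq)
  have N: "?N \<in> sets mu" by (intro sets.countable_INT'' countableI_type) (use SN in auto)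
  have "measure mu ?N <= eps" if eps: "0 < eps" for eps
  proof -
   obtain t where t: "0 < t" "1 - eps <= limit_prob {(z, t)}" using limit_prob_tight[OF eps] by blast
   obtain q :: rat where q: "t < of_rat q" by (rule of_rat_between[of t "t + 1"]) auto
   then have q0: "0 < q" using t(1) by (metis less_trans zero_less_of_rat_iff)
   have "?N \<subseteq> space mu - {x. b z q x}" using q0 by auto
   then have "measure mu ?N <= measure mu (space mu - {x. b z q x})" using Sb by (intro mu.finite_measure_mono) auto
   also have "\<dots> = 1 - limit_prob {(z, of_rat q)}"
   proof -
    have "measure mu {x. b z q x} = limit_prob {(z, of_rat q)}"
     using P[of "{(z, q)}"] q0 by (simp add: rat_thresholds_def b_def)
    then show ?thesis by (subst mu.prob_compl[OF Sb]) simp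
   qed
   also have "\<dots> <= eps" using limit_prob_mono(1)[OF t(1), of "of_rat q" z] q t(2) by simp
   finally show ?thesis .
  qed
  then have "measure mu ?N <= 0" by (rule field_le_epsilon[of _ 0, simplified])
  then have "measure mu ?N = 0" using measure_nonneg[of mu ?N] by linarith
  then have "AE x in mu. x \<notin> ?N" using N by (intro AE_not_in) (simp add: null_setsI mu.emeasure_eq_measure)
  then show ?thesis by eventually_elim auto
 qed
 have good: "AE x in mu. \<forall>z. (\<forall>q>0. \<forall>q'\<ge>q. b z q x --> b z q' x) \<and> (\<exists>q>0. b z q x)"
 proof -
  have "AE x in mu. \<forall>z. \<forall>q. \<forall>q'. 0 < q --> q <= q' --> b z q x --> b z q' x"
  proof (subst AE_all_countable, intro allI)
   fix z show "AE x in mu. \<forall>q q'. 0 < q --> q <= q' --> b z q x --> b z q' x"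
   proof (subst AE_all_countable, intro allI)
    fix q show "AE x in mu. \<forall>q'. 0 < q --> q <= q' --> b z q x --> b z q' x"
    proof (subst AE_all_countable, intro allI)
     fix q' show "AE x in mu. 0 < q --> q <= q' --> b z q x --> b z q' x"
      using mono[of q q' z] by (cases "0 < q \<and> q <= q'") auto
    qed
   qed
  qed
  moreover have "AE x in mu. \<forall>z. \<exists>q>0. b z q x" unfolding AE_all_countable using ex by blast
  ultimately show ?thesis by eventually_elim blast
 qed
 have le: "limit_field x z <= of_rat q" if "0 < q" "b z q x" for x z q
 proof -
  have "q \<in> open_rats x z" using that by (simp add: open_rats_def b_def)
  then show ?thesis unfolding limit_field_def by (auto intro!: cInf_lower open_rats_bdd)
 qed
 have ge: "b z q' x" if g: "\<forall>z. (\<forall>q>0. \<forall>q'\<ge>q. b z q x --> b z q' x) \<and> (\<exists>q>0. b z q x)" and lt: "limit_field x z < of_rat q'" for x z q'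
 proof -
  have ne: "open_rats x z \<noteq> {}" using g by (auto simp: open_rats_def b_def)
  then have "\<exists>y\<in>(of_rat ` open_rats x z :: real set). y < of_rat q'"
   using lt cInf_less_iff[OF _ open_rats_bdd, of x z "of_rat q'"] by (auto simp: limit_field_def)
  then obtain q where "0 < q" "b z q x" "q < q'" by (auto simp: open_rats_def b_def of_rat_less)
  then show ?thesis using g by (meson less_imp_le)
 qed
 have "measure mu {x. \<forall>q\<in>A. limit_field x (fst q) <= snd q} = limit_prob A" if A: "thresholds A" for A
 proof -
  have fin: "finite A" and pos: "\<And>p. p \<in> A ==> 0 < snd p" using A by (auto simp: thresholds_def)
  define E where "E = {x. \<forall>q\<in>A. limit_field x (fst q) <= snd q}"
  have E: "E \<in> sets mu"
  proof -
   have [measurable]: "(\<lambda>x. limit_field x z) \<in> borel_measurable borel" for z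
    using measurable_product_then_coordinatewise[OF limit_field_measurable] .
   have "{x \<in> space borel. \<forall>q\<in>A. limit_field x (fst q) <= snd q} \<in> sets borel" using fin by measurable
   then show ?thesis by (simp add: E_def)
  qed
  have "\<bar>measure mu E - limit_prob A\<bar> <= eps" if eps: "0 < eps" for eps
  proof -
   obtain dl where dl: "0 < dl" and near: "\<And>f. (\<forall>q\<in>A. fst (f q) = fst q \<and> 0 < snd (f q) \<and> \<bar>snd (f q) - snd q\<bar> <= dl) ==>
     \<bar>limit_prob (f ` A) - limit_prob A\<bar> <= eps"
    using limit_prob_continuous[OF A eps] by blast
   have "\<exists>q :: rat. max 0 (snd p - dl) < of_rat q \<and> of_rat q < snd p" if "p \<in> A" for p
    by (rule of_rat_between[of "max 0 (snd p - dl)" "snd p"]) (use pos[OF that] dl in auto)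
   then obtain l where l: "\<And>p. p \<in> A ==> max 0 (snd p - dl) < of_rat (l p) \<and> of_rat (l p) < snd p" by metis
   have "\<exists>q :: rat. snd p < of_rat q \<and> of_rat q < snd p + dl" for p :: "hpoint \<times> real"
    by (rule of_rat_between[of "snd p" "snd p + dl"]) (use dl in auto)
   then obtain r where r: "\<And>p :: hpoint \<times> real. snd p < of_rat (r p) \<and> of_rat (r p) < snd p + dl" by metis
   have lpos: "0 < l p" if "p \<in> A" for p using l[OF that] by (simp add: zero_less_of_rat_iff)
   have rpos: "0 < r p" if "p \<in> A" for p
   proof -
    have "(0 :: real) < of_rat (r p)" using r[of p] pos[OF that] by linarith
    then show ?thesis by (simp add: zero_less_of_rat_iff)
   qed
   have val: "measure mu {x. \<forall>p\<in>A. b (fst p) (g p) x} = limit_prob ((\<lambda>p. (fst p, of_rat (g p))) ` A)"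
    if "\<And>p. p \<in> A ==> 0 < g p" for g
   proof -
    have "rat_thresholds ((\<lambda>p. (fst p, g p)) ` A)" using fin that by (auto simp: rat_thresholds_def)
    from P[OF this] show ?thesis by (simp add: b_def image_image)
   qed
   have L: "\<bar>limit_prob ((\<lambda>p. (fst p, of_rat (l p))) ` A) - limit_prob A\<bar> <= eps"
    by (rule near) (use l dl in \<open>fastforce simp: abs_le_iff\<close>)
   have R: "\<bar>limit_prob ((\<lambda>p. (fst p, of_rat (r p))) ` A) - limit_prob A\<bar> <= eps"
   proof (rule near, intro ballI conjI)
    fix p assume p: "p \<in> A"
    show "\<bar>snd (fst p, of_rat (r p)) - snd p\<bar> <= dl" using r[of p] by auto
    show "0 < snd (fst p, of_rat (r p) :: real)" using rpos[OF p] by simp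
   qed simp
   have "measure mu {x. \<forall>p\<in>A. b (fst p) (l p) x} <= measure mu E"
   proof (rule mu.finite_measure_mono[OF _ E], rule subsetI)
    fix x assume x: "x \<in> {x. \<forall>p\<in>A. b (fst p) (l p) x}"
    have "limit_field x (fst p) <= snd p" if p: "p \<in> A" for p
    proof -
     have "limit_field x (fst p) <= of_rat (l p)" by (rule le[OF lpos[OF p]]) (use x p in auto)
     then show ?thesis using l[OF p] by linarith
    qed
    then show "x \<in> E" by (simp add: E_def)
   qed
   moreover have "measure mu E <= measure mu {x. \<forall>p\<in>A. b (fst p) (r p) x}"
   proof (rule mu.finite_measure_mono_AE[OF _ SA[OF fin]])
    show "AE x in mu. x \<in> E --> x \<in> {x. \<forall>p\<in>A. b (fst p) (r p) x}"
     using good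
    proof eventually_elim
     case (elim x)
     show ?case
     proof (intro impI CollectI ballI)
      fix p assume "x \<in> E" and p: "p \<in> A"
      then have "limit_field x (fst p) <= snd p" by (simp add: E_def)
      then have "limit_field x (fst p) < of_rat (r p)" using r[of p] by linarith
      then show "b (fst p) (r p) x" by (rule ge[OF elim])
     qed
    qed
   qed
   moreover have "measure mu {x. \<forall>p\<in>A. b (fst p) (l p) x} = limit_prob ((\<lambda>p. (fst p, of_rat (l p))) ` A)"
    by (rule val) (rule lpos)
   moreover have "measure mu {x. \<forall>p\<in>A. b (fst p) (r p) x} = limit_prob ((\<lambda>p. (fst p, of_rat (r p))) ` A)"
    by (rule val) (rule rpos)
   ultimately show ?thesis using L R by linarith
  qed
  then have "\<bar>measure mu E - limit_prob A\<bar> <= 0" by (rule field_le_epsilon[of _ 0, simplified])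
  then show ?thesis by (simp add: E_def)
 qed
 then show ?thesis using mu by blast
qed

subsection \<open>Convergence in distribution\<close>

text \<open>The map from \<open>r\<close> to \<open>r / (1 - r)\<close>, a homeomorphism of the unit
  interval onto the compactified half-line; written as a product it is continuous at
  \<open>r = 1\<close>, where its value is infinite.\<close>

definition from_unit :: "real => ennreal" where
 "from_unit r = ennreal r * inverse (ennreal (1 - r))"

definition to_unit :: "ennreal => real" where
 "to_unit s = (if s = \<top> then 1 else enn2real s / (1 + enn2real s))"

lemma to_unit_range: "0 <= to_unit s" "to_unit s <= 1"
 by (auto simp: to_unit_def divide_le_eq_1 add_pos_nonneg)

lemma from_to_unit: "from_unit (to_unit s) = s"
proof (cases s rule: ennreal_cases)
 case (real a)
 have "1 - a / (1 + a) = 1 / (1 + a)" using real by (simp add: field_simps)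
 then have "from_unit (to_unit s) = ennreal (a / (1 + a)) * ennreal (inverse (1 / (1 + a)))"
  using real by (simp add: from_unit_def to_unit_def inverse_ennreal add_pos_nonneg)
 also have "\<dots> = ennreal (a / (1 + a) * inverse (1 / (1 + a)))" using real by (intro ennreal_mult[symmetric]) auto
 also have "a / (1 + a) * inverse (1 / (1 + a)) = a" using real by (simp add: field_simps)
 finally show ?thesis using real by simp
qed (simp add: from_unit_def to_unit_def)

lemma to_unit_le_iff:
 assumes "0 < r" "r < 1"
 shows "to_unit s <= r \<longleftrightarrow> s <= ennreal (r / (1 - r))"
proof (cases s rule: ennreal_cases)
 case (real a)
 have "a / (1 + a) <= r \<longleftrightarrow> a <= r / (1 - r)" using real assms by (simp add: field_simps)
 then show ?thesis using real assms by (simp add: to_unit_def)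
qed (use assms in \<open>simp add: to_unit_def top_unique\<close>)

lemma continuous_from_unit: "continuous_on {0..1} from_unit"
 unfolding continuous_on_def
proof
 fix r :: real assume r: "r \<in> {0..1}"
 have "((\<lambda>r. ennreal r) \<longlongrightarrow> ennreal r) (at r within {0..1})" by (intro tendsto_intros)
 moreover have "continuous_on {0..1} (\<lambda>r. inverse (ennreal (1 - r)))"
  by (intro continuous_on_inverse_ennreal continuous_on_ennreal continuous_intros)
 then have "((\<lambda>r. inverse (ennreal (1 - r))) \<longlongrightarrow> inverse (ennreal (1 - r))) (at r within {0..1})"
  using r unfolding continuous_on_def by blast
 moreover have "\<not> ((ennreal r = 0 \<and> inverse (ennreal (1 - r)) = \<infinity>) \<or> (ennreal r = \<infinity> \<and> inverse (ennreal (1 - r)) = 0))"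
  using r by (auto simp: ennreal_eq_0_iff)
 ultimately show "(from_unit \<longlongrightarrow> from_unit r) (at r within {0..1})"
  unfolding from_unit_def[abs_def] by (rule tendsto_mult_ennreal)
qed

definition unit_cube :: "(hpoint => real) set" where
 "unit_cube = {x. \<forall>z. x z \<in> {0..1}}"

lemma compact_unit_cube: "compact unit_cube"
proof -
 have "compactin (product_topology (\<lambda>_. euclidean) UNIV) (PiE (UNIV :: hpoint set) (\<lambda>_. {0..1 :: real}))"
  unfolding compactin_PiE by simp
 moreover have "unit_cube = PiE UNIV (\<lambda>_. {0..1})" by (auto simp: unit_cube_def PiE_def)
 ultimately show ?thesis unfolding euclidean_product_topology by simp
qed

definition rect :: "(hpoint \<times> real) set => (hpoint => ennreal) set" where
 "rect A = {x. \<forall>q\<in>A. x (fst q) <= ennreal (snd q)}"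

lemma rect_Un: "rect (A \<union> B) = rect A \<inter> rect B"
 by (auto simp: rect_def)

lemma thresholds_Un: "thresholds A ==> thresholds B ==> thresholds (A \<union> B)"
 by (auto simp: thresholds_def)

lemma rect_measurable: "finite A ==> rect A \<in> sets borel"
proof -
 assume "finite A"
 have [measurable]: "(\<lambda>x :: hpoint => ennreal. x z) \<in> borel_measurable borel" for z
  by (rule borel_measurable_continuous_onI) simp
 have "{x \<in> space borel. \<forall>q\<in>A. x (fst q) <= ennreal (snd q)} \<in> sets borel"
  using \<open>finite A\<close> by measurable
 then show ?thesis by (simp add: rect_def)
qed

text \<open>Linear combinations of rectangle indicators. They form an algebra because rectangles are
  closed under intersection.\<close>

inductive_set rect_simple :: "((hpoint => ennreal) => real) set" where
 ind: "thresholds A ==> (\<lambda>x. indicator (rect A) x) \<in> rect_simple"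
| add: "s \<in> rect_simple ==> t \<in> rect_simple ==> (\<lambda>x. s x + t x) \<in> rect_simple"
| scale: "s \<in> rect_simple ==> (\<lambda>x. c * s x) \<in> rect_simple"

lemma rect_simple_const: "(\<lambda>_. c) \<in> rect_simple"
 using rect_simple.scale[OF rect_simple.ind[of "{}"], of c] by (simp add: thresholds_def rect_def)

lemma rect_simple_mult: "s \<in> rect_simple ==> t \<in> rect_simple ==> (\<lambda>x. s x * t x) \<in> rect_simple"
proof (induction rule: rect_simple.induct)
 case (ind A)
 show ?case using ind(2,1)
 proof (induction rule: rect_simple.induct)
  case (ind B)
  have "(\<lambda>x. indicat_real (rect A) x * indicat_real (rect B) x) = (\<lambda>x. indicat_real (rect (A \<union> B)) x)"
   by (auto simp: rect_Un indicator_def fun_eq_iff)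
  moreover have "thresholds (A \<union> B)" using ind by (intro thresholds_Un)
  ultimately show ?case using rect_simple.ind[of "A \<union> B"] by simp
 next
  case (add s t)
  then show ?case using rect_simple.add[of "\<lambda>x. indicator (rect A) x * s x" "\<lambda>x. indicator (rect A) x * t x"] by (simp add: distrib_left)
 next
  case (scale s c)
  then show ?case using rect_simple.scale[of "\<lambda>x. indicator (rect A) x * s x" c] by (simp add: mult_ac)
 qed
next
 case (add s s')
 then show ?case using rect_simple.add[of "\<lambda>x. s x * t x" "\<lambda>x. s' x * t x"] by (simp add: distrib_right)
next
 case (scale s c)
 then show ?case using rect_simple.scale[of "\<lambda>x. s x * t x" c] by (simp add: mult_ac)
qed

lemma rect_simple_sum: "finite J ==> (\<And>j. j \<in> J ==> s j \<in> rect_simple) ==> (\<lambda>x. \<Sum>j\<in>J. s j x) \<in> rect_simple"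
 by (induction J rule: finite_induct) (auto intro: rect_simple.add rect_simple_const)

lemma rect_simple_bounded: "s \<in> rect_simple ==> \<exists>B\<ge>0. \<forall>x. \<bar>s x\<bar> <= B"
proof (induction rule: rect_simple.induct)
 case (ind A)
 then show ?case by (intro exI[of _ 1]) (auto simp: indicator_def)
next
 case (add s t)
 then obtain B B' where B: "0 <= B" "\<And>x. \<bar>s x\<bar> <= B" "0 <= B'" "\<And>x. \<bar>t x\<bar> <= B'" by blast
 have "\<bar>s x + t x\<bar> <= B + B'" for x using B(2)[of x] B(4)[of x] by linarith
 then show ?case using B(1,3) by (intro exI[of _ "B + B'"]) simp
next
 case (scale s c)
 then obtain B where "0 <= B" "\<And>x. \<bar>s x\<bar> <= B" by blast
 then show ?case by (intro exI[of _ "\<bar>c\<bar> * B"]) (auto simp: abs_mult intro: mult_left_mono)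
qed

lemma rect_simple_measurable: "s \<in> rect_simple ==> s \<in> borel_measurable borel"
 by (induction rule: rect_simple.induct)
  (auto intro!: borel_measurable_indicator rect_measurable simp: thresholds_def)

text \<open>The uniform closure of the step functions. That the generators are discontinuous does no
  harm: rectangle probabilities converge for all positive thresholds, and this passes to uniform
  limits.\<close>

definition rect_approx :: "((hpoint => ennreal) => real) set" where
 "rect_approx = {f. \<forall>eps>0. \<exists>s\<in>rect_simple. \<forall>x. \<bar>f x - s x\<bar> <= eps}"

lemma rect_approx_bounded: "f \<in> rect_approx ==> \<exists>B\<ge>0. \<forall>x. \<bar>f x\<bar> <= B"
proof -
 assume "f \<in> rect_approx"
 then obtain s where s: "s \<in> rect_simple" "\<And>x. \<bar>f x - s x\<bar> <= 1" unfolding rect_approx_def using zero_less_one by blast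
 obtain B where B: "0 <= B" "\<And>x. \<bar>s x\<bar> <= B" using rect_simple_bounded[OF s(1)] by blast
 have "\<bar>f x\<bar> <= B + 1" for x using s(2)[of x] B(2)[of x] by linarith
 then show ?thesis using B(1) by (intro exI[of _ "B + 1"]) simp
qed

text \<open>Only the \<open>N - 1\<close> interior levels occur in the sum. They correspond to
  thresholds that are positive and finite, the ones for which rectangle probabilities are
  controlled.\<close>

lemma staircase_sum:
 fixes T v :: real
 assumes T: "0 < T" and v: "0 <= v" "v <= T" and N: "0 < N"
 shows "\<bar>v - (\<Sum>k<N - 1. T / real N * (1 - of_bool (v <= real (Suc k) * T / real N)))\<bar> <= T / real N"
proof -
 define y where "y = v * real N / T"
 have y: "0 <= y" "y <= real N" using v T N by (auto simp: y_def pos_divide_le_eq mult.commute intro: mult_left_mono)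
 define c where "c = nat (\<lceil>y\<rceil> - 1)"
 have yc: "\<not> v <= real (Suc k) * T / real N \<longleftrightarrow> k < c" for k
 proof -
  have "\<not> v <= real (Suc k) * T / real N \<longleftrightarrow> real (Suc k) < y" using T N by (simp add: y_def not_le field_simps)
  also have "\<dots> \<longleftrightarrow> int (Suc k) < \<lceil>y\<rceil>" by (simp add: less_ceiling_iff)
  also have "\<dots> \<longleftrightarrow> k < c" by (auto simp: c_def)
  finally show ?thesis .
 qed
 have "\<lceil>y\<rceil> <= int N" using y by (simp add: ceiling_le_iff)
 then have cN: "c <= N - 1" using N by (auto simp: c_def)
 have "(\<Sum>k<N - 1. T / real N * (1 - of_bool (v <= real (Suc k) * T / real N))) = (\<Sum>k<N - 1. if k < c then T / real N else 0)"
  by (rule sum.cong) (use yc in auto)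
 also have "\<dots> = (\<Sum>k<c. T / real N)"
 proof -
  have "{k \<in> {..<N - 1}. k < c} = {..<c}" using cN by auto
  then show ?thesis by (subst sum.inter_filter[symmetric]) simp_all
 qed
 finally have S: "(\<Sum>k<N - 1. T / real N * (1 - of_bool (v <= real (Suc k) * T / real N))) = T / real N * real c" by simp
 have c: "y - 1 <= real c" "real c <= y" using y unfolding c_def by linarith+
 have "v = T / real N * y" using T N by (simp add: y_def)
 then have "v - T / real N * real c = T / real N * (y - real c)" by (simp add: right_diff_distrib)
 moreover have "\<bar>T / real N * (y - real c)\<bar> <= T / real N * 1"
  unfolding abs_mult using c T by (intro mult_mono) auto
 ultimately show ?thesis unfolding S by simp
qed

lemma to_unit_approx: "(\<lambda>x. to_unit (x z)) \<in> rect_approx"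
proof -
 have "\<exists>s\<in>rect_simple. \<forall>x. \<bar>to_unit (x z) - s x\<bar> <= eps" if eps: "0 < eps" for eps
 proof -
  obtain N0 :: nat where N0: "1 / eps <= real N0" using real_arch_simple by blast
  define N where "N = Suc N0"
  have N: "0 < N" "1 / real N <= eps"
  proof -
   have "1 / eps <= real N" using N0 by (simp add: N_def)
   then show "1 / real N <= eps" using eps by (simp add: N_def pos_divide_le_eq mult.commute)
  qed (simp add: N_def)
  define r where "r k = real (Suc k) * 1 / real N" for k
  have r: "0 < r k" "r k < 1" if "k < N - 1" for k
  proof -
   have "real (Suc k) < real N" using that by auto
   then show "0 < r k" "r k < 1" using N by (simp_all add: r_def pos_divide_less_eq del: of_nat_Suc)
  qed
  define s where "s x = (\<Sum>k<N - 1. 1 / real N * (1 + - 1 * indicator (rect {(z, r k / (1 - r k))}) x))" for x :: "hpoint => ennreal"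
  have "s \<in> rect_simple"
   unfolding s_def using r
   by (intro rect_simple_sum rect_simple.scale rect_simple.add rect_simple_const rect_simple.ind)
    (auto simp: thresholds_def)
  moreover have "\<bar>to_unit (x z) - s x\<bar> <= eps" for x
  proof -
   have "s x = (\<Sum>k<N - 1. 1 / real N * (1 - of_bool (to_unit (x z) <= real (Suc k) * 1 / real N)))"
    unfolding s_def
   proof (rule sum.cong[OF refl])
    fix k assume "k \<in> {..<N - 1}"
    then have "to_unit (x z) <= r k \<longleftrightarrow> x z <= ennreal (r k / (1 - r k))" using r by (intro to_unit_le_iff) auto
    then show "1 / real N * (1 + - 1 * indicator (rect {(z, r k / (1 - r k))}) x)
     = 1 / real N * (1 - of_bool (to_unit (x z) <= real (Suc k) * 1 / real N))"
     unfolding r_def[symmetric] by (simp add: rect_def indicator_def)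
   qed
   then show ?thesis using staircase_sum[OF zero_less_one to_unit_range N(1), of "x z"] N(2) by linarith
  qed
  ultimately show ?thesis by blast
 qed
 then show ?thesis by (simp add: rect_approx_def)
qed

lemma rect_approx_mult:
 assumes f: "f \<in> rect_approx" and g: "g \<in> rect_approx"
 shows "(\<lambda>x. f x * g x) \<in> rect_approx"
proof -
 obtain B where B: "0 <= B" "\<And>x. \<bar>f x\<bar> <= B" using rect_approx_bounded[OF f] by blast
 have "\<exists>s\<in>rect_simple. \<forall>x. \<bar>f x * g x - s x\<bar> <= eps" if eps: "0 < eps" for eps
 proof -
  have "0 < eps / (2 * (B + 1))" using eps B(1) by simp
  then obtain t where t: "t \<in> rect_simple" "\<And>x. \<bar>g x - t x\<bar> <= eps / (2 * (B + 1))" using g unfolding rect_approx_def by blast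
  obtain D where D: "0 <= D" "\<And>x. \<bar>t x\<bar> <= D" using rect_simple_bounded[OF t(1)] by blast
  have "0 < eps / (2 * (D + 1))" using eps D(1) by simp
  then obtain s where s: "s \<in> rect_simple" "\<And>x. \<bar>f x - s x\<bar> <= eps / (2 * (D + 1))" using f unfolding rect_approx_def by blast
  have "\<bar>f x * g x - s x * t x\<bar> <= eps" for x
  proof -
   have "f x * g x - s x * t x = f x * (g x - t x) + (f x - s x) * t x" by (simp add: algebra_simps)
   then have "\<bar>f x * g x - s x * t x\<bar> <= \<bar>f x\<bar> * \<bar>g x - t x\<bar> + \<bar>t x\<bar> * \<bar>f x - s x\<bar>"
    by (metis abs_mult abs_triangle_ineq mult.commute)
   also have "\<dots> <= (B + 1) * (eps / (2 * (B + 1))) + (D + 1) * (eps / (2 * (D + 1)))"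
   proof (intro add_mono mult_mono)
    show "\<bar>f x\<bar> <= B + 1" "\<bar>t x\<bar> <= D + 1" using B(2)[of x] D(2)[of x] by linarith+
   qed (use B(1) D(1) s(2)[of x] t(2)[of x] eps in auto)
   also have "\<dots> = eps"
   proof -
    have "p * (eps / (2 * p)) = eps / 2" if "p \<noteq> 0" for p :: real using that by simp
    from this[of "B + 1"] this[of "D + 1"] B(1) D(1) show ?thesis by linarith
   qed
   finally show ?thesis .
  qed
  then show ?thesis using rect_simple_mult[OF s(1) t(1)] by (intro bexI[of _ "\<lambda>x. s x * t x"] allI)
 qed
 then show ?thesis by (simp add: rect_approx_def)
qed

lemma rect_approx_add:
 assumes f: "f \<in> rect_approx" and g: "g \<in> rect_approx"
 shows "(\<lambda>x. f x + g x) \<in> rect_approx"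
proof -
 have "\<exists>s\<in>rect_simple. \<forall>x. \<bar>f x + g x - s x\<bar> <= eps" if eps: "0 < eps" for eps
 proof -
  have "0 < eps / 2" using eps by simp
  then obtain s t where s: "s \<in> rect_simple" "\<And>x. \<bar>f x - s x\<bar> <= eps / 2" and t: "t \<in> rect_simple" "\<And>x. \<bar>g x - t x\<bar> <= eps / 2"
   using f g unfolding rect_approx_def by blast
  have "\<bar>f x + g x - (s x + t x)\<bar> <= eps" for x using s(2)[of x] t(2)[of x] by linarith
  then show ?thesis using rect_simple.add[OF s(1) t(1)] by (intro bexI[of _ "\<lambda>x. s x + t x"] allI)
 qed
 then show ?thesis by (simp add: rect_approx_def)
qed

text \<open>Fields are transported to the compact cube, where the continuous functions with
  approximable pullback form an algebra containing the coordinates. Stone-Weierstrass then reaches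
  every continuous function on the cube, in particular \<open>f\<close> composed with the inverse
  transport.\<close>

lemma rect_approx_all:
 assumes f: "continuous_on UNIV f"
 shows "f \<in> rect_approx"
proof -
 define \<Phi> where "\<Phi> x = (\<lambda>z. to_unit (x z))" for x :: "hpoint => ennreal"
 define \<Psi> where "\<Psi> y = (\<lambda>z. from_unit (y z))" for y :: "hpoint => real"
 have \<Phi>: "\<Phi> x \<in> unit_cube" "\<Psi> (\<Phi> x) = x" for x
  by (simp_all add: \<Phi>_def \<Psi>_def unit_cube_def to_unit_range from_to_unit)
 define R where "R = {g. continuous_on unit_cube g \<and> (\<lambda>x. g (\<Phi> x)) \<in> rect_approx}"
 have const: "(\<lambda>_. c) \<in> rect_approx" for c
  unfolding rect_approx_def using rect_simple_const[of c] by (auto intro!: bexI[of _ "\<lambda>_. c"])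
 interpret function_ring_on R unit_cube
 proof
  show "compact unit_cube" by (rule compact_unit_cube)
  show "continuous_on unit_cube g" if "g \<in> R" for g using that by (simp add: R_def)
  show "(\<lambda>x. g x + h x) \<in> R" "(\<lambda>x. g x * h x) \<in> R" if "g \<in> R" "h \<in> R" for g h
   using that by (auto simp: R_def intro!: continuous_on_add continuous_on_mult rect_approx_add rect_approx_mult)
  show "(\<lambda>_. c) \<in> R" for c by (simp add: R_def const)
  show "\<exists>g\<in>R. g x \<noteq> g y" if neq: "x \<noteq> y" for x y :: "hpoint => real"
  proof -
   obtain z where z: "x z \<noteq> y z" using neq by (auto simp: fun_eq_iff)
   have "(\<lambda>x. x z) \<in> R"
    unfolding R_def \<Phi>_def using to_unit_approx[of z] continuous_on_subset[OF continuous_on_product_coordinates] by auto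
   then show ?thesis using z by (intro bexI[of _ "\<lambda>x. x z"])
  qed
 qed
 have "continuous_on unit_cube \<Psi>"
 proof (rule continuous_on_coordinatewise_then_product)
  fix z
  have "continuous_on unit_cube (\<lambda>y. y z)" by (rule continuous_on_subset[OF continuous_on_product_coordinates]) simp
  then show "continuous_on unit_cube (\<lambda>y. \<Psi> y z)"
   unfolding \<Psi>_def by (rule continuous_on_compose2[OF continuous_from_unit]) (auto simp: unit_cube_def)
 qed
 then have cont: "continuous_on unit_cube (\<lambda>y. f (\<Psi> y))" by (rule continuous_on_compose2[OF f]) simp
 have "\<exists>s\<in>rect_simple. \<forall>x. \<bar>f x - s x\<bar> <= eps" if eps: "0 < eps" for eps
 proof -
  have e2: "0 < eps / 2" using eps by simp
  obtain g where g: "g \<in> R" "\<And>y. y \<in> unit_cube ==> \<bar>f (\<Psi> y) - g y\<bar> < eps / 2"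
   using Stone_Weierstrass_basic[OF cont e2] by blast
  obtain s where s: "s \<in> rect_simple" "\<And>x. \<bar>g (\<Phi> x) - s x\<bar> <= eps / 2" using g(1) e2 unfolding R_def rect_approx_def by blast
  have "\<bar>f x - s x\<bar> <= eps" for x using g(2)[OF \<Phi>(1)[of x]] s(2)[of x] unfolding \<Phi>(2) by linarith
  then show ?thesis using s(1) by blast
 qed
 then show ?thesis by (simp add: rect_approx_def)
qed

lemma converges_in_distribution_rects:
 fixes mus :: "nat => (hpoint => ennreal) measure"
 assumes ps: "\<And>n. prob_space (mus n)" "prob_space mu" and bo: "\<And>n. sets (mus n) = sets borel" "sets mu = sets borel"
  and conv: "\<And>A. thresholds A ==> (\<lambda>n. measure (mus n) (rect A)) \<longlonglongrightarrow> measure mu (rect A)"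
 shows "converges_in_distribution mus mu"
 unfolding converges_in_distribution_def
proof (intro allI impI)
 fix f :: "(hpoint => ennreal) => real" assume f: "continuous_on UNIV f" "bounded (range f)"
 have int: "integrable M g" if "prob_space M" "sets M = sets borel" "g \<in> borel_measurable borel" "\<And>x. \<bar>g x\<bar> <= B"
  for M :: "(hpoint => ennreal) measure" and g :: "(hpoint => ennreal) => real" and B
 proof -
  interpret prob_space M by (rule that(1))
  have "g \<in> borel_measurable M" using that(2,3) by (simp cong: measurable_cong_sets)
  then show ?thesis using that(4) by (intro integrable_const_bound[where B = B]) auto
 qed
 have ints: "integrable M s" if "prob_space M" "sets M = sets borel" "s \<in> rect_simple" for M s
  using rect_simple_bounded[OF that(3)] int[OF that(1,2) rect_simple_measurable[OF that(3)]] by blast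
 obtain B where B: "\<And>x. \<bar>f x\<bar> <= B" using f(2) unfolding bounded_iff by auto
 have intf: "integrable M f" if "prob_space M" "sets M = sets borel" for M
  by (rule int[OF that borel_measurable_continuous_onI[OF f(1)] B])
 have simple: "(\<lambda>n. integral\<^sup>L (mus n) s) \<longlonglongrightarrow> integral\<^sup>L mu s" if "s \<in> rect_simple" for s
  using that
 proof (induction rule: rect_simple.induct)
  case (ind A)
  have "rect A \<in> sets borel" using ind by (auto simp: thresholds_def intro: rect_measurable)
  then show ?case using conv[OF ind] bo by simp
 next
  case (add s t)
  then show ?case using ints ps bo by (simp add: tendsto_add)
 next
  case (scale s c)
  then show ?case by (simp add: tendsto_mult_left)
 qed
 show "(\<lambda>n. integral\<^sup>L (mus n) f) \<longlonglongrightarrow> integral\<^sup>L mu f"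
 proof (rule LIMSEQ_I)
  fix eps :: real assume eps: "0 < eps"
  then have e3: "0 < eps / 3" by simp
  then obtain s where s: "s \<in> rect_simple" "\<And>x. \<bar>f x - s x\<bar> <= eps / 3"
   using rect_approx_all[OF f(1)] unfolding rect_approx_def by blast
  have near: "\<bar>integral\<^sup>L M f - integral\<^sup>L M s\<bar> <= eps / 3" if M: "prob_space M" "sets M = sets borel" for M
  proof -
   interpret prob_space M by (rule M(1))
   have "integral\<^sup>L M f - integral\<^sup>L M s = integral\<^sup>L M (\<lambda>x. f x - s x)" using intf[OF M] ints[OF M s(1)] by simp
   also have "\<bar>\<dots>\<bar> <= integral\<^sup>L M (\<lambda>x. \<bar>f x - s x\<bar>)" by (rule integral_abs_bound)
   also have "\<dots> <= integral\<^sup>L M (\<lambda>_. eps / 3)"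
    using intf[OF M] ints[OF M s(1)] s(2) by (intro integral_mono integrable_abs Bochner_Integration.integrable_diff) auto
   finally show ?thesis by (simp add: prob_space)
  qed
  obtain N where N: "\<And>n. N <= n ==> \<bar>integral\<^sup>L (mus n) s - integral\<^sup>L mu s\<bar> < eps / 3"
   using LIMSEQ_D[OF simple[OF s(1)] e3] by auto
  show "\<exists>N. \<forall>n\<ge>N. norm (integral\<^sup>L (mus n) f - integral\<^sup>L mu f) < eps"
  proof (intro exI[of _ N] allI impI)
   fix n assume "N <= n"
   then show "norm (integral\<^sup>L (mus n) f - integral\<^sup>L mu f) < eps"
    using N[of n] near[OF ps(1) bo(1), of n] near[OF ps(2) bo(2)] unfolding real_norm_def by linarith
  qed
 qed
qed

subsection \<open>Stationarity and mixing\<close>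

definition below_set :: "(hpoint \<times> real) set => (hpoint => real) set" where
 "below_set A = {f. \<forall>q\<in>A. f (fst q) <= snd q}"

definition below_sets :: "(hpoint => real) set set" where
 "below_sets = below_set ` Collect thresholds"

text \<open>This is the random field \<open>F\<close> of the theorem: almost surely the identity
  under the limit law, and nonnegative without exception.\<close>

definition positive_part :: "(hpoint => real) => hpoint => real" where
 "positive_part f = (\<lambda>z. max 0 (f z))"

lemma coordinate_measurable: "(\<lambda>f :: hpoint => real. f z) \<in> borel_measurable borel"
 by (rule borel_measurable_continuous_onI) simp

lemma below_set_measurable: "finite A ==> below_set A \<in> sets borel"
proof -
 assume "finite A"
 note [measurable] = coordinate_measurable
 have "{f \<in> space borel. \<forall>q\<in>A. f (fst q) <= snd q} \<in> sets borel" using \<open>finite A\<close> by measurable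
 then show ?thesis by (simp add: below_set_def)
qed

lemma below_sets_Int_stable: "Int_stable below_sets"
proof (rule Int_stableI)
 fix a b assume "a \<in> below_sets" "b \<in> below_sets"
 then obtain A B where "thresholds A" "thresholds B" "a = below_set A" "b = below_set B" by (auto simp: below_sets_def)
 then show "a \<inter> b \<in> below_sets" unfolding below_sets_def
  by (intro image_eqI[of _ _ "A \<union> B"]) (auto simp: below_set_def thresholds_Un)
qed

lemma below_sets_Pow: "below_sets \<subseteq> Pow UNIV"
 by simp

lemma below_sets_sigma: "sigma_sets UNIV below_sets \<subseteq> sets borel"
proof -
 have "below_sets \<subseteq> sets borel" by (auto simp: below_sets_def thresholds_def intro: below_set_measurable)
 then show ?thesis using sets.sigma_sets_subset[of below_sets "borel :: (hpoint => real) measure"] by simp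
qed

text \<open>Thresholds are positive, so the generators do not see the sign of a coordinate; nothing is lost on
 the nonnegative fields that carry the limit law.\<close>

lemma positive_part_preimage:
 assumes "B \<in> sets borel"
 shows "positive_part -` B \<in> sigma_sets UNIV below_sets"
proof -
 let ?M = "sigma UNIV below_sets :: (hpoint => real) measure"
 have sM: "sets ?M = sigma_sets UNIV below_sets" by (rule sets_measure_of) simp
 have cyl: "{f. f z <= t} \<in> sets ?M" if "0 < t" for z t
 proof -
  have "{f. f z <= t} = below_set {(z, t)}" by (simp add: below_set_def)
  then have "{f. f z <= t} \<in> below_sets" using that by (auto simp: below_sets_def thresholds_def)
  then show ?thesis unfolding sM by (rule sigma_sets.Basic)
 qed
 have "positive_part \<in> borel_measurable ?M"
 proof (rule measurable_coordinatewise_then_product)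
  fix z
  show "(\<lambda>f. positive_part f z) \<in> borel_measurable ?M"
  proof (rule borel_measurableI_le)
   fix y :: real
   consider "y < 0" | "y = 0" | "0 < y" by linarith
   then show "{f \<in> space ?M. positive_part f z <= y} \<in> sets ?M"
   proof cases
    case 1
    then have e: "{f \<in> space ?M. positive_part f z <= y} = {}" by (auto simp: positive_part_def)
    show ?thesis unfolding e by (rule sets.empty_sets)
   next
    case 2
    have "{f \<in> space ?M. positive_part f z <= y} = (\<Inter>n. {f. f z <= 1 / real (Suc n)})"
    proof (intro set_eqI iffI)
     fix f assume "f \<in> {f \<in> space ?M. positive_part f z <= y}"
     then have "f z <= 0" using 2 by (simp add: positive_part_def)
     then have "f z <= 1 / real (Suc n)" for n by (rule order_trans) simp
     then show "f \<in> (\<Inter>n. {f. f z <= 1 / real (Suc n)})" by blast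
    next
     fix f assume f: "f \<in> (\<Inter>n. {f. f z <= 1 / real (Suc n)})"
     have "f z <= 0"
     proof (rule ccontr)
      assume "\<not> f z <= 0"
      then obtain n where "inverse (real (Suc n)) < f z" using reals_Archimedean[of "f z"] by auto
      moreover have "f z <= 1 / real (Suc n)" using f by blast
      ultimately show False by (simp add: inverse_eq_divide)
     qed
     then show "f \<in> {f \<in> space ?M. positive_part f z <= y}" using 2 by (simp add: positive_part_def)
    qed
    also have "\<dots> \<in> sets ?M" by (intro sets.countable_INT'' cyl) (simp_all add: sigma_sets_top)
    finally show ?thesis .
   next
    case 3
    then have "{f \<in> space ?M. positive_part f z <= y} = {f. f z <= y}" by (auto simp: positive_part_def)
    then show ?thesis using cyl[OF 3] by simp
   qed
  qed
 qed
 from measurable_sets[OF this assms] show ?thesis using sM by simp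
qed

lemma shift_funpow: "(shift_fun ^^ s) f = (\<lambda>z. f (move_point (int s) z))"
proof (induction s arbitrary: f)
 case 0
 then show ?case by (simp add: move_point_def box_eq)
next
 case (Suc s)
 have sp: "shift_point z = move_point 1 z" for z
 proof -
  have "(fst (Rep_hpoint z) + 2, snd (Rep_hpoint z)) = Rep_hpoint (move_point 1 z)"
   using snd_Rep[of z] by (simp add: move_point_def Rep_box hcol_def)
  then show ?thesis unfolding shift_point_def by (simp only: Rep_hpoint_inverse)
 qed
 have "(shift_fun ^^ Suc s) f = (\<lambda>z. shift_fun f (move_point (int s) z))"
  using Suc.IH[of "shift_fun f"] by (simp add: funpow_Suc_right del: funpow.simps)
 also have "\<dots> = (\<lambda>z. f (move_point (int (Suc s)) z))" by (simp add: shift_fun_def sp move_point_def algebra_simps)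
 finally show ?case .
qed

lemma shift_funpow_measurable: "(shift_fun ^^ s) \<in> measurable borel (borel :: (hpoint => real) measure)"
proof (rule measurable_coordinatewise_then_product)
 fix z show "(\<lambda>f. (shift_fun ^^ s) f z) \<in> borel_measurable (borel :: (hpoint => real) measure)"
  unfolding shift_funpow by (rule coordinate_measurable)
qed

lemma shift_below_set: "(shift_fun ^^ s) -` below_set A = below_set (map_prod (move_point (int s)) id ` A)"
 by (auto simp: below_set_def shift_funpow)

lemma thresholds_move: "thresholds A ==> thresholds (map_prod (move_point c) id ` A)"
 by (auto simp: thresholds_def)

text \<open>The product estimate with a single factor, for which the distance condition is void and
  \<open>eps\<close> arbitrary.\<close>

lemma limit_prob_move:
 assumes "thresholds A"
 shows "limit_prob (map_prod (move_point c) id ` A) = limit_prob A"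
proof -
 have "\<bar>limit_prob (map_prod (move_point c) id ` A) - limit_prob A\<bar> <= eps" if eps: "0 < eps" for eps
 proof -
  obtain D where "\<And>M. spaced 1 D M ==>
   \<bar>limit_prob (\<Union>i<1. map_prod (move_point (M i)) id ` A) - (\<Prod>i<1::nat. limit_prob A)\<bar> <= eps"
   using limit_prob_product[of 1 "\<lambda>_. A" eps, OF assms eps] by blast
  from this[of "\<lambda>_. c"] show ?thesis by (simp add: lessThan_Suc One_nat_def spaced_def)
 qed
 then have "\<bar>limit_prob (map_prod (move_point c) id ` A) - limit_prob A\<bar> <= 0" by (rule field_le_epsilon[of _ 0, simplified])
 then show ?thesis by simp
qed

text \<open>All gaps tend to infinity together. As a filter this turns mixing into an ordinary
  limit, so that limits can be added and subtracted in the Dynkin argument.\<close>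

definition gap_filter :: "nat => (nat => nat) filter" where
 "gap_filter k = (INF D. principal {m. \<forall>j<k - 1. D <= m j})"

lemma eventually_gap_filter: "eventually P (gap_filter k) \<longleftrightarrow> (\<exists>D. \<forall>m. (\<forall>j<k - 1. D <= m j) --> P m)"
proof -
 have "eventually P (gap_filter k) \<longleftrightarrow> (\<exists>D\<in>UNIV. eventually P (principal {m. \<forall>j<k - 1. D <= m j}))"
  unfolding gap_filter_def
 proof (rule eventually_INF_base)
  fix a b :: nat
  show "\<exists>x\<in>UNIV. principal {m. \<forall>j<k - 1. x <= m j} <= inf (principal {m. \<forall>j<k - 1. a <= m j}) (principal {m. \<forall>j<k - 1. b <= m j})"
   by (intro bexI[of _ "max a b"]) auto
 qed simp
 then show ?thesis by (simp add: eventually_principal)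
qed

section \<open>Laws with the limiting rectangle probabilities\<close>

locale limit_law = prob_space nu for nu :: "(hpoint => real) measure" +
 assumes sets_nu: "sets nu = sets borel"
  and nonneg: "AE f in nu. \<forall>z. 0 <= f z"
  and below: "thresholds A ==> prob (below_set A) = limit_prob A"
begin

lemma space_nu: "space nu = UNIV"
 using sets_eq_imp_space_eq[OF sets_nu] by simp

lemma sigma_in_sets: "X \<in> sigma_sets UNIV below_sets ==> X \<in> sets nu"
 using below_sets_sigma sets_nu by auto

lemma shift_preimage_sets: "X \<in> sets nu ==> (shift_fun ^^ s) -` X \<in> sets nu"
 using measurable_sets[OF shift_funpow_measurable, of X s] sets_nu by simp

lemma prob_shift:
 assumes "X \<in> sigma_sets UNIV below_sets"
 shows "prob ((shift_fun ^^ s) -` X) = prob X"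
 using below_sets_Int_stable below_sets_Pow assms
proof (induction rule: sigma_sets_induct_disjoint)
 case (basic X)
 then obtain A where A: "thresholds A" "X = below_set A" by (auto simp: below_sets_def)
 then show ?case using below thresholds_move limit_prob_move by (simp add: shift_below_set)
next
 case (compl X)
 note X = sigma_in_sets[OF compl(1)]
 have "prob (UNIV - (shift_fun ^^ s) -` X) = 1 - prob ((shift_fun ^^ s) -` X)"
  using prob_compl[OF shift_preimage_sets[OF X]] by (simp add: space_nu)
 moreover have "prob (UNIV - X) = 1 - prob X" using prob_compl[OF X] by (simp add: space_nu)
 ultimately show ?case using compl(2) by (simp add: vimage_Diff)
next
 case (union X)
 have X: "X i \<in> sets nu" for i using sigma_in_sets union(2) by blast
 have "(\<lambda>i. prob ((shift_fun ^^ s) -` X i)) sums prob (\<Union>i. (shift_fun ^^ s) -` X i)"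
 proof (rule finite_measure_UNION)
  have "X a \<inter> X b = {}" if "a \<noteq> b" for a b using union(1) that by (auto simp: disjoint_family_on_def)
  then show "disjoint_family (\<lambda>i. (shift_fun ^^ s) -` X i)"
   by (simp add: disjoint_family_on_def vimage_Int[symmetric])
 qed (use X shift_preimage_sets in auto)
 moreover have "(\<lambda>i. prob (X i)) sums prob (\<Union>i. X i)" using X union(1) by (intro finite_measure_UNION) auto
 ultimately show ?case using union(3) by (simp add: vimage_UN sums_unique2)
qed simp

definition joint :: "nat => (nat => (hpoint => real) set) => (nat => nat) => (hpoint => real) set" where
 "joint k C m = {f. \<forall>i<k. (shift_fun ^^ (\<Sum>j<i. m j)) f \<in> C i}"

definition mixes :: "nat => (nat => (hpoint => real) set) => bool" where
 "mixes k C \<longleftrightarrow> ((\<lambda>m. prob (joint k C m)) \<longlongrightarrow> (\<Prod>i<k. prob (C i))) (gap_filter k)"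

lemma joint_sets:
 assumes "\<And>i. i < k ==> C i \<in> sets nu"
 shows "joint k C m \<in> sets nu"
proof -
 have "joint k C m = space nu - (\<Union>i\<in>{..<k}. space nu - (shift_fun ^^ (\<Sum>j<i. m j)) -` C i)"
  by (auto simp: joint_def space_nu)
 also have "\<dots> \<in> sets nu" using assms shift_preimage_sets by (intro sets.Diff sets.finite_UN) auto
 finally show ?thesis .
qed

text \<open>A shift only moves the points of a rectangle, so the joint event is again a rectangle,
  over separated translates, and the product estimate applies.\<close>

lemma mixes_below:
 assumes C: "\<And>i. i < k ==> C i \<in> below_sets"
 shows "mixes k C"
 unfolding mixes_def tendsto_iff dist_real_def
proof (intro allI impI)
 fix e :: real assume "0 < e"
 then have e: "0 < e / 2" by simp
 have "\<forall>i. \<exists>A. i < k --> thresholds A \<and> C i = below_set A" using C by (auto simp: below_sets_def)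
 then obtain A where A: "\<And>i. i < k ==> thresholds (A i)" "\<And>i. i < k ==> C i = below_set (A i)" by metis
 obtain D where D: "\<And>M. spaced k D M ==>
  \<bar>limit_prob (\<Union>i<k. map_prod (move_point (M i)) id ` A i) - (\<Prod>i<k. limit_prob (A i))\<bar> <= e / 2"
  using limit_prob_product[of k A "e / 2"] A(1) e by blast
 show "eventually (\<lambda>m. \<bar>prob (joint k C m) - (\<Prod>i<k. prob (C i))\<bar> < e) (gap_filter k)"
  unfolding eventually_gap_filter
 proof (intro exI[of _ "nat D"] allI impI)
  fix m :: "nat => nat" assume m: "\<forall>j<k - 1. nat D <= m j"
  define M where "M i = int (\<Sum>j<i. m j)" for i
  \<comment> \<open>The offsets are partial sums of the gaps, so two of them differ by at least the
    first gap between them.\<close>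
  have lt: "D <= M j - M i" if "i < j" "j < k" for i j
  proof -
   have "m i <= (\<Sum>l\<in>{i..<j}. m l)" by (rule member_le_sum) (use that in auto)
   moreover have "(\<Sum>l<j. m l) = (\<Sum>l<i. m l) + (\<Sum>l\<in>{i..<j}. m l)"
    using that by (subst sum.union_disjoint[symmetric]) (auto intro!: sum.cong)
   moreover have "nat D <= m i" using m that by auto
   ultimately show ?thesis unfolding M_def by linarith
  qed
  have far: "spaced k D M"
   unfolding spaced_def
  proof (intro allI impI)
   fix i j assume "i < k" "j < k" "i \<noteq> j"
   then show "D <= \<bar>M i - M j\<bar>" using lt[of i j] lt[of j i] by (cases "i < j") auto
  qed
  have "joint k C m = below_set (\<Union>i<k. map_prod (move_point (M i)) id ` A i)"
  proof -
   have "joint k C m = (\<Inter>i\<in>{..<k}. (shift_fun ^^ (\<Sum>j<i. m j)) -` below_set (A i))"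
    using A(2) by (auto simp: joint_def)
   then show ?thesis unfolding shift_below_set M_def by (auto simp: below_set_def)
  qed
  moreover have "thresholds (\<Union>i<k. map_prod (move_point (M i)) id ` A i)"
   using A(1) by (auto simp: thresholds_def)
  ultimately have "prob (joint k C m) = limit_prob (\<Union>i<k. map_prod (move_point (M i)) id ` A i)" by (simp add: below)
  moreover have "(\<Prod>i<k. prob (C i)) = (\<Prod>i<k. limit_prob (A i))"
   using A below by (intro prod.cong) auto
  ultimately show "\<bar>prob (joint k C m) - (\<Prod>i<k. prob (C i))\<bar> < e" using D[OF far] \<open>0 < e\<close> by simp
 qed
qed

lemma joint_upd:
 assumes "l < k"
 shows "joint k (C(l := X)) m = joint k (C(l := UNIV)) m \<inter> (shift_fun ^^ (\<Sum>j<l. m j)) -` X"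
 using assms by (auto simp: joint_def)

lemma prod_upd:
 fixes l k :: nat
 assumes "l < k"
 shows "(\<Prod>i<k. prob ((C(l := X)) i)) = prob X * (\<Prod>i\<in>{..<k} - {l}. prob (C i))"
 using assms by (subst prod.remove[of "{..<k}" l]) (auto intro!: prod.cong)

text \<open>Dynkin's lemma is applied in one coordinate at a time.\<close>

lemma mixes_upd:
 assumes l: "l < k" and C: "\<And>i. i < k ==> C i \<in> sigma_sets UNIV below_sets"
  and base: "\<And>X. X \<in> below_sets ==> mixes k (C(l := X))"
  and X: "X \<in> sigma_sets UNIV below_sets"
 shows "mixes k (C(l := X))"
 using below_sets_Int_stable below_sets_Pow X
proof (induction rule: sigma_sets_induct_disjoint)
 case (basic X)
 then show ?case by (rule base)
next
 case empty
 have "joint k (C(l := {})) m = {}" for m using joint_upd[OF l, of C "{}"] by simp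
 then show ?case unfolding mixes_def prod_upd[OF l] by simp
next
 case (compl X)
 define U where "U m = joint k (C(l := UNIV)) m" for m
 define V where "V m = joint k (C(l := X)) m" for m
 have s: "U m \<in> sets nu" "V m \<in> sets nu" for m
  unfolding U_def V_def using C compl(1) sigma_in_sets sets.top[of nu] space_nu by (auto intro!: joint_sets)
 have "UNIV \<in> below_sets" unfolding below_sets_def by (rule image_eqI[of _ _ "{}"]) (auto simp: below_set_def thresholds_def)
 from base[OF this] have U: "((\<lambda>m. prob (U m)) \<longlongrightarrow> (\<Prod>i<k. prob ((C(l := UNIV)) i))) (gap_filter k)"
  unfolding mixes_def U_def .
 have "joint k (C(l := UNIV - X)) m = U m - V m" for m
  unfolding U_def V_def joint_upd[OF l, of C X] joint_upd[OF l, of C "UNIV - X"] by auto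
 moreover have "V m \<subseteq> U m" for m unfolding U_def V_def joint_upd[OF l, of C X] by auto
 ultimately have "prob (joint k (C(l := UNIV - X)) m) = prob (U m) - prob (V m)" for m
  using s finite_measure_Diff by simp
 moreover have "prob (UNIV - X) = prob UNIV - prob X"
  using prob_compl[OF sigma_in_sets[OF compl(1)]] prob_space by (simp add: space_nu)
 ultimately show ?case
  using tendsto_diff[OF U compl(2)[unfolded mixes_def, folded V_def]]
  unfolding mixes_def prod_upd[OF l] by (simp add: left_diff_distrib)
next
 case (union X)
 define P where "P = (\<Prod>i\<in>{..<k} - {l}. prob (C i))"
 have P: "0 <= P" "P <= 1" unfolding P_def by (auto intro!: prod_nonneg prod_le_1)
 define a where "a Y m = prob (joint k (C(l := Y)) m)" for Y m
 have Xs: "X j \<in> sigma_sets UNIV below_sets" "X j \<in> sets nu" for j using union(2) sigma_in_sets by auto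
 have js: "joint k (C(l := Y)) m \<in> sets nu" if "Y \<in> sets nu" for Y m
  using C that sigma_in_sets by (intro joint_sets) auto
 have IH: "((\<lambda>m. a (X j) m) \<longlongrightarrow> prob (X j) * P) (gap_filter k)" for j
  using union(3)[of j] unfolding mixes_def prod_upd[OF l] a_def P_def .
 define W where "W = (\<Union>j. X j)"
 have W: "W \<in> sets nu" unfolding W_def using Xs by auto
 have W': "W \<in> sigma_sets UNIV below_sets" unfolding W_def using Xs(1) by (intro sigma_sets.Union)
 have fin_sum: "a (\<Union>j<J. X j) m = (\<Sum>j<J. a (X j) m)" for J m
 proof -
  have "joint k (C(l := \<Union>j<J. X j)) m = (\<Union>j<J. joint k (C(l := X j)) m)"
   unfolding joint_upd[OF l, of C "\<Union>j<J. X j"] joint_upd[OF l, of C "X _"] by auto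
  moreover have "disjoint_family_on (\<lambda>j. joint k (C(l := X j)) m) {..<J}"
   using union(1) unfolding joint_upd[OF l, of C "X _"] by (auto simp: disjoint_family_on_def)
  ultimately show ?thesis unfolding a_def using js Xs by (simp add: finite_measure_finite_Union image_subset_iff)
 qed
 have "((\<lambda>m. a W m) \<longlongrightarrow> prob W * P) (gap_filter k)"
  unfolding tendsto_iff dist_real_def
 proof (intro allI impI)
  fix e :: real assume "0 < e"
  then have e: "0 < e / 3" by simp
  have "(\<lambda>j. prob (X j)) sums prob W" unfolding W_def using Xs union(1) by (intro finite_measure_UNION) auto
  then have "(\<lambda>J. \<Sum>j<J. prob (X j)) \<longlonglongrightarrow> prob W" unfolding sums_def .
  from LIMSEQ_D[OF this e] obtain J where J: "\<bar>(\<Sum>j<J. prob (X j)) - prob W\<bar> < e / 3" by auto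
  define Y where "Y = (\<Union>j<J. X j)"
  have Y: "Y \<in> sets nu" unfolding Y_def using Xs by auto
  have Y': "W - Y \<in> sigma_sets UNIV below_sets"
  proof -
   interpret S: sigma_algebra UNIV "sigma_sets UNIV below_sets" by (rule sigma_algebra_sigma_sets) simp
   show ?thesis unfolding Y_def using W' Xs(1) by (intro S.Diff S.finite_UN) auto
  qed
  have pY: "prob Y = (\<Sum>j<J. prob (X j))"
   unfolding Y_def using Xs union(1)
   by (intro finite_measure_finite_Union) (auto simp: disjoint_family_on_def)
  have WY: "prob (W - Y) < e / 3"
  proof -
   have "Y \<subseteq> W" by (auto simp: Y_def W_def)
   then have "prob (W - Y) = prob W - prob Y" using W Y by (simp add: finite_measure_Diff)
   then show ?thesis using J pY by linarith
  qed
  have thirds: "\<bar>x - w\<bar> < e" if "\<bar>x - y\<bar> < e / 3" "\<bar>y - z\<bar> < e / 3" "\<bar>z - w\<bar> < e / 3" for x y z w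
   using that by linarith
  \<comment> \<open>By stationarity the cost of cutting the union off after \<open>J\<close> sets is
    at most \<open>prob (W - Y)\<close>, uniformly in the gaps; this is what allows the limits to be
    interchanged.\<close>
  have near: "\<bar>a W m - a Y m\<bar> < e / 3" for m
  proof -
   have sub: "joint k (C(l := Y)) m \<subseteq> joint k (C(l := W)) m"
    unfolding joint_upd[OF l, of C Y] joint_upd[OF l, of C W] by (auto simp: Y_def W_def)
   have "a W m - a Y m = prob (joint k (C(l := W)) m - joint k (C(l := Y)) m)"
    unfolding a_def using js[OF W] js[OF Y] sub by (simp add: finite_measure_Diff)
   also have "\<dots> <= prob ((shift_fun ^^ (\<Sum>j<l. m j)) -` (W - Y))"
    using shift_preimage_sets[of "W - Y"] W Y
    by (intro finite_measure_mono) (auto simp: joint_upd[OF l, of C Y] joint_upd[OF l, of C W])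
   also have "\<dots> = prob (W - Y)" by (rule prob_shift[OF Y'])
   finally have "a W m - a Y m < e / 3" using WY by linarith
   moreover have "0 <= a W m - a Y m"
    unfolding a_def using finite_measure_mono[OF sub js[OF W]] by simp
   ultimately show ?thesis by linarith
  qed
  have "((\<lambda>m. \<Sum>j<J. a (X j) m) \<longlongrightarrow> (\<Sum>j<J. prob (X j) * P)) (gap_filter k)" by (intro tendsto_sum IH)
  then have "((\<lambda>m. a Y m) \<longlongrightarrow> prob Y * P) (gap_filter k)"
   unfolding Y_def[symmetric] fin_sum[symmetric] pY sum_distrib_right .
  then have "eventually (\<lambda>m. \<bar>a Y m - prob Y * P\<bar> < e / 3) (gap_filter k)"
   using e unfolding tendsto_iff dist_real_def by blast
  then show "eventually (\<lambda>m. \<bar>a W m - prob W * P\<bar> < e) (gap_filter k)"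
  proof eventually_elim
   case (elim m)
   have "\<bar>prob Y * P - prob W * P\<bar> = \<bar>prob Y - prob W\<bar> * P"
    using P by (simp add: abs_mult flip: left_diff_distrib)
   also have "\<dots> <= \<bar>prob Y - prob W\<bar> * 1" using P by (intro mult_left_mono) auto
   also have "\<dots> < e / 3" using J unfolding pY by simp
   finally have "\<bar>prob Y * P - prob W * P\<bar> < e / 3" .
   then show ?case by (rule thirds[OF near[of m] elim])
  qed
 qed
 then show ?case unfolding mixes_def prod_upd[OF l] a_def P_def W_def .
qed

text \<open>The coordinates are released one after the other: the first \<open>l\<close> sets are
  arbitrary, the others still rectangles.\<close>

lemma mixes_sigma:
 assumes "\<And>i. i < k ==> C i \<in> sigma_sets UNIV below_sets"
 shows "mixes k C"
proof -
 have "mixes k C" if "l <= k" "\<And>i. i < k ==> C i \<in> sigma_sets UNIV below_sets" "\<And>i. l <= i ==> i < k ==> C i \<in> below_sets" for l C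
  using that
 proof (induction l arbitrary: C)
  case 0
  then show ?case by (intro mixes_below) auto
 next
  case (Suc l)
  have "mixes k (C(l := C l))"
  proof (rule mixes_upd)
   fix X assume X: "X \<in> below_sets"
   show "mixes k (C(l := X))"
   proof (rule Suc.IH)
    show "(C(l := X)) i \<in> sigma_sets UNIV below_sets" if "i < k" for i
     using Suc.prems(2)[OF that] X by (auto intro: sigma_sets.Basic)
    show "(C(l := X)) i \<in> below_sets" if "l <= i" "i < k" for i
     using Suc.prems(3)[of i] X that by (cases "i = l") auto
   qed (use Suc.prems in auto)
  qed (use Suc.prems in auto)
  then show ?case by simp
 qed
 then show ?thesis using assms by (metis le_refl not_less)
qed

lemma prob_positive_part:
 assumes "B \<in> sets borel"
 shows "prob (positive_part -` B) = prob B"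
proof (rule finite_measure_eq_AE)
 show "AE f in nu. f \<in> positive_part -` B \<longleftrightarrow> f \<in> B"
  using nonneg by eventually_elim (simp add: positive_part_def max_absorb2)
 show "positive_part -` B \<in> sets nu" by (rule sigma_in_sets[OF positive_part_preimage[OF assms]])
 show "B \<in> sets nu" using assms sets_nu by simp
qed

lemma mixing: "mixing_of_all_orders nu shift_fun"
 unfolding mixing_of_all_orders_def k_mixing_def
proof (intro allI impI)
 fix k :: nat and A :: "nat => (hpoint => real) set" and e :: real
 assume A: "\<forall>i<k. A i \<in> sets nu" and e: "0 < e"
 \<comment> \<open>This preimage lies in the sigma-algebra of the rectangles and differs from
   \<open>A i\<close> by a null set, as the law sits on nonnegative fields.\<close>
 define C where "C i = positive_part -` A i" for i
 have C: "C i \<in> sigma_sets UNIV below_sets" if "i < k" for i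
  unfolding C_def using A that sets_nu by (intro positive_part_preimage) auto
 have "mixes k C" by (rule mixes_sigma[OF C])
 then have "eventually (\<lambda>m. \<bar>prob (joint k C m) - (\<Prod>i<k. prob (C i))\<bar> < e) (gap_filter k)"
  using e unfolding mixes_def tendsto_iff dist_real_def by blast
 then obtain D where D: "\<And>m. (\<forall>j<k - 1. D <= m j) ==> \<bar>prob (joint k C m) - (\<Prod>i<k. prob (C i))\<bar> < e"
  unfolding eventually_gap_filter by blast
 have "prob (joint k C m) = prob (joint k A m)" for m
 proof (rule finite_measure_eq_AE)
  show "AE f in nu. f \<in> joint k C m \<longleftrightarrow> f \<in> joint k A m"
   using nonneg by eventually_elim (simp add: joint_def C_def positive_part_def shift_funpow max_absorb2)
  show "joint k C m \<in> sets nu" using C sigma_in_sets by (intro joint_sets) auto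
  show "joint k A m \<in> sets nu" using A by (intro joint_sets) auto
 qed
 moreover have "(\<Prod>i<k. prob (C i)) = (\<Prod>i<k. prob (A i))"
  using A sets_nu unfolding C_def by (intro prod.cong prob_positive_part) auto
 ultimately show "\<exists>M. \<forall>m. (\<forall>j<k - 1. M <= m j) -->
   \<bar>prob {x \<in> space nu. \<forall>i<k. (shift_fun ^^ (\<Sum>j<i. m j)) x \<in> A i} - (\<Prod>i<k. prob (A i))\<bar> < e"
  using D unfolding joint_def space_nu by auto
qed

lemma positive_part_measurable: "positive_part \<in> measurable nu borel"
 using measurable_sets positive_part_preimage sigma_in_sets by (intro measurableI) (auto simp: space_nu)

lemma distr_positive_part: "distr nu borel positive_part = nu"
proof (rule measure_eqI)
 show "sets (distr nu borel positive_part) = sets nu" using sets_nu by simp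
 fix B assume "B \<in> sets (distr nu borel positive_part)"
 then have "B \<in> sets borel" by simp
 then show "emeasure (distr nu borel positive_part) B = emeasure nu B"
  using prob_positive_part[of B] positive_part_measurable by (simp add: emeasure_distr space_nu emeasure_eq_measure)
qed

lemma stationary: "distr nu borel (\<lambda>f. positive_part f \<circ> shift_point) = distr nu borel positive_part"
proof -
 have eq: "(\<lambda>f. positive_part f \<circ> shift_point) = positive_part \<circ> (shift_fun ^^ 1)"
  by (simp add: fun_eq_iff positive_part_def shift_fun_def One_nat_def)
 have "(shift_fun ^^ 1) \<in> measurable nu nu"
  using shift_funpow_measurable[of 1] by (simp only: measurable_cong_sets[OF sets_nu sets_nu])
 then have m: "(\<lambda>f. positive_part f \<circ> shift_point) \<in> measurable nu borel"
  unfolding eq by (rule measurable_comp[OF _ positive_part_measurable])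
 show ?thesis
 proof (rule measure_eqI)
  fix B assume "B \<in> sets (distr nu borel (\<lambda>f. positive_part f \<circ> shift_point))"
  then have B: "B \<in> sets borel" by simp
  have "prob ((\<lambda>f. positive_part f \<circ> shift_point) -` B) = prob ((shift_fun ^^ 1) -` (positive_part -` B))"
   unfolding eq by (simp add: vimage_comp)
  also have "\<dots> = prob (positive_part -` B)" by (rule prob_shift[OF positive_part_preimage[OF B]])
  finally show "emeasure (distr nu borel (\<lambda>f. positive_part f \<circ> shift_point)) B = emeasure (distr nu borel positive_part) B"
   using B m positive_part_measurable by (simp add: emeasure_distr space_nu emeasure_eq_measure)
 qed simp
qed

end

lemma limit_law_exists: "\<exists>nu. limit_law nu"
proof -
 obtain mu where mu: "real_distribution mu"
  and P: "\<And>A. thresholds A ==> measure mu {x. \<forall>q\<in>A. limit_field x (fst q) <= snd q} = limit_prob A"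
  using limit_field_distribution by blast
 interpret mu: real_distribution mu by (rule mu)
 have m: "limit_field \<in> measurable mu borel"
  using limit_field_measurable by (simp cong: measurable_cong_sets)
 let ?nu = "distr mu borel limit_field"
 have "limit_law ?nu"
 proof (rule limit_law.intro)
  show "prob_space ?nu" by (rule mu.prob_space_distr[OF m])
  show "limit_law_axioms ?nu"
  proof
   show "sets ?nu = sets borel" by simp
   have "{f. \<forall>z. 0 <= f z} = (\<Inter>z. {f :: hpoint => real. 0 <= f z})" by auto
   also have "\<dots> \<in> sets borel"
   proof (intro sets.countable_INT'')
    fix z
    note [measurable] = coordinate_measurable
    have "{f \<in> space borel. 0 <= f z} \<in> sets (borel :: (hpoint => real) measure)" by measurable
    then show "{f :: hpoint => real. 0 <= f z} \<in> sets borel" by simp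
   qed simp_all
   finally have "{f \<in> space borel. \<forall>z. 0 <= f z} \<in> sets (borel :: (hpoint => real) measure)" by simp
   then show "AE f in ?nu. \<forall>z. 0 <= f z"
    by (subst AE_distr_iff[OF m]) (simp_all add: limit_field_nonneg)
   fix A assume A: "thresholds A"
   then have "measure ?nu (below_set A) = measure mu (limit_field -` below_set A \<inter> space mu)"
    by (intro measure_distr[OF m] below_set_measurable) (simp add: thresholds_def)
   also have "limit_field -` below_set A \<inter> space mu = {x. \<forall>q\<in>A. limit_field x (fst q) <= snd q}"
    by (auto simp: below_set_def)
   finally show "measure ?nu (below_set A) = limit_prob A" using P[OF A] by simp
  qed
 qed
 then show ?thesis by blast
qed

context limit_law
begin

text \<open>Scaling by \<open>1 / w\<close> pulls a rectangle back to one whose thresholds are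
  multiplied by \<open>w\<close>, and these are the probabilities found in
  \<open>tableau_limit\<close>.\<close>

lemma tableaux_converge:
 fixes u :: real and k :: "nat => int"
 assumes u: "u \<in> {-1<..<1}" and odd: "\<forall>n\<ge>2. odd (k n + int n)"
  and lim: "(\<lambda>n. ir (k n) / real n) \<longlonglongrightarrow> u"
 shows "converges_in_distribution
     (\<lambda>n. distr (uniform_tableau (k n) n) borel (\<lambda>G z. extend_tableau (k n) n G z / of_nat n))
     (distr nu borel (\<lambda>\<omega> z. ennreal (1 / sqrt (1 - u\<^sup>2) * positive_part \<omega> z)))"
proof (rule converges_in_distribution_rects)
 define w where "w = sqrt (1 - u\<^sup>2)"
 have u1: "\<bar>u\<bar> < 1" using u by auto
 then have w: "0 < w" by (simp add: w_def abs_square_less_1)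
 have mG: "(\<lambda>G z. extend_tableau (k n) n G z / of_nat n) \<in> measurable (uniform_tableau (k n) n) borel" for n
  by (simp add: uniform_tableau_def)
 have mF: "(\<lambda>\<omega> z. ennreal (1 / sqrt (1 - u\<^sup>2) * positive_part \<omega> z)) \<in> measurable nu borel"
 proof (rule measurable_coordinatewise_then_product)
  fix z
  have [measurable]: "(\<lambda>\<omega>. positive_part \<omega> z) \<in> borel_measurable nu"
   by (rule measurable_product_then_coordinatewise[OF positive_part_measurable])
  show "(\<lambda>\<omega>. ennreal (1 / sqrt (1 - u\<^sup>2) * positive_part \<omega> z)) \<in> borel_measurable nu" by measurable
 qed
 show "prob_space (distr (uniform_tableau (k n) n) borel (\<lambda>G z. extend_tableau (k n) n G z / of_nat n))" for n
  using mG[of n] by (intro prob_space.prob_space_distr) (simp_all add: uniform_tableau_def prob_space_measure_pmf)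
 show "prob_space (distr nu borel (\<lambda>\<omega> z. ennreal (1 / sqrt (1 - u\<^sup>2) * positive_part \<omega> z)))"
  by (rule prob_space_distr[OF mF])
 fix A assume A: "thresholds A"
 have R: "rect A \<in> sets borel" using A by (intro rect_measurable) (simp add: thresholds_def)
 have "(\<lambda>n. tableau_prob (k n) n A)
  \<longlonglongrightarrow> limit_prob (map_prod id ((*) w) ` A)"
  unfolding w_def by (rule tableau_limit[OF u1 _ lim A]) (use odd in auto)
 moreover have "measure (distr (uniform_tableau (k n) n) borel (\<lambda>G z. extend_tableau (k n) n G z / of_nat n)) (rect A)
  = tableau_prob (k n) n A" for n
  by (subst measure_distr[OF mG R]) (simp add: rect_def vimage_def uniform_tableau_def)
 moreover have "measure (distr nu borel (\<lambda>\<omega> z. ennreal (1 / sqrt (1 - u\<^sup>2) * positive_part \<omega> z))) (rect A)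
  = limit_prob (map_prod id ((*) w) ` A)"
 proof -
  have "ennreal (1 / sqrt (1 - u\<^sup>2) * positive_part f (fst q)) <= ennreal (snd q) \<longleftrightarrow> f (fst q) <= w * snd q" if "q \<in> A" for f q
  proof -
   have t: "0 < snd q" using A that by (auto simp: thresholds_def)
   then have "ennreal (1 / sqrt (1 - u\<^sup>2) * positive_part f (fst q)) <= ennreal (snd q) \<longleftrightarrow> positive_part f (fst q) / w <= snd q"
    unfolding w_def[symmetric] by simp
   also have "\<dots> \<longleftrightarrow> positive_part f (fst q) <= w * snd q" using w by (simp add: pos_divide_le_eq mult.commute)
   also have "\<dots> \<longleftrightarrow> f (fst q) <= w * snd q" using t w by (simp add: positive_part_def)
   finally show ?thesis .
  qed
  then have "(\<lambda>\<omega> z. ennreal (1 / sqrt (1 - u\<^sup>2) * positive_part \<omega> z)) -` rect A = below_set (map_prod id ((*) w) ` A)"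
   by (auto simp: rect_def below_set_def)
  moreover have "thresholds (map_prod id ((*) w) ` A)" using A w by (auto simp: thresholds_def)
  ultimately show ?thesis by (subst measure_distr[OF mF R]) (simp add: space_nu below)
 qed
 ultimately show "(\<lambda>n. measure (distr (uniform_tableau (k n) n) borel (\<lambda>G z. extend_tableau (k n) n G z / of_nat n)) (rect A))
  \<longlonglongrightarrow> measure (distr nu borel (\<lambda>\<omega> z. ennreal (1 / sqrt (1 - u\<^sup>2) * positive_part \<omega> z))) (rect A)" by simp
qed simp_all

end

theorem theorem2:
 "\<exists>(M :: (hpoint \<Rightarrow> real) measure) (F :: (hpoint \<Rightarrow> real) \<Rightarrow> hpoint \<Rightarrow> real).
  prob_space M \<and>
  F \<in> borel_measurable M \<and>
  (\<forall>\<omega>\<in>space M. \<forall>z. 0 \<le> F \<omega> z) \<and>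
  (\<forall>(u :: real) (k :: nat \<Rightarrow> int).
    u \<in> {-1<..<1} \<longrightarrow>
    (\<forall>n\<ge>2. odd (k n + int n)) \<longrightarrow>
    (\<lambda>n. real_of_int (k n) / real n) \<longlonglongrightarrow> u \<longrightarrow>
    converges_in_distribution
     (\<lambda>n. distr (uniform_tableau (k n) n) borel
        (\<lambda>G z. extend_tableau (k n) n G z / of_nat n))
     (distr M borel (\<lambda>\<omega> z. ennreal (1 / sqrt (1 - u\<^sup>2) * F \<omega> z)))) \<and>
  distr M borel (\<lambda>\<omega>. F \<omega> \<circ> shift_point) = distr M borel F \<and>
  mixing_of_all_orders (distr M borel F) shift_fun"
proof -
 obtain nu where "limit_law nu" using limit_law_exists by blast
 then interpret limit_law nu .
 have "\<forall>\<omega>\<in>space nu. \<forall>z. 0 <= positive_part \<omega> z" by (simp add: positive_part_def)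
 moreover have "mixing_of_all_orders (distr nu borel positive_part) shift_fun"
  unfolding distr_positive_part by (rule mixing)
 ultimately show ?thesis
  using prob_space_axioms positive_part_measurable tableaux_converge stationary
  by (intro exI[of _ nu] exI[of _ positive_part] conjI allI impI) simp_all
qed

end
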